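(* Let $T:\mathcal{S}(\mathbb{R}^n)\times\mathcal{S}(\mathbb{R}^n)\to\mathcal{S}'(\mathbb{R}^n)$ be a bilinear continuous operator associated to a complex-valued locally integrable function $\mathcal{K}$ defined on $\mathbb{R}^{3n}\setminus\Delta$ such that, for some $0<\varepsilon<1$, $0<s\le1$ and some constants $c,C>0$, $$|\mathcal{K}(x,y,z)-\mathcal{K}(x',y,z)|\le C\,\frac{|x-x'|^s}{(|x-y|+|x-z|)^{2n+\frac{s}{\varepsilon}}}\quad\text{whenever } |x-x'|^\varepsilon\le c\,(|x-y|+|x-z|).$$ Assume also that $T$ can be extended to a bounded operator from $L^2(\mathbb{R}^n)\times L^2(\mathbb{R}^n)$ into $L^1(\mathbb{R}^n)$ and from $L^2(\mathbb{R}^n)\times L^2(\mathbb{R}^n)$ into $L^{1/\varepsilon}(\mathbb{R}^n)$. Then the following hold: (a) $T$ can be extended to a bounded operator from $L^\infty(\mathbb{R}^n)\times L^\infty(\mathbb{R}^n)$ into $BMO(\mathbb{R}^n)$. (b) Let $2<p,q<\infty$ and let $r$ be such that $1/r=1/p+1/q$; let $v\in A_{p/2}$, $w\in A_{q/2}$ and define $u:=v^{r/p}w^{r/q}$. Then $T$ can be extended to a bounded operator from $L^p_v(\mathbb{R}^n)\times L^q_w(\mathbb{R}^n)$ into $L^r_u(\mathbb{R}^n)$.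
   Context: Notation. $\mathcal{S}(\mathbb{R}^n)$ is the Schwartz class, $\mathcal{S}'(\mathbb{R}^n)$ the tempered distributions, and $\Delta=\{(x,x,x):x\in\mathbb{R}^n\}\subset\mathbb{R}^{3n}$. $BMO(\mathbb{R}^n)$ is the space of functions (modulo constants) with $\|f\|_{BMO}=\sup_Q \frac{1}{|Q|}\int_Q|f-f_Q|\,dy<\infty$, where the supremum is over all cubes $Q\subset\mathbb{R}^n$ and $f_Q=\frac{1}{|Q|}\int_Q f$. Weights. A weight is a non-negative locally integrable function on $\mathbb{R}^n$. For $1<p<\infty$ with conjugate exponent $p'$, $A_p$ is the class of weights $w$ with $$\sup_Q\left(\frac{1}{|Q|}\int_Q w(y)\,dy\right)\left(\frac{1}{|Q|}\int_Q w(y)^{1-p'}\,dy\right)^{p-1}<\infty,$$ the supremum being over all cubes $Q\subset\mathbb{R}^n$. $L^p_w(\mathbb{R}^n)$ is the Lebesgue space with respect to the measure $w(x)\,dx$. Boundedness and extension. A bilinear operator is bounded from $X\times Y$ into $Z$ if $\|T(f,g)\|_Z\le C\|f\|_X\|g\|_Y$ for some constant $C$ and all $f\in X$, $g\in Y$. "$T$ can be extended to a bounded operator from $X\times Y$ into $Z$" means that there is a bounded bilinear operator from $X\times Y$ into $Z$ that agrees with $T$ on pairs of Schwartz functions (agreement modulo constants when $Z=BMO(\mathbb{R}^n)$). Associated kernel. A continuous bilinear operator $T:\mathcal{S}(\mathbb{R}^n)\times\mathcal{S}(\mathbb{R}^n)\to\mathcal{S}'(\mathbb{R}^n)$ is associated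 to a complex-valued locally integrable function $\mathcal{K}$ defined on $\mathbb{R}^{3n}\setminus\Delta$ if for all $f,g\in C_c^\infty(\mathbb{R}^n)$, $$T(f,g)(x)=\int_{\mathbb{R}^{2n}}\mathcal{K}(x,y,z)f(y)g(z)\,dy\,dz\quad\text{for all }x\notin\operatorname{supp}(f)\cap\operatorname{supp}(g).$$ *)

theory Defs
  imports "HOL-Analysis.Analysis" "HOL-Probability.Essential_Supremum"
begin

section \<open>Schwartz functions and tempered distributions\<close>

type_synonym 'n cfun = "real ^ 'n \<Rightarrow> complex"

definition partial :: "'n::finite \<Rightarrow> 'n cfun \<Rightarrow> 'n cfun" where
  "partial i f = (\<lambda>x. frechet_derivative f (at x) (axis i 1))"

text \<open>A list of indices plays the role of a multi-index; the order is irrelevant for smooth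
  functions.\<close>

primrec partials :: "'n::finite list \<Rightarrow> 'n cfun \<Rightarrow> 'n cfun" where
  "partials [] f = f"
| "partials (i # is) f = partial i (partials is f)"

definition smooth :: "'n::finite cfun \<Rightarrow> bool" where
  "smooth f \<longleftrightarrow> (\<forall>is. partials is f differentiable_on UNIV)"

definition supp :: "('a::topological_space \<Rightarrow> complex) \<Rightarrow> 'a set" where
  "supp f = closure {x. f x \<noteq> 0}"

definition test_functions :: "'n::finite cfun set" where
  "test_functions = {f. smooth f \<and> compact (supp f)}"

definition schwartz_space :: "'n::finite cfun set" where
  "schwartz_space = {f. smooth f \<and>
     (\<forall>k is. bounded (range (\<lambda>x. (1 + norm x) ^ k * norm (partials is f x))))}"

definition schwartz_seminorm :: "nat \<Rightarrow> 'n::finite list \<Rightarrow> 'n cfun \<Rightarrow> real" where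
  "schwartz_seminorm k is f = (SUP x. (1 + norm x) ^ k * norm (partials is f x))"

text \<open>The locally convex topology defined by the seminorms: the seminorm balls around
  arbitrary centres form a subbase.\<close>

definition schwartz_topology :: "'n::finite cfun topology" where
  "schwartz_topology = topology_generated_by
     {{g \<in> schwartz_space. schwartz_seminorm k is (\<lambda>x. g x - f x) < e} | k is f e.
        f \<in> schwartz_space \<and> 0 < e}"

lemma topspace_schwartz_topology [simp]:
  "topspace schwartz_topology = (schwartz_space :: 'n::finite cfun set)"
  (is "?A = ?B")
proof
  show "?A \<subseteq> ?B"
    unfolding schwartz_topology_def topology_generated_by_topspace by blast
  show "?B \<subseteq> ?A"
  proof
    fix f :: "'n cfun" assume f: "f \<in> ?B"
    have "schwartz_seminorm 0 [] (\<lambda>x. f x - f x) < 1"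
      by (simp add: schwartz_seminorm_def)
    with f have "f \<in> {g \<in> schwartz_space. schwartz_seminorm 0 [] (\<lambda>x. g x - f x) < 1}"
      by blast
    moreover have "(0::real) < 1"
      by simp
    ultimately show "f \<in> ?A"
      unfolding schwartz_topology_def topology_generated_by_topspace using f by blast
  qed
qed

text \<open>Tempered distributions are functionals on the Schwartz space only; being
  \<^const>\<open>extensional\<close> makes them independent of values outside of it.\<close>

definition tempered_distributions :: "('n::finite cfun \<Rightarrow> complex) set" where
  "tempered_distributions = {u \<in> extensional schwartz_space.
     continuous_map schwartz_topology euclidean u \<and>
     (\<forall>\<phi>\<in>schwartz_space. \<forall>\<psi>\<in>schwartz_space. \<forall>a b.
        u (\<lambda>x. a * \<phi> x + b * \<psi> x) = a * u \<phi> + b * u \<psi>)}"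

text \<open>The weak-* topology, i.e. pointwise convergence on the Schwartz space.\<close>

definition tempered_topology :: "('n::finite cfun \<Rightarrow> complex) topology" where
  "tempered_topology =
     subtopology (product_topology (\<lambda>\<phi>. euclidean) schwartz_space) tempered_distributions"

type_synonym 'n bilinear_op = "'n cfun \<Rightarrow> 'n cfun \<Rightarrow> 'n cfun \<Rightarrow> complex"

text \<open>\<open>T f g \<phi>\<close> is the pairing of the distribution \<open>T(f,g)\<close> with \<open>\<phi>\<close>.\<close>

definition continuous_bilinear_op :: "'n::finite bilinear_op \<Rightarrow> bool" where
  "continuous_bilinear_op T \<longleftrightarrow>
     continuous_map (prod_topology schwartz_topology schwartz_topology) tempered_topology
       (\<lambda>(f, g). T f g) \<and>
     (\<forall>f\<in>schwartz_space. \<forall>h\<in>schwartz_space. \<forall>g\<in>schwartz_space. \<forall>\<phi>\<in>schwartz_space. \<forall>a b.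
        T (\<lambda>x. a * f x + b * h x) g \<phi> = a * T f g \<phi> + b * T h g \<phi> \<and>
        T g (\<lambda>x. a * f x + b * h x) \<phi> = a * T g f \<phi> + b * T g h \<phi>)"

section \<open>Associated kernels\<close>

definition locally_integrable_on ::
  "('a::euclidean_space \<Rightarrow> 'b::{banach, second_countable_topology}) \<Rightarrow> 'a set \<Rightarrow> bool" where
  "locally_integrable_on f S \<longleftrightarrow>
     (\<forall>C. compact C \<and> C \<subseteq> S \<longrightarrow> f absolutely_integrable_on C)"

definition triple_diagonal :: "('a \<times> 'a \<times> 'a) set" where
  "triple_diagonal = {(x, x, x) | x. True}"

text \<open>The equality of the distribution \<open>T(f,g)\<close> with the kernel integral off
  \<open>supp f \<inter> supp g\<close> is meant in the sense of distributions on this open set, i.e. after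
  pairing with test functions supported in it.  Values of \<open>K\<close> on the diagonal are
  irrelevant.\<close>

definition associated_kernel ::
  "'n::finite bilinear_op \<Rightarrow> ((real ^ 'n) \<times> (real ^ 'n) \<times> (real ^ 'n) \<Rightarrow> complex) \<Rightarrow> bool" where
  "associated_kernel T K \<longleftrightarrow>
     (\<forall>f\<in>test_functions. \<forall>g\<in>test_functions. \<forall>\<phi>\<in>test_functions.
        supp \<phi> \<inter> (supp f \<inter> supp g) = {} \<longrightarrow>
        T f g \<phi> = (LINT x|lebesgue. (LINT (y, z)|lebesgue. K (x, y, z) * f y * g z) * \<phi> x))"

section \<open>Function spaces\<close>

text \<open>Real powers on \<open>[0,\<infinity>]\<close>; in contrast to \<^const>\<open>powr\<close>, zero to a negative power is
  infinite.\<close>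

definition epowr :: "ennreal \<Rightarrow> real \<Rightarrow> ennreal" where
  "epowr x a =
     (if a = 0 then 1
      else if x = 0 then (if a < 0 then \<infinity> else 0)
      else if x = \<infinity> then (if a < 0 then 0 else \<infinity>)
      else ennreal (enn2real x powr a))"

definition cubes :: "(real ^ 'n::finite) set set" where
  "cubes = {cbox a (a + (\<chi> i. l)) | a l. 0 < l}"

definition eaverage :: "(real ^ 'n::finite) set \<Rightarrow> (real ^ 'n \<Rightarrow> ennreal) \<Rightarrow> ennreal" where
  "eaverage Q h = (\<integral>\<^sup>+y\<in>Q. h y \<partial>lebesgue) / emeasure lebesgue Q"

definition average :: "(real ^ 'n::finite) set \<Rightarrow> 'n cfun \<Rightarrow> complex" where
  "average Q f = (LINT y:Q|lebesgue. f y) /\<^sub>R measure lebesgue Q"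

definition weight :: "(real ^ 'n::finite \<Rightarrow> real) \<Rightarrow> bool" where
  "weight w \<longleftrightarrow> (\<forall>x. 0 \<le> w x) \<and> locally_integrable_on w UNIV"

text \<open>The conjugate exponent of \<open>p\<close> is \<open>p / (p - 1)\<close>.  By the convention
  \<open>0 * \<infinity> = 0\<close> the zero weight is a degenerate member of the class; all other members
  are positive almost everywhere.\<close>

definition A_class :: "real \<Rightarrow> (real ^ 'n::finite \<Rightarrow> real) set" where
  "A_class p = {w. 1 < p \<and> weight w \<and>
     (SUP Q\<in>cubes. eaverage Q (\<lambda>y. ennreal (w y)) *
        epowr (eaverage Q (\<lambda>y. epowr (ennreal (w y)) (1 - p / (p - 1)))) (p - 1)) < \<infinity>}"

text \<open>A function space is given by a set of functions and a seminorm on it; it stands for the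
  quotient by the functions of seminorm zero.  These are the functions vanishing almost
  everywhere (with respect to \<open>w(x) dx\<close>) for \<open>L\<^sup>p\<^sub>w\<close> and \<open>L\<^sup>\<infinity>\<close>, and the functions
  that are almost everywhere constant for \<open>BMO\<close>.\<close>

type_synonym 'n fspace = "'n cfun set \<times> ('n cfun \<Rightarrow> ennreal)"

definition Lp_norm :: "real \<Rightarrow> (real ^ 'n::finite \<Rightarrow> real) \<Rightarrow> 'n cfun \<Rightarrow> ennreal" where
  "Lp_norm p w f =
     epowr (\<integral>\<^sup>+x. ennreal (norm (f x) powr p) \<partial>density lebesgue (\<lambda>x. ennreal (w x))) (1 / p)"

definition weighted_Lp :: "real \<Rightarrow> (real ^ 'n::finite \<Rightarrow> real) \<Rightarrow> 'n fspace" where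
  "weighted_Lp p w = ({f \<in> borel_measurable lebesgue. Lp_norm p w f < \<infinity>}, Lp_norm p w)"

abbreviation Lp :: "real \<Rightarrow> 'n::finite fspace" where
  "Lp p \<equiv> weighted_Lp p (\<lambda>x. 1)"

definition Linf_norm :: "'n::finite cfun \<Rightarrow> ennreal" where
  "Linf_norm f = esssup lebesgue (\<lambda>x. ennreal (norm (f x)))"

definition Linf :: "'n::finite fspace" where
  "Linf = ({f \<in> borel_measurable lebesgue. Linf_norm f < \<infinity>}, Linf_norm)"

definition BMO_norm :: "'n::finite cfun \<Rightarrow> ennreal" where
  "BMO_norm f = (SUP Q\<in>cubes. eaverage Q (\<lambda>y. ennreal (norm (f y - average Q f))))"

definition BMO :: "'n::finite fspace" where
  "BMO = ({f. locally_integrable_on f UNIV \<and> BMO_norm f < \<infinity>}, BMO_norm)"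

section \<open>Bounded bilinear extensions\<close>

text \<open>Linearity holds modulo functions of seminorm zero; together with the norm bound this
  makes \<open>B\<close> well defined on the quotient spaces.\<close>

definition bounded_bilinear_operator ::
  "'n::finite fspace \<Rightarrow> 'n fspace \<Rightarrow> 'n fspace \<Rightarrow> ('n cfun \<Rightarrow> 'n cfun \<Rightarrow> 'n cfun) \<Rightarrow> bool" where
  "bounded_bilinear_operator X Y Z B \<longleftrightarrow>
     (\<forall>f\<in>fst X. \<forall>g\<in>fst Y. B f g \<in> fst Z) \<and>
     (\<forall>f\<in>fst X. \<forall>h\<in>fst X. \<forall>g\<in>fst Y. \<forall>a b.
        snd Z (\<lambda>x. B (\<lambda>x. a * f x + b * h x) g x - (a * B f g x + b * B h g x)) = 0) \<and>
     (\<forall>f\<in>fst X. \<forall>g\<in>fst Y. \<forall>h\<in>fst Y. \<forall>a b.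
        snd Z (\<lambda>x. B f (\<lambda>x. a * g x + b * h x) x - (a * B f g x + b * B f h x)) = 0) \<and>
     (\<exists>C::real. \<forall>f\<in>fst X. \<forall>g\<in>fst Y. snd Z (B f g) \<le> ennreal C * snd X f * snd Y g)"

definition represents :: "'n::finite cfun \<Rightarrow> ('n cfun \<Rightarrow> complex) \<Rightarrow> bool" where
  "represents h u \<longleftrightarrow> (\<forall>\<phi>\<in>schwartz_space.
     integrable lebesgue (\<lambda>x. h x * \<phi> x) \<and> u \<phi> = (LINT x|lebesgue. h x * \<phi> x))"

text \<open>Agreement on Schwartz functions: the distribution \<open>T(f,g)\<close> is given by a function in the
  class of \<open>B f g\<close>; for \<open>Z = BMO\<close> this is agreement modulo constants.\<close>

definition extends_to_bounded ::
  "'n::finite bilinear_op \<Rightarrow> 'n fspace \<Rightarrow> 'n fspace \<Rightarrow> 'n fspace \<Rightarrow> bool" where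
  "extends_to_bounded T X Y Z \<longleftrightarrow>
     (\<exists>B. bounded_bilinear_operator X Y Z B \<and>
        (\<forall>f\<in>schwartz_space. \<forall>g\<in>schwartz_space. \<exists>h\<in>fst Z.
           snd Z (\<lambda>x. B f g x - h x) = 0 \<and> represents h (T f g)))"

end

theory Submission
  imports Defs
begin

text \<open>The regularity of \<open>K\<close> in its first variable makes the part of \<open>T(f,g)\<close> coming from functions
supported away from a cube nearly constant on this cube.  The remaining local part is controlled by
the \<open>L\<^sup>2 \<times> L\<^sup>2 \<rightarrow> L\<^sup>1\<close> bound on cubes of side at least one; on smaller cubes the kernel condition
forces a neighbourhood of size \<open>l powr \<epsilon>\<close>, and the gain in the \<open>L\<^sup>2 \<times> L\<^sup>2 \<rightarrow> L\<^bsup>1/\<epsilon>\<^esup>\<close> bound compensates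
exactly for this.  Hence the mean oscillation of \<open>T(f,g)\<close> over any cube is at most a constant times
\<open>(M|f|\<^sup>2)\<^bsup>1/2\<^esup> (M|g|\<^sup>2)\<^bsup>1/2\<^esup>\<close> at any of its points, where \<open>M\<close> is the maximal function.

For bounded functions this is the \<open>BMO\<close> bound, and \<open>T(f,g)\<close> is defined as the limit of the truncations
\<open>T(f 1\<^sub>N, g 1\<^sub>N)\<close> normalised to have mean value zero on a fixed cube.  In the weighted case \<open>u\<close> is an
\<open>A\<^sub>\<infinity>\<close> weight by Hoelder's inequality, so that the Fefferman--Stein inequality bounds \<open>T(f,g)\<close> in
\<open>L\<^sup>r\<^sub>u\<close> by the product of maximal functions; Hoelder's inequality and Muckenhoupt's theorem in
\<open>L\<^bsup>p/2\<^esup>\<^sub>v\<close> and \<open>L\<^bsup>q/2\<^esup>\<^sub>w\<close> then give the claim for truncated functions, and completeness for all.\<close>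

text \<open>For a cube of half-side l the regularity of the kernel is available beyond a radius R of
  the order of the larger of l and l^\<epsilon>. The far terms carry the factor l^s
  R^(-s/\<epsilon>), which such an R keeps bounded for every l. The same R enlarges the local part;
  for l < 1, Hoelder's inequality with exponent 1/\<epsilon> bounds it by l^(n(1-\<epsilon>)) R^n,
  again of order l^n.

  T is known through distributions and its kernel through test functions. Pointwise bounds are
  therefore proved for test functions and carried to L2 along almost everywhere convergent
  subsequences, and the two given extensions are compared on test functions.

  The good-lambda argument subtracts an integral from both sides, so it is run on finitely many
  cells, where that integral is finite. L1 convergence of cell means together with Fatou's lemma
  replaces differentiation of integrals, and integrability of \<open>B f g\<close> makes its mean
  over a growing cube tend to zero, so that no additive constant survives.

  A weight of the class may vanish almost everywhere; the target is then trivial and treated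
  apart.\<close>

declare emeasure_completion [simp del]

abbreviation bmeas :: "(('a::euclidean_space) \<Rightarrow> ('b::topological_space)) set" where
  "bmeas \<equiv> borel_measurable lebesgue"

abbreviation vol :: "('a::euclidean_space) set \<Rightarrow> ennreal" where
  "vol \<equiv> emeasure lebesgue"

abbreviation pow_int :: "'a measure \<Rightarrow> real \<Rightarrow> ('a \<Rightarrow> complex) \<Rightarrow> ennreal" where
  "pow_int M r f \<equiv> \<integral>\<^sup>+x. ennreal (norm (f x) powr r) \<partial>M"

abbreviation sq_int :: "(real ^ 'n::finite) set \<Rightarrow> 'n cfun \<Rightarrow> ennreal" where
  "sq_int Q f \<equiv> \<integral>\<^sup>+x. ennreal ((norm (f x))\<^sup>2) * indicator Q x \<partial>lebesgue"

abbreviation abs_int :: "(real ^ 'n::finite) set \<Rightarrow> 'n cfun \<Rightarrow> ennreal" where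
  "abs_int Q f \<equiv> \<integral>\<^sup>+x. ennreal (norm (f x)) * indicator Q x \<partial>lebesgue"

subsection \<open>Cubes\<close>

definition cb :: "real ^ 'n::finite \<Rightarrow> real \<Rightarrow> (real ^ 'n) set" where
 "cb x R = cbox (x - (\<chi> i. R)) (x + (\<chi> i. R))"

lemma mem_cb: "y \<in> cb x R \<longleftrightarrow> (\<forall>i. \<bar>y $ i - x $ i\<bar> \<le> R)"
 unfolding cb_def mem_box_cart by (simp add: abs_le_iff algebra_simps) (smt (verit))

lemma compact_cb [simp]: "compact (cb x R)" and closed_cb [simp]: "closed (cb x R)"
 and bounded_cb [simp]: "bounded (cb x R)"
 by (simp_all add: cb_def bounded_cbox closed_cbox)

lemma sets_cb [measurable, simp]: "cb x R \<in> sets borel" "cb x R \<in> sets lebesgue"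
 by (simp_all add: cb_def)

lemma interior_cb: "y \<in> interior (cb x R) \<longleftrightarrow> (\<forall>i. \<bar>y $ i - x $ i\<bar> < R)"
 unfolding cb_def interior_cbox mem_box_cart by (simp add: abs_less_iff algebra_simps) (smt (verit))

lemma cb_mono: "R \<le> R' \<Longrightarrow> cb x R \<subseteq> cb x R'"
 by (intro subsetI) (meson mem_cb order_trans)

lemma emeasure_cb:
 assumes "0 \<le> R" shows "vol (cb (x::real^'n::finite) R) = ennreal ((2 * R) ^ CARD('n))"
proof -
 have "vol (cb x R) = emeasure lborel (cb x R)"
  by (simp add: emeasure_completion)
 also have "\<dots> = ennreal (\<Prod>b\<in>Basis. ((x + (\<chi> i. R)) - (x - (\<chi> i. R))) \<bullet> b)"
  unfolding cb_def using assms
  by (intro emeasure_lborel_cbox) (auto simp: Basis_vec_def inner_axis axis_eq_axis algebra_simps)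
 also have "(\<Prod>b\<in>Basis. ((x + (\<chi> i. R)) - (x - (\<chi> i. R))) \<bullet> b) = (\<Prod>b\<in>(Basis::(real^'n) set). 2 * R)"
  by (intro prod.cong refl) (auto simp: Basis_vec_def inner_axis algebra_simps)
 finally show ?thesis by simp
qed

lemma measure_cb: "0 \<le> R \<Longrightarrow> measure lebesgue (cb (x::real^'n::finite) R) = (2 * R) ^ CARD('n)"
 unfolding measure_def by (subst emeasure_cb) simp_all

lemma cubes_eq: "cubes = {cb x R | x R. 0 < (R::real)}"
proof -
 have "cbox a (a + (\<chi> i. l)) = cb (a + (\<chi> i. l/2)) (l/2)" for a :: "real^'n" and l :: real
  unfolding cb_def by (rule arg_cong2[where f=cbox]) (simp_all add: vec_eq_iff)
 moreover have "cb x R = cbox (x - (\<chi> i. R)) ((x - (\<chi> i. R)) + (\<chi> i. 2*R))" for x :: "real^'n" and R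
  unfolding cb_def by (rule arg_cong2[where f=cbox]) (simp_all add: vec_eq_iff)
 ultimately have *: "\<And>a l. cbox a (a + (\<chi> i. l)) = cb (a + (\<chi> i. l/2)) (l/2 :: real)"
  "\<And>x R. cb x R = cbox (x - (\<chi> i. R)) ((x - (\<chi> i. R)) + (\<chi> i. 2*R))" for a x :: "real^'n"
  by blast+
 show ?thesis unfolding cubes_def
 proof (intro equalityI subsetI; clarify)
  fix a :: "real^'n" and l :: real assume "0 < l"
  then show "\<exists>x R. cbox a (a + (\<chi> i. l)) = cb x R \<and> 0 < R"
   by (intro exI[of _ "a + (\<chi> i. l/2)"] exI[of _ "l/2"]) (simp add: *(1))
 next
  fix x :: "real^'n" and R :: real assume "0 < R"
  then show "\<exists>a l. cb x R = cbox a (a + (\<chi> i. l)) \<and> 0 < l"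
   by (intro exI[of _ "x - (\<chi> i. R)"] exI[of _ "2*R"]) (simp add: *(2))
 qed
qed

lemma bounded_subset_cb:
 assumes "bounded (S :: (real^'n::finite) set)" shows "\<exists>R>0. S \<subseteq> cb x R"
proof -
 obtain B where B: "\<And>y. y \<in> S \<Longrightarrow> norm y \<le> B" using assms by (auto simp: bounded_iff)
 have "\<bar>y $ i - x $ i\<bar> \<le> \<bar>B\<bar> + norm x + 1" if "y \<in> S" for y i
  using component_le_norm_cart[of "y - x" i] B[OF that] norm_triangle_ineq4[of y x] by simp
 then show ?thesis by (intro exI[of _ "\<bar>B\<bar> + norm x + 1"]) (auto simp: mem_cb add_nonneg_pos)
qed

subsection \<open>Smooth functions\<close>

text \<open>The derivative of a member is a combination of the members of index k + 1 and k + 2, so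
  the whole family is needed to describe the derivatives of the standard smooth function exp
  (-1/t).\<close>

definition flat_exp :: "nat \<Rightarrow> real \<Rightarrow> real" where
 "flat_exp k t = (if t \<le> 0 then 0 else exp (- inverse t) * inverse t ^ k)"

text \<open>A single term of the exponential series at 1/t, the one of index k + 2, suffices. Its
  two spare powers leave t^2, which makes the difference quotient at the origin tend to 0.\<close>

lemma flat_exp_le: "\<bar>flat_exp k t\<bar> \<le> fact (k + 2) * t\<^sup>2"
proof (cases "t \<le> 0")
 case False
 then have t: "t > 0" by simp
 have "inverse t ^ (k+2) / fact (k+2) \<le> exp (inverse t)"
  using sum_le_suminf[OF summable_exp[of "inverse t"], of "{k+2}"] t
  by (simp add: exp_def divide_inverse_commute scaleR_conv_of_real del: power_add)
 then have "inverse t ^ (k+2) \<le> exp (inverse t) * fact (k+2)"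
  by (simp only: pos_divide_le_eq[OF fact_gt_zero])
 then have "exp (- inverse t) * inverse t ^ (k+2) \<le> exp (- inverse t) * (exp (inverse t) * fact (k+2))"
  by (intro mult_left_mono) auto
 also have "\<dots> = fact (k+2)"
  by (simp only: mult.assoc[symmetric] exp_add[symmetric]) simp
 finally have "exp (- inverse t) * inverse t ^ (k+2) \<le> fact (k+2)" .
 then have "exp (- inverse t) * inverse t ^ (k+2) * t\<^sup>2 \<le> fact (k+2) * t\<^sup>2"
  by (intro mult_right_mono) auto
 moreover have "inverse t ^ (k+2) * t\<^sup>2 = inverse t ^ k"
  using t by (simp add: power_add power2_eq_square field_simps)
 ultimately have "exp (- inverse t) * inverse t ^ k \<le> fact (k+2) * t\<^sup>2"
  by (simp only: mult.assoc)
 then show ?thesis using t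
  by (simp add: flat_exp_def del: fact_Suc power_inverse)
qed (simp add: flat_exp_def)

lemma flat_exp_deriv:
 "(flat_exp k has_real_derivative (flat_exp (k + 2) t - real k * flat_exp (k + 1) t)) (at t)"
proof -
 consider "t < 0" | "t > 0" | "t = 0" by linarith
 then show ?thesis
 proof cases
  case 1
  have "((\<lambda>_. 0) has_real_derivative 0) (at t)" by simp
  then have "(flat_exp k has_real_derivative 0) (at t)"
   by (rule has_field_derivative_transform_within_open[where S="{..<0}"])
     (use 1 in \<open>auto simp: flat_exp_def\<close>)
  then show ?thesis using 1 by (simp add: flat_exp_def)
 next
  case 2
  have "((\<lambda>t. exp (- inverse t) * inverse t ^ k) has_real_derivative
    (flat_exp (k + 2) t - real k * flat_exp (k + 1) t)) (at t)"
   using 2 by (auto intro!: derivative_eq_intros simp: flat_exp_def power2_eq_square power_add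
     algebra_simps power_Suc2[symmetric] simp del: power_Suc) (cases k; simp add: field_simps)
  then show ?thesis
   by (rule has_field_derivative_transform_within_open[where S="{0<..}"])
     (use 2 in \<open>auto simp: flat_exp_def\<close>)
 next
  case 3
  have "((\<lambda>h. (flat_exp k (0 + h) - flat_exp k 0) / h) \<longlongrightarrow> 0) (at 0)"
  proof (rule Lim_null_comparison)
   show "eventually (\<lambda>h. norm ((flat_exp k (0 + h) - flat_exp k 0) / h) \<le> fact (k+2) * \<bar>h\<bar>) (at 0)"
   proof (rule always_eventually, rule allI)
    fix h :: real
    show "norm ((flat_exp k (0 + h) - flat_exp k 0) / h) \<le> fact (k+2) * \<bar>h\<bar>"
     using flat_exp_le[of k h] by (cases "h = 0") (simp_all add: flat_exp_def[of k 0] abs_divide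
       pos_divide_le_eq power2_eq_square abs_mult[symmetric] mult.assoc)
   qed
   show "((\<lambda>h::real. fact (k+2) * \<bar>h\<bar>) \<longlongrightarrow> 0) (at 0)"
    by (auto intro!: tendsto_eq_intros)
  qed
  then show ?thesis unfolding 3 DERIV_def by (simp add: flat_exp_def)
 qed
qed

lemma flat_exp0: "0 \<le> flat_exp 0 t" "flat_exp 0 t < 1" "flat_exp 0 t > 0 \<longleftrightarrow> t > 0"
 by (auto simp: flat_exp_def)

text \<open>Closed under partial derivatives, so all members are smooth.\<close>

inductive_set elem :: "'n::finite cfun set" where
 const: "(\<lambda>x. c) \<in> elem"
| coord: "(\<lambda>x. complex_of_real (x $ i)) \<in> elem"
| bump: "(\<lambda>x. complex_of_real (flat_exp k (\<alpha> * x $ i + \<beta>))) \<in> elem"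
| add: "f \<in> elem \<Longrightarrow> g \<in> elem \<Longrightarrow> (\<lambda>x. f x + g x) \<in> elem"
| mult: "f \<in> elem \<Longrightarrow> g \<in> elem \<Longrightarrow> (\<lambda>x. f x * g x) \<in> elem"

lemma elem_derivative:
 assumes "f \<in> elem"
 shows "\<exists>f'. (\<forall>x. (f has_derivative f' x) (at x)) \<and> (\<forall>i. (\<lambda>x. f' x (axis i 1)) \<in> elem)"
 using assms
proof induct
 case (const c)
 show ?case by (rule exI[of _ "\<lambda>x h. 0"]) (auto intro: elem.const)
next
 case (coord i)
 have "(\<lambda>x::real^'a. complex_of_real (axis j 1 $ i)) \<in> elem" for j by (rule elem.const)
 then show ?case
  by (intro exI[of _ "\<lambda>x h. complex_of_real (h $ i)"])
    (auto intro!: derivative_eq_intros has_derivative_of_real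
     bounded_linear.has_derivative[OF bounded_linear_vec_nth])
next
 case (bump k a i b)
 let ?D = "\<lambda>t. flat_exp (k + 2) t - real k * flat_exp (k + 1) t"
 have d: "((\<lambda>x::real^'a. flat_exp k (a * x $ i + b)) has_derivative
    (\<lambda>h. ?D (a * x $ i + b) * (a * h $ i))) (at x)" for x
 proof -
  have 1: "((\<lambda>x::real^'a. a * x $ i + b) has_derivative (\<lambda>h. a * h $ i)) (at x)"
   by (auto intro!: derivative_eq_intros bounded_linear.has_derivative[OF bounded_linear_vec_nth])
  have "(flat_exp k has_derivative (\<lambda>t. ?D (a * x $ i + b) * t)) (at (a * x $ i + b))"
   using flat_exp_deriv[of k "a * x $ i + b"] unfolding has_field_derivative_def .
  from diff_chain_at[OF 1 this] show ?thesis by (simp add: o_def)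
 qed
 have e: "(\<lambda>x::real^'a. complex_of_real (?D (a * x $ i + b) * (a * axis j 1 $ i))) \<in> elem" for j
 proof -
  have "(\<lambda>x::real^'a. complex_of_real (a * axis j 1 $ i) *
    (complex_of_real (flat_exp (k + 2) (a * x $ i + b)) +
    complex_of_real (- real k) * complex_of_real (flat_exp (k + 1) (a * x $ i + b)))) \<in> elem"
   by (intro elem.intros)
  then show ?thesis by (simp add: algebra_simps)
 qed
 show ?case
  by (rule exI[of _ "\<lambda>x h. complex_of_real (?D (a * x $ i + b) * (a * h $ i))"])
    (intro conjI allI has_derivative_of_real d e)
next
 case (add f g)
 then obtain f' g' where
  "\<forall>x. (f has_derivative f' x) (at x)" "\<forall>i. (\<lambda>x. f' x (axis i 1)) \<in> elem"
  "\<forall>x. (g has_derivative g' x) (at x)" "\<forall>i. (\<lambda>x. g' x (axis i 1)) \<in> elem" by auto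
 then show ?case
  by (intro exI[of _ "\<lambda>x h. f' x h + g' x h"]) (auto intro!: derivative_eq_intros elem.add)
next
 case (mult f g)
 then obtain f' g' where
  "\<forall>x. (f has_derivative f' x) (at x)" "\<forall>i. (\<lambda>x. f' x (axis i 1)) \<in> elem"
  "\<forall>x. (g has_derivative g' x) (at x)" "\<forall>i. (\<lambda>x. g' x (axis i 1)) \<in> elem" by auto
 then show ?case using mult(1,3)
  by (intro exI[of _ "\<lambda>x h. f x * g' x h + f' x h * g x"])
   (auto intro!: derivative_eq_intros elem.add elem.mult)
qed

lemma elem_partial: assumes "f \<in> elem" shows "partial i f \<in> elem" "f differentiable (at x)"
proof -
 obtain f' where f': "\<And>x. (f has_derivative f' x) (at x)" "\<And>i. (\<lambda>x. f' x (axis i 1)) \<in> elem"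
  using elem_derivative[OF assms] by blast
 have "partial i f = (\<lambda>x. f' x (axis i 1))"
  unfolding partial_def using frechet_derivative_at[OF f'(1)] by simp
 with f' show "partial i f \<in> elem" "f differentiable (at x)"
  by (auto simp: differentiable_def)
qed

lemma elem_partials: "f \<in> elem \<Longrightarrow> partials js f \<in> elem"
 by (induct js) (auto intro: elem_partial)

lemma elem_smooth: "f \<in> elem \<Longrightarrow> smooth f"
 unfolding smooth_def differentiable_on_def
 using elem_partial(2)[OF elem_partials] by (blast intro: differentiable_at_withinI)

lemma smooth_continuous: "smooth f \<Longrightarrow> continuous_on UNIV (partials js f)"
 unfolding smooth_def by (blast intro: differentiable_imp_continuous_on)

lemma partials_outside_supp:
 assumes "x \<notin> supp f" shows "partials js f x = 0"
 using assms
proof (induct js arbitrary: x)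
 case Nil
 then show ?case using closure_subset[of "{x. f x \<noteq> 0}"] by (auto simp: supp_def)
next
 case (Cons i js)
 have "open (- supp f)" unfolding supp_def by (simp add: open_Compl)
 have "((\<lambda>_. 0) has_derivative (\<lambda>_. 0)) (at x)" by simp
 then have "(partials js f has_derivative (\<lambda>_. 0)) (at x)"
  by (rule has_derivative_transform_within_open[OF _ \<open>open (- supp f)\<close>]) (use Cons in auto)
 then have "frechet_derivative (partials js f) (at x) = (\<lambda>_. 0)"
  by (rule frechet_derivative_at[symmetric])
 then show ?case by (simp add: partial_def)
qed

lemma test_continuous: "f \<in> test_functions \<Longrightarrow> continuous_on UNIV f"
 using smooth_continuous[of f "[]"] by (simp add: test_functions_def)

lemma schwartz_continuous: "f \<in> schwartz_space \<Longrightarrow> continuous_on UNIV f"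
 using smooth_continuous[of f "[]"] by (simp add: schwartz_space_def)

lemma outside_supp: "x \<notin> supp (f :: 'n::finite cfun) \<Longrightarrow> f x = 0"
 using partials_outside_supp[of x f "[]"] by simp

lemma test_in_schwartz: "test_functions \<subseteq> (schwartz_space :: 'n::finite cfun set)"
proof
 fix f :: "'n cfun" assume f: "f \<in> test_functions"
 then have sm: "smooth f" and c: "compact (supp f)" by (auto simp: test_functions_def)
 have "bounded (range (\<lambda>x. (1 + norm x) ^ k * norm (partials js f x)))" for k js
 proof -
  let ?g = "\<lambda>x. (1 + norm x) ^ k * norm (partials js f x)"
  have "continuous_on UNIV ?g"
   by (intro continuous_intros smooth_continuous sm)
  then have "compact (?g ` supp f)"
   using c by (blast intro: compact_continuous_image continuous_on_subset)
  then have "bounded (insert 0 (?g ` supp f))" by (simp add: compact_imp_bounded)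
  moreover have "range ?g \<subseteq> insert 0 (?g ` supp f)"
   using partials_outside_supp[of _ f js] by fastforce
  ultimately show ?thesis by (rule bounded_subset)
 qed
 with sm show "f \<in> schwartz_space" by (auto simp: schwartz_space_def)
qed

lemma elem_sum: "(\<And>i. i \<in> I \<Longrightarrow> f i \<in> elem) \<Longrightarrow> (\<lambda>x. \<Sum>i\<in>I. f i x) \<in> elem"
 by (induct I rule: infinite_finite_induct) (auto intro: elem.intros)

lemma elem_prod: "(\<And>i. i \<in> I \<Longrightarrow> f i \<in> elem) \<Longrightarrow> (\<lambda>x. \<Prod>i\<in>I. f i x) \<in> elem"
 by (induct I rule: infinite_finite_induct) (auto intro: elem.intros)

lemma elem_power: "f \<in> elem \<Longrightarrow> (\<lambda>x. f x ^ k) \<in> elem"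
 by (induct k) (auto intro: elem.intros)

lemma elem_minus: "f \<in> elem \<Longrightarrow> g \<in> elem \<Longrightarrow> (\<lambda>x. f x - g x) \<in> elem"
 using elem.add[of f "\<lambda>x. (-1) * g x"] elem.mult[OF elem.const, of g "-1"] by simp

text \<open>The Stone--Weierstrass theorem delivers polynomials; membership in \<open>elem\<close>
  makes their products with cutoffs smooth.\<close>

lemma elem_real_polynomial:
 "real_polynomial_function (p :: real^'n::finite \<Rightarrow> real) \<Longrightarrow> (\<lambda>x. complex_of_real (p x)) \<in> elem"
proof (induct rule: real_polynomial_function.induct)
 case (linear f)
 have L: "f x = (\<Sum>i\<in>UNIV. f (axis i 1) * x $ i)" for x
 proof -
  have "f x = f (\<Sum>i\<in>UNIV. x $ i *\<^sub>R axis i 1)"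
   using basis_expansion[of x] by (simp add: scalar_mult_eq_scaleR)
  also have "\<dots> = (\<Sum>i\<in>UNIV. x $ i *\<^sub>R f (axis i 1))"
   using linear by (simp add: linear_sum bounded_linear.linear linear_cmul)
  finally show ?thesis by (simp add: mult.commute)
 qed
 have *: "(\<lambda>x. complex_of_real (f x)) =
   (\<lambda>x. \<Sum>i\<in>UNIV. complex_of_real (f (axis i 1)) * complex_of_real (x $ i))"
  by (rule ext, subst L) simp
 show ?case unfolding * by (intro elem_sum elem.intros)
qed (auto intro: elem.intros)

lemma elem_polynomial:
 assumes "polynomial_function (p :: real^'n::finite \<Rightarrow> complex)" shows "p \<in> elem"
proof -
 have "real_polynomial_function (Re \<circ> p)" "real_polynomial_function (Im \<circ> p)"
  using assms by (auto simp: polynomial_function_def bounded_linear_Re bounded_linear_Im)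
 then have "(\<lambda>x. complex_of_real (Re (p x)) + \<i> * complex_of_real (Im (p x))) \<in> elem"
  by (intro elem.add elem.mult elem.const elem_real_polynomial) (simp_all add: o_def)
 then show ?thesis by (simp add: complex_eq[symmetric])
qed

subsection \<open>Approximation by test functions\<close>

definition cube_bump :: "real^'n::finite \<Rightarrow> real \<Rightarrow> real^'n \<Rightarrow> real" where
 "cube_bump c R x = (\<Prod>i\<in>UNIV. flat_exp 0 (x $ i - c $ i + R) * flat_exp 0 (c $ i + R - x $ i))"

lemma cube_bump_bounds: "0 \<le> cube_bump c R x" "cube_bump c R x \<le> 1"
proof -
 have "0 \<le> flat_exp 0 t" "flat_exp 0 t \<le> 1" for t using flat_exp0(1,2)[of t] by auto
 then show "0 \<le> cube_bump c R x" "cube_bump c R x \<le> 1" unfolding cube_bump_def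
  by (simp_all add: prod_nonneg prod_le_1 mult_le_one)
qed

lemma cube_bump_pos: "cube_bump c R x > 0 \<longleftrightarrow> x \<in> interior (cb c R)"
proof -
 have nz: "flat_exp 0 t \<noteq> 0 \<longleftrightarrow> t > 0" for t by (auto simp: flat_exp_def)
 have "cube_bump c R x > 0 \<longleftrightarrow> cube_bump c R x \<noteq> 0" using cube_bump_bounds(1)[of c R x] by linarith
 also have "\<dots> \<longleftrightarrow> (\<forall>i. x $ i - c $ i + R > 0 \<and> c $ i + R - x $ i > 0)"
  unfolding cube_bump_def by (simp add: nz)
 also have "\<dots> \<longleftrightarrow> x \<in> interior (cb c R)"
  unfolding interior_cb by (intro all_cong1) auto
 finally show "cube_bump c R x > 0 \<longleftrightarrow> x \<in> interior (cb c R)" .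
qed

lemma cube_bump_elem: "(\<lambda>x. complex_of_real (cube_bump c R x)) \<in> elem"
proof -
 have "(\<lambda>x. \<Prod>i\<in>UNIV. complex_of_real (flat_exp 0 (1 * x $ i + (R - c $ i))) *
   complex_of_real (flat_exp 0 ((-1) * x $ i + (c $ i + R)))) \<in> elem"
  by (intro elem_prod elem.intros)
 then show ?thesis by (simp add: cube_bump_def algebra_simps)
qed

lemma supp_subset_closed: "closed F \<Longrightarrow> (\<And>x. x \<notin> F \<Longrightarrow> f x = 0) \<Longrightarrow> supp f \<subseteq> F"
 unfolding supp_def by (rule closure_minimal) auto

abbreviation rcube :: "('n::finite \<Rightarrow> rat) \<times> rat \<Rightarrow> (real^'n) set" where
 "rcube m \<equiv> cb (\<chi> i. of_rat (fst m i)) (of_rat (snd m))"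

text \<open>Rational cubes are countable, so an open set is exhausted by a sequence of them;
  \<open>cutoff\<close> rests on this.\<close>

lemma rational_cube:
 assumes "open V" "x \<in> (V :: (real^'n::finite) set)"
 shows "\<exists>m. x \<in> interior (rcube m) \<and> rcube m \<subseteq> V"
proof -
 obtain e where e: "e > 0" "ball x e \<subseteq> V" using assms openE by blast
 \<comment> \<open>A radius below 2 d and a centre off by less than d leave each point of the cube
   within 3 d of x in every coordinate, hence within 3 e / 4 in the l1 norm.\<close>
 define d where "d = e / (4 * real CARD('n))"
 have d: "d > 0" using e by (simp add: d_def)
 obtain R' where R': "d < of_rat R'" "of_rat R' < 2 * d" using of_rat_dense[of d "2*d"] d by auto
 have "\<exists>q. x $ i - d < of_rat q \<and> of_rat q < x $ i + d" for i
  using of_rat_dense[of "x $ i - d" "x $ i + d"] d by auto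
 then obtain m where m: "\<And>i. x $ i - d < of_rat (m i) \<and> of_rat (m i) < x $ i + d" by metis
 have "\<bar>x $ i - of_rat (m i)\<bar> < of_rat R'" for i using m[of i] R' by linarith
 then have 1: "x \<in> interior (rcube (m, R'))"
  unfolding interior_cb by simp
 have "y \<in> ball x e" if y: "y \<in> rcube (m, R')" for y
 proof -
  have "\<bar>(y - x) $ i\<bar> \<le> 3 * d" for i
  proof -
   have "\<bar>y $ i - of_rat (m i)\<bar> \<le> of_rat R'" using y unfolding mem_cb by simp
   then show ?thesis using m[of i] R' unfolding vector_minus_component by linarith
  qed
  then have "(\<Sum>i\<in>UNIV. \<bar>(y - x) $ i\<bar>) \<le> (\<Sum>i\<in>(UNIV::'n set). 3 * d)" by (intro sum_mono)
  also have "\<dots> < e" using e(1) by (simp add: d_def field_simps)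
  finally have "norm (y - x) < e" using norm_le_l1_cart[of "y - x"] by linarith
  then show ?thesis by (simp add: dist_norm norm_minus_commute)
 qed
 with 1 e(2) show ?thesis by blast
qed

text \<open>A smooth function supported in \<open>V\<close> which converges to 1 on \<open>V\<close> as \<open>k\<close> grows.\<close>

definition cutoff :: "(real^'n::finite) set \<Rightarrow> nat \<Rightarrow> real^'n \<Rightarrow> real" where
 "cutoff V k x = 1 - (\<Prod>i\<in>{i. i \<le> k \<and> rcube (from_nat i :: ('n \<Rightarrow> rat) \<times> rat) \<subseteq> V}.
   (1 - cube_bump (\<chi> j. of_rat (fst (from_nat i :: ('n \<Rightarrow> rat) \<times> rat) j))
    (of_rat (snd (from_nat i :: ('n \<Rightarrow> rat) \<times> rat))) x) ^ k)"

text \<open>A point of V is interior to some rational cube inside V. Its bump b is positive there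
  and enters the product once k is large, where the factor (1 - b)^k tends to 0. For fixed k only
  finitely many cubes occur, which gives the compact support.\<close>

lemma cutoff_props:
 fixes V :: "(real^'n::finite) set"
 shows "0 \<le> cutoff V k x" "cutoff V k x \<le> 1"
  "(\<lambda>x. complex_of_real (cutoff V k x)) \<in> elem"
  "\<exists>F. compact F \<and> F \<subseteq> V \<and> (\<forall>x. x \<notin> F \<longrightarrow> cutoff V k x = 0)"
  "open V \<Longrightarrow> x \<in> V \<Longrightarrow> (\<lambda>k. cutoff V k x) \<longlonglongrightarrow> 1"
proof -
 let ?m = "from_nat :: nat \<Rightarrow> ('n \<Rightarrow> rat) \<times> rat"
 let ?c = "\<lambda>i. (\<chi> j. of_rat (fst (?m i) j)) :: real^'n"
 let ?R = "\<lambda>i. of_rat (snd (?m i)) :: real"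
 let ?I = "\<lambda>k. {i. i \<le> k \<and> rcube (?m i) \<subseteq> V}"
 have fin: "finite (?I k)" for k by auto
 have b: "0 \<le> (1 - cube_bump (?c i) (?R i) x) ^ k" "(1 - cube_bump (?c i) (?R i) x) ^ k \<le> 1" for i k x
  using cube_bump_bounds[where c="?c i" and R="?R i" and x=x] by (auto intro: power_le_one)
 show "0 \<le> cutoff V k x" unfolding cutoff_def using b by (simp add: prod_le_1)
 show le1: "cutoff V k x \<le> 1" for k x unfolding cutoff_def using b by (simp add: prod_nonneg)
 have "(\<lambda>x. 1 - (\<Prod>i\<in>?I k. (1 - complex_of_real (cube_bump (?c i) (?R i) x)) ^ k)) \<in> elem"
  by (intro elem_minus elem.const elem_prod elem_power cube_bump_elem)
 then show "(\<lambda>x. complex_of_real (cutoff V k x)) \<in> elem" by (simp add: cutoff_def)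
 show "\<exists>F. compact F \<and> F \<subseteq> V \<and> (\<forall>x. x \<notin> F \<longrightarrow> cutoff V k x = 0)"
 proof (intro exI conjI allI impI)
  show "compact (\<Union>i\<in>?I k. rcube (?m i))" using fin by (intro compact_UN) auto
  show "(\<Union>i\<in>?I k. rcube (?m i)) \<subseteq> V" by auto
  fix x assume x: "x \<notin> (\<Union>i\<in>?I k. rcube (?m i))"
  have "cube_bump (?c i) (?R i) x = 0" if "i \<in> ?I k" for i
  proof -
   have "x \<notin> interior (rcube (?m i))" using x that interior_subset by fastforce
   then show ?thesis using cube_bump_pos[of "?c i" "?R i" x] cube_bump_bounds(1)[of "?c i" "?R i" x] by linarith
  qed
  then show "cutoff V k x = 0" by (simp add: cutoff_def)
 qed
 assume "open V" "x \<in> V"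
 then obtain m where m: "x \<in> interior (rcube m)" "rcube m \<subseteq> V" using rational_cube by blast
 define i where "i = to_nat m"
 have mi: "?m i = m" by (simp add: i_def)
 let ?b = "cube_bump (?c i) (?R i) x"
 have bp: "0 < ?b" "?b \<le> 1" using m(1) cube_bump_bounds(2) unfolding mi cube_bump_pos by auto
 have le: "1 - cutoff V k x \<le> (1 - ?b) ^ k" if "k \<ge> i" for k
 proof -
  have "i \<in> ?I k" using m mi that by simp
  then have "(\<Prod>i\<in>?I k. (1 - cube_bump (?c i) (?R i) x) ^ k) =
    (1 - ?b) ^ k * (\<Prod>i\<in>?I k - {i}. (1 - cube_bump (?c i) (?R i) x) ^ k)"
   using fin by (intro prod.remove)
  also have "\<dots> \<le> (1 - ?b) ^ k"
   using b by (intro mult_left_le prod_le_1) auto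
  finally show ?thesis by (simp add: cutoff_def)
 qed
 have "(\<lambda>k. (1 - ?b) ^ k) \<longlonglongrightarrow> 0" using bp by (intro LIMSEQ_realpow_zero) auto
 moreover have "eventually (\<lambda>k. norm (1 - cutoff V k x) \<le> (1 - ?b) ^ k) sequentially"
  using eventually_ge_at_top[of i]
  by eventually_elim (use le le1 in simp)
 ultimately have "(\<lambda>k. 1 - cutoff V k x) \<longlonglongrightarrow> 0" by (rule Lim_null_comparison[rotated])
 then have "(\<lambda>k. 1 - (1 - cutoff V k x)) \<longlonglongrightarrow> 1 - 0" by (intro tendsto_intros)
 then show "(\<lambda>k. cutoff V k x) \<longlonglongrightarrow> 1" by simp
qed

text \<open>The radial retraction of the plane onto the closed disc of radius B, for positive
  B.\<close>

definition clip :: "real \<Rightarrow> complex \<Rightarrow> complex" where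
 "clip B z = z /\<^sub>R max 1 (norm z / B)"

lemma clip_props:
 assumes "0 < B"
 shows "norm (clip B z) \<le> B" "norm z \<le> B \<Longrightarrow> clip B z = z" "continuous_on S (clip B)"
  "norm (clip B z) \<le> norm z"
proof -
 show "norm (clip B z) \<le> B"
  using assms by (auto simp: clip_def max_def divide_simps)
 show "norm z \<le> B \<Longrightarrow> clip B z = z"
  using assms by (simp add: clip_def max_def divide_simps)
 show "continuous_on S (clip B)"
  unfolding clip_def using assms by (intro continuous_intros) auto
 show "norm (clip B z) \<le> norm z"
  using assms by (auto simp: clip_def max_def divide_simps mult_left_le_one_le)
qed

text \<open>Measurability yields continuous functions converging off a negligible set. Clipping
  keeps them bounded, polynomials replace them uniformly on a cube around V, and cutoffs push the
  supports into V. The common bound is kept for the sake of dominated convergence.\<close>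

lemma test_approx:
 fixes f :: "'n::finite cfun"
 assumes V: "open V" "bounded V" and f: "f \<in> bmeas"
  and fB: "\<And>x. norm (f x) \<le> B" and B: "0 < B" and f0: "\<And>x. x \<notin> V \<Longrightarrow> f x = 0"
 shows "\<exists>\<phi>. (\<forall>k. \<phi> k \<in> test_functions \<and> supp (\<phi> k) \<subseteq> V \<and> (\<forall>x. norm (\<phi> k x) \<le> B + 1)) \<and>
  (AE x in lebesgue. (\<lambda>k. \<phi> k x) \<longlonglongrightarrow> f x)"
proof -
 have "f measurable_on UNIV" using f by (intro lebesgue_measurable_imp_measurable_on) auto
 then obtain N g where N: "negligible N" and g: "\<And>k. continuous_on UNIV (g k)"
  "\<And>x. x \<notin> N \<Longrightarrow> (\<lambda>k. g k x) \<longlonglongrightarrow> f x"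
  by (auto simp: measurable_on_def)
 obtain R where R: "V \<subseteq> cb 0 R" using bounded_subset_cb[OF V(2)] by blast
 have "\<exists>p. polynomial_function p \<and> (\<forall>x\<in>cb 0 R. norm (clip B (g k x) - p x) < inverse (real (Suc k)))" for k
  by (rule Stone_Weierstrass_polynomial_function)
    (auto intro!: continuous_on_compose2[OF clip_props(3)[OF B]] continuous_on_subset[OF g(1)])
 then obtain p where p: "\<And>k. polynomial_function (p k)"
  "\<And>k x. x \<in> cb 0 R \<Longrightarrow> norm (clip B (g k x) - p k x) < inverse (real (Suc k))" by metis
 define \<phi> where "\<phi> k x = p k x * complex_of_real (cutoff V k x)" for k x
 have "\<phi> k \<in> test_functions \<and> supp (\<phi> k) \<subseteq> V \<and> (\<forall>x. norm (\<phi> k x) \<le> B + 1)" for k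
 proof (intro conjI allI)
  obtain F where F: "compact F" "F \<subseteq> V" "\<And>x. x \<notin> F \<Longrightarrow> cutoff V k x = 0"
   using cutoff_props(4) by blast
  have s: "supp (\<phi> k) \<subseteq> F" using F by (intro supp_subset_closed) (auto simp: \<phi>_def compact_imp_closed)
  with F show "supp (\<phi> k) \<subseteq> V" by blast
  have "compact (F \<inter> supp (\<phi> k))"
   using F by (intro compact_Int_closed) (auto simp: supp_def)
  moreover have "\<phi> k \<in> elem" unfolding \<phi>_def by (intro elem.mult elem_polynomial p cutoff_props)
  ultimately show "\<phi> k \<in> test_functions"
   using s by (auto simp: test_functions_def elem_smooth Int_absorb1)
  fix x
  show "norm (\<phi> k x) \<le> B + 1"
  proof (cases "x \<in> F")
   case True
   then have "x \<in> cb 0 R" using F R by blast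
   from p(2)[OF this, of k] have "norm (p k x) \<le> norm (clip B (g k x)) + inverse (real (Suc k))"
    using norm_triangle_ineq2[of "p k x" "clip B (g k x)"] by (simp add: norm_minus_commute)
   also have "\<dots> \<le> B + 1" using clip_props(1)[OF B, of "g k x"]
    by (intro add_mono) (auto simp: inverse_eq_divide divide_le_eq)
   finally have "norm (p k x) \<le> B + 1" .
   moreover have "norm (\<phi> k x) \<le> norm (p k x) * 1"
    unfolding \<phi>_def norm_mult using cutoff_props(1,2)[of V k x] by (intro mult_left_mono) auto
   ultimately show ?thesis by simp
  qed (use F B in \<open>simp add: \<phi>_def\<close>)
 qed
 moreover have "AE x in lebesgue. (\<lambda>k. \<phi> k x) \<longlonglongrightarrow> f x"
 proof -
  have "AE x in lebesgue. x \<notin> N" using N by (simp add: negligible_iff_null_sets AE_not_in)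
  then show ?thesis
  proof eventually_elim
   case (elim x)
   show ?case
   proof (cases "x \<in> V")
    case True
    have "(\<lambda>k. clip B (g k x)) \<longlonglongrightarrow> clip B (f x)"
     using clip_props(3)[OF B, of UNIV] g(2)[OF elim]
     by (intro continuous_on_tendsto_compose[of UNIV "clip B"]) auto
    moreover have "(\<lambda>k. p k x - clip B (g k x)) \<longlonglongrightarrow> 0"
    proof (rule Lim_null_comparison)
     show "(\<lambda>k. inverse (real (Suc k))) \<longlonglongrightarrow> 0" by (rule LIMSEQ_inverse_real_of_nat)
     show "eventually (\<lambda>k. norm (p k x - clip B (g k x)) \<le> inverse (real (Suc k))) sequentially"
      using p(2)[of x] True R by (intro always_eventually allI) (metis norm_minus_commute less_imp_le subset_iff)
    qed
    ultimately have "(\<lambda>k. clip B (g k x) + (p k x - clip B (g k x))) \<longlonglongrightarrow> clip B (f x) + 0"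
     by (rule tendsto_add)
    then have "(\<lambda>k. p k x) \<longlonglongrightarrow> f x" using clip_props(2)[OF B fB] by simp
    then have "(\<lambda>k. p k x * complex_of_real (cutoff V k x)) \<longlonglongrightarrow> f x * complex_of_real 1"
     using V True by (intro tendsto_intros cutoff_props(5))
    then show ?thesis by (simp add: \<phi>_def)
   next
    case False
    then have "cutoff V k x = 0" for k using cutoff_props(4)[of V k] by blast
    then show ?thesis using False f0 by (simp add: \<phi>_def)
   qed
  qed
 qed
 ultimately show ?thesis by blast
qed

lemma measurable_continuous_lebesgue:
 "continuous_on UNIV (f :: 'a::euclidean_space \<Rightarrow> 'b::topological_space) \<Longrightarrow> f \<in> bmeas"
 by (intro measurable_completion) (simp add: borel_measurable_continuous_onI)

lemma test_measurable: "\<phi> \<in> test_functions \<Longrightarrow> \<phi> \<in> bmeas"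
 and schwartz_measurable: "f \<in> schwartz_space \<Longrightarrow> f \<in> bmeas"
 by (simp_all add: measurable_continuous_lebesgue test_continuous schwartz_continuous)

lemma open_lebesgue: "open V \<Longrightarrow> V \<in> sets lebesgue"
 by (simp add: borel_open sets_completionI_sets)

lemma integrable_indicator_bounded:
 assumes "open V" "bounded (V :: 'a::euclidean_space set)"
 shows "integrable lebesgue (indicator V :: 'a \<Rightarrow> real)"
proof -
 have "V \<in> lmeasurable" using assms by (simp add: bounded_set_imp_lmeasurable open_lebesgue)
 then show ?thesis by (intro integrable_real_indicator) (auto dest: fmeasurableD fmeasurableD2 simp: top.not_eq_extremum)
qed

text \<open>Test functions approximating the conjugate sign of h turn the vanishing pairings, in the
  limit, into the L1 norm of h on V.\<close>

lemma fundamental_lemma: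
 fixes h :: "'n::finite cfun"
 assumes V: "open V" "bounded V" and h: "set_integrable lebesgue V h"
  and 0: "\<And>\<phi>. \<phi> \<in> test_functions \<Longrightarrow> supp \<phi> \<subseteq> V \<Longrightarrow> (LINT x|lebesgue. h x * \<phi> x) = 0"
 shows "AE x in lebesgue. x \<in> V \<longrightarrow> h x = 0"
proof -
 define H where "H x = indicator V x *\<^sub>R h x" for x
 have H: "integrable lebesgue H" using h by (simp add: H_def[abs_def] set_integrable_def)
 then have Hm [measurable]: "H \<in> bmeas" by simp
 define f where "f x = cnj (sgn (H x))" for x
 have fm: "f \<in> bmeas"
 proof -
  have "cnj \<in> borel_measurable borel" by (intro borel_measurable_continuous_onI continuous_intros)
  from measurable_compose[OF Hm this] show ?thesis unfolding f_def[abs_def] by (simp add: sgn_div_norm)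
 qed
 obtain \<phi> where \<phi>: "\<And>k. \<phi> k \<in> test_functions" "\<And>k. supp (\<phi> k) \<subseteq> V" "\<And>k x. norm (\<phi> k x) \<le> 1 + 1"
  and lim: "AE x in lebesgue. (\<lambda>k. \<phi> k x) \<longlonglongrightarrow> f x"
 proof -
  have "norm (f x) \<le> 1" for x by (simp add: f_def norm_sgn)
  moreover have "f x = 0" if "x \<notin> V" for x using that by (simp add: f_def H_def)
  ultimately have "\<exists>\<phi>. (\<forall>k. \<phi> k \<in> test_functions \<and> supp (\<phi> k) \<subseteq> V \<and> (\<forall>x. norm (\<phi> k x) \<le> 1 + 1)) \<and>
    (AE x in lebesgue. (\<lambda>k. \<phi> k x) \<longlonglongrightarrow> f x)"
   by (intro test_approx[OF V fm]) auto
  then show ?thesis using that by blast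
 qed
 have m: "\<phi> k \<in> bmeas" for k using \<phi>(1) by (rule test_measurable)
 have "(\<lambda>k. LINT x|lebesgue. H x * \<phi> k x) \<longlonglongrightarrow> (LINT x|lebesgue. H x * f x)"
 proof (rule integral_dominated_convergence[where w="\<lambda>x. norm (H x) * 2"])
  show "AE x in lebesgue. (\<lambda>k. H x * \<phi> k x) \<longlonglongrightarrow> H x * f x"
   using lim by eventually_elim (intro tendsto_intros)
  show "integrable lebesgue (\<lambda>x. norm (H x) * 2)" using H by simp
  show "AE x in lebesgue. norm (H x * \<phi> k x) \<le> norm (H x) * 2" for k
   using \<phi>(3)[of k] by (intro AE_I2) (auto simp: norm_mult intro!: mult_left_mono)
 qed (use m fm in measurable)
 moreover have "(LINT x|lebesgue. H x * \<phi> k x) = 0" for k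
 proof -
  have "H x * \<phi> k x = h x * \<phi> k x" for x
   using outside_supp[of x "\<phi> k"] \<phi>(2)[of k] by (cases "x \<in> V") (auto simp: H_def)
  then have "(\<lambda>x. H x * \<phi> k x) = (\<lambda>x. h x * \<phi> k x)" by (rule ext)
  then show ?thesis using 0[OF \<phi>(1,2)] by (simp only:)
 qed
 ultimately have "(\<lambda>k::nat. 0) \<longlonglongrightarrow> (LINT x|lebesgue. H x * f x)" by (simp only:)
 then have "(LINT x|lebesgue. H x * f x) = 0" by (simp add: LIMSEQ_const_iff)
 moreover have "H x * f x = complex_of_real (norm (H x))" for x
  by (cases "H x = 0") (simp_all add: f_def sgn_div_norm complex_norm_square[symmetric]
    power2_eq_square scaleR_conv_of_real field_simps)
 ultimately have "(LINT x|lebesgue. norm (H x)) = 0" by simp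
 then have "AE x in lebesgue. norm (H x) = 0"
  using H by (subst (asm) integral_nonneg_eq_0_iff_AE) auto
 then show ?thesis by eventually_elim (auto simp: H_def)
qed

lemma power_add_le: "0 \<le> a \<Longrightarrow> 0 \<le> b \<Longrightarrow> (a + b) ^ q \<le> 2 ^ q * (a ^ q + (b::real) ^ q)"
proof (induct a b rule: linorder_wlog)
 case (le a b)
 have "(a + b) ^ q \<le> (2 * b) ^ q" using le by (intro power_mono) auto
 also have "\<dots> \<le> 2 ^ q * (a ^ q + b ^ q)" using le by (simp add: power_mult_distrib)
 finally show ?case .
qed (simp add: add.commute)

text \<open>Values are clipped first, since \<open>test_approx\<close> handles bounded functions.
  Both errors are small in the mean of order q and are combined by \<open>power_add_le\<close>,
  which is where the factor 2 ^ q in the thresholds comes from.\<close>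

lemma test_dense:
 fixes f :: "'n::finite cfun"
 assumes V: "open V" "bounded V" and f [measurable]: "f \<in> bmeas"
  and q: "0 < q" and fi: "integrable lebesgue (\<lambda>x. norm (f x) ^ q)"
  and f0: "\<And>x. x \<notin> V \<Longrightarrow> f x = 0" and e: "0 < e"
 shows "\<exists>\<phi>\<in>test_functions. supp \<phi> \<subseteq> V \<and> integrable lebesgue (\<lambda>x. norm (\<phi> x - f x) ^ q) \<and>
   (LINT x|lebesgue. norm (\<phi> x - f x) ^ q) < e"
proof -
 define g where "g k x = clip (real (Suc k)) (f x)" for k x
 have gm [measurable]: "g k \<in> bmeas" for k
  unfolding g_def[abs_def] clip_def by measurable
 have gn: "norm (g k x) \<le> norm (f x)" "norm (g k x) \<le> real (Suc k)" for k x
  by (simp_all add: g_def clip_props del: of_nat_Suc)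
 have b1: "norm (g k x - f x) ^ q \<le> 2 ^ q * norm (f x) ^ q" for k x
 proof -
  have "norm (g k x - f x) \<le> 2 * norm (f x)" using gn(1)[of k x] norm_triangle_ineq4[of "g k x" "f x"] by linarith
  then have "norm (g k x - f x) ^ q \<le> (2 * norm (f x)) ^ q" by (intro power_mono) auto
  then show ?thesis by (simp add: power_mult_distrib)
 qed
 have i1: "integrable lebesgue (\<lambda>x. norm (g k x - f x) ^ q)" for k
  by (rule Bochner_Integration.integrable_bound[OF integrable_mult_right[OF fi, of "2^q"]])
    (auto simp: b1)
 have "(\<lambda>k. LINT x|lebesgue. norm (g k x - f x) ^ q) \<longlonglongrightarrow> (LINT (x::real^'n)|lebesgue. (0::real))"
 proof (rule integral_dominated_convergence[where w="\<lambda>x. 2 ^ q * norm (f x) ^ q"])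
  show "AE x in lebesgue. (\<lambda>k. norm (g k x - f x) ^ q) \<longlonglongrightarrow> 0"
  proof (intro AE_I2)
   fix x
   obtain K :: nat where "norm (f x) \<le> real K" using real_arch_simple by blast
   then have "g k x = f x" if "k \<ge> K" for k
    unfolding g_def using that by (intro clip_props(2)) auto
   then show "(\<lambda>k. norm (g k x - f x) ^ q) \<longlonglongrightarrow> 0"
    using q by (intro tendsto_eventually eventually_sequentiallyI[of K]) simp
  qed
 qed (use fi b1 in auto)
 then have "(\<lambda>k. 2 ^ q * (LINT x|lebesgue. norm (g k x - f x) ^ q)) \<longlonglongrightarrow> 2 ^ q * 0"
  by (intro tendsto_intros) simp
 then have "eventually (\<lambda>k. 2 ^ q * (LINT x|lebesgue. norm (g k x - f x) ^ q) < e / 2) sequentially"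
  by (rule order_tendstoD(2)) (use e in simp)
 then obtain k where k: "2 ^ q * (LINT x|lebesgue. norm (g k x - f x) ^ q) < e / 2"
  by (auto simp: eventually_sequentially)
 have "g k x = 0" if "x \<notin> V" for x using f0[OF that] by (simp add: g_def clip_def)
 then obtain \<phi> where \<phi>: "\<And>j. \<phi> j \<in> test_functions" "\<And>j. supp (\<phi> j) \<subseteq> V" "\<And>j x. norm (\<phi> j x) \<le> real (Suc k) + 1"
  and lim: "AE x in lebesgue. (\<lambda>j. \<phi> j x) \<longlonglongrightarrow> g k x"
  using test_approx[OF V gm gn(2), of k] that by (auto simp del: of_nat_Suc) blast
 have [measurable]: "\<phi> j \<in> bmeas" for j using \<phi>(1) by (rule test_measurable)
 let ?w = "\<lambda>x. (2 * real (Suc k) + 1) ^ q * indicator V x :: real"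
 have wi: "integrable lebesgue ?w" using integrable_indicator_bounded[OF V] by simp
 have b2: "norm (\<phi> j x - g k x) ^ q \<le> ?w x" for j x
 proof (cases "x \<in> V")
  case True
  have "norm (\<phi> j x - g k x) \<le> 2 * real (Suc k) + 1"
   using \<phi>(3)[of j x] gn(2)[of k x] norm_triangle_ineq4[of "\<phi> j x" "g k x"] by argo
  then show ?thesis using True by (simp add: power_mono)
 next
  case False
  then have "\<phi> j x = 0" using outside_supp[of x "\<phi> j"] \<phi>(2)[of j] by blast
  then show ?thesis using False \<open>x \<notin> V \<Longrightarrow> g k x = 0\<close> q by (simp add: zero_power)
 qed
 have i2: "integrable lebesgue (\<lambda>x. norm (\<phi> j x - g k x) ^ q)" for j
  by (rule Bochner_Integration.integrable_bound[OF wi]) (use b2 in \<open>auto simp del: of_nat_Suc\<close>)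
 have "(\<lambda>j. LINT x|lebesgue. norm (\<phi> j x - g k x) ^ q) \<longlonglongrightarrow> (LINT (x::real^'n)|lebesgue. (0::real))"
 proof (rule integral_dominated_convergence[where w="?w"])
  show "AE x in lebesgue. (\<lambda>j. norm (\<phi> j x - g k x) ^ q) \<longlonglongrightarrow> 0"
   using lim
  proof eventually_elim
   case (elim x)
   then have "(\<lambda>j. norm (\<phi> j x - g k x) ^ q) \<longlonglongrightarrow> norm (g k x - g k x) ^ q" by (intro tendsto_intros)
   moreover have "norm (g k x - g k x) ^ q = 0" using q by simp
   ultimately show ?case by (simp only:)
  qed
 qed (use wi b2 in \<open>auto simp del: of_nat_Suc\<close>)
 then have "(\<lambda>j. 2 ^ q * (LINT x|lebesgue. norm (\<phi> j x - g k x) ^ q)) \<longlonglongrightarrow> 2 ^ q * 0"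
  by (intro tendsto_intros) simp
 then have "eventually (\<lambda>j. 2 ^ q * (LINT x|lebesgue. norm (\<phi> j x - g k x) ^ q) < e / 2) sequentially"
  by (rule order_tendstoD(2)) (use e in simp)
 then obtain j where j: "2 ^ q * (LINT x|lebesgue. norm (\<phi> j x - g k x) ^ q) < e / 2"
  by (auto simp: eventually_sequentially)
 let ?W = "\<lambda>x. 2 ^ q * (norm (\<phi> j x - g k x) ^ q + norm (g k x - f x) ^ q)"
 have Wi: "integrable lebesgue ?W" using i1 i2 by simp
 have b3: "norm (\<phi> j x - f x) ^ q \<le> ?W x" for x
 proof -
  have "norm (\<phi> j x - f x) \<le> norm (\<phi> j x - g k x) + norm (g k x - f x)"
   using norm_triangle_ineq[of "\<phi> j x - g k x" "g k x - f x"] by simp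
  then have "norm (\<phi> j x - f x) ^ q \<le> (norm (\<phi> j x - g k x) + norm (g k x - f x)) ^ q"
   by (intro power_mono) auto
  also have "\<dots> \<le> ?W x" by (intro power_add_le) auto
  finally show ?thesis .
 qed
 have i3: "integrable lebesgue (\<lambda>x. norm (\<phi> j x - f x) ^ q)"
  by (rule Bochner_Integration.integrable_bound[OF Wi]) (use b3 in auto)
 have "(LINT x|lebesgue. norm (\<phi> j x - f x) ^ q) \<le> (LINT x|lebesgue. ?W x)"
  using i3 Wi b3 by (intro integral_mono) auto
 also have "\<dots> = 2 ^ q * (LINT x|lebesgue. norm (\<phi> j x - g k x) ^ q) + 2 ^ q * (LINT x|lebesgue. norm (g k x - f x) ^ q)"
  using i1 i2 by (simp add: distrib_left)
 also have "\<dots> < e" using j k by simp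
 finally show ?thesis using \<phi>(1,2)[of j] i3 by blast
qed

lemma nn_term_le_suminf: "f i \<le> (\<Sum>i. f i :: ennreal)"
 using sum_le_suminf[of f "{i}"] by simp

text \<open>Points are sorted by the first dyadic cube that contains them; rapid decay beats the
  assumed geometric growth of the measure. Stated for a general measure in order to serve both
  Lebesgue measure and the weights.\<close>

lemma schwartz_nn_integral_finite:
 fixes f :: "'n::finite cfun"
 assumes f: "f \<in> schwartz_space" and p: "0 < p"
  and [measurable_cong, simp]: "sets \<mu> = sets lebesgue"
  and D: "1 \<le> D" and gr: "\<And>j::nat. emeasure \<mu> (cb 0 (2 ^ j)) \<le> ennreal (C * D ^ j)"
 shows "pow_int \<mu> p f < \<infinity>"
proof -
 \<comment> \<open>With this k the decay by 2^(-p k) per generation beats the growth by D with a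
   factor 2 to spare, so the series is geometric.\<close>
 obtain k :: nat where k: "2 * D \<le> (2 powr p) ^ k"
  using real_arch_pow[where x="2 powr p"] p by (auto intro: less_imp_le)
 have "bounded (range (\<lambda>x. (1 + norm x) ^ k * norm (partials [] f x)))"
  using f unfolding schwartz_space_def by blast
 then obtain M where M: "\<And>x. (1 + norm x) ^ k * norm (f x) \<le> M" "0 < M"
  by (auto simp: bounded_pos abs_mult)
 define C' where "C' = \<bar>C\<bar>"
 \<comment> \<open>The factor 2 D pays for a shift by one: a point first captured at index j is only
   known to be large at scale 2^(j-1).\<close>
 let ?t = "\<lambda>j. M powr p * (2 * D) * (1 / (2 * D)) ^ j"
 have pt: "ennreal (norm (f x) powr p) \<le> (\<Sum>j. ennreal (?t j) * indicator (cb 0 (2^j)) x)" for x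
 proof -
  obtain R where "R > 0" "{x} \<subseteq> cb 0 R" using bounded_subset_cb[where S="{x}" and x=0] by auto
  moreover obtain j :: nat where "R < 2 ^ j" using real_arch_pow[where x=2] by auto
  ultimately have "x \<in> cb 0 (2 ^ j)" using cb_mono[where R=R and R'="2^j" and x=0] by auto
  then obtain j :: nat where j: "x \<in> cb 0 (2 ^ j)" "\<And>i. i < j \<Longrightarrow> x \<notin> cb 0 (2 ^ i)"
   using exists_least_iff[where P="\<lambda>j::nat. x \<in> cb 0 (2 ^ j)"] by blast
  have "norm (f x) powr p \<le> ?t j"
  proof (cases j)
   case 0
   have "1 * norm (f x) \<le> (1 + norm x) ^ k * norm (f x)" by (intro mult_right_mono) auto
   then have "norm (f x) powr p \<le> M powr p" using M(1)[of x] p by (intro powr_mono2) auto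
   also have "\<dots> \<le> ?t 0" using D mult_left_mono[of 1 "2 * D" "M powr p"] by simp
   finally show ?thesis using 0 by simp
  next
   case (Suc i)
   then have "x \<notin> cb 0 (2 ^ i)" using j by simp
   then obtain l where "\<bar>x $ l\<bar> > 2 ^ i" by (auto simp: mem_cb not_le)
   then have "2 ^ i \<le> 1 + norm x" using component_le_norm_cart[where x=x and i=l] by linarith
   then have "(2 ^ i) ^ k * norm (f x) \<le> M"
    using M(1)[of x] by (meson mult_right_mono norm_ge_zero order_trans power_mono zero_le_numeral zero_le_power)
   then have "norm (f x) \<le> M / (2 ^ i) ^ k" by (simp add: field_simps)
   then have "norm (f x) powr p \<le> (M / (2 ^ i) ^ k) powr p" using p by (intro powr_mono2) auto
   also have "\<dots> = M powr p / ((2 powr p) ^ k) ^ i"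
   proof -
    have "((2::real) ^ (i * k)) powr p = (2 powr p) ^ (i * k)"
    proof -
     have "((2::real) ^ (i * k)) powr p = (2 powr real (i * k)) powr p"
      by (subst powr_realpow) simp_all
     also have "\<dots> = (2 powr p) powr real (i * k)" by (simp only: powr_powr mult.commute)
     also have "\<dots> = (2 powr p) ^ (i * k)" by (rule powr_realpow) simp
     finally show ?thesis .
    qed
    then show ?thesis
     using M(2) by (simp add: powr_divide power_mult[symmetric] mult.commute)
   qed
   also have "\<dots> \<le> M powr p / (2 * D) ^ i"
    using k D M(2) by (intro divide_left_mono power_mono mult_pos_pos) auto
   also have "\<dots> = ?t j" using D Suc by (simp add: power_divide power_mult_distrib)
   finally show ?thesis .
  qed
  then have "ennreal (norm (f x) powr p) \<le> ennreal (?t j) * indicator (cb 0 (2^j)) x"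
   using j(1) by (simp add: ennreal_leI)
  also have "\<dots> \<le> (\<Sum>j. ennreal (?t j) * indicator (cb 0 (2^j)) x)" by (rule nn_term_le_suminf)
  finally show ?thesis .
 qed
 have "pow_int \<mu> p f \<le> (\<integral>\<^sup>+x. (\<Sum>j. ennreal (?t j) * indicator (cb 0 (2^j)) x) \<partial>\<mu>)"
  by (intro nn_integral_mono pt)
 also have "\<dots> = (\<Sum>j. ennreal (?t j) * emeasure \<mu> (cb 0 (2^j)))"
  by (subst nn_integral_suminf) (auto simp: nn_integral_cmult)
 also have "\<dots> \<le> (\<Sum>j. ennreal (M powr p * (2 * D) * C' * (1/2) ^ j))"
 proof (intro suminf_le summableI allI)
  fix j
  have "ennreal (?t j) * emeasure \<mu> (cb 0 (2^j)) \<le> ennreal (?t j) * ennreal (C' * D ^ j)"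
   using D by (intro mult_left_mono order_trans[OF gr] ennreal_leI mult_right_mono) (auto simp: C'_def)
  also have "\<dots> = ennreal (M powr p * (2 * D) * C' * (1/2) ^ j)"
   using D by (subst ennreal_mult[symmetric]) (auto simp: C'_def power_divide power_mult_distrib)
  finally show "ennreal (?t j) * emeasure \<mu> (cb 0 (2^j)) \<le> ennreal (M powr p * (2 * D) * C' * (1/2) ^ j)" .
 qed
 also have "\<dots> < \<infinity>"
  using D by (subst suminf_ennreal2) (auto simp: C'_def intro!: summable_mult summable_geometric)
 finally show ?thesis .
qed

subsection \<open>Powers of extended nonnegative reals\<close>

lemma epowr_ennreal: "0 < a \<Longrightarrow> 0 \<le> x \<Longrightarrow> epowr (ennreal x) a = ennreal (x powr a)"
 by (auto simp: epowr_def)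

lemma epowr_simps [simp]:
 "0 < a \<Longrightarrow> epowr \<infinity> a = \<infinity>" "0 < a \<Longrightarrow> epowr top a = \<infinity>" "0 < a \<Longrightarrow> epowr 0 a = 0" "epowr x 1 = x"
 by (auto simp: epowr_def ennreal_enn2real top.not_eq_extremum)

lemma epowr_measurable [measurable]: "(\<lambda>x. epowr x a) \<in> borel_measurable borel"
 unfolding epowr_def by measurable

lemma epowr_cases:
 fixes x :: ennreal obtains r where "0 \<le> r" "x = ennreal r" | "x = \<infinity>"
 by (cases x) (auto simp: infinity_ennreal_def)

lemma epowr_eq_0_iff: "0 < a \<Longrightarrow> epowr x a = 0 \<longleftrightarrow> x = 0"
 by (cases x rule: epowr_cases) (auto simp: epowr_ennreal)

lemma epowr_mult:
 assumes a: "0 < a" shows "epowr (x * y) a = epowr x a * epowr y a"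
proof -
 have top: "epowr (top * y) a = epowr top a * epowr y a" for y
  using a by (cases "y = 0") (simp_all add: ennreal_top_mult epowr_eq_0_iff)
 consider "x = top" | "y = top" | r t where "0 \<le> r" "0 \<le> t" "x = ennreal r" "y = ennreal t"
  by (cases x rule: epowr_cases; cases y rule: epowr_cases) auto
 then show ?thesis
 proof cases
  case 3
  then show ?thesis using a by (simp add: ennreal_mult[symmetric] epowr_ennreal powr_mult)
 qed (use top[of x] top[of y] in \<open>simp_all add: mult.commute\<close>)
qed

lemma epowr_epowr:
 assumes a: "0 < a" "0 < b" shows "epowr (epowr x a) b = epowr x (a * b)"
 by (cases x rule: epowr_cases) (use a in \<open>simp_all add: epowr_ennreal powr_powr\<close>)

lemma epowr_add:
 assumes a: "0 < a" "0 < b" shows "epowr x (a + b) = epowr x a * epowr x b"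
 by (cases x rule: epowr_cases)
   (use a in \<open>simp_all add: epowr_ennreal powr_add ennreal_mult ennreal_top_mult\<close>)

lemma epowr_mono:
 assumes a: "0 < a" and "x \<le> y" shows "epowr x a \<le> epowr y a"
 using assms(2)
 by (cases x rule: epowr_cases; cases y rule: epowr_cases)
   (use a in \<open>auto simp: epowr_ennreal powr_mono2 ennreal_le_iff top_unique intro!: ennreal_leI\<close>)

lemma epowr_inverse: "0 < a \<Longrightarrow> epowr (epowr x a) (1 / a) = x"
 by (simp add: epowr_epowr)

lemma epowr_le_iff: "0 < a \<Longrightarrow> epowr x a \<le> epowr y a \<longleftrightarrow> x \<le> y"
 using epowr_mono[of a x y] epowr_mono[of "1/a" "epowr x a" "epowr y a"] by (auto simp: epowr_inverse)

lemma epowr_less_top_iff: "0 < a \<Longrightarrow> epowr x a < \<infinity> \<longleftrightarrow> x < \<infinity>"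
 by (cases x rule: epowr_cases) (simp_all add: epowr_ennreal)

lemma epowr_young:
 assumes t: "0 < t" "t < 1"
 shows "epowr x t * epowr y (1 - t) \<le> ennreal t * x + ennreal (1 - t) * y"
proof (cases "x = 0 \<or> y = 0")
 case False
 then show ?thesis
 proof (cases x rule: epowr_cases; cases y rule: epowr_cases)
  fix a b assume ab: "0 \<le> a" "x = ennreal a" "0 \<le> b" "y = ennreal b"
  then have "a powr t * b powr (1 - t) \<le> t * a + (1 - t) * b"
   using Youngs_inequality_0[of t "1 - t" a b] t False by (auto simp: less_le)
  then show ?thesis using ab t
   by (simp add: epowr_ennreal ennreal_mult[symmetric] ennreal_plus[symmetric] ennreal_leI del: ennreal_plus)
 qed (use t False in \<open>auto simp: ennreal_mult_top ennreal_top_mult\<close>)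
qed (use t in auto)

text \<open>Both integrals are normalised to 1 and the pointwise inequality
  \<open>epowr_young\<close> is integrated. Zero and infinite integrals are split off because the
  normalisation divides by them.\<close>

lemma nn_Holder:
 assumes t: "0 < t" "t < 1" and [measurable]: "f \<in> borel_measurable M" "g \<in> borel_measurable M"
 shows "(\<integral>\<^sup>+x. epowr (f x) t * epowr (g x) (1 - t) \<partial>M) \<le>
   epowr (\<integral>\<^sup>+x. f x \<partial>M) t * epowr (\<integral>\<^sup>+x. g x \<partial>M) (1 - t)"
proof -
 let ?F = "\<integral>\<^sup>+x. f x \<partial>M" and ?G = "\<integral>\<^sup>+x. g x \<partial>M"
 consider "?F = 0 \<or> ?G = 0" | "?F \<noteq> 0" "?G \<noteq> 0" "?F = \<infinity> \<or> ?G = \<infinity>"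
  | "?F \<noteq> 0" "?G \<noteq> 0" "?F \<noteq> \<infinity>" "?G \<noteq> \<infinity>" by blast
 then show ?thesis
 proof cases
  case 1
  then have "(\<integral>\<^sup>+x. epowr (f x) t * epowr (g x) (1 - t) \<partial>M) = 0"
  proof
   assume "?F = 0"
   then have "AE x in M. f x = 0" by (simp add: nn_integral_0_iff_AE)
   then have "AE x in M. epowr (f x) t * epowr (g x) (1 - t) = 0" by eventually_elim (use t in simp)
   then show ?thesis by (simp add: nn_integral_0_iff_AE)
  next
   assume "?G = 0"
   then have "AE x in M. g x = 0" by (simp add: nn_integral_0_iff_AE)
   then have "AE x in M. epowr (f x) t * epowr (g x) (1 - t) = 0" by eventually_elim (use t in simp)
   then show ?thesis by (simp add: nn_integral_0_iff_AE)
  qed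
  then show ?thesis by simp
 next
  case 2
  then have "epowr ?F t * epowr ?G (1 - t) = \<infinity>"
   using t by (auto simp: ennreal_mult_eq_top_iff epowr_eq_0_iff)
  then show ?thesis by simp
 next
  case 3
  have e: "epowr (f x) t * epowr (g x) (1 - t) =
    (epowr ?F t * epowr ?G (1 - t)) * (epowr (f x / ?F) t * epowr (g x / ?G) (1 - t))" for x
  proof -
   have "f x = ?F * (f x / ?F)" "g x = ?G * (g x / ?G)"
    using 3 by (simp_all add: ennreal_times_divide ennreal_mult_divide_eq top.not_eq_extremum mult.commute)
   then have "epowr (f x) t = epowr ?F t * epowr (f x / ?F) t"
    "epowr (g x) (1 - t) = epowr ?G (1 - t) * epowr (g x / ?G) (1 - t)"
    using t by (metis epowr_mult diff_gt_0_iff_gt)+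
   then show ?thesis by (simp add: mult_ac)
  qed
  have "(\<integral>\<^sup>+x. epowr (f x) t * epowr (g x) (1 - t) \<partial>M) =
   (epowr ?F t * epowr ?G (1 - t)) * (\<integral>\<^sup>+x. epowr (f x / ?F) t * epowr (g x / ?G) (1 - t) \<partial>M)"
   unfolding e by (rule nn_integral_cmult) measurable
  also have "(\<integral>\<^sup>+x. epowr (f x / ?F) t * epowr (g x / ?G) (1 - t) \<partial>M) \<le>
    (\<integral>\<^sup>+x. ennreal t * (f x / ?F) + ennreal (1 - t) * (g x / ?G) \<partial>M)"
   by (intro nn_integral_mono epowr_young t)
  also have "\<dots> = ennreal t * (?F / ?F) + ennreal (1 - t) * (?G / ?G)"
   by (simp add: nn_integral_add nn_integral_cmult nn_integral_divide)
  also have "\<dots> = 1" using 3 t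
   by (simp add: ennreal_divide_self top.not_eq_extremum ennreal_plus[symmetric] del: ennreal_plus)
  finally show ?thesis by (simp add: mult_left_mono)
 qed
qed

subsection \<open>The layer cake formula and interpolation\<close>

lemma ennreal_top_if_unbounded:
 assumes "\<And>n::nat. ennreal (real n) \<le> X" shows "X = \<infinity>"
proof (cases X)
 case (real r)
 obtain n :: nat where "r < real n" using reals_Archimedean2 by blast
 then show ?thesis using assms[of n] real by (simp add: ennreal_le_iff)
qed simp

lemma epowr_layer:
 assumes r: "0 < r"
 shows "(\<integral>\<^sup>+l. ennreal (r * l powr (r - 1)) * indicator {l. 0 < l \<and> ennreal l < y} l \<partial>lborel) = epowr y r"
proof -
 have fin: "(\<integral>\<^sup>+l. ennreal (r * l powr (r - 1)) * indicator {l. 0 < l \<and> l < b} l \<partial>lborel) = ennreal (b powr r)"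
  if b: "0 \<le> b" for b :: real
 proof -
  have "((\<lambda>l. r * l powr (r - 1)) has_integral (r * (b powr (r - 1 + 1) / (r - 1 + 1)))) {0..b}"
   using r b by (intro has_integral_mult_right has_integral_powr_from_0) auto
  then have hi: "((\<lambda>l. r * l powr (r - 1)) has_integral (b powr r)) {0..b}" using r by simp
  have "(\<integral>\<^sup>+l\<in>{0..b}. ennreal (r * l powr (r - 1)) \<partial>lborel) = ennreal (b powr r)"
  proof -
   have "((\<lambda>l. if l \<in> {0..b} then r * l powr (r - 1) else 0) has_integral (b powr r)) UNIV"
    using hi by (simp only: has_integral_restrict_UNIV)
   then have "(\<integral>\<^sup>+l. ennreal (if l \<in> {0..b} then r * l powr (r - 1) else 0) \<partial>lborel) = ennreal (b powr r)"
    using r by (intro nn_integral_has_integral_lborel) auto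
   then show ?thesis
    by (subst (asm) nn_integral_cong[where v="\<lambda>l. ennreal (r * l powr (r - 1)) * indicator {0..b} l"])
     (auto simp: indicator_def)
  qed
  moreover have "(\<integral>\<^sup>+l. ennreal (r * l powr (r - 1)) * indicator {l. 0 < l \<and> l < b} l \<partial>lborel) =
    (\<integral>\<^sup>+l\<in>{0..b}. ennreal (r * l powr (r - 1)) \<partial>lborel)"
  proof (rule nn_integral_cong_AE)
   have "AE l in lborel. l \<noteq> 0" "AE l in lborel. l \<noteq> b" by (simp_all add: AE_lborel_singleton)
   then show "AE l in lborel. ennreal (r * l powr (r - 1)) * indicator {l. 0 < l \<and> l < b} l =
     ennreal (r * l powr (r - 1)) * indicator {0..b} l"
    by eventually_elim (auto simp: indicator_def)
  qed
  ultimately show ?thesis by simp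
 qed
 show ?thesis
 proof (cases y rule: epowr_cases)
  case (1 b)
  have "{l. 0 < l \<and> ennreal l < y} = {l. 0 < l \<and> l < b}" using 1 by (auto simp: ennreal_less_iff)
  then show ?thesis using fin[of b] 1 r by (simp add: epowr_ennreal)
 next
  case 2
  \<comment> \<open>The infinite case is reached from below: the levels under n^(1/r) already
    contribute n.\<close>
  have "ennreal (real n) \<le> (\<integral>\<^sup>+l. ennreal (r * l powr (r - 1)) * indicator {l. 0 < l \<and> ennreal l < y} l \<partial>lborel)" for n :: nat
  proof -
   have "ennreal (real n) = ennreal ((real n powr (1 / r)) powr r)"
    using r by (cases "n = 0") (simp_all add: powr_powr)
   also have "\<dots> = (\<integral>\<^sup>+l. ennreal (r * l powr (r - 1)) * indicator {l. 0 < l \<and> l < real n powr (1 / r)} l \<partial>lborel)"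
    by (rule fin[symmetric]) simp
   also have "\<dots> \<le> (\<integral>\<^sup>+l. ennreal (r * l powr (r - 1)) * indicator {l. 0 < l \<and> ennreal l < y} l \<partial>lborel)"
    by (intro nn_integral_mono mult_left_mono) (auto simp: 2 indicator_def)
   finally show ?thesis .
  qed
  then have "(\<integral>\<^sup>+l. ennreal (r * l powr (r - 1)) * indicator {l. 0 < l \<and> ennreal l < y} l \<partial>lborel) = \<infinity>"
   by (rule ennreal_top_if_unbounded)
  then show ?thesis using 2 r by simp
 qed
qed

text \<open>In the interpolation argument g is f itself: the levels below 2 f contribute the power p
  - 1, and g supplies the remaining one.\<close>

lemma layer_cake:
 assumes "sigma_finite_measure M" and r: "0 < r" and [measurable]: "f \<in> borel_measurable M" "g \<in> borel_measurable M"
 shows "(\<integral>\<^sup>+x. g x * epowr (f x) r \<partial>M) =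
  (\<integral>\<^sup>+l. ennreal (r * l powr (r - 1)) * indicator {0<..} l *
    (\<integral>\<^sup>+x. g x * indicator {x. ennreal l < f x} x \<partial>M) \<partial>lborel)"
proof -
 interpret M: sigma_finite_measure M by fact
 interpret P: pair_sigma_finite lborel M ..
 have 1: "{x. ennreal l < f x} \<inter> space M \<in> sets M" for l by measurable
 have "(\<integral>\<^sup>+x. g x * epowr (f x) r \<partial>M) =
  (\<integral>\<^sup>+x. (\<integral>\<^sup>+l. g x * (ennreal (r * l powr (r - 1)) * indicator {l. 0 < l \<and> ennreal l < f x} l) \<partial>lborel) \<partial>M)"
  by (subst nn_integral_cmult) (simp_all add: epowr_layer r)
 also have "\<dots> = (\<integral>\<^sup>+x. (\<integral>\<^sup>+l. g x * (ennreal (r * l powr (r - 1)) * (if 0 < l \<and> ennreal l < f x then 1 else 0)) \<partial>lborel) \<partial>M)"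
  by (intro nn_integral_cong) (auto simp: indicator_def)
 also have "\<dots> = (\<integral>\<^sup>+l. (\<integral>\<^sup>+x. g x * (ennreal (r * l powr (r - 1)) * (if 0 < l \<and> ennreal l < f x then 1 else 0)) \<partial>M) \<partial>lborel)"
  by (rule P.Fubini') measurable
 also have "\<dots> = (\<integral>\<^sup>+l. ennreal (r * l powr (r - 1)) * indicator {0<..} l *
    (\<integral>\<^sup>+x. g x * indicator {x. ennreal l < f x} x \<partial>M) \<partial>lborel)"
 proof (rule nn_integral_cong)
  fix l :: real
  have [measurable]: "(\<lambda>x. indicator {x. ennreal l < f x} x :: ennreal) \<in> borel_measurable M"
   by (subst measurable_cong[where g="\<lambda>x. if ennreal l < f x then 1 else 0"]) (auto simp: indicator_def)
  have "(\<integral>\<^sup>+x. g x * (ennreal (r * l powr (r - 1)) * (if 0 < l \<and> ennreal l < f x then 1 else 0)) \<partial>M) =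
   (\<integral>\<^sup>+x. (ennreal (r * l powr (r - 1)) * indicator {0<..} l) * (g x * indicator {x. ennreal l < f x} x) \<partial>M)"
   by (intro nn_integral_cong) (auto simp: indicator_def mult_ac)
  then show "(\<integral>\<^sup>+x. g x * (ennreal (r * l powr (r - 1)) * (if 0 < l \<and> ennreal l < f x then 1 else 0)) \<partial>M) =
   ennreal (r * l powr (r - 1)) * indicator {0<..} l * (\<integral>\<^sup>+x. g x * indicator {x. ennreal l < f x} x \<partial>M)"
   by (simp add: nn_integral_cmult)
 qed
 finally show ?thesis .
qed

lemma layer_cake1:
 assumes "sigma_finite_measure M" and r: "0 < r" and [measurable]: "f \<in> borel_measurable M"
 shows "(\<integral>\<^sup>+x. epowr (f x) r \<partial>M) =
  (\<integral>\<^sup>+l. ennreal (r * l powr (r - 1)) * indicator {0<..} l * emeasure M {x\<in>space M. ennreal l < f x} \<partial>lborel)"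
proof -
 have "(\<integral>\<^sup>+x. 1 * indicator {x. ennreal l < f x} x \<partial>M) = emeasure M {x\<in>space M. ennreal l < f x}" for l
 proof -
  have "(\<integral>\<^sup>+x. 1 * indicator {x. ennreal l < f x} x \<partial>M) = (\<integral>\<^sup>+x. indicator {x\<in>space M. ennreal l < f x} x \<partial>M)"
   by (intro nn_integral_cong) (auto simp: indicator_def)
  then show ?thesis by simp
 qed
 with layer_cake[OF assms, of "\<lambda>_. 1"] show ?thesis by simp
qed

text \<open>Marcinkiewicz interpolation. The weak bound is assumed with f already cut at level l /
  2, which incorporates the trivial estimate for bounded functions. Exchanging the integrations
  produces the integral of f (2 f)^(p-1), whence the constant.\<close>

lemma strong_type:
 assumes sf: "sigma_finite_measure M" and p: "1 < p"
  and [measurable]: "f \<in> borel_measurable M" "g \<in> borel_measurable M" and A: "0 \<le> A"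
  and weak: "\<And>l. 0 < l \<Longrightarrow> ennreal l * emeasure M {x\<in>space M. ennreal l < g x} \<le>
    ennreal A * (\<integral>\<^sup>+x. f x * indicator {x. ennreal l < 2 * f x} x \<partial>M)"
 shows "(\<integral>\<^sup>+x. epowr (g x) p \<partial>M) \<le> ennreal (A * (p / (p - 1)) * 2 powr (p - 1)) * (\<integral>\<^sup>+x. epowr (f x) p \<partial>M)"
proof -
 have "(\<integral>\<^sup>+x. epowr (g x) p \<partial>M) =
  (\<integral>\<^sup>+l. ennreal (p * l powr (p - 1)) * indicator {0<..} l * emeasure M {x\<in>space M. ennreal l < g x} \<partial>lborel)"
  using p by (intro layer_cake1 sf) auto
 also have "\<dots> \<le> (\<integral>\<^sup>+l. ennreal (A * (p / (p - 1))) * (ennreal ((p - 1) * l powr ((p - 1) - 1)) * indicator {0<..} l *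
    (\<integral>\<^sup>+x. f x * indicator {x. ennreal l < 2 * f x} x \<partial>M)) \<partial>lborel)"
 proof (rule nn_integral_mono)
  fix l :: real
  show "ennreal (p * l powr (p - 1)) * indicator {0<..} l * emeasure M {x\<in>space M. ennreal l < g x} \<le>
   ennreal (A * (p / (p - 1))) * (ennreal ((p - 1) * l powr ((p - 1) - 1)) * indicator {0<..} l *
    (\<integral>\<^sup>+x. f x * indicator {x. ennreal l < 2 * f x} x \<partial>M))"
  proof (cases "0 < l")
   case True
   have "ennreal (p * l powr (p - 1)) = ennreal (p * l powr (p - 2)) * ennreal l"
    using True p powr_add[of l "p - 2" 1] by (subst ennreal_mult[symmetric]) auto
   then have "ennreal (p * l powr (p - 1)) * emeasure M {x\<in>space M. ennreal l < g x} =
    ennreal (p * l powr (p - 2)) * (ennreal l * emeasure M {x\<in>space M. ennreal l < g x})"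
    by (simp add: mult.assoc)
   also have "\<dots> \<le> ennreal (p * l powr (p - 2)) * (ennreal A * (\<integral>\<^sup>+x. f x * indicator {x. ennreal l < 2 * f x} x \<partial>M))"
    by (intro mult_left_mono weak True) simp
   also have "\<dots> = (ennreal (p * l powr (p - 2)) * ennreal A) * (\<integral>\<^sup>+x. f x * indicator {x. ennreal l < 2 * f x} x \<partial>M)"
    by (simp add: mult.assoc)
   also have "ennreal (p * l powr (p - 2)) * ennreal A =
     ennreal (A * (p / (p - 1))) * ennreal ((p - 1) * l powr ((p - 1) - 1))"
    using p A by (simp add: ennreal_mult[symmetric] mult_ac)
   finally show ?thesis using True by (simp add: mult.assoc)
  qed simp
 qed
 also have "\<dots> = ennreal (A * (p / (p - 1))) * (\<integral>\<^sup>+l. ennreal ((p - 1) * l powr ((p - 1) - 1)) * indicator {0<..} l *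
    (\<integral>\<^sup>+x. f x * indicator {x. ennreal l < 2 * f x} x \<partial>M) \<partial>lborel)"
 proof (rule nn_integral_cmult)
  interpret M: sigma_finite_measure M by fact
  have "(\<lambda>l. \<integral>\<^sup>+x. f x * (if ennreal l < 2 * f x then 1 else 0) \<partial>M) \<in> borel_measurable lborel"
   by measurable
  also have "(\<lambda>l. \<integral>\<^sup>+x. f x * (if ennreal l < 2 * f x then 1 else 0) \<partial>M) =
    (\<lambda>l. \<integral>\<^sup>+x. f x * indicator {x. ennreal l < 2 * f x} x \<partial>M)"
   by (intro ext nn_integral_cong) (auto simp: indicator_def)
  finally have [measurable]: "(\<lambda>l. \<integral>\<^sup>+x. f x * indicator {x. ennreal l < 2 * f x} x \<partial>M) \<in> borel_measurable lborel" .
  show "(\<lambda>l. ennreal ((p - 1) * l powr ((p - 1) - 1)) * indicator {0<..} l *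
    (\<integral>\<^sup>+x. f x * indicator {x. ennreal l < 2 * f x} x \<partial>M)) \<in> borel_measurable lborel"
   by measurable
 qed
 also have "(\<integral>\<^sup>+l. ennreal ((p - 1) * l powr ((p - 1) - 1)) * indicator {0<..} l *
    (\<integral>\<^sup>+x. f x * indicator {x. ennreal l < 2 * f x} x \<partial>M) \<partial>lborel) = (\<integral>\<^sup>+x. f x * epowr (2 * f x) (p - 1) \<partial>M)"
  using p by (intro layer_cake[symmetric] sf) auto
 also have "\<dots> = (\<integral>\<^sup>+x. ennreal (2 powr (p - 1)) * epowr (f x) p \<partial>M)"
 proof (rule nn_integral_cong)
  fix x
  have "epowr 2 (p - 1) = ennreal (2 powr (p - 1))" using p epowr_ennreal[of "p - 1" 2] by simp
  moreover have "epowr (f x) p = f x * epowr (f x) (p - 1)"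
   using epowr_add[of 1 "p - 1" "f x"] p by simp
  ultimately show "f x * epowr (2 * f x) (p - 1) = ennreal (2 powr (p - 1)) * epowr (f x) p"
   using p by (simp add: epowr_mult mult_ac)
 qed
 also have "\<dots> = ennreal (2 powr (p - 1)) * (\<integral>\<^sup>+x. epowr (f x) p \<partial>M)"
  by (rule nn_integral_cmult) measurable
 finally have "(\<integral>\<^sup>+x. epowr (g x) p \<partial>M) \<le> ennreal (A * (p / (p - 1))) *
   (ennreal (2 powr (p - 1)) * (\<integral>\<^sup>+x. epowr (f x) p \<partial>M))" .
 moreover have "ennreal (A * (p / (p - 1))) * ennreal (2 powr (p - 1)) = ennreal (A * (p / (p - 1)) * 2 powr (p - 1))"
  using p A by (subst ennreal_mult[symmetric]) auto
 ultimately show ?thesis by (simp only: mult.assoc[symmetric])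
qed

subsection \<open>The maximal function over rational cubes\<close>

text \<open>Greedy selection: a cube of largest radius, once tripled, swallows every cube that meets
  it, and the cubes disjoint from it form a strictly smaller family.\<close>

lemma vitali_finite:
 fixes S :: "((real^'n::finite) \<times> real) set"
 assumes "finite S"
 shows "\<exists>T\<subseteq>S. pairwise (\<lambda>k l. disjnt (cb (fst k) (snd k)) (cb (fst l) (snd l))) T \<and>
  (\<Union>k\<in>S. cb (fst k) (snd k)) \<subseteq> (\<Union>k\<in>T. cb (fst k) (3 * snd k))"
 using assms
proof (induct S rule: finite_psubset_induct)
 case (psubset S)
 show ?case
 proof (cases "S = {}")
  case False
  then have "Max (snd ` S) \<in> snd ` S" using psubset(1) by (intro Max_in) auto
  then obtain m where "m \<in> S" "snd m = Max (snd ` S)" by auto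
  then have m: "m \<in> S" "\<And>k. k \<in> S \<Longrightarrow> snd k \<le> snd m"
   using psubset(1) by simp_all
  define S' where "S' = {k\<in>S. k \<noteq> m \<and> disjnt (cb (fst k) (snd k)) (cb (fst m) (snd m))}"
  have S': "S' \<subset> S" using m by (auto simp: S'_def)
  obtain T where T: "T \<subseteq> S'" "pairwise (\<lambda>k l. disjnt (cb (fst k) (snd k)) (cb (fst l) (snd l))) T"
   "(\<Union>k\<in>S'. cb (fst k) (snd k)) \<subseteq> (\<Union>k\<in>T. cb (fst k) (3 * snd k))" using psubset(2)[OF S'] by (elim exE conjE)
  have "cb (fst k) (snd k) \<subseteq> (\<Union>k\<in>insert m T. cb (fst k) (3 * snd k))" if k: "k \<in> S" for k
  proof (cases "k \<in> S'")
   case False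
   have "cb (fst k) (snd k) \<subseteq> cb (fst m) (3 * snd m)"
   proof (cases "disjnt (cb (fst k) (snd k)) (cb (fst m) (snd m))")
    case True
    then have km: "k = m" using False k by (auto simp: S'_def)
    show ?thesis
    proof
     fix x assume x: "x \<in> cb (fst k) (snd k)"
     then have "0 \<le> snd m" using km unfolding mem_cb by (meson abs_ge_zero order_trans)
     then show "x \<in> cb (fst m) (3 * snd m)" using x km cb_mono[where x="fst m" and R="snd m" and R'="3 * snd m"] by auto
    qed
   next
    case False
    then obtain y where y: "y \<in> cb (fst k) (snd k)" "y \<in> cb (fst m) (snd m)" by (auto simp: disjnt_def)
    show ?thesis
    proof
     fix x assume x: "x \<in> cb (fst k) (snd k)"
     have "\<bar>x $ i - fst m $ i\<bar> \<le> 3 * snd m" for i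
     proof -
      have "\<bar>x $ i - fst k $ i\<bar> \<le> snd k" "\<bar>y $ i - fst k $ i\<bar> \<le> snd k" "\<bar>y $ i - fst m $ i\<bar> \<le> snd m"
       using x y by (auto simp: mem_cb)
      then show ?thesis using m(2)[OF k] by linarith
     qed
     then show "x \<in> cb (fst m) (3 * snd m)" by (simp add: mem_cb)
    qed
   qed
   then show ?thesis by blast
  qed (use T(3) in blast)
  moreover have "pairwise (\<lambda>k l. disjnt (cb (fst k) (snd k)) (cb (fst l) (snd l))) (insert m T)"
   using T(1,2) by (auto simp: pairwise_insert S'_def disjnt_sym)
  moreover have "insert m T \<subseteq> S" using T(1) m(1) by (auto simp: S'_def)
  ultimately show ?thesis by (intro exI[of _ "insert m T"]) blast
 qed (auto intro: exI[of _ "{}"])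
qed

text \<open>Rational cubes suffice, and a supremum over countably many cubes is measurable.\<close>

definition maxf :: "(real^'n::finite) measure \<Rightarrow> (real^'n \<Rightarrow> ennreal) \<Rightarrow> real^'n \<Rightarrow> ennreal" where
 "maxf \<mu> f x = (SUP m. (if 0 < snd m \<and> x \<in> rcube m
   then (\<integral>\<^sup>+y. f y * indicator (rcube m) y \<partial>\<mu>) / emeasure \<mu> (rcube m) else 0))"

lemma maxf_measurable [measurable]:
 assumes [measurable_cong]: "sets \<mu> = sets lebesgue"
 shows "maxf \<nu> f \<in> borel_measurable \<mu>"
proof -
 have "{x \<in> space \<mu>. x \<in> rcube m} \<in> sets \<mu>" for m :: "('a \<Rightarrow> rat) \<times> rat"
  using sets_eq_imp_space_eq[OF assms] assms by simp
 then have [measurable]: "Measurable.pred \<mu> (\<lambda>x. x \<in> rcube m)" for m :: "('a \<Rightarrow> rat) \<times> rat"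
  by (simp add: pred_def)
 show ?thesis unfolding maxf_def[abs_def] by measurable
qed

lemma maxf_upper:
 assumes "0 < snd m" "x \<in> rcube m"
 shows "(\<integral>\<^sup>+y. f y * indicator (rcube m) y \<partial>\<mu>) / emeasure \<mu> (rcube m) \<le> maxf \<mu> f x"
 unfolding maxf_def using assms by (intro SUP_upper2[of m]) auto

text \<open>Dilation by 3 matches \<open>vitali_finite\<close>; positivity and finiteness on cubes
  make the averages in \<open>maxf\<close> genuine quotients.\<close>

locale doubling =
 fixes \<mu> :: "(real^'n::finite) measure" and D :: real
 assumes sets_mu [measurable_cong, simp]: "sets \<mu> = sets lebesgue"
  and sf: "sigma_finite_measure \<mu>"
  and pos: "0 < R \<Longrightarrow> 0 < emeasure \<mu> (cb x R)" and fin: "emeasure \<mu> (cb x R) < \<infinity>"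
  and D: "0 \<le> D" and dbl: "0 < R \<Longrightarrow> emeasure \<mu> (cb x (3 * R)) \<le> ennreal D * emeasure \<mu> (cb x R)"
begin

lemma space_mu [simp]: "space \<mu> = UNIV"
 using sets_eq_imp_space_eq[OF sets_mu] by simp

text \<open>Passing to a disjoint subfamily costs the doubling constant; disjointness then bounds
  the sum of the integrals over the cubes by one integral.\<close>

lemma finite_cover_bound:
 assumes F: "finite F" and [measurable]: "f \<in> borel_measurable \<mu>"
  and J: "\<And>k. k \<in> F \<Longrightarrow> 0 < snd k \<and> ennreal l * emeasure \<mu> (cb (fst k) (snd k)) \<le> (\<integral>\<^sup>+y. f y * indicator (cb (fst k) (snd k)) y \<partial>\<mu>)"
 shows "ennreal l * emeasure \<mu> (\<Union>k\<in>F. cb (fst k) (snd k)) \<le> ennreal D * (\<integral>\<^sup>+y. f y \<partial>\<mu>)"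
proof -
 obtain T where T: "T \<subseteq> F" "pairwise (\<lambda>k l. disjnt (cb (fst k) (snd k)) (cb (fst l) (snd l))) T"
   "(\<Union>k\<in>F. cb (fst k) (snd k)) \<subseteq> (\<Union>k\<in>T. cb (fst k) (3 * snd k))" using vitali_finite[OF F] by blast
 have fT: "finite T" using T(1) F by (rule finite_subset)
 have "emeasure \<mu> (\<Union>k\<in>F. cb (fst k) (snd k)) \<le> emeasure \<mu> (\<Union>k\<in>T. cb (fst k) (3 * snd k))"
  using fT by (intro emeasure_mono T(3)) (auto intro!: sets.finite_UN)
 also have "\<dots> \<le> (\<Sum>k\<in>T. emeasure \<mu> (cb (fst k) (3 * snd k)))"
  by (rule emeasure_subadditive_finite) (use fT in auto)
 also have "\<dots> \<le> (\<Sum>k\<in>T. ennreal D * emeasure \<mu> (cb (fst k) (snd k)))"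
  using J T(1) by (intro sum_mono dbl) auto
 finally have "ennreal l * emeasure \<mu> (\<Union>k\<in>F. cb (fst k) (snd k)) \<le>
   ennreal l * (\<Sum>k\<in>T. ennreal D * emeasure \<mu> (cb (fst k) (snd k)))" by (rule mult_left_mono) simp
 also have "\<dots> = ennreal D * (\<Sum>k\<in>T. ennreal l * emeasure \<mu> (cb (fst k) (snd k)))"
  by (simp add: sum_distrib_left mult_ac)
 also have "\<dots> \<le> ennreal D * (\<Sum>k\<in>T. (\<integral>\<^sup>+y. f y * indicator (cb (fst k) (snd k)) y \<partial>\<mu>))"
  using J T(1) by (intro mult_left_mono sum_mono) auto
 also have "(\<Sum>k\<in>T. (\<integral>\<^sup>+y. f y * indicator (cb (fst k) (snd k)) y \<partial>\<mu>)) =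
   (\<integral>\<^sup>+y. (\<Sum>k\<in>T. f y * indicator (cb (fst k) (snd k)) y) \<partial>\<mu>)"
  by (rule nn_integral_sum[symmetric]) simp
 also have "\<dots> \<le> (\<integral>\<^sup>+y. f y \<partial>\<mu>)"
 proof (rule nn_integral_mono)
  fix y
  show "(\<Sum>k\<in>T. f y * indicator (cb (fst k) (snd k)) y) \<le> f y"
  proof (cases "\<exists>k\<in>T. y \<in> cb (fst k) (snd k)")
   case True
   then obtain k where k: "k \<in> T" "y \<in> cb (fst k) (snd k)" by blast
   have "(\<Sum>k'\<in>T. f y * indicator (cb (fst k') (snd k')) y) = (\<Sum>k'\<in>T. if k' = k then f y else 0)"
    using T(2) k by (intro sum.cong refl) (auto simp: pairwise_def disjnt_iff indicator_def)
   then show ?thesis using fT k by simp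
  next
   case False
   then have "(\<Sum>k\<in>T. f y * indicator (cb (fst k) (snd k)) y) = 0" by (intro sum.neutral) auto
   then show ?thesis by simp
  qed
 qed
 finally show ?thesis by (simp add: mult_left_mono)
qed

lemma weak_type:
 assumes [measurable]: "f \<in> borel_measurable \<mu>" and l: "0 < l"
 shows "ennreal l * emeasure \<mu> {x. ennreal l < maxf \<mu> f x} \<le> ennreal D * (\<integral>\<^sup>+y. f y \<partial>\<mu>)"
proof -
 define J where "J = {m. 0 < snd m \<and> ennreal l * emeasure \<mu> (rcube m) \<le> (\<integral>\<^sup>+y. f y * indicator (rcube m) y \<partial>\<mu>)}"
 define A where "A n = (\<Union>m\<in>{m\<in>J. to_nat m \<le> n}. rcube m)" for n
 have fin': "finite {m\<in>J. to_nat m \<le> n}" for n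
  by (rule finite_subset[OF _ finite_vimageI[OF finite_atMost[of n] inj_to_nat]]) auto
 have "{x. ennreal l < maxf \<mu> f x} \<subseteq> (\<Union>n. A n)"
 proof
  fix x assume "x \<in> {x. ennreal l < maxf \<mu> f x}"
  then obtain m where m: "ennreal l < (if 0 < snd m \<and> x \<in> rcube m
   then (\<integral>\<^sup>+y. f y * indicator (rcube m) y \<partial>\<mu>) / emeasure \<mu> (rcube m) else 0)"
   unfolding mem_Collect_eq maxf_def less_SUP_iff by blast
  then have m1: "0 < snd m" "x \<in> rcube m" by (auto split: if_splits)
  have q: "emeasure \<mu> (rcube m) \<noteq> 0" "emeasure \<mu> (rcube m) < \<infinity>" using pos m1(1) fin by (auto simp: less_le)
  have "ennreal l * emeasure \<mu> (rcube m) \<le>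
   (\<integral>\<^sup>+y. f y * indicator (rcube m) y \<partial>\<mu>) / emeasure \<mu> (rcube m) * emeasure \<mu> (rcube m)"
   using m m1 by (intro mult_right_mono) auto
  also have "\<dots> = (\<integral>\<^sup>+y. f y * indicator (rcube m) y \<partial>\<mu>)"
   using q by (simp add: ennreal_divide_times ennreal_mult_divide_eq)
  finally have "m \<in> J" using m1 by (simp add: J_def)
  then have "x \<in> A (to_nat m)" unfolding A_def using m1 by blast
  then show "x \<in> (\<Union>n. A n)" by blast
 qed
 moreover have Am: "A n \<in> sets \<mu>" for n unfolding A_def using fin' by (intro sets.finite_UN) auto
 ultimately have "emeasure \<mu> {x. ennreal l < maxf \<mu> f x} \<le> emeasure \<mu> (\<Union>n. A n)"
  by (intro emeasure_mono) auto
 also have "\<dots> = (SUP n. emeasure \<mu> (A n))"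
  using Am by (intro SUP_emeasure_incseq[symmetric]) (auto simp: incseq_def A_def)
 finally have "ennreal l * emeasure \<mu> {x. ennreal l < maxf \<mu> f x} \<le> ennreal l * (SUP n. emeasure \<mu> (A n))"
  by (rule mult_left_mono) simp
 also have "\<dots> = (SUP n. ennreal l * emeasure \<mu> (A n))" by (rule SUP_mult_left_ennreal)
 also have "\<dots> \<le> ennreal D * (\<integral>\<^sup>+y. f y \<partial>\<mu>)"
 proof (rule SUP_least)
  fix n
  let ?F = "(\<lambda>m::('n \<Rightarrow> rat) \<times> rat. ((\<chi> i. of_rat (fst m i)) :: real^'n, of_rat (snd m) :: real)) ` {m\<in>J. to_nat m \<le> n}"
  have "A n = (\<Union>k\<in>?F. cb (fst k) (snd k))" by (simp add: A_def)
  then show "ennreal l * emeasure \<mu> (A n) \<le> ennreal D * (\<integral>\<^sup>+y. f y \<partial>\<mu>)"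
   using fin' by (simp only:) (rule finite_cover_bound, auto simp: J_def)
 qed
 finally show ?thesis .
qed

lemma maximal_strong_type:
 assumes [measurable]: "f \<in> borel_measurable \<mu>" and p: "1 < p"
 shows "(\<integral>\<^sup>+x. epowr (maxf \<mu> f x) p \<partial>\<mu>) \<le>
  ennreal (2 * D * (p / (p - 1)) * 2 powr (p - 1)) * (\<integral>\<^sup>+x. epowr (f x) p \<partial>\<mu>)"
proof (rule strong_type[OF sf p])
 show "f \<in> borel_measurable \<mu>" by fact
 show "maxf \<mu> f \<in> borel_measurable \<mu>" by measurable
 show "0 \<le> 2 * D" using D by simp
 fix l :: real assume l: "0 < l"
 \<comment> \<open>The discarded part of f is at most l / 2 and contributes at most l / 2 to any
   average. Hence the level set of \<open>maxf \<mu> f\<close> above l lies in that of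
   \<open>maxf \<mu> g\<close> above l / 2.\<close>
 define g where "g x = f x * indicator {x. ennreal l < 2 * f x} x" for x
 have gm [measurable]: "g \<in> borel_measurable \<mu>"
 proof -
  have "g = (\<lambda>x. if ennreal l < 2 * f x then f x else 0)" by (auto simp: g_def indicator_def)
  then show ?thesis by simp
 qed
 have fg: "f x \<le> g x + ennreal (l / 2)" for x
 proof (cases "ennreal l < 2 * f x")
  case False
  then have 1: "2 * f x \<le> ennreal l" by simp
  have "f x \<le> ennreal (l / 2)"
  proof (cases "f x")
   case (real r)
   then have "ennreal (2 * r) \<le> ennreal l" using 1 ennreal_mult[of 2 r] by simp
   then show ?thesis using real l by (simp add: ennreal_le_iff)
  next
   case top
   then show ?thesis using 1 by (simp add: ennreal_mult_top top_unique)
  qed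
  then show ?thesis by (simp add: add_increasing)
 qed (simp add: g_def)
 have sub: "ennreal (l / 2) < maxf \<mu> g x" if x: "ennreal l < maxf \<mu> f x" for x
 proof -
  obtain m where m: "ennreal l < (if 0 < snd m \<and> x \<in> rcube m
   then (\<integral>\<^sup>+y. f y * indicator (rcube m) y \<partial>\<mu>) / emeasure \<mu> (rcube m) else 0)"
   using x unfolding maxf_def less_SUP_iff by blast
  then have m1: "0 < snd m" "x \<in> rcube m" by (auto split: if_splits)
  have q: "emeasure \<mu> (rcube m) \<noteq> 0" "emeasure \<mu> (rcube m) < \<infinity>" using pos m1(1) fin by (auto simp: less_le)
  have "(\<integral>\<^sup>+y. f y * indicator (rcube m) y \<partial>\<mu>) \<le>
   (\<integral>\<^sup>+y. g y * indicator (rcube m) y + ennreal (l/2) * indicator (rcube m) y \<partial>\<mu>)"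
   using fg by (intro nn_integral_mono) (auto simp: indicator_def)
  also have "\<dots> = (\<integral>\<^sup>+y. g y * indicator (rcube m) y \<partial>\<mu>) + ennreal (l/2) * emeasure \<mu> (rcube m)"
   by (subst nn_integral_add) (auto simp: nn_integral_cmult)
  finally have "(\<integral>\<^sup>+y. f y * indicator (rcube m) y \<partial>\<mu>) / emeasure \<mu> (rcube m) \<le>
   ((\<integral>\<^sup>+y. g y * indicator (rcube m) y \<partial>\<mu>) + ennreal (l/2) * emeasure \<mu> (rcube m)) / emeasure \<mu> (rcube m)"
   by (rule divide_right_mono_ennreal)
  also have "\<dots> = (\<integral>\<^sup>+y. g y * indicator (rcube m) y \<partial>\<mu>) / emeasure \<mu> (rcube m) + ennreal (l/2)"
   using q by (simp add: add_divide_distrib_ennreal ennreal_mult_divide_eq)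
  also have "\<dots> \<le> maxf \<mu> g x + ennreal (l/2)" by (intro add_right_mono maxf_upper m1)
  finally have "ennreal l < maxf \<mu> g x + ennreal (l/2)" using m m1 by simp
  moreover have "ennreal l = ennreal (l/2) + ennreal (l/2)" using l by (simp add: ennreal_plus[symmetric] del: ennreal_plus)
  ultimately show ?thesis by (metis add_right_mono not_le)
 qed
 have "ennreal (l/2) * emeasure \<mu> {x. ennreal l < maxf \<mu> f x} \<le> ennreal (l/2) * emeasure \<mu> {x. ennreal (l/2) < maxf \<mu> g x}"
 proof (intro mult_left_mono emeasure_mono)
  have "{x \<in> space \<mu>. ennreal (l/2) < maxf \<mu> g x} \<in> sets \<mu>" by measurable
  then show "{x. ennreal (l/2) < maxf \<mu> g x} \<in> sets \<mu>" by simp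
 qed (use sub in auto)
 also have "\<dots> \<le> ennreal D * (\<integral>\<^sup>+x. g x \<partial>\<mu>)" using l by (intro weak_type) auto
 finally have "2 * (ennreal (l/2) * emeasure \<mu> {x. ennreal l < maxf \<mu> f x}) \<le> 2 * (ennreal D * (\<integral>\<^sup>+x. g x \<partial>\<mu>))"
  by (rule mult_left_mono) simp
 moreover have "2 * ennreal (l/2) = ennreal l" "2 * ennreal D = ennreal (2 * D)"
  using l D ennreal_mult[of 2 "l/2"] ennreal_mult[of 2 D] by simp_all
 ultimately show "ennreal l * emeasure \<mu> {x \<in> space \<mu>. ennreal l < maxf \<mu> f x} \<le>
   ennreal (2 * D) * (\<integral>\<^sup>+x. f x * indicator {x. ennreal l < 2 * f x} x \<partial>\<mu>)"
  by (simp only: mult.assoc[symmetric] g_def space_mu UNIV_I simp_thms)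
qed

end

subsection \<open>Muckenhoupt weights\<close>

abbreviation wmeas :: "(real^'n::finite \<Rightarrow> real) \<Rightarrow> (real^'n) measure" where
 "wmeas w \<equiv> density lebesgue (\<lambda>x. ennreal (w x))"

text \<open>The exponent equals 1 - p' for the conjugate exponent p' of p.\<close>

definition dual_weight :: "real \<Rightarrow> (real^'n::finite \<Rightarrow> real) \<Rightarrow> real^'n \<Rightarrow> real" where
 "dual_weight p w x = w x powr (- 1 / (p - 1))"

lemma sigma_finite_lebesgue: "sigma_finite_measure (lebesgue :: (real^'n::finite) measure)"
proof
 have "(\<Union>n::nat. cb (0::real^'n) (real n)) = UNIV"
 proof (intro equalityI subsetI UNIV_I)
  fix x :: "real^'n"
  obtain R where R: "R > 0" "{x} \<subseteq> cb 0 R" using bounded_subset_cb[where S="{x}" and x=0] by auto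
  obtain n :: nat where "R \<le> real n" using real_arch_simple by blast
  then show "x \<in> (\<Union>n::nat. cb 0 (real n))" using R cb_mono[where R=R and R'="real n" and x=0] by auto
 qed
 then show "\<exists>A. countable A \<and> A \<subseteq> sets lebesgue \<and> \<Union> A = space (lebesgue :: (real^'n) measure) \<and> (\<forall>a\<in>A. vol a \<noteq> \<infinity>)"
  by (intro exI[of _ "range (\<lambda>n::nat. cb 0 (real n))"]) (auto simp: emeasure_cb)
qed

lemma sigma_finite_wmeas:
 "w \<in> bmeas \<Longrightarrow> sigma_finite_measure (wmeas (w :: real^'n::finite \<Rightarrow> real))"
proof -
 assume w: "w \<in> bmeas"
 interpret L: sigma_finite_measure "lebesgue :: (real^'n) measure"
  by (rule sigma_finite_lebesgue)
 show ?thesis using w by (subst L.sigma_finite_iff_density_finite) auto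
qed

lemma emeasure_cb_pos: "0 < R \<Longrightarrow> vol (cb x R) \<noteq> 0" "vol (cb x R) < \<infinity>"
proof -
 show "0 < R \<Longrightarrow> vol (cb x R) \<noteq> 0"
  by (subst emeasure_cb) auto
 show "vol (cb x R) < \<infinity>"
  unfolding cb_def using emeasure_lborel_cbox_finite by (simp add: emeasure_completion)
qed

lemma wmeas_pos:
 assumes "AE x in lebesgue. 0 < w x" "w \<in> bmeas" "0 < R"
 shows "0 < emeasure (wmeas w) (cb x R)"
proof (rule ccontr)
 assume "\<not> 0 < emeasure (wmeas w) (cb x R)"
 then have "(\<integral>\<^sup>+y. ennreal (w y) * indicator (cb x R) y \<partial>lebesgue) = 0"
  using assms(2) by (subst (asm) emeasure_density) auto
 then have "AE y in lebesgue. ennreal (w y) * indicator (cb x R) y = 0"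
  using assms(2) by (subst (asm) nn_integral_0_iff_AE) auto
 with assms(1) have "AE y in lebesgue. y \<notin> cb x R"
  by eventually_elim (auto simp: indicator_def ennreal_eq_0_iff split: if_splits)
 then have "vol (cb x R) = 0"
  by (subst (asm) AE_iff_measurable[where N="cb x R"]) auto
 then show False using emeasure_cb_pos(1)[OF assms(3)] by blast
qed

text \<open>The condition of \<open>A_class\<close> with the averages multiplied out, hence the
  power p of the volume. Positivity almost everywhere excludes the zero weight and allows division
  by w and by its dual.\<close>

locale Ap_weight =
 fixes p K :: real and w :: "real^'n::finite \<Rightarrow> real"
 assumes p: "1 < p" and K: "0 \<le> K" and wm [measurable]: "w \<in> bmeas"
  and w0: "0 \<le> w x" and wpos: "AE x in lebesgue. 0 < w x"
  and Ap: "0 < R \<Longrightarrow> emeasure (wmeas w) (cb x R) * epowr (emeasure (wmeas (dual_weight p w)) (cb x R)) (p - 1)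
    \<le> ennreal K * epowr (vol (cb x R)) p"
  and Wfin: "emeasure (wmeas w) (cb x R) < \<infinity>" and Sfin: "emeasure (wmeas (dual_weight p w)) (cb x R) < \<infinity>"
begin

abbreviation "S \<equiv> wmeas (dual_weight p w)"
abbreviation "W \<equiv> wmeas w"

lemma sm [measurable]: "dual_weight p w \<in> bmeas"
 unfolding dual_weight_def[abs_def] by measurable

lemma spos: "AE x in lebesgue. 0 < dual_weight p w x"
 using wpos by eventually_elim (simp add: dual_weight_def)

text \<open>The weight to the power 1/p times the dual weight to the power 1 - 1/p is 1 almost
  everywhere; Hoelder's inequality is applied to this factorisation of the indicator. The outcome is
  opposite in direction to \<open>Ap\<close>.\<close>

lemma holder_set:
 assumes E [measurable]: "E \<in> sets lebesgue"
 shows "epowr (vol E) p \<le> emeasure W E * epowr (emeasure S E) (p - 1)"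
proof -
 have t: "0 < 1 / p" "1 / p < 1" using p by auto
 have "vol E = (\<integral>\<^sup>+x. indicator E x \<partial>lebesgue)" by simp
 also have "\<dots> = (\<integral>\<^sup>+x. epowr (ennreal (w x) * indicator E x) (1/p) * epowr (ennreal (dual_weight p w x) * indicator E x) (1 - 1/p) \<partial>lebesgue)"
 proof (rule nn_integral_cong_AE, use wpos in eventually_elim)
  fix x assume x: "0 < w x"
  have "w x powr (1/p) * (w x powr (- 1 / (p - 1))) powr (1 - 1/p) = w x powr (1/p + (- 1 / (p - 1)) * (1 - 1/p))"
   by (simp only: powr_powr powr_add)
  also have "1/p + (- 1 / (p - 1)) * (1 - 1/p) = 0" using p by (simp add: field_simps)
  finally have "epowr (ennreal (w x)) (1/p) * epowr (ennreal (dual_weight p w x)) (1 - 1/p) = 1"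
   using x t by (subst epowr_ennreal, simp, simp, subst epowr_ennreal)
    (simp_all add: dual_weight_def ennreal_mult[symmetric])
  then show "indicator E x = epowr (ennreal (w x) * indicator E x) (1/p) * epowr (ennreal (dual_weight p w x) * indicator E x) (1 - 1/p)"
   using t by (cases "x \<in> E") simp_all
 qed
 also have "\<dots> \<le> epowr (\<integral>\<^sup>+x. ennreal (w x) * indicator E x \<partial>lebesgue) (1/p) *
   epowr (\<integral>\<^sup>+x. ennreal (dual_weight p w x) * indicator E x \<partial>lebesgue) (1 - 1/p)"
  by (rule nn_Holder[OF t]) measurable
 also have "\<dots> = epowr (emeasure W E) (1/p) * epowr (emeasure S E) (1 - 1/p)"
  by (simp add: emeasure_density)
 finally have "epowr (vol E) p \<le> epowr (epowr (emeasure W E) (1/p) * epowr (emeasure S E) (1 - 1/p)) p"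
  using p by (intro epowr_mono) auto
 also have "\<dots> = emeasure W E * epowr (emeasure S E) (p - 1)"
  using p t by (simp add: epowr_mult epowr_epowr algebra_simps)
 finally show ?thesis .
qed

text \<open>\<open>holder_set\<close> on E meets \<open>Ap\<close> on the cube: enlarging E to the
  cube in one factor completes the left side of \<open>Ap\<close>. Subsets filling a fixed share of
  the volume thus carry a fixed share of the mass, for both measures.\<close>

lemma key:
 assumes R: "0 < R" and E: "E \<in> sets lebesgue" "E \<subseteq> cb x R"
 shows "epowr (vol E) p * emeasure W (cb x R) \<le> ennreal K * epowr (vol (cb x R)) p * emeasure W E"
  and "epowr (vol E) p * epowr (emeasure S (cb x R)) (p - 1) \<le>
    ennreal K * epowr (vol (cb x R)) p * epowr (emeasure S E) (p - 1)"
proof -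
 have "epowr (vol E) p * emeasure W (cb x R) \<le>
   (emeasure W E * epowr (emeasure S E) (p - 1)) * emeasure W (cb x R)"
  by (intro mult_right_mono holder_set E) simp
 also have "\<dots> \<le> (emeasure W E * epowr (emeasure S (cb x R)) (p - 1)) * emeasure W (cb x R)"
  using p E by (intro mult_right_mono mult_left_mono epowr_mono emeasure_mono) auto
 also have "\<dots> = (emeasure W (cb x R) * epowr (emeasure S (cb x R)) (p - 1)) * emeasure W E" by (simp add: mult_ac)
 also have "\<dots> \<le> (ennreal K * epowr (vol (cb x R)) p) * emeasure W E"
  by (intro mult_right_mono Ap R) simp
 finally show "epowr (vol E) p * emeasure W (cb x R) \<le> ennreal K * epowr (vol (cb x R)) p * emeasure W E" .
 have "epowr (vol E) p * epowr (emeasure S (cb x R)) (p - 1) \<le>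
   (emeasure W E * epowr (emeasure S E) (p - 1)) * epowr (emeasure S (cb x R)) (p - 1)"
  by (intro mult_right_mono holder_set E) simp
 also have "\<dots> \<le> (emeasure W (cb x R) * epowr (emeasure S E) (p - 1)) * epowr (emeasure S (cb x R)) (p - 1)"
  using E by (intro mult_right_mono emeasure_mono) auto
 also have "\<dots> = (emeasure W (cb x R) * epowr (emeasure S (cb x R)) (p - 1)) * epowr (emeasure S E) (p - 1)" by (simp add: mult_ac)
 also have "\<dots> \<le> (ennreal K * epowr (vol (cb x R)) p) * epowr (emeasure S E) (p - 1)"
  by (intro mult_right_mono Ap R) simp
 finally show "epowr (vol E) p * epowr (emeasure S (cb x R)) (p - 1) \<le>
    ennreal K * epowr (vol (cb x R)) p * epowr (emeasure S E) (p - 1)" .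
qed

lemma epowr_cb_scale:
 assumes "0 < R" "0 < t"
 shows "epowr (vol (cb (x::real^'n) (t * R))) p =
   ennreal ((t ^ CARD('n)) powr p) * epowr (vol (cb x R)) p"
proof -
 have "vol (cb x (t * R)) = ennreal (t ^ CARD('n)) * vol (cb x R)"
 proof -
  have "(2 * (t * R)) ^ CARD('n) = t ^ CARD('n) * (2 * R) ^ CARD('n)"
   by (simp add: power_mult_distrib)
  then have "ennreal ((2 * (t * R)) ^ CARD('n)) = ennreal (t ^ CARD('n)) * ennreal ((2 * R) ^ CARD('n))"
   using assms by (simp only: ennreal_mult' zero_le_power less_imp_le)
  then show ?thesis using assms by (subst (1 2) emeasure_cb) auto
 qed
 moreover have "epowr (ennreal (t ^ CARD('n))) p = ennreal ((t ^ CARD('n)) powr p)"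
  using p assms by (intro epowr_ennreal) auto
 ultimately show ?thesis using p by (simp add: epowr_mult)
qed

lemma epowr_cb_pos:
 assumes "0 < R"
 shows "epowr (vol (cb (x::real^'n) R)) p \<noteq> 0" "epowr (vol (cb x R)) p \<noteq> top"
 using emeasure_cb_pos(1)[OF assms, of x] emeasure_cb_pos(2)[of x R] p epowr_less_top_iff[of p "vol (cb x R)"]
 by (auto simp: epowr_eq_0_iff)

text \<open>\<open>key\<close> with a smaller concentric cube as E. The case t = 3 is doubling;
  large t gives the polynomial growth that makes Schwartz functions integrable.\<close>

lemma growth:
 assumes R: "0 < R" and t: "1 \<le> t"
 shows "emeasure W (cb x (t * R)) \<le> ennreal (K * (t ^ CARD('n)) powr p) * emeasure W (cb x R)"
  and "epowr (emeasure S (cb x (t * R))) (p - 1) \<le> ennreal (K * (t ^ CARD('n)) powr p) * epowr (emeasure S (cb x R)) (p - 1)"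
proof -
 let ?a = "epowr (vol (cb x R)) p"
 have a: "?a \<noteq> 0" "?a \<noteq> top" using epowr_cb_pos[OF R] by auto
 have sub: "cb x R \<subseteq> cb x (t * R)" using R t by (intro cb_mono) simp
 have tR: "0 < t * R" "0 < t" using R t by auto
 have sc: "epowr (vol (cb x (t * R))) p = ennreal ((t ^ CARD('n)) powr p) * ?a"
  by (rule epowr_cb_scale[OF R tR(2)])
 have e: "ennreal K * (ennreal ((t ^ CARD('n)) powr p) * ?a) = ?a * ennreal (K * (t ^ CARD('n)) powr p)"
  using K by (simp add: ennreal_mult mult_ac)
 have "?a * emeasure W (cb x (t * R)) \<le> ?a * (ennreal (K * (t ^ CARD('n)) powr p) * emeasure W (cb x R))"
  using key(1)[OF tR(1) _ sub] unfolding sc e by (simp only: mult.assoc sets_cb)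
 then show "emeasure W (cb x (t * R)) \<le> ennreal (K * (t ^ CARD('n)) powr p) * emeasure W (cb x R)"
  by (rule ennreal_mult_le_mult_iff[OF a, THEN iffD1])
 have "?a * epowr (emeasure S (cb x (t * R))) (p - 1) \<le> ?a * (ennreal (K * (t ^ CARD('n)) powr p) * epowr (emeasure S (cb x R)) (p - 1))"
  using key(2)[OF tR(1) _ sub] unfolding sc e by (simp only: mult.assoc sets_cb)
 then show "epowr (emeasure S (cb x (t * R))) (p - 1) \<le> ennreal (K * (t ^ CARD('n)) powr p) * epowr (emeasure S (cb x R)) (p - 1)"
  by (rule ennreal_mult_le_mult_iff[OF a, THEN iffD1])
qed

sublocale W: doubling W "K * (3 ^ CARD('n)) powr p"
proof (rule doubling.intro)
 show "sigma_finite_measure W" by (rule sigma_finite_wmeas) (rule wm)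
 show "sets W = sets lebesgue" by simp
 show "0 < emeasure W (cb x R)" if "0 < R" for x R by (rule wmeas_pos[OF wpos wm that])
 show "emeasure W (cb x R) < \<infinity>" for x R by (rule Wfin)
 show "0 \<le> K * (3 ^ CARD('n)) powr p" using K by simp
 show "emeasure W (cb x (3 * R)) \<le> ennreal (K * (3 ^ CARD('n)) powr p) * emeasure W (cb x R)" if "0 < R" for x R
  by (rule growth(1)[OF that]) simp
qed

sublocale S: doubling S "(K * (3 ^ CARD('n)) powr p) powr (1 / (p - 1))"
proof (rule doubling.intro)
 show "sigma_finite_measure S" by (rule sigma_finite_wmeas) (rule sm)
 fix R :: real and x assume R: "0 < R"
 let ?D = "(K * (3 ^ CARD('n)) powr p) powr (1 / (p - 1))"
 have "epowr (ennreal ?D) (p - 1) = ennreal (K * (3 ^ CARD('n)) powr p)"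
  using p K by (subst epowr_ennreal) (auto simp: powr_powr)
 then have "epowr (emeasure S (cb x (3 * R))) (p - 1) \<le> epowr (ennreal ?D * emeasure S (cb x R)) (p - 1)"
  using growth(2)[OF R, of 3 x] p by (simp add: epowr_mult)
 then show "emeasure S (cb x (3 * R)) \<le> ennreal ?D * emeasure S (cb x R)"
  using epowr_le_iff[of "p - 1"] p by auto
next
 show "sets S = sets lebesgue" by simp
 show "0 < emeasure S (cb x R)" if "0 < R" for x R by (rule wmeas_pos[OF spos sm that])
 show "emeasure S (cb x R) < \<infinity>" for x R by (rule Sfin)
 show "0 \<le> (K * (3 ^ CARD('n)) powr p) powr (1 / (p - 1))" by simp
qed

text \<open>Lerner's argument: the maximal function is dominated by a composition of the maximal functions
with respect to \<open>W\<close> and \<open>S\<close>, both of which are doubling; no reverse Hoelder inequality is needed.\<close>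

lemma maxf_pointwise:
 assumes fm [measurable]: "f \<in> bmeas"
 defines "F \<equiv> maxf S (\<lambda>x. f x / ennreal (dual_weight p w x))"
 shows "maxf lebesgue f x0 \<le> epowr (ennreal K * maxf W (\<lambda>x. epowr (F x) (p - 1) / ennreal (w x)) x0) (1 / (p - 1))"
  (is "_ \<le> epowr (_ * ?M) _")
proof -
 have p1: "0 < p - 1" using p by simp
 have [measurable]: "F \<in> bmeas" unfolding F_def by (rule maxf_measurable) simp
 have *: "(\<integral>\<^sup>+y. f y * indicator (rcube m) y \<partial>lebesgue) / vol (rcube m) \<le> epowr (ennreal K * ?M) (1 / (p - 1))"
  if m: "0 < snd m" "x0 \<in> rcube m" for m
 proof -
  let ?Q = "rcube m" let ?A = "\<integral>\<^sup>+y. f y * indicator ?Q y \<partial>lebesgue"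
  let ?V = "vol ?Q" and ?SQ = "emeasure S ?Q" and ?WQ = "emeasure W ?Q"
  have R: "0 < (of_rat (snd m) :: real)" using m by simp
  have V: "?V \<noteq> 0" "?V \<noteq> top" using emeasure_cb_pos(1)[OF R] emeasure_cb_pos(2) by (auto simp: less_top[symmetric])
  have SQ: "?SQ \<noteq> 0" "?SQ \<noteq> top" using S.pos[OF R] Sfin by (auto simp: less_le)
  have WQ: "?WQ \<noteq> 0" "?WQ \<noteq> top" using W.pos[OF R] Wfin by (auto simp: less_le)
  have A: "?A = (\<integral>\<^sup>+y. (f y / ennreal (dual_weight p w y)) * indicator ?Q y \<partial>S)"
  proof (subst nn_integral_density)
   show "?A = (\<integral>\<^sup>+y. ennreal (dual_weight p w y) * (f y / ennreal (dual_weight p w y) * indicator ?Q y) \<partial>lebesgue)"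
   proof (rule nn_integral_cong_AE, use spos in eventually_elim)
    fix y assume y: "0 < dual_weight p w y"
    then have "ennreal (dual_weight p w y) * (f y / ennreal (dual_weight p w y)) = f y"
     by (simp add: ennreal_times_divide ennreal_mult_divide_eq mult.commute)
    then show "f y * indicator ?Q y = ennreal (dual_weight p w y) * (f y / ennreal (dual_weight p w y) * indicator ?Q y)"
     by (simp add: mult.assoc[symmetric])
   qed
  qed measurable
  have up: "?A / ?SQ \<le> F x" if "x \<in> ?Q" for x
   unfolding A F_def using m(1) that by (rule maxf_upper)
  \<comment> \<open>The average with respect to S is a constant below F on the cube. Integrating its
    power over the cube and inserting w / w produces an integral with respect to W, bounded through
    the second maximal function.\<close>
  have "epowr (?A / ?SQ) (p - 1) * ?V = (\<integral>\<^sup>+x. epowr (?A / ?SQ) (p - 1) * indicator ?Q x \<partial>lebesgue)"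
   by (simp add: nn_integral_cmult_indicator)
  also have "\<dots> \<le> (\<integral>\<^sup>+x. epowr (F x) (p - 1) * indicator ?Q x \<partial>lebesgue)"
   using p1 up by (intro nn_integral_mono) (auto simp: indicator_def intro: epowr_mono)
  also have "\<dots> = (\<integral>\<^sup>+x. (epowr (F x) (p - 1) / ennreal (w x)) * indicator ?Q x \<partial>W)"
  proof (subst nn_integral_density)
   show "(\<integral>\<^sup>+x. epowr (F x) (p - 1) * indicator ?Q x \<partial>lebesgue) =
    (\<integral>\<^sup>+x. ennreal (w x) * (epowr (F x) (p - 1) / ennreal (w x) * indicator ?Q x) \<partial>lebesgue)"
   proof (rule nn_integral_cong_AE, use wpos in eventually_elim)
    fix y assume y: "0 < w y"
    then have "ennreal (w y) * (epowr (F y) (p - 1) / ennreal (w y)) = epowr (F y) (p - 1)"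
     by (simp add: ennreal_times_divide mult.commute[of "ennreal (w y)"] ennreal_mult_divide_eq)
    then show "epowr (F y) (p - 1) * indicator ?Q y = ennreal (w y) * (epowr (F y) (p - 1) / ennreal (w y) * indicator ?Q y)"
     by (simp add: mult.assoc[symmetric])
   qed
  qed measurable
  also have "\<dots> = (\<integral>\<^sup>+x. (epowr (F x) (p - 1) / ennreal (w x)) * indicator ?Q x \<partial>W) / ?WQ * ?WQ"
   using WQ by (simp add: ennreal_divide_times ennreal_mult_divide_eq top.not_eq_extremum)
  also have "\<dots> \<le> ?M * ?WQ" by (intro mult_right_mono maxf_upper m) simp
  finally have 1: "epowr (?A / ?SQ) (p - 1) * ?V \<le> ?M * ?WQ" .
  have AS: "?A = ?A / ?SQ * ?SQ"
   using SQ by (simp add: ennreal_divide_times ennreal_mult_divide_eq top.not_eq_extremum)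
  have "epowr ?A (p - 1) = epowr (?A / ?SQ) (p - 1) * epowr ?SQ (p - 1)"
   by (rule trans[OF arg_cong[OF AS, where f="\<lambda>x. epowr x (p - 1)"] epowr_mult[OF p1]])
  \<comment> \<open>The factor with S completes the left side of \<open>Ap\<close>, which trades
    both weighted masses for the volume; one volume factor is then cancelled and the root of order p
    - 1 is taken.\<close>
  then have "?V * epowr ?A (p - 1) = (epowr (?A / ?SQ) (p - 1) * ?V) * epowr ?SQ (p - 1)" by (simp only: mult_ac)
  also have "\<dots> \<le> (?M * ?WQ) * epowr ?SQ (p - 1)" using 1 by (intro mult_right_mono) auto
  also have "\<dots> = ?M * (?WQ * epowr ?SQ (p - 1))" by (simp only: mult_ac)
  also have "\<dots> \<le> ?M * (ennreal K * epowr ?V p)" by (intro mult_left_mono Ap R) simp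
  also have "epowr ?V p = ?V * epowr ?V (p - 1)" using epowr_add[of 1 "p - 1" ?V] p1 by simp
  also have "?M * (ennreal K * (?V * epowr ?V (p - 1))) = ?V * (ennreal K * ?M * epowr ?V (p - 1))" by (simp only: mult_ac)
  finally have "epowr ?A (p - 1) \<le> ennreal K * ?M * epowr ?V (p - 1)"
   by (rule ennreal_mult_le_mult_iff[OF V, THEN iffD1])
  also have "ennreal K * ?M * epowr ?V (p - 1) = epowr (epowr (ennreal K * ?M) (1 / (p - 1)) * ?V) (p - 1)"
   using p1 by (simp add: epowr_mult epowr_epowr)
  finally have "?A \<le> epowr (ennreal K * ?M) (1 / (p - 1)) * ?V" using p1 by (simp add: epowr_le_iff)
  then have "?A / ?V \<le> epowr (ennreal K * ?M) (1 / (p - 1)) * ?V / ?V" by (rule divide_right_mono_ennreal)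
  also have "\<dots> = epowr (ennreal K * ?M) (1 / (p - 1))"
   using V by (simp only: ennreal_mult_divide_eq top.not_eq_extremum not_False_eq_True simp_thms)
  finally show ?thesis .
 qed
 show ?thesis unfolding maxf_def[of lebesgue] by (rule SUP_least) (use * in auto)
qed

text \<open>Raised to the power p, the pointwise bound leaves the outer maximal function with the
  conjugate exponent p'. The divisions are arranged so that w times G^p' is the dual weight times
  F^p, and the dual weight times g^p is w times f^p. Hence the maximal theorems in L^p' of W and in
  L^p of S fit together.\<close>

theorem muckenhoupt:
 shows "\<exists>C\<ge>0. \<forall>f\<in>bmeas.
  (\<integral>\<^sup>+x. epowr (maxf lebesgue f x) p \<partial>W) \<le> ennreal C * (\<integral>\<^sup>+x. epowr (f x) p \<partial>W)"
proof -
 define p' where "p' = p / (p - 1)"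
 have p1: "0 < p - 1" and p': "1 < p'" "(p - 1) * p' = p" "1 / (p - 1) * p = p'" "0 < p'" using p by (auto simp: p'_def)
 define DW where "DW = K * (3 ^ CARD('n)) powr p"
 define DS where "DS = DW powr (1 / (p - 1))"
 define C1 where "C1 = 2 * DW * (p' / (p' - 1)) * 2 powr (p' - 1)"
 define C2 where "C2 = 2 * DS * (p / (p - 1)) * 2 powr (p - 1)"
 have nn: "0 \<le> C1" "0 \<le> C2" using K p p' by (simp_all add: C1_def C2_def DW_def DS_def)
 show ?thesis
 proof (intro exI[of _ "K powr p' * C1 * C2"] conjI ballI)
  show "0 \<le> K powr p' * C1 * C2" using nn by simp
  fix f :: "real^'n \<Rightarrow> ennreal" assume f [measurable]: "f \<in> bmeas"
  define g where "g x = f x / ennreal (dual_weight p w x)" for x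
  define F where "F = maxf S g"
  define G where "G x = epowr (F x) (p - 1) / ennreal (w x)" for x
  have [measurable]: "g \<in> bmeas" unfolding g_def by measurable
  have [measurable]: "F \<in> bmeas" unfolding F_def by (rule maxf_measurable) simp
  have [measurable]: "G \<in> bmeas" unfolding G_def by measurable
  have [measurable]: "maxf W G \<in> bmeas" by (rule maxf_measurable) simp
  have "(\<integral>\<^sup>+x. epowr (maxf lebesgue f x) p \<partial>W) \<le> (\<integral>\<^sup>+x. ennreal (K powr p') * epowr (maxf W G x) p' \<partial>W)"
  proof (rule nn_integral_mono)
   fix x
   have "epowr (maxf lebesgue f x) p \<le> epowr (epowr (ennreal K * maxf W G x) (1 / (p - 1))) p"
    using p maxf_pointwise[OF f, of x] by (intro epowr_mono) (simp_all add: G_def[abs_def] F_def g_def[abs_def])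
   also have "\<dots> = epowr (ennreal K * maxf W G x) p'" using p p1 p'(3) by (subst epowr_epowr) auto
   also have "\<dots> = ennreal (K powr p') * epowr (maxf W G x) p'" using p' K by (simp add: epowr_mult epowr_ennreal)
   finally show "epowr (maxf lebesgue f x) p \<le> ennreal (K powr p') * epowr (maxf W G x) p'" .
  qed
  also have "\<dots> = ennreal (K powr p') * (\<integral>\<^sup>+x. epowr (maxf W G x) p' \<partial>W)"
   by (rule nn_integral_cmult) measurable
  finally have h1: "(\<integral>\<^sup>+x. epowr (maxf lebesgue f x) p \<partial>W) \<le> ennreal (K powr p') * (\<integral>\<^sup>+x. epowr (maxf W G x) p' \<partial>W)" .
  have h2: "(\<integral>\<^sup>+x. epowr (maxf W G x) p' \<partial>W) \<le> ennreal C1 * (\<integral>\<^sup>+x. epowr (G x) p' \<partial>W)"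
   unfolding C1_def DW_def using p' by (intro W.maximal_strong_type) auto
  have h3: "(\<integral>\<^sup>+x. epowr (G x) p' \<partial>W) = (\<integral>\<^sup>+x. epowr (F x) p \<partial>S)"
  proof (subst (1 2) nn_integral_density)
   show "(\<integral>\<^sup>+x. ennreal (w x) * epowr (G x) p' \<partial>lebesgue) = (\<integral>\<^sup>+x. ennreal (dual_weight p w x) * epowr (F x) p \<partial>lebesgue)"
   proof (rule nn_integral_cong_AE, use wpos in eventually_elim)
    fix x assume x: "0 < w x"
    have "G x = epowr (F x) (p - 1) * ennreal (1 / w x)"
     using x by (simp add: G_def divide_ennreal_def inverse_ennreal inverse_eq_divide)
    then have "epowr (G x) p' = epowr (F x) p * ennreal ((1 / w x) powr p')"
     using x p' p1 by (simp add: epowr_mult epowr_epowr epowr_ennreal)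
    moreover have "w x * (1 / w x) powr p' = dual_weight p w x"
    proof -
     have "w x * (1 / w x) powr p' = w x powr 1 * w x powr (- p')" using x by (simp add: powr_minus powr_divide inverse_eq_divide)
     also have "\<dots> = w x powr (1 - p')" by (simp only: powr_add[symmetric]) simp
     also have "1 - p' = - 1 / (p - 1)" using p1 by (simp add: p'_def field_simps)
     finally show ?thesis by (simp add: dual_weight_def)
    qed
    ultimately show "ennreal (w x) * epowr (G x) p' = ennreal (dual_weight p w x) * epowr (F x) p"
     using ennreal_mult[of "w x" "(1 / w x) powr p'"] x by (simp only: less_imp_le powr_ge_zero simp_thms mult_ac)
   qed
  qed measurable
  have h4: "(\<integral>\<^sup>+x. epowr (F x) p \<partial>S) \<le> ennreal C2 * (\<integral>\<^sup>+x. epowr (g x) p \<partial>S)"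
   unfolding C2_def DS_def DW_def F_def using p by (intro S.maximal_strong_type) auto
  have h5: "(\<integral>\<^sup>+x. epowr (g x) p \<partial>S) = (\<integral>\<^sup>+x. epowr (f x) p \<partial>W)"
  proof (subst (1 2) nn_integral_density)
   show "(\<integral>\<^sup>+x. ennreal (dual_weight p w x) * epowr (g x) p \<partial>lebesgue) = (\<integral>\<^sup>+x. ennreal (w x) * epowr (f x) p \<partial>lebesgue)"
   proof (rule nn_integral_cong_AE, use wpos in eventually_elim)
    fix x assume x: "0 < w x"
    let ?s = "dual_weight p w x"
    have s: "0 < ?s" using x by (simp add: dual_weight_def)
    have "g x = f x * ennreal (1 / ?s)"
     using s by (simp add: g_def divide_ennreal_def inverse_ennreal inverse_eq_divide)
    then have "epowr (g x) p = epowr (f x) p * ennreal ((1 / ?s) powr p)"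
     using s p by (simp add: epowr_mult epowr_ennreal)
    moreover have "?s * (1 / ?s) powr p = w x"
    proof -
     have "?s * (1 / ?s) powr p = ?s powr 1 * ?s powr (- p)" using s by (simp add: powr_minus powr_divide inverse_eq_divide)
     also have "\<dots> = ?s powr (1 - p)" by (simp only: powr_add[symmetric]) simp
     also have "\<dots> = w x powr ((- 1 / (p - 1)) * (1 - p))" by (simp add: dual_weight_def powr_powr)
     also have "(- 1 / (p - 1)) * (1 - p) = 1" using p1 by (simp add: field_simps)
     finally show ?thesis using x by simp
    qed
    ultimately show "ennreal ?s * epowr (g x) p = ennreal (w x) * epowr (f x) p"
     using ennreal_mult[of ?s "(1 / ?s) powr p"] s by (simp only: less_imp_le powr_ge_zero simp_thms mult_ac)
   qed
  qed measurable
  note h1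
  also have "ennreal (K powr p') * (\<integral>\<^sup>+x. epowr (maxf W G x) p' \<partial>W) \<le>
   ennreal (K powr p') * (ennreal C1 * (ennreal C2 * (\<integral>\<^sup>+x. epowr (f x) p \<partial>W)))"
   by (intro mult_left_mono order_trans[OF h2] h4[folded h3, unfolded h5]) auto
  also have "\<dots> = ennreal (K powr p' * C1 * C2) * (\<integral>\<^sup>+x. epowr (f x) p \<partial>W)"
   using nn by (simp add: ennreal_mult mult.assoc)
  finally show "(\<integral>\<^sup>+x. epowr (maxf lebesgue f x) p \<partial>W) \<le> ennreal (K powr p' * C1 * C2) * (\<integral>\<^sup>+x. epowr (f x) p \<partial>W)" .
 qed
qed

end

subsection \<open>A good-lambda inequality on finite laminar families\<close>

text \<open>Distinct maximal members of a laminar family cannot be nested and are therefore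
  disjoint; finiteness puts every member below a maximal one.\<close>

lemma maximal_members:
 assumes "finite A" and lam: "\<And>q q'. q \<in> A \<Longrightarrow> q' \<in> A \<Longrightarrow> q \<subseteq> q' \<or> q' \<subseteq> q \<or> q \<inter> q' = {}"
 shows "\<exists>B. B \<subseteq> A \<and> disjoint B \<and> (\<forall>q\<in>A. \<exists>q'\<in>B. q \<subseteq> q') \<and> (\<forall>q\<in>B. \<forall>q'\<in>A. q \<subseteq> q' \<longrightarrow> q' = q)"
proof -
 define B where "B = {q\<in>A. \<forall>q'\<in>A. q \<subseteq> q' \<longrightarrow> q' = q}"
 have "B \<subseteq> A" by (auto simp: B_def)
 moreover have "disjoint B"
 proof (rule disjointI)
  fix q q' assume "q \<in> B" "q' \<in> B" "q \<noteq> q'"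
  then show "q \<inter> q' = {}" using lam[of q q'] unfolding B_def by blast
 qed
 moreover have "\<exists>q'\<in>B. q \<subseteq> q'" if qA: "q \<in> A" for q
 proof -
  obtain m where "m \<in> A" "q \<le> m" "\<forall>b\<in>A. m \<le> b \<longrightarrow> m = b" using finite_has_maximal2[OF assms(1) qA] by blast
  then show ?thesis by (intro bexI[of _ m]) (auto simp: B_def)
 qed
 moreover have "\<forall>q\<in>B. \<forall>q'\<in>A. q \<subseteq> q' \<longrightarrow> q' = q" by (simp add: B_def)
 ultimately show ?thesis by blast
qed

lemma norm_average_le:
 fixes F :: "'n::finite cfun"
 assumes q: "q \<in> sets lebesgue" "0 < measure lebesgue q" "vol q < \<infinity>" and F: "set_integrable lebesgue q F"
 shows "ennreal (norm (average q F - c)) * vol q \<le> abs_int q (\<lambda>y. F y - c)"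
proof -
 have qf: "vol q = ennreal (measure lebesgue q)" using q by (simp add: emeasure_eq_ennreal_measure)
 have ci: "set_integrable lebesgue q (\<lambda>_. c)"
  using q by (simp add: set_integrable_def integrable_indicator_iff)
 have di: "set_integrable lebesgue q (\<lambda>y. F y - c)" using F ci by (rule set_integral_diff)
 have "(LINT y:q|lebesgue. (F y - c)) = measure lebesgue q *\<^sub>R (average q F - c)"
  using set_integral_diff(2)[OF F ci] q
  by (simp add: average_def scaleR_diff_right set_integral_const)
 then have "norm (average q F - c) * measure lebesgue q = norm (LINT y:q|lebesgue. (F y - c))"
  using q by (simp add: mult.commute)
 also have "\<dots> \<le> (LINT y:q|lebesgue. norm (F y - c))"
  using di by (rule set_integral_norm_bound)
 finally have "ennreal (norm (average q F - c) * measure lebesgue q) \<le> ennreal (LINT y:q|lebesgue. norm (F y - c))"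
  by (rule ennreal_leI)
 also have "ennreal (LINT y:q|lebesgue. norm (F y - c)) = abs_int q (\<lambda>y. F y - c)"
  using nn_integral_eq_integral[OF set_integrable_norm[OF di, unfolded set_integrable_def]]
  by (simp add: set_lebesgue_integral_def ennreal_mult' ennreal_indicator mult.commute)
 finally show ?thesis by (simp add: qf ennreal_mult)
qed

text \<open>\<open>\<C>\<close> plays the role of the dyadic cells of \<open>Q0\<close> up to a fixed generation.  Of the \<open>A\<^sub>\<infinity>\<close> property
of \<open>U\<close> only the assumption \<open>UA\<close> is used.\<close>

locale laminar_family =
 fixes \<C> :: "(real^'n::finite) set set" and Q0 :: "(real^'n) set" and H :: real and F :: "'n cfun"
  and U :: "(real^'n) measure" and \<eta> :: real
 assumes fin: "finite \<C>" and Q0: "Q0 \<in> \<C>" and sub: "q \<in> \<C> \<Longrightarrow> q \<subseteq> Q0"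
  and qs: "q \<in> \<C> \<Longrightarrow> q \<in> sets lebesgue" and qpos: "q \<in> \<C> \<Longrightarrow> 0 < measure lebesgue q"
  and qfin: "q \<in> \<C> \<Longrightarrow> vol q < \<infinity>"
  and lam: "q \<in> \<C> \<Longrightarrow> q' \<in> \<C> \<Longrightarrow> q \<subseteq> q' \<or> q' \<subseteq> q \<or> q \<inter> q' = {}"
  and parent: "q \<in> \<C> \<Longrightarrow> q \<noteq> Q0 \<Longrightarrow> \<exists>P\<in>\<C>. q \<subset> P \<and> vol P \<le> ennreal H * vol q"
  and H: "0 < H"
  and F: "q \<in> \<C> \<Longrightarrow> set_integrable lebesgue q F" and F0: "average Q0 F = 0"
  and setsU [measurable_cong, simp]: "sets U = sets lebesgue" and Ufin: "emeasure U Q0 < \<infinity>"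
  and \<eta>: "0 \<le> \<eta>" "\<eta> < 1"
  and UA: "q \<in> \<C> \<Longrightarrow> E \<in> sets lebesgue \<Longrightarrow> E \<subseteq> q \<Longrightarrow> 2 * vol E \<le> vol q \<Longrightarrow>
    emeasure U E \<le> ennreal \<eta> * emeasure U q"
begin

text \<open>The norm of the mean is taken, not the mean of the norm: the function is to dominate the
  cell means of F, while all its size information comes from oscillations.\<close>

definition M :: "real^'n \<Rightarrow> ennreal" where
 "M x = (SUP q\<in>\<C>. ennreal (norm (average q F)) * indicator q x)"

lemma spaceU [simp]: "space U = UNIV"
 using sets_eq_imp_space_eq[OF setsU] by simp

lemma M_measurable [measurable]: "M \<in> bmeas"
proof -
 have [measurable]: "\<And>q. q \<in> \<C> \<Longrightarrow> q \<in> sets lebesgue" by (rule qs)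
 show ?thesis unfolding M_def[abs_def] using fin by (intro borel_measurable_SUP countable_finite) measurable
qed

lemma M_gt: "ennreal l < M x \<longleftrightarrow> (\<exists>q\<in>\<C>. x \<in> q \<and> ennreal l < ennreal (norm (average q F)))"
 unfolding M_def less_SUP_iff by (auto simp: indicator_def)

text \<open>The maximal members of A are disjoint and cover its union. On each of them the mean
  deviates from c by at least t, so the norm of F - c integrates to at least t times the volume. In
  use, c is the mean over P.\<close>

lemma weak:
 assumes A: "A \<subseteq> \<C>" and q: "\<And>q'. q' \<in> A \<Longrightarrow> q' \<subseteq> P" and P: "P \<in> \<C>" and t: "0 \<le> t"
  and big: "\<And>q'. q' \<in> A \<Longrightarrow> t \<le> norm (average q' F - c)"
 shows "ennreal t * vol (\<Union>A) \<le> abs_int P (\<lambda>y. F y - c)"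
proof -
 have fA: "finite A" using A fin by (rule finite_subset)
 have lamA: "q \<subseteq> q' \<or> q' \<subseteq> q \<or> q \<inter> q' = {}" if "q \<in> A" "q' \<in> A" for q q'
  using that A by (intro lam) auto
 have MM: "\<exists>B. B \<subseteq> A \<and> disjoint B \<and> (\<forall>q\<in>A. \<exists>q'\<in>B. q \<subseteq> q') \<and> (\<forall>q\<in>B. \<forall>q'\<in>A. q \<subseteq> q' \<longrightarrow> q' = q)"
  by (rule maximal_members[OF fA]) (rule lamA)
 obtain B where B: "B \<subseteq> A" "disjoint B" "\<forall>q\<in>A. \<exists>q'\<in>B. q \<subseteq> q'"
  using MM by blast
 have fB: "finite B" using B(1) fA by (rule finite_subset)
 have Bs: "b \<in> sets lebesgue" if "b \<in> B" for b using that B(1) A qs by blast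
 have AB: "\<Union>A = (\<Union>b\<in>B. b)" using B(1,3) by blast
 have "(\<Sum>b\<in>B. vol b) = vol (\<Union>b\<in>B. b)"
  using B(2) fB Bs by (intro sum_emeasure) (auto simp: disjoint_family_on_def disjoint_def)
 then have "ennreal t * vol (\<Union>A) = ennreal t * (\<Sum>b\<in>B. vol b)"
  unfolding AB by (simp only:)
 also have "\<dots> = (\<Sum>b\<in>B. ennreal t * vol b)" by (rule sum_distrib_left)
 also have "\<dots> \<le> (\<Sum>b\<in>B. (abs_int b (\<lambda>y. F y - c)))"
 proof (rule sum_mono)
  fix b assume b: "b \<in> B"
  then have bC: "b \<in> \<C>" "b \<in> A" using B(1) A by auto
  have "ennreal t * vol b \<le> ennreal (norm (average b F - c)) * vol b"
   by (intro mult_right_mono ennreal_leI big bC) simp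
  also have "\<dots> \<le> abs_int b (\<lambda>y. F y - c)"
   using bC by (intro norm_average_le qs qpos qfin F)
  finally show "ennreal t * vol b \<le> abs_int b (\<lambda>y. F y - c)" .
 qed
 also have "\<dots> = (\<integral>\<^sup>+y. (\<Sum>b\<in>B. ennreal (norm (F y - c)) * indicator b y) \<partial>lebesgue)"
 proof (rule nn_integral_sum[symmetric])
  fix b assume b: "b \<in> B"
  then have "set_integrable lebesgue b F" using B(1) A F by blast
  then have "(\<lambda>y. indicator b y *\<^sub>R F y) \<in> bmeas" by (simp add: set_integrable_def)
  moreover have [measurable]: "b \<in> sets lebesgue" using Bs b by blast
  ultimately have "(\<lambda>y. ennreal (norm (indicator b y *\<^sub>R F y - c)) * indicator b y) \<in> bmeas" by measurable
  then show "(\<lambda>y. ennreal (norm (F y - c)) * indicator b y) \<in> bmeas"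
   by (rule measurable_cong[THEN iffD1, rotated]) (simp add: indicator_def)
 qed
 also have "\<dots> \<le> abs_int P (\<lambda>y. F y - c)"
 proof (rule nn_integral_mono)
  fix y
  show "(\<Sum>b\<in>B. ennreal (norm (F y - c)) * indicator b y) \<le> ennreal (norm (F y - c)) * indicator P y"
  proof (cases "\<exists>b\<in>B. y \<in> b")
   case True
   then obtain b where b: "b \<in> B" "y \<in> b" by blast
   then have yP: "y \<in> P" using B(1) q by blast
   have "(\<Sum>b'\<in>B. ennreal (norm (F y - c)) * indicator b' y) = (\<Sum>b'\<in>B. if b' = b then ennreal (norm (F y - c)) else 0)"
    using B(2) b by (intro sum.cong refl) (auto simp: disjoint_def indicator_def)
   then show ?thesis using fB b yP by simp
  next
   case False
   then have "(\<Sum>b\<in>B. ennreal (norm (F y - c)) * indicator b y) = 0" by (intro sum.neutral) auto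
   then show ?thesis by simp
  qed
 qed
 finally show ?thesis .
qed

text \<open>Since \<open>\<eta>\<close> may be close to 1, the level is raised only by a factor \<open>1 + a\<close> close to 1, which still
allows absorbing the first term after integration.\<close>

lemma good_lambda:
 assumes S [measurable]: "S \<in> bmeas"
  and osc: "\<And>q x. q \<in> \<C> \<Longrightarrow> x \<in> q \<Longrightarrow>
   abs_int q (\<lambda>y. F y - average q F) \<le> S x * vol q"
  and a: "0 < a" and l: "0 < l"
 shows "emeasure U {x. ennreal ((1 + a) * l) < M x} \<le>
   ennreal \<eta> * emeasure U {x. ennreal l < M x} + emeasure U {x. ennreal (a / (2 * H) * l) < S x * indicator Q0 x}"
proof -
 define A where "A = {q\<in>\<C>. l < norm (average q F)}"
 have fA: "finite A" using fin by (simp add: A_def)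
 have lamA: "q \<subseteq> q' \<or> q' \<subseteq> q \<or> q \<inter> q' = {}" if "q \<in> A" "q' \<in> A" for q q'
  using that by (intro lam) (auto simp: A_def)
 have MM: "\<exists>B. B \<subseteq> A \<and> disjoint B \<and> (\<forall>q\<in>A. \<exists>q'\<in>B. q \<subseteq> q') \<and> (\<forall>q\<in>B. \<forall>q'\<in>A. q \<subseteq> q' \<longrightarrow> q' = q)"
  by (rule maximal_members[OF fA]) (rule lamA)
 obtain B where B: "B \<subseteq> A" "disjoint B" "\<forall>q\<in>A. \<exists>q'\<in>B. q \<subseteq> q'" "\<forall>q\<in>B. \<forall>q'\<in>A. q \<subseteq> q' \<longrightarrow> q' = q"
  using MM by blast
 have fB: "finite B" using B(1) fA by (rule finite_subset)
 have BC: "b \<in> \<C>" if "b \<in> B" for b using that B(1) by (auto simp: A_def)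
 \<comment> \<open>Chosen with \<gamma> H = a / 2: passing from b to its parent costs H, and the set
   \<open>E b\<close> must end up with at most half the volume of b.\<close>
 define \<gamma> where "\<gamma> = a / (2 * H)"
 have \<gamma>: "0 < \<gamma>" "\<gamma> * H = a / 2" using a H by (simp_all add: \<gamma>_def)
 define par where "par q = (SOME P. P \<in> \<C> \<and> q \<subset> P \<and> vol P \<le> ennreal H * vol q)" for q
 have par: "par b \<in> \<C>" "b \<subset> par b" "vol (par b) \<le> ennreal H * vol b" "norm (average (par b) F) \<le> l" if b: "b \<in> B" for b
 proof -
  \<comment> \<open>The root has mean zero and is never selected, so every selected cell has a
    parent; by maximality the mean over that parent has norm at most l.\<close>
  have "b \<noteq> Q0" using B(1) b F0 l by (auto simp: A_def)
  then have "\<exists>P. P \<in> \<C> \<and> b \<subset> P \<and> vol P \<le> ennreal H * vol b" using parent[OF BC[OF b]] by blast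
  then have P: "par b \<in> \<C> \<and> b \<subset> par b \<and> vol (par b) \<le> ennreal H * vol b" unfolding par_def by (rule someI_ex)
  then show "par b \<in> \<C>" "b \<subset> par b" "vol (par b) \<le> ennreal H * vol b" by blast+
  show "norm (average (par b) F) \<le> l"
  proof (rule ccontr)
   assume "\<not> norm (average (par b) F) \<le> l"
   then have "par b \<in> A" using P by (simp add: A_def)
   then have "par b = b" using B(4) b P by blast
   then show False using P by blast
  qed
 qed
 \<comment> \<open>Since the mean over the parent has norm at most l, a cell inside b with mean
   above (1 + a) l must differ from it by at least a l.\<close>
 define E where "E b = \<Union>{q'\<in>\<C>. q' \<subseteq> b \<and> a * l \<le> norm (average q' F - average (par b) F)}" for b
 have Es: "E b \<in> sets lebesgue" for b unfolding E_def using fin qs by (intro sets.finite_Union) auto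
 have Eb: "E b \<subseteq> b" for b by (auto simp: E_def)
 \<comment> \<open>A selected cell left out here consists of points where S is large and is charged
   to the second term.\<close>
 define B' where "B' = {b\<in>B. \<exists>x\<in>b. S x \<le> ennreal (\<gamma> * l)}"
 have small: "2 * vol (E b) \<le> vol b" if b: "b \<in> B'" for b
 proof -
  have bB: "b \<in> B" using b by (simp add: B'_def)
  obtain x where x: "x \<in> b" "S x \<le> ennreal (\<gamma> * l)" using b by (auto simp: B'_def)
  have "ennreal (a * l) * vol (E b) \<le> abs_int (par b) (\<lambda>y. F y - average (par b) F)"
   unfolding E_def using a l par(1,2)[OF bB] by (intro weak) auto
  also have "\<dots> \<le> S x * vol (par b)"
   using par(1,2)[OF bB] x(1) by (intro osc) auto
  also have "\<dots> \<le> ennreal (\<gamma> * l) * (ennreal H * vol b)"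
   by (intro mult_mono x par bB) auto
  also have "\<dots> = ennreal (a * l / 2) * vol b"
  proof -
   have "ennreal (\<gamma> * l) * ennreal H = ennreal (\<gamma> * H * l)" using \<gamma> l H by (simp add: ennreal_mult[symmetric] mult_ac)
   then show ?thesis by (simp only: mult.assoc[symmetric] \<gamma>(2)) simp
  qed
  finally have "2 * (ennreal (a * l) * vol (E b)) \<le> 2 * (ennreal (a * l / 2) * vol b)"
   by (rule mult_left_mono) simp
  also have "\<dots> = ennreal (a * l) * vol b"
  proof -
   have "2 * ennreal (a * l / 2) = ennreal (a * l)" using a l ennreal_mult[of 2 "a * l / 2"] by simp
   then show ?thesis by (simp only: mult.assoc[symmetric])
  qed
  finally have le: "ennreal (a * l) * (2 * vol (E b)) \<le> ennreal (a * l) * vol b"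
   by (simp only: mult.left_commute)
  have al: "ennreal (a * l) \<noteq> 0" "ennreal (a * l) \<noteq> top" using a l by auto
  show ?thesis using le by (rule ennreal_mult_le_mult_iff[OF al, THEN iffD1])
 qed
 have cover: "{x. ennreal ((1 + a) * l) < M x} \<subseteq> (\<Union>b\<in>B'. E b) \<union> {x. ennreal (\<gamma> * l) < S x * indicator Q0 x}"
 proof
  fix x assume "x \<in> {x. ennreal ((1 + a) * l) < M x}"
  then obtain q where q: "q \<in> \<C>" "x \<in> q" "ennreal ((1 + a) * l) < ennreal (norm (average q F))" by (auto simp: M_gt)
  have q3: "(1 + a) * l < norm (average q F)" using q(3) a l by (subst (asm) ennreal_less_iff) auto
  have al: "0 < a * l" using a l by simp
  have "l < norm (average q F)" using q3 al by (simp add: algebra_simps)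
  then have "q \<in> A" using q(1) by (simp add: A_def)
  then obtain b where b: "b \<in> B" "q \<subseteq> b" using B(3) by blast
  have "norm (average q F) - norm (average (par b) F) \<le> norm (average q F - average (par b) F)" by (rule norm_triangle_ineq2)
  then have "a * l \<le> norm (average q F - average (par b) F)" using q3 par(4)[OF b(1)] by (simp add: algebra_simps)
  then have xE: "x \<in> E b" using q b by (auto simp: E_def)
  show "x \<in> (\<Union>b\<in>B'. E b) \<union> {x. ennreal (\<gamma> * l) < S x * indicator Q0 x}"
  proof (cases "S x \<le> ennreal (\<gamma> * l)")
   case True
   then have "b \<in> B'" using b q by (auto simp: B'_def)
   then show ?thesis using xE by blast
  next
   case False
   then show ?thesis using sub[OF q(1)] q(2) by auto
  qed
 qed
 have [measurable]: "Q0 \<in> sets lebesgue" using qs Q0 by blast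
 have Sset: "{x. ennreal (\<gamma> * l) < S x * indicator Q0 x} \<in> sets U"
 proof -
  have "{x\<in>space lebesgue. ennreal (\<gamma> * l) < S x * indicator Q0 x} \<in> sets lebesgue" by measurable
  then show ?thesis by simp
 qed
 have fB': "finite B'" using fB by (simp add: B'_def)
 have "emeasure U {x. ennreal ((1 + a) * l) < M x} \<le> emeasure U ((\<Union>b\<in>B'. E b) \<union> {x. ennreal (\<gamma> * l) < S x * indicator Q0 x})"
  using Sset Es fB' by (intro emeasure_mono cover sets.Un sets.finite_UN) auto
 also have "\<dots> \<le> emeasure U (\<Union>b\<in>B'. E b) + emeasure U {x. ennreal (\<gamma> * l) < S x * indicator Q0 x}"
  using Sset Es fB' by (intro emeasure_subadditive sets.finite_UN) auto
 also have "emeasure U (\<Union>b\<in>B'. E b) \<le> ennreal \<eta> * emeasure U {x. ennreal l < M x}"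
 proof -
  have "emeasure U (\<Union>b\<in>B'. E b) \<le> (\<Sum>b\<in>B'. emeasure U (E b))"
   using fB' Es by (intro emeasure_subadditive_finite) auto
  also have "\<dots> \<le> (\<Sum>b\<in>B'. ennreal \<eta> * emeasure U b)"
   using BC by (intro sum_mono UA Es Eb small) (auto simp: B'_def)
  also have "\<dots> = ennreal \<eta> * (\<Sum>b\<in>B'. emeasure U b)" by (rule sum_distrib_left[symmetric])
  also have "(\<Sum>b\<in>B'. emeasure U b) = emeasure U (\<Union>b\<in>B'. b)"
   using fB' B(2) BC qs by (intro sum_emeasure) (auto simp: disjoint_family_on_def disjoint_def B'_def)
  also have "ennreal \<eta> * emeasure U (\<Union>b\<in>B'. b) \<le> ennreal \<eta> * emeasure U {x. ennreal l < M x}"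
  proof (intro mult_left_mono emeasure_mono)
   show "(\<Union>b\<in>B'. b) \<subseteq> {x. ennreal l < M x}"
    using B(1) l by (auto simp: M_gt B'_def A_def ennreal_less_iff intro!: bexI)
   have "{x\<in>space lebesgue. ennreal l < M x} \<in> sets lebesgue" by measurable
   then show "{x. ennreal l < M x} \<in> sets U" by simp
  qed simp
  finally show ?thesis .
 qed
 finally show ?thesis by (simp add: \<gamma>_def add_right_mono)
qed

text \<open>With b^r = 2 / (1 + \<eta>) the factor b^(-r) = (1 + \<eta>) / 2 exceeds \<eta>.
  Integrating the good-lambda inequality over the levels and absorbing therefore leaves the
  coefficient (1 - \<eta>) / 2 in front of the integral of M^r.\<close>

lemma M_strong:
 assumes sfU: "sigma_finite_measure U" and r: "0 < r" and S [measurable]: "S \<in> bmeas"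
  and osc: "\<And>q x. q \<in> \<C> \<Longrightarrow> x \<in> q \<Longrightarrow>
   abs_int q (\<lambda>y. F y - average q F) \<le> S x * vol q"
 defines "b \<equiv> (2 / (1 + \<eta>)) powr (1 / r)"
 shows "(\<integral>\<^sup>+x. epowr (M x) r \<partial>U) \<le>
  ennreal ((1 + \<eta>) / (1 - \<eta>) * (b * (2 * H / (b - 1))) powr r) * (\<integral>\<^sup>+x. epowr (S x * indicator Q0 x) r \<partial>U)"
proof -
 have b1: "1 < b" unfolding b_def using \<eta> r by (intro gr_one_powr) auto
 have br: "b powr r = 2 / (1 + \<eta>)" unfolding b_def using \<eta> r by (simp add: powr_powr)
 define a where "a = b - 1"
 have a: "0 < a" "1 + a = b" using b1 by (simp_all add: a_def)
 define \<gamma> where "\<gamma> = a / (2 * H)"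
 have \<gamma>: "0 < \<gamma>" using a H by (simp add: \<gamma>_def)
 have [measurable]: "Q0 \<in> sets lebesgue" using qs Q0 by blast
 define S' where "S' x = S x * indicator Q0 x" for x
 have S'm [measurable]: "S' \<in> bmeas" unfolding S'_def[abs_def] by measurable
 define X where "X = (\<integral>\<^sup>+x. epowr (M x) r \<partial>U)"
 define Y where "Y = (\<integral>\<^sup>+x. epowr (S' x) r \<partial>U)"
 let ?w = "\<lambda>l. ennreal (r * l powr (r - 1)) * indicator {0<..} l :: ennreal"
 have resc: "ennreal l < ennreal (1 / c) * y \<longleftrightarrow> ennreal (c * l) < y" if c: "0 < c" and l: "0 < l" for c l y
 proof -
  have c0: "ennreal (1 / c) \<noteq> 0" "ennreal (1 / c) \<noteq> top" using c by auto
  have "ennreal l = ennreal (1 / c) * ennreal (c * l)" using c l by (simp add: ennreal_mult[symmetric])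
  then have "ennreal (1 / c) * y \<le> ennreal l \<longleftrightarrow> y \<le> ennreal (c * l)"
   using ennreal_mult_le_mult_iff[OF c0, of y "ennreal (c * l)"] by (simp only:)
  then show ?thesis by (simp only: not_le[symmetric])
 qed
 have sc: "(\<integral>\<^sup>+x. epowr (ennreal (1 / c) * f x) r \<partial>U) = ennreal ((1 / c) powr r) * (\<integral>\<^sup>+x. epowr (f x) r \<partial>U)"
  if c: "0 < c" and [measurable]: "f \<in> bmeas" for c f
  using r c by (simp add: epowr_mult epowr_ennreal nn_integral_cmult)
 have ms: "{x. ennreal l < f x} \<in> sets U" if [measurable]: "f \<in> bmeas" for f l
 proof -
  have "{x\<in>space lebesgue. ennreal l < f x} \<in> sets lebesgue" by measurable
  then show ?thesis by simp
 qed
 have dm [measurable]: "(\<lambda>l. emeasure U {x. ennreal l < f x}) \<in> borel_measurable lborel"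
  if [measurable]: "f \<in> bmeas" for f
 proof -
  interpret U: sigma_finite_measure U by fact
  have "(\<lambda>l. \<integral>\<^sup>+x. (if ennreal l < f x then 1 else 0) \<partial>U) \<in> borel_measurable lborel"
   by measurable
  also have "(\<lambda>l. \<integral>\<^sup>+x. (if ennreal l < f x then 1 else 0) \<partial>U) = (\<lambda>l. emeasure U {x. ennreal l < f x})"
  proof
   fix l
   have "(\<integral>\<^sup>+x. (if ennreal l < f x then 1 else 0) \<partial>U) = (\<integral>\<^sup>+x. indicator {x. ennreal l < f x} x \<partial>U)"
    by (intro nn_integral_cong) (auto simp: indicator_def)
   then show "(\<integral>\<^sup>+x. (if ennreal l < f x then 1 else 0) \<partial>U) = emeasure U {x. ennreal l < f x}"
    using ms[OF that] by simp
  qed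
  finally show ?thesis .
 qed
 have "ennreal ((1 / b) powr r) * X = (\<integral>\<^sup>+x. epowr (ennreal (1 / b) * M x) r \<partial>U)"
  using sc[of b M] b1 by (simp add: X_def)
 also have "\<dots> = (\<integral>\<^sup>+l. ?w l * emeasure U {x\<in>space U. ennreal l < ennreal (1 / b) * M x} \<partial>lborel)"
  by (intro layer_cake1 sfU r) measurable
 also have "\<dots> \<le> (\<integral>\<^sup>+l. ennreal \<eta> * (?w l * emeasure U {x\<in>space U. ennreal l < M x}) +
   ?w l * emeasure U {x\<in>space U. ennreal l < ennreal (1 / \<gamma>) * S' x} \<partial>lborel)"
 proof (rule nn_integral_mono)
  fix l :: real
  show "?w l * emeasure U {x\<in>space U. ennreal l < ennreal (1 / b) * M x} \<le>
   ennreal \<eta> * (?w l * emeasure U {x\<in>space U. ennreal l < M x}) +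
   ?w l * emeasure U {x\<in>space U. ennreal l < ennreal (1 / \<gamma>) * S' x}"
  proof (cases "0 < l")
   case True
   have "emeasure U {x. ennreal ((1 + a) * l) < M x} \<le>
    ennreal \<eta> * emeasure U {x. ennreal l < M x} + emeasure U {x. ennreal (a / (2 * H) * l) < S x * indicator Q0 x}"
    by (rule good_lambda[OF S osc a(1) True])
   then have g: "emeasure U {x. ennreal (b * l) < M x} \<le>
    ennreal \<eta> * emeasure U {x. ennreal l < M x} + emeasure U {x. ennreal (\<gamma> * l) < S' x}"
    by (simp only: a(2) \<gamma>_def S'_def)
   have "?w l * emeasure U {x\<in>space U. ennreal l < ennreal (1 / b) * M x} = ?w l * emeasure U {x. ennreal (b * l) < M x}"
    using b1 True by (simp add: resc)
   also have "\<dots> \<le> ?w l * (ennreal \<eta> * emeasure U {x. ennreal l < M x} + emeasure U {x. ennreal (\<gamma> * l) < S' x})"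
    by (rule mult_left_mono[OF g]) simp
   also have "\<dots> = ennreal \<eta> * (?w l * emeasure U {x\<in>space U. ennreal l < M x}) +
     ?w l * emeasure U {x\<in>space U. ennreal l < ennreal (1 / \<gamma>) * S' x}"
    using \<gamma> True by (simp add: resc distrib_left mult.left_commute)
   finally show ?thesis .
  qed simp
 qed
 also have "\<dots> = ennreal \<eta> * (\<integral>\<^sup>+l. ?w l * emeasure U {x\<in>space U. ennreal l < M x} \<partial>lborel) +
   (\<integral>\<^sup>+l. ?w l * emeasure U {x\<in>space U. ennreal l < ennreal (1 / \<gamma>) * S' x} \<partial>lborel)"
 proof -
  have [measurable]: "(\<lambda>l. emeasure U {x\<in>space U. ennreal l < M x}) \<in> borel_measurable lborel"
   "(\<lambda>l. emeasure U {x\<in>space U. ennreal l < ennreal (1 / \<gamma>) * S' x}) \<in> borel_measurable lborel"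
   using dm[of M] dm[of "\<lambda>x. ennreal (1 / \<gamma>) * S' x"] by simp_all
  have 1: "(\<lambda>l. ?w l * emeasure U {x\<in>space U. ennreal l < M x}) \<in> borel_measurable lborel"
   "(\<lambda>l. ?w l * emeasure U {x\<in>space U. ennreal l < ennreal (1 / \<gamma>) * S' x}) \<in> borel_measurable lborel"
   by measurable
  have 2: "(\<lambda>l. ennreal \<eta> * (?w l * emeasure U {x\<in>space U. ennreal l < M x})) \<in> borel_measurable lborel"
   by measurable
  show ?thesis using nn_integral_add[OF 2 1(2)] nn_integral_cmult[OF 1(1), of "ennreal \<eta>"] by (simp only:)
 qed
 also have "(\<integral>\<^sup>+l. ?w l * emeasure U {x\<in>space U. ennreal l < M x} \<partial>lborel) = X"
  unfolding X_def by (intro layer_cake1[symmetric] sfU r) measurable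
 also have "(\<integral>\<^sup>+l. ?w l * emeasure U {x\<in>space U. ennreal l < ennreal (1 / \<gamma>) * S' x} \<partial>lborel) =
   (\<integral>\<^sup>+x. epowr (ennreal (1 / \<gamma>) * S' x) r \<partial>U)"
  by (intro layer_cake1[symmetric] sfU r) measurable
 also have "\<dots> = ennreal ((1 / \<gamma>) powr r) * Y"
  using sc[of \<gamma> S'] \<gamma> by (simp add: Y_def)
 finally have main: "ennreal ((1 / b) powr r) * X \<le> ennreal \<eta> * X + ennreal ((1 / \<gamma>) powr r) * Y" .
 \<comment> \<open>Absorption subtracts \<eta> X and needs X finite. This holds because finitely
   many means occur and M is supported in Q0.\<close>
 have Xfin: "X < \<infinity>"
 proof -
  define B where "B = (\<Sum>q\<in>\<C>. norm (average q F))"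
  have MB: "M x \<le> ennreal B * indicator Q0 x" for x
   unfolding M_def
  proof (rule SUP_least)
   fix q assume q: "q \<in> \<C>"
   have "norm (average q F) \<le> B" unfolding B_def using q fin by (intro member_le_sum) auto
   then show "ennreal (norm (average q F)) * indicator q x \<le> ennreal B * indicator Q0 x"
    using sub[OF q] by (auto simp: indicator_def ennreal_leI)
  qed
  have "X \<le> (\<integral>\<^sup>+x. ennreal (B powr r) * indicator Q0 x \<partial>U)"
   unfolding X_def
  proof (rule nn_integral_mono)
   fix x
   have "epowr (M x) r \<le> epowr (ennreal B * indicator Q0 x) r" using r MB by (rule epowr_mono)
   also have "\<dots> = ennreal (B powr r) * indicator Q0 x"
    using r by (cases "x \<in> Q0") (simp_all add: epowr_ennreal B_def sum_nonneg)
   finally show "epowr (M x) r \<le> ennreal (B powr r) * indicator Q0 x" .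
  qed
  also have "\<dots> = ennreal (B powr r) * emeasure U Q0" by (rule nn_integral_cmult_indicator) simp
  also have "\<dots> < \<infinity>" using Ufin by (simp add: ennreal_mult_less_top)
  finally show ?thesis .
 qed
 have "X \<le> ennreal ((1 + \<eta>) / (1 - \<eta>) * (b * (2 * H / (b - 1))) powr r) * Y"
 proof (cases Y)
  case (real y)
  obtain x where x: "0 \<le> x" "X = ennreal x" using Xfin by (cases X) auto
  have "ennreal ((1 / b) powr r * x) \<le> ennreal (\<eta> * x + (1 / \<gamma>) powr r * y)"
   using main x real \<eta> by (simp add: ennreal_mult ennreal_plus)
  then have "(1 / b) powr r * x \<le> \<eta> * x + (1 / \<gamma>) powr r * y"
   using x real \<eta> by (subst (asm) ennreal_le_iff) auto
  moreover have "(1 / b) powr r = (1 + \<eta>) / 2" using b1 br by (simp add: powr_divide)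
  ultimately have "(1 - \<eta>) / 2 * x \<le> (1 / \<gamma>) powr r * y" by (simp add: field_simps)
  then have "x \<le> 2 / (1 - \<eta>) * ((1 / \<gamma>) powr r * y)" using \<eta> by (simp add: field_simps)
  also have "2 / (1 - \<eta>) * ((1 / \<gamma>) powr r * y) = (1 + \<eta>) / (1 - \<eta>) * (b powr r * (1 / \<gamma>) powr r) * y"
   using \<eta> by (simp add: br)
  also have "b powr r * (1 / \<gamma>) powr r = (b * (2 * H / (b - 1))) powr r"
   using b1 \<gamma> H a by (simp add: powr_mult[symmetric] \<gamma>_def a_def)
  finally have "ennreal x \<le> ennreal ((1 + \<eta>) / (1 - \<eta>) * (b * (2 * H / (b - 1))) powr r * y)" by (rule ennreal_leI)
  moreover have c0: "0 \<le> (1 + \<eta>) / (1 - \<eta>) * (b * (2 * H / (b - 1))) powr r" using \<eta> by simp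
  ultimately show ?thesis by (simp only: x(2) real(2) ennreal_mult[OF c0 real(1)])
 next
  case top
  have gen: "ennreal c * top = top" if "0 < c" for c using that by (simp add: ennreal_mult_top)
  show ?thesis unfolding top by (subst gen) (use \<eta> b1 H in auto)
 qed
 then show ?thesis by (simp only: X_def Y_def S'_def)
qed

end

subsection \<open>Dyadic cells\<close>

text \<open>The half-open dyadic cells of generation \<open>k\<close> of the cube with centre 0 and half-side \<open>L\<close>.\<close>

definition cell :: "real \<Rightarrow> nat \<Rightarrow> ('n::finite \<Rightarrow> int) \<Rightarrow> (real^'n) set" where
 "cell L k j = {y. \<forall>i. \<lfloor>2 ^ k * (y $ i + L) / (2 * L)\<rfloor> = j i}"

definition center :: "real \<Rightarrow> nat \<Rightarrow> ('n::finite \<Rightarrow> int) \<Rightarrow> real^'n" where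
 "center L k j = (\<chi> i. (2 * of_int (j i) + 1) * L / 2 ^ k - L)"

definition cell_index :: "nat \<Rightarrow> ('n::finite \<Rightarrow> int) set" where
 "cell_index k = {j. \<forall>i. 0 \<le> j i \<and> j i < 2 ^ k}"

definition cells :: "real \<Rightarrow> nat \<Rightarrow> (real^'n::finite) set set" where
 "cells L N = (\<Union>k\<le>N. cell L k ` cell_index k)"

lemma finite_cell_index: "finite (cell_index k :: ('n::finite \<Rightarrow> int) set)"
proof -
 have "cell_index k \<subseteq> (UNIV :: 'n set) \<rightarrow>\<^sub>E {0..<2 ^ k}" by (auto simp: cell_index_def PiE_def extensional_def)
 then show ?thesis by (rule finite_subset) (intro finite_PiE, auto)
qed

lemma finite_cells: "finite (cells L N)"
 unfolding cells_def by (intro finite_UN_I) (auto intro: finite_cell_index)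

lemma cell_floor:
 fixes L y :: real
 assumes L: "0 < L"
 shows "\<lfloor>2 ^ k * (y + L) / (2 * L)\<rfloor> = m \<longleftrightarrow>
  - (L / 2 ^ k) \<le> y - ((2 * of_int m + 1) * L / 2 ^ k - L) \<and> y - ((2 * of_int m + 1) * L / 2 ^ k - L) < L / 2 ^ k"
proof -
 have "\<lfloor>2 ^ k * (y + L) / (2 * L)\<rfloor> = m \<longleftrightarrow> of_int m \<le> 2 ^ k * (y + L) / (2 * L) \<and> 2 ^ k * (y + L) / (2 * L) < of_int m + 1"
  by (rule floor_eq_iff)
 also have "of_int m \<le> 2 ^ k * (y + L) / (2 * L) \<longleftrightarrow> - (L / 2 ^ k) \<le> y - ((2 * of_int m + 1) * L / 2 ^ k - L)"
  using L by (simp add: field_simps)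
 also have "2 ^ k * (y + L) / (2 * L) < of_int m + 1 \<longleftrightarrow> y - ((2 * of_int m + 1) * L / 2 ^ k - L) < L / 2 ^ k"
 proof -
  have "2 ^ k * (y + L) / (2 * L) < of_int m + 1 \<longleftrightarrow> (y + L) * 2 ^ k < (2 * of_int m + 2) * L"
   using L by (simp add: pos_divide_less_eq algebra_simps)
  also have "\<dots> \<longleftrightarrow> y + L < (2 * of_int m + 2) * L / 2 ^ k" by (simp add: pos_less_divide_eq)
  also have "(2 * of_int m + 2) * L / 2 ^ k = (2 * of_int m + 1) * L / 2 ^ k + L / 2 ^ k"
   by (simp add: add_divide_distrib[symmetric] algebra_simps)
  finally show ?thesis by linarith
 qed
 finally show ?thesis .
qed

lemma cell_cb:
 assumes L: "0 < L"
 shows "cell L k j \<subseteq> cb (center L k j) (L / 2 ^ k)" "interior (cb (center L k j) (L / 2 ^ k)) \<subseteq> cell L k j"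
proof -
 show "cell L k j \<subseteq> cb (center L k j) (L / 2 ^ k)"
  unfolding cell_def cell_floor[OF L] by (auto simp: mem_cb center_def abs_le_iff less_imp_le) (smt (verit))+
 show "interior (cb (center L k j) (L / 2 ^ k)) \<subseteq> cell L k j"
  unfolding cell_def cell_floor[OF L] subset_iff interior_cb by (auto simp: center_def abs_less_iff) (smt (verit))+
qed

lemma AE_interior_cb: "AE y in lebesgue. y \<in> cb x R \<longrightarrow> y \<in> interior (cb x R)"
proof -
 have "negligible (frontier (cb x R))" unfolding cb_def by (intro negligible_convex_frontier convex_box)
 then have "AE y in lebesgue. y \<notin> frontier (cb x R)" by (simp add: negligible_iff_null_sets AE_not_in)
 then show ?thesis by eventually_elim (auto simp: frontier_def)
qed

lemma sets_cell [measurable, simp]: "cell L k j \<in> sets lebesgue"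
proof -
 have "{y :: real^'a \<in> space borel. \<forall>i. \<lfloor>2 ^ k * (y $ i + L) / (2 * L)\<rfloor> = j i} \<in> sets borel" by measurable
 then show ?thesis by (simp add: cell_def sets_completionI_sets)
qed

text \<open>Half-open cells partition exactly, while the geometric estimates concern closed cubes;
  the two differ by part of a boundary of measure zero.\<close>

lemma AE_cell:
 assumes L: "0 < L" shows "AE y in lebesgue. y \<in> cell L k j \<longleftrightarrow> y \<in> cb (center L k j) (L / 2 ^ k)"
 using AE_interior_cb[of "center L k j" "L / 2 ^ k"]
 by eventually_elim (use cell_cb[OF L] in blast)

lemma emeasure_cell:
 assumes L: "0 < L"
 shows "vol (cell L k (j :: 'n::finite \<Rightarrow> int)) = ennreal ((2 * (L / 2 ^ k)) ^ CARD('n))"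
proof -
 have "vol (cell L k j) = vol (cb (center L k j) (L / 2 ^ k))"
  by (intro emeasure_eq_AE AE_cell L) auto
 also have "\<dots> = ennreal ((2 * (L / 2 ^ k)) ^ CARD('n))" using L by (intro emeasure_cb) simp
 finally show ?thesis .
qed

text \<open>Passing to an ancestor is integer division of the index, which reduces nesting and
  laminarity to arithmetic.\<close>

lemma cell_div:
 assumes "k \<le> k'" "y \<in> cell L k' j'"
 shows "y \<in> cell L k (\<lambda>i. j' i div 2 ^ (k' - k))"
proof -
 obtain d where d: "k' = k + d" using assms(1) le_iff_add by blast
 have "\<lfloor>2 ^ k * (y $ i + L) / (2 * L)\<rfloor> = j' i div 2 ^ (k' - k)" for i
 proof -
  have "2 ^ k * (y $ i + L) / (2 * L) = (2 ^ k' * (y $ i + L) / (2 * L)) / real_of_int (2 ^ d)"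
   unfolding d by (simp add: power_add)
  then have "\<lfloor>2 ^ k * (y $ i + L) / (2 * L)\<rfloor> = \<lfloor>2 ^ k' * (y $ i + L) / (2 * L)\<rfloor> div 2 ^ d"
   by (simp only: floor_divide_real_eq_div zero_le_power zero_le_numeral)
  then show ?thesis using assms(2) by (simp add: cell_def d)
 qed
 then show ?thesis by (simp add: cell_def)
qed

lemma cell_unique: "y \<in> cell L k j \<Longrightarrow> y \<in> cell L k j' \<Longrightarrow> j = j'"
 by (auto simp: cell_def)

lemma cell_nested:
 assumes "k \<le> k'" "cell L k j \<inter> cell L k' j' \<noteq> {}" shows "cell L k' j' \<subseteq> cell L k j"
proof -
 obtain y where y: "y \<in> cell L k j" "y \<in> cell L k' j'" using assms(2) by blast
 have "j = (\<lambda>i. j' i div 2 ^ (k' - k))" using cell_unique[OF y(1) cell_div[OF assms(1) y(2)]] .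
 then show ?thesis using cell_div[OF assms(1)] by blast
qed

lemma cells_laminar:
 assumes "q \<in> cells L N" "q' \<in> cells L N" shows "q \<subseteq> q' \<or> q' \<subseteq> q \<or> q \<inter> q' = {}"
proof -
 obtain k j k' j' where q: "q = cell L k j" "q' = cell L k' j'" using assms by (auto simp: cells_def)
 show ?thesis
 proof (cases "k \<le> k'")
  case True
  then show ?thesis using cell_nested[of k k' L j j'] unfolding q by blast
 next
  case False
  then have "cell L k' j' \<inter> cell L k j \<noteq> {} \<Longrightarrow> cell L k j \<subseteq> cell L k' j'" by (intro cell_nested) auto
  then show ?thesis unfolding q by (auto simp: Int_commute)
 qed
qed

abbreviation root_cell :: "real \<Rightarrow> (real^'n::finite) set" where
 "root_cell L \<equiv> cell L 0 (\<lambda>_. 0)"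

lemma cell_index_0: "cell_index 0 = {\<lambda>_. 0}"
proof (intro set_eqI iffI)
 fix j :: "'a \<Rightarrow> int" assume j: "j \<in> cell_index 0"
 have "j i = 0" for i
 proof -
  have "0 \<le> j i" "j i < 1" using j by (auto simp: cell_index_def)
  then show ?thesis by linarith
 qed
 then show "j \<in> {\<lambda>_. 0}" by (simp add: fun_eq_iff)
qed (simp add: cell_index_def)

lemma cell_div_index: "j \<in> cell_index k' \<Longrightarrow> k \<le> k' \<Longrightarrow> (\<lambda>i. j i div 2 ^ (k' - k)) \<in> cell_index k"
proof -
 assume j: "j \<in> cell_index k'" "k \<le> k'"
 have "j i div 2 ^ (k' - k) < 2 ^ k" for i
 proof -
  have "j i < 2 ^ k * 2 ^ (k' - k)" using j by (simp add: cell_index_def power_add[symmetric])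
  moreover have "j i div 2 ^ (k' - k) * 2 ^ (k' - k) \<le> j i"
  proof -
   have "0 \<le> j i mod 2 ^ (k' - k)" by simp
   then show ?thesis using div_mult_mod_eq[of "j i" "2 ^ (k' - k)"] by linarith
  qed
  ultimately have "j i div 2 ^ (k' - k) * 2 ^ (k' - k) < 2 ^ k * 2 ^ (k' - k)" by (rule le_less_trans[rotated])
  then show ?thesis by (rule mult_right_less_imp_less) simp
 qed
 then show ?thesis using j by (auto simp: cell_index_def pos_imp_zdiv_nonneg_iff)
qed

lemma cell_sub_root: "j \<in> cell_index k \<Longrightarrow> cell L k j \<subseteq> root_cell L"
 using cell_div[of 0 k _ L j] cell_div_index[of j k 0] by (auto simp: cell_index_0)

lemma cell_cover:
 assumes "y \<in> root_cell L" shows "\<exists>j\<in>cell_index k. y \<in> cell L k j"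
proof -
 define j where "j i = \<lfloor>2 ^ k * (y $ i + L) / (2 * L)\<rfloor>" for i
 have y: "y \<in> cell L k j" by (simp add: cell_def j_def)
 then have "y \<in> cell L 0 (\<lambda>i. j i div 2 ^ k)" using cell_div[of 0 k y L j] by simp
 then have "(\<lambda>i. j i div 2 ^ k) = (\<lambda>_. 0)" using assms by (rule cell_unique)
 then have d0: "j i div 2 ^ k = 0" for i by (simp only: fun_eq_iff)
 have "0 \<le> j i \<and> j i < 2 ^ k" for i
  using div_mult_mod_eq[of "j i" "2 ^ k"] pos_mod_sign[of "2 ^ k" "j i"] pos_mod_bound[of "2 ^ k" "j i"] d0[of i] by simp
 then show ?thesis using y by (auto simp: cell_index_def)
qed

lemma cells_props:
 assumes L: "0 < L" and q: "(q :: (real^'n::finite) set) \<in> cells L N"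
 shows "q \<in> sets lebesgue" "vol q < \<infinity>" "0 < measure lebesgue q" "q \<subseteq> root_cell L"
  "\<exists>k j. q = cell L k j"
proof -
 obtain k j where kj: "q = cell L k j" "j \<in> cell_index k" using q by (auto simp: cells_def)
 show "q \<in> sets lebesgue" "q \<subseteq> root_cell L" "\<exists>k j. q = cell L k j" using kj cell_sub_root by auto
 show "vol q < \<infinity>" unfolding kj emeasure_cell[OF L] by simp
 show "0 < measure lebesgue q" using L unfolding kj measure_def emeasure_cell[OF L] by simp
qed

lemma cells_parent:
 assumes L: "0 < L" and q: "(q :: (real^'n::finite) set) \<in> cells L N" "q \<noteq> root_cell L"
 shows "\<exists>P\<in>cells L N. q \<subset> P \<and> vol P \<le> ennreal (2 ^ CARD('n)) * vol q"
proof -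
 obtain k j where kj: "q = cell L k j" "j \<in> cell_index k" "k \<le> N" using q by (auto simp: cells_def)
 have "k \<noteq> 0"
 proof
  assume k: "k = 0"
  then have "j = (\<lambda>_. 0)" using kj(2) by (simp add: cell_index_0)
  then show False using kj(1) q(2) k by simp
 qed
 then obtain k0 where k0: "k = Suc k0" using not0_implies_Suc by blast
 let ?j = "\<lambda>i. j i div 2 ^ (k - k0)"
 have P: "cell L k0 ?j \<in> cells L N" "q \<subseteq> cell L k0 ?j"
  using cell_div_index[OF kj(2), of k0] cell_div[of k0 k _ L j] kj k0 by (auto simp: cells_def)
 have e: "vol (cell L k0 ?j) = ennreal (2 ^ CARD('n)) * vol q"
 proof -
  have "(2 * (L / 2 ^ k0)) ^ CARD('n) = 2 ^ CARD('n) * (2 * (L / 2 ^ k)) ^ CARD('n)"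
   by (simp add: k0 power_mult_distrib[symmetric])
  then show ?thesis unfolding kj emeasure_cell[OF L] using L by (simp only: ennreal_mult' zero_le_power zero_le_numeral)
 qed
 have "q \<noteq> cell L k0 ?j"
 proof
  assume "q = cell L k0 ?j"
  then have "vol q = vol (cell L k0 ?j)" by (rule arg_cong)
  then have "(2 * (L / 2 ^ k)) ^ CARD('n) = (2 * (L / 2 ^ k0)) ^ CARD('n)"
   unfolding kj(1) emeasure_cell[OF L] using L by simp
  then have "2 * (L / 2 ^ k) = 2 * (L / 2 ^ k0)" using L by (subst (asm) power_eq_iff_eq_base) auto
  then show False using L by (simp add: k0)
 qed
 with P e show ?thesis by (intro bexI[of _ "cell L k0 ?j"]) auto
qed

lemma average_diff_const:
 assumes "q \<in> sets lebesgue" "vol q < \<infinity>" "0 < measure lebesgue q" "set_integrable lebesgue q h"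
 shows "average q (\<lambda>y. h y - c) = average q h - c" "set_integrable lebesgue q (\<lambda>y. h y - c)"
proof -
 have ci: "set_integrable lebesgue q (\<lambda>_. c)"
  using assms by (simp add: set_integrable_def integrable_indicator_iff)
 show "average q (\<lambda>y. h y - c) = average q h - c"
  using set_integral_diff(2)[OF assms(4) ci] assms
  by (simp add: average_def scaleR_diff_right set_integral_const)
 show "set_integrable lebesgue q (\<lambda>y. h y - c)" using assms(4) ci by (rule set_integral_diff)
qed

text \<open>The mean is optimal among constants up to a factor 2, so oscillations may be estimated
  with any convenient constant.\<close>

lemma average_osc_le:
 fixes h :: "'n::finite cfun"
 assumes q: "q \<in> sets lebesgue" "vol q < \<infinity>" "0 < measure lebesgue q" and h: "set_integrable lebesgue q h"
 shows "abs_int q (\<lambda>y. h y - average q h) \<le>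
  2 * abs_int q (\<lambda>y. h y - c)"
proof -
 have "(\<lambda>y. indicator q y *\<^sub>R h y) \<in> bmeas" using h by (simp add: set_integrable_def)
 then have "(\<lambda>y. ennreal (norm (indicator q y *\<^sub>R h y - c)) * indicator q y) \<in> bmeas"
  using q(1) by measurable
 then have m [measurable]: "(\<lambda>y. ennreal (norm (h y - c)) * indicator q y) \<in> bmeas"
  by (rule measurable_cong[THEN iffD1, rotated]) (simp add: indicator_def)
 have "abs_int q (\<lambda>y. h y - average q h) \<le>
  (\<integral>\<^sup>+y. ennreal (norm (h y - c)) * indicator q y + ennreal (norm (average q h - c)) * indicator q y \<partial>lebesgue)"
 proof (rule nn_integral_mono)
  fix y
  have "norm (h y - average q h) \<le> norm (h y - c) + norm (average q h - c)"
   using norm_triangle_ineq4[of "h y - c" "average q h - c"] by simp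
  then show "ennreal (norm (h y - average q h)) * indicator q y \<le>
   ennreal (norm (h y - c)) * indicator q y + ennreal (norm (average q h - c)) * indicator q y"
   by (auto simp: indicator_def ennreal_plus[symmetric] ennreal_leI simp del: ennreal_plus)
 qed
 also have "\<dots> = abs_int q (\<lambda>y. h y - c) + ennreal (norm (average q h - c)) * vol q"
  using q(1) by (subst nn_integral_add) (auto simp: nn_integral_cmult_indicator)
 also have "\<dots> \<le> abs_int q (\<lambda>y. h y - c) + abs_int q (\<lambda>y. h y - c)"
  by (intro add_left_mono norm_average_le q h)
 finally show ?thesis by (simp only: mult_2)
qed

subsection \<open>The weighted Fefferman--Stein inequality\<close>

text \<open>The conditional expectation on the cells of generation N, extended by zero off the root
  cell.\<close>

definition cell_expect :: "real \<Rightarrow> nat \<Rightarrow> 'n::finite cfun \<Rightarrow> 'n cfun" where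
 "cell_expect L N F x = (\<Sum>j\<in>cell_index N. indicator (cell L N j) x *\<^sub>R average (cell L N j) F)"

lemma cell_sum_single:
 fixes g :: "('n::finite \<Rightarrow> int) \<Rightarrow> 'b::comm_monoid_add"
 assumes "x \<in> cell L N j" "j \<in> cell_index N" "\<And>j'. x \<notin> cell L N j' \<Longrightarrow> g j' = 0"
 shows "(\<Sum>j\<in>cell_index N. g j) = g j"
proof -
 have "(\<Sum>j\<in>cell_index N. g j) = (\<Sum>j\<in>{j}. g j)"
 proof (rule sum.mono_neutral_right[OF finite_cell_index])
  show "{j} \<subseteq> cell_index N" using assms(2) by simp
  show "\<forall>i\<in>cell_index N - {j}. g i = 0" using assms(3) cell_unique[OF assms(1)] by blast
 qed
 then show ?thesis by simp
qed

lemma cell_expect_in: "x \<in> cell L N j \<Longrightarrow> j \<in> cell_index N \<Longrightarrow> cell_expect L N F x = average (cell L N j) F"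
 unfolding cell_expect_def by (subst cell_sum_single[of x L N j]) auto

lemma cell_expect_out: "x \<notin> root_cell L \<Longrightarrow> cell_expect L N F x = 0"
 unfolding cell_expect_def using cell_sub_root by (intro sum.neutral) (auto simp: indicator_def)

lemma cell_expect_integrable: "0 < L \<Longrightarrow> integrable lebesgue (cell_expect L N F)"
 unfolding cell_expect_def[abs_def]
 by (intro Bochner_Integration.integrable_sum integrable_scaleR_left integrable_real_indicator)
   (auto simp: emeasure_cell)

lemma root_cell_cb: "0 < L \<Longrightarrow> root_cell L \<subseteq> cb 0 L"
 using cell_cb(1)[of L 0 "\<lambda>_. 0"] by (simp add: center_def zero_vec_def)

lemma nn_integral_cells:
 assumes "f \<in> bmeas"
 shows "(\<integral>\<^sup>+x. f x * indicator (root_cell L) x \<partial>lebesgue) =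
  (\<Sum>j\<in>cell_index N. (\<integral>\<^sup>+x. f x * indicator (cell L N j) x \<partial>lebesgue))"
proof -
 have "f x * indicator (root_cell L) x = (\<Sum>j\<in>cell_index N. f x * indicator (cell L N j) x)" for x
 proof (cases "x \<in> root_cell L")
  case True
  then obtain j where "j \<in> cell_index N" "x \<in> cell L N j" using cell_cover by blast
  then show ?thesis using True by (subst cell_sum_single[of x L N j]) auto
 next
  case False
  then have "(\<Sum>j\<in>cell_index N. f x * indicator (cell L N j) x) = 0"
   using cell_sub_root by (intro sum.neutral) (auto simp: indicator_def)
  then show ?thesis using False by simp
 qed
 then show ?thesis using assms by (simp add: nn_integral_sum)
qed

text \<open>F is approximated in L1 by a test function. On small cells this function is nearly
  constant by uniform continuity, and its value at the centre serves as the constant in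
  \<open>average_osc_le\<close>.\<close>

lemma cell_expect_tendsto:
 fixes F :: "'n::finite cfun"
 assumes L: "0 < L" and F: "integrable lebesgue F"
 shows "(\<lambda>N. LINT x|lebesgue. norm (cell_expect L N F x - indicator (root_cell L) x *\<^sub>R F x)) \<longlonglongrightarrow> 0"
proof (rule LIMSEQ_I)
 fix e :: real assume e: "0 < e"
 let ?Q = "root_cell L :: (real^'n) set"
 define f where "f x = indicator ?Q x *\<^sub>R F x" for x
 have [measurable]: "F \<in> bmeas" using F by simp
 have fi: "integrable lebesgue f" unfolding f_def[abs_def] using F by (intro integrable_mult_indicator) auto
 then have [measurable]: "f \<in> bmeas" by simp
 let ?V = "interior (cb (0::real^'n) (L + 1))"
 have "cb (0::real^'n) L \<subseteq> ?V" by (intro subsetI) (auto simp: mem_cb interior_cb intro: le_less_trans)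
 then have f0: "f x = 0" if "x \<notin> ?V" for x
 proof -
  have "x \<notin> ?Q" using root_cell_cb[OF L] that \<open>cb 0 L \<subseteq> ?V\<close> by blast
  then show ?thesis by (simp add: f_def)
 qed
 have "\<exists>\<phi>\<in>test_functions. supp \<phi> \<subseteq> ?V \<and> integrable lebesgue (\<lambda>x. norm (\<phi> x - f x) ^ 1) \<and>
   (LINT x|lebesgue. norm (\<phi> x - f x) ^ 1) < e / 8"
  by (rule test_dense) (use fi f0 e in \<open>auto intro: bounded_subset[OF bounded_cb interior_subset]\<close>)
 then obtain \<phi> where \<phi>: "\<phi> \<in> test_functions" "integrable lebesgue (\<lambda>x. norm (\<phi> x - f x))"
  "(LINT x|lebesgue. norm (\<phi> x - f x)) < e / 8" by auto
 have [measurable]: "\<phi> \<in> bmeas" using \<phi>(1) by (rule test_measurable)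
 define V where "V = (2 * L) ^ CARD('n)"
 have V: "0 < V" using L by (simp add: V_def)
 \<comment> \<open>The approximation and the oscillation term V e' cost e / 8 each;
   \<open>average_osc_le\<close> doubles their sum to e / 2.\<close>
 define e' where "e' = e / (8 * V)"
 have e': "0 < e'" using e V by (simp add: e'_def)
 have "uniformly_continuous_on (cb 0 L) \<phi>"
  by (rule compact_uniformly_continuous[OF continuous_on_subset[OF test_continuous[OF \<phi>(1)] subset_UNIV] compact_cb])
 then have "\<exists>d>0. \<forall>x\<in>cb 0 L. \<forall>x'\<in>cb 0 L. dist x' x < d \<longrightarrow> dist (\<phi> x') (\<phi> x) < e'"
  using e' unfolding uniformly_continuous_on_def by simp
 then obtain d where d: "0 < d" "\<forall>x\<in>cb 0 L. \<forall>x'\<in>cb 0 L. dist x' x < d \<longrightarrow> dist (\<phi> x') (\<phi> x) < e'"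
  by (elim exE conjE)
 obtain N0 :: nat where N0: "real CARD('n) * L / d < 2 ^ N0" using real_arch_pow[where x=2] by auto
 show "\<exists>no. \<forall>N\<ge>no. norm ((LINT x|lebesgue. norm (cell_expect L N F x - indicator ?Q x *\<^sub>R F x)) - 0) < e"
 proof (intro exI[of _ N0] allI impI)
  fix N assume N: "N0 \<le> N"
  have small: "real CARD('n) * (L / 2 ^ N) < d"
  proof -
   have "real CARD('n) * L / d < 2 ^ N" using N0 N by (meson less_le_trans one_le_numeral power_increasing)
   then show ?thesis using d(1) by (simp add: field_simps)
  qed
  have cl: "abs_int (cell L N j) (\<lambda>x. F x - average (cell L N j) F) \<le>
    2 * (\<integral>\<^sup>+x. (ennreal (norm (\<phi> x - f x)) + ennreal e') * indicator (cell L N j) x \<partial>lebesgue)"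
   if j: "j \<in> cell_index N" for j
  proof -
   have c: "cell L N j \<in> cells L N" using j by (auto simp: cells_def)
   have Fc: "set_integrable lebesgue (cell L N j) F"
    unfolding set_integrable_def using F by (intro integrable_mult_indicator) auto
   let ?c = "center L N j"
   have cc: "?c \<in> cell L N j" using cell_cb(2)[OF L, of N j] L by (auto simp: interior_cb)
   have "abs_int (cell L N j) (\<lambda>x. F x - average (cell L N j) F) \<le>
    2 * abs_int (cell L N j) (\<lambda>x. F x - \<phi> ?c)"
    by (rule average_osc_le[OF cells_props(1-3)[OF L c] Fc])
   also have "\<dots> \<le> 2 * (\<integral>\<^sup>+x. (ennreal (norm (\<phi> x - f x)) + ennreal e') * indicator (cell L N j) x \<partial>lebesgue)"
   proof (intro mult_left_mono nn_integral_mono)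
    fix x
    show "ennreal (norm (F x - \<phi> ?c)) * indicator (cell L N j) x \<le>
     (ennreal (norm (\<phi> x - f x)) + ennreal e') * indicator (cell L N j) x"
    proof (cases "x \<in> cell L N j")
     case True
     have xr: "x \<in> ?Q" "?c \<in> ?Q" using True cc cell_sub_root[OF j, of L] by auto
     have "norm (x - ?c) \<le> (\<Sum>i\<in>UNIV. \<bar>(x - ?c) $ i\<bar>)" by (rule norm_le_l1_cart)
     also have "\<dots> \<le> (\<Sum>i\<in>(UNIV::'n set). L / 2 ^ N)"
      using True cell_cb(1)[OF L, of N j] by (intro sum_mono) (auto simp: mem_cb)
     also have "\<dots> < d" using small by simp
     finally have "dist (\<phi> x) (\<phi> ?c) < e'"
      using xr root_cell_cb[OF L] by (intro d(2)[rule_format]) (auto simp: dist_norm)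
     moreover have "norm (F x - \<phi> ?c) \<le> norm (\<phi> x - F x) + norm (\<phi> x - \<phi> ?c)"
      using norm_triangle_ineq4[of "\<phi> x - \<phi> ?c" "\<phi> x - F x"] by (simp add: norm_minus_commute add.commute)
     ultimately have "norm (F x - \<phi> ?c) \<le> norm (\<phi> x - f x) + e'"
      using xr by (simp add: f_def dist_norm)
     then show ?thesis using True e' by (simp add: ennreal_plus[symmetric] ennreal_leI del: ennreal_plus)
    qed simp
   qed simp
   finally show ?thesis .
  qed
  have "(\<integral>\<^sup>+x. ennreal (norm (cell_expect L N F x - f x)) \<partial>lebesgue) =
    abs_int ?Q (\<lambda>x. cell_expect L N F x - f x)"
   by (intro nn_integral_cong) (auto simp: f_def cell_expect_out indicator_def)
  also have "\<dots> = (\<Sum>j\<in>cell_index N. (abs_int (cell L N j) (\<lambda>x. cell_expect L N F x - f x)))"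
  proof (rule nn_integral_cells)
   have [measurable]: "cell_expect L N F \<in> bmeas"
    using cell_expect_integrable[OF L, of N F] by simp
   show "(\<lambda>x. ennreal (norm (cell_expect L N F x - f x))) \<in> bmeas" by measurable
  qed
  also have "\<dots> = (\<Sum>j\<in>cell_index N. (abs_int (cell L N j) (\<lambda>x. F x - average (cell L N j) F)))"
  proof (intro sum.cong refl nn_integral_cong)
   fix j x assume j: "j \<in> (cell_index N :: ('n \<Rightarrow> int) set)"
   show "ennreal (norm (cell_expect L N F x - f x)) * indicator (cell L N j) x =
    ennreal (norm (F x - average (cell L N j) F)) * indicator (cell L N j) x"
    using cell_expect_in[OF _ j, of x L F] cell_sub_root[OF j, of L]
    by (cases "x \<in> cell L N j") (auto simp: f_def norm_minus_commute)
  qed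
  also have "\<dots> \<le> (\<Sum>j\<in>cell_index N. 2 * (\<integral>\<^sup>+x. (ennreal (norm (\<phi> x - f x)) + ennreal e') * indicator (cell L N j) x \<partial>lebesgue))"
   by (intro sum_mono cl)
  also have "\<dots> = 2 * (\<integral>\<^sup>+x. (ennreal (norm (\<phi> x - f x)) + ennreal e') * indicator ?Q x \<partial>lebesgue)"
   by (subst nn_integral_cells[where N=N]) (simp_all add: sum_distrib_left)
  also have "\<dots> \<le> 2 * (ennreal (LINT x|lebesgue. norm (\<phi> x - f x)) + ennreal (e' * V))"
  proof (rule mult_left_mono)
   have "(\<integral>\<^sup>+x. (ennreal (norm (\<phi> x - f x)) + ennreal e') * indicator ?Q x \<partial>lebesgue) \<le>
    (\<integral>\<^sup>+x. ennreal (norm (\<phi> x - f x)) + ennreal e' * indicator ?Q x \<partial>lebesgue)"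
    by (intro nn_integral_mono) (auto simp: indicator_def)
   also have "\<dots> = (\<integral>\<^sup>+x. ennreal (norm (\<phi> x - f x)) \<partial>lebesgue) + ennreal e' * vol ?Q"
    by (subst nn_integral_add) (auto simp: nn_integral_cmult_indicator)
   also have "ennreal e' * vol ?Q = ennreal (e' * V)"
    using e' L unfolding emeasure_cell[OF L] by (simp add: V_def ennreal_mult)
   also have "(\<integral>\<^sup>+x. ennreal (norm (\<phi> x - f x)) \<partial>lebesgue) = ennreal (LINT x|lebesgue. norm (\<phi> x - f x))"
    using \<phi>(2) by (intro nn_integral_eq_integral) auto
   finally show "(\<integral>\<^sup>+x. (ennreal (norm (\<phi> x - f x)) + ennreal e') * indicator ?Q x \<partial>lebesgue) \<le>
    ennreal (LINT x|lebesgue. norm (\<phi> x - f x)) + ennreal (e' * V)" .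
  qed simp
  also have "\<dots> = ennreal (2 * ((LINT x|lebesgue. norm (\<phi> x - f x)) + e' * V))"
   using e' V by (subst ennreal_mult) (auto simp: ennreal_plus)
  also have "\<dots> \<le> ennreal (e / 2)"
   using \<phi>(3) V e by (intro ennreal_leI) (simp add: e'_def)
  finally have "(\<integral>\<^sup>+x. ennreal (norm (cell_expect L N F x - f x)) \<partial>lebesgue) \<le> ennreal (e / 2)" .
  moreover have "integrable lebesgue (\<lambda>x. norm (cell_expect L N F x - f x))"
   using cell_expect_integrable[OF L, of N F] fi by (intro integrable_norm Bochner_Integration.integrable_diff)
  ultimately have "(LINT x|lebesgue. norm (cell_expect L N F x - f x)) \<le> e / 2"
   using e by (subst (asm) nn_integral_eq_integral) auto
  then show "norm ((LINT x|lebesgue. norm (cell_expect L N F x - indicator ?Q x *\<^sub>R F x)) - 0) < e"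
   using e by (simp add: f_def)
 qed
qed

lemma nn_fatou_bound:
 fixes g :: "'a \<Rightarrow> ennreal"
 assumes "\<And>n::nat. f n \<in> borel_measurable M" "AE x in M. (\<lambda>n. f n x) \<longlonglongrightarrow> g x"
  and "\<And>n. (\<integral>\<^sup>+x. f n x \<partial>M) \<le> C"
 shows "(\<integral>\<^sup>+x. g x \<partial>M) \<le> C"
proof -
 have "(\<integral>\<^sup>+x. g x \<partial>M) = (\<integral>\<^sup>+x. liminf (\<lambda>n. f n x) \<partial>M)"
  by (rule nn_integral_cong_AE, use assms(2) in eventually_elim) (simp add: lim_imp_Liminf)
 also have "\<dots> \<le> liminf (\<lambda>n. \<integral>\<^sup>+x. f n x \<partial>M)" using assms(1) by (rule nn_integral_liminf)
 also have "\<dots> \<le> C" using assms(3) by (intro Liminf_le) auto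
 finally show ?thesis .
qed

lemma powr_norm_tendsto:
 "0 < r \<Longrightarrow> (\<lambda>n. z n) \<longlonglongrightarrow> z0 \<Longrightarrow> (\<lambda>n. ennreal (norm (z n) powr r)) \<longlonglongrightarrow> ennreal (norm (z0::complex) powr r)"
 by (intro tendsto_ennrealI tendsto_powr' tendsto_norm tendsto_const) auto

locale Ainf_weight =
 fixes u :: "real^'n::finite \<Rightarrow> real" and \<eta> :: real
 assumes um [measurable]: "u \<in> bmeas" and u0: "0 \<le> u x"
  and ufin: "emeasure (wmeas u) (cb x R) < \<infinity>" and \<eta>: "0 \<le> \<eta>" "\<eta> < 1"
  and ainf: "0 < R \<Longrightarrow> E \<in> sets lebesgue \<Longrightarrow> E \<subseteq> cb x R \<Longrightarrow>
   2 * vol E \<le> vol (cb x R) \<Longrightarrow>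
   emeasure (wmeas u) E \<le> ennreal \<eta> * emeasure (wmeas u) (cb x R)"
begin

abbreviation "U \<equiv> wmeas u"

text \<open>The constant of \<open>M_strong\<close> with H = 2^n, the ratio of the volumes of a
  parent and its cell in dimension n.\<close>

definition fs_const :: "real \<Rightarrow> real" where
 "fs_const r = (let b = (2 / (1 + \<eta>)) powr (1 / r) in
   (1 + \<eta>) / (1 - \<eta>) * (b * (2 * 2 ^ CARD('n) / (b - 1))) powr r)"

lemma AE_U: "AE x in lebesgue. P x \<Longrightarrow> AE x in U. P x"
 by (subst AE_density) auto

text \<open>In every generation the cell means lie below the maximal function of a finite family,
  with a bound independent of the generation. L1 convergence gives an almost everywhere convergent
  subsequence, and Fatou's lemma transfers the bound to h.\<close>

lemma FS_root:
 fixes h :: "'n cfun"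
 assumes L: "0 < L" and r: "0 < r" and h: "integrable lebesgue h" and S [measurable]: "S \<in> bmeas"
  and osc: "\<And>k j x. x \<in> cell L k j \<Longrightarrow>
   abs_int (cell L k j) (\<lambda>y. h y - average (cell L k j) h) \<le> S x * vol (cell L k j)"
 shows "(\<integral>\<^sup>+x. ennreal (norm (h x - average (root_cell L) h) powr r) * indicator (root_cell L) x \<partial>U) \<le>
  ennreal (fs_const r) * (\<integral>\<^sup>+x. epowr (S x) r \<partial>U)"
proof -
 let ?Q = "root_cell L"
 define c where "c = average ?Q h"
 \<comment> \<open>\<open>laminar_family\<close> asks for mean zero over the root, which prevents
   the root itself from being selected.\<close>
 define F where "F y = indicator ?Q y *\<^sub>R (h y - c)" for y
 have sq: "set_integrable lebesgue q h" if "q \<in> sets lebesgue" for q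
  unfolding set_integrable_def using h that by (intro integrable_mult_indicator) auto
 have av: "average q F = average q h - c" "set_integrable lebesgue q F" if q: "q \<in> cells L N" for q N
 proof -
  note qp = cells_props[OF L q]
  have e: "indicator q x *\<^sub>R F x = indicator q x *\<^sub>R (h x - c)" for x
   by (cases "x \<in> q") (use qp(4) in \<open>auto simp: F_def\<close>)
  have "average q F = average q (\<lambda>y. h y - c)"
   unfolding average_def set_lebesgue_integral_def e ..
  also have "\<dots> = average q h - c" by (rule average_diff_const(1)[OF qp(1-3) sq[OF qp(1)]])
  finally show "average q F = average q h - c" .
  have "set_integrable lebesgue q (\<lambda>y. h y - c)" by (rule average_diff_const(2)[OF qp(1-3) sq[OF qp(1)]])
  then show "set_integrable lebesgue q F"
   unfolding set_integrable_def e .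
 qed
 have Q: "?Q \<in> cells L N" for N by (auto simp: cells_def cell_index_0 intro!: bexI[of _ 0])
 have QF: "indicator ?Q x *\<^sub>R F x = F x" for x by (simp add: F_def indicator_def)
 have F: "integrable lebesgue F"
  using av(2)[OF Q[of 0]] unfolding set_integrable_def QF .
 have UE: "emeasure U (cell L k j) = emeasure U (cb (center L k j) (L / 2 ^ k))" for k j
  by (intro emeasure_eq_AE AE_U AE_cell L) auto
 have b: "pow_int U r (cell_expect L N F) \<le> ennreal (fs_const r) * (\<integral>\<^sup>+x. epowr (S x) r \<partial>U)" for N
 proof -
  interpret laminar_family "cells L N" ?Q "2 ^ CARD('n)" F U \<eta>
  proof (rule laminar_family.intro)
   show "average ?Q F = 0" using av(1)[OF Q[of 0]] by (simp add: c_def)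
   show "emeasure U ?Q < \<infinity>" unfolding UE by (rule ufin)
   show "emeasure U E \<le> ennreal \<eta> * emeasure U q"
    if q: "q \<in> cells L N" and E: "E \<in> sets lebesgue" "E \<subseteq> q" "2 * vol E \<le> vol q" for q E
   proof -
    obtain k j where kj: "q = cell L k j" using cells_props(5)[OF L q] by blast
    have "vol q = vol (cb (center L k j) (L / 2 ^ k))"
     unfolding kj by (intro emeasure_eq_AE AE_cell L) auto
    then show ?thesis unfolding kj UE using E L cell_cb(1)[OF L, of k j]
     by (intro ainf) (auto simp: kj)
   qed
   show "finite (cells L N :: (real^'n) set set)" by (rule finite_cells)
   show "?Q \<in> cells L N" by (rule Q)
   show "q \<subseteq> ?Q" "q \<in> sets lebesgue" "0 < measure lebesgue q" "vol q < \<infinity>"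
    if "q \<in> cells L N" for q :: "(real^'n) set"
    using cells_props[OF L that] by blast+
   show "q \<subseteq> q' \<or> q' \<subseteq> q \<or> q \<inter> q' = {}" if "q \<in> cells L N" "q' \<in> cells L N" for q q' :: "(real^'n) set"
    by (rule cells_laminar[OF that])
   show "\<exists>P\<in>cells L N. q \<subset> P \<and> vol P \<le> ennreal (2 ^ CARD('n)) * vol q"
    if "q \<in> cells L N" "q \<noteq> ?Q" for q :: "(real^'n) set"
    by (rule cells_parent[OF L that])
   show "set_integrable lebesgue q F" if "q \<in> cells L N" for q :: "(real^'n) set" by (rule av(2)[OF that])
   show "0 < (2::real) ^ CARD('n)" by simp
   show "sets U = sets lebesgue" by simp
   show "0 \<le> \<eta>" "\<eta> < 1" by (rule \<eta>)+
  qed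
  have "pow_int U r (cell_expect L N F) \<le> (\<integral>\<^sup>+x. epowr (M x) r \<partial>U)"
  proof (rule nn_integral_mono)
   fix x
   have "ennreal (norm (cell_expect L N F x)) \<le> M x"
   proof (cases "x \<in> ?Q")
    case True
    then obtain j where j: "j \<in> cell_index N" "x \<in> cell L N j" using cell_cover by blast
    then have "cell L N j \<in> cells L N" by (auto simp: cells_def)
    then show ?thesis unfolding M_def using j by (intro SUP_upper2[of "cell L N j"]) (auto simp: cell_expect_in)
   qed (simp add: cell_expect_out)
   then have "epowr (ennreal (norm (cell_expect L N F x))) r \<le> epowr (M x) r" by (rule epowr_mono[OF r])
   then show "ennreal (norm (cell_expect L N F x) powr r) \<le> epowr (M x) r" using r by (simp add: epowr_ennreal)
  qed
  also have "\<dots> \<le> ennreal (fs_const r) * (\<integral>\<^sup>+x. epowr (S x * indicator ?Q x) r \<partial>U)"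
   unfolding fs_const_def Let_def
  proof (rule M_strong[OF sigma_finite_wmeas[OF um] r S])
   fix q :: "(real^'n) set" and x assume q: "q \<in> cells L N" and x: "x \<in> q"
   obtain k j where kj: "q = cell L k j" using cells_props(5)[OF L q] by blast
   have "abs_int q (\<lambda>y. F y - average q F) =
    abs_int q (\<lambda>y. h y - average q h)"
    using cells_props(4)[OF L q] by (intro nn_integral_cong) (auto simp: av(1)[OF q] F_def indicator_def)
   also have "\<dots> \<le> S x * vol q" using x unfolding kj by (rule osc)
   finally show "abs_int q (\<lambda>y. F y - average q F) \<le> S x * vol q" .
  qed
  also have "\<dots> \<le> ennreal (fs_const r) * (\<integral>\<^sup>+x. epowr (S x) r \<partial>U)"
   using r by (intro mult_left_mono nn_integral_mono epowr_mono) (auto simp: indicator_def)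
  finally show ?thesis .
 qed
 have "\<exists>s. strict_mono s \<and> (AE x in lebesgue. (\<lambda>n. cell_expect L (s n) F x - indicator ?Q x *\<^sub>R F x) \<longlonglongrightarrow> 0)"
 proof (rule tendsto_L1_AE_subseq)
  show "integrable lebesgue (\<lambda>x. cell_expect L N F x - indicator ?Q x *\<^sub>R F x)" for N
   using cell_expect_integrable[OF L, of N F] F by (intro Bochner_Integration.integrable_diff integrable_mult_indicator) auto
 qed (rule cell_expect_tendsto[OF L F])
 then obtain s where s: "AE x in lebesgue. (\<lambda>n. cell_expect L (s n) F x - indicator ?Q x *\<^sub>R F x) \<longlonglongrightarrow> 0" by blast
 have "pow_int U r F \<le> ennreal (fs_const r) * (\<integral>\<^sup>+x. epowr (S x) r \<partial>U)"
 proof (rule nn_fatou_bound)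
  show "pow_int U r (\<lambda>x. cell_expect L (s n) F x) \<le> ennreal (fs_const r) * (\<integral>\<^sup>+x. epowr (S x) r \<partial>U)" for n
   by (rule b)
  show "(\<lambda>x. ennreal (norm (cell_expect L (s n) F x) powr r)) \<in> borel_measurable U" for n
  proof -
   have [measurable]: "cell_expect L (s n) F \<in> bmeas" using cell_expect_integrable[OF L, of "s n" F] by simp
   show ?thesis by measurable
  qed
  have "AE x in lebesgue. (\<lambda>n. ennreal (norm (cell_expect L (s n) F x) powr r)) \<longlonglongrightarrow> ennreal (norm (F x) powr r)"
   using s
  proof eventually_elim
   case (elim x)
   then have "(\<lambda>n. cell_expect L (s n) F x) \<longlonglongrightarrow> indicator ?Q x *\<^sub>R F x" by (simp add: LIM_zero_iff)
   then have "(\<lambda>n. cell_expect L (s n) F x) \<longlonglongrightarrow> F x" by (simp only: QF)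
   then show ?case by (rule powr_norm_tendsto[OF r])
  qed
  then show "AE x in U. (\<lambda>n. ennreal (norm (cell_expect L (s n) F x) powr r)) \<longlonglongrightarrow> ennreal (norm (F x) powr r)"
   by (rule AE_U)
 qed
 also have "pow_int U r F =
   (\<integral>\<^sup>+x. ennreal (norm (h x - average ?Q h) powr r) * indicator ?Q x \<partial>U)"
  by (intro nn_integral_cong) (auto simp: F_def c_def indicator_def)
 finally show ?thesis .
qed

text \<open>The root cells exhaust the space and the means of the integrable h over them tend to
  zero, so Fatou's lemma removes the constant left by \<open>FS_root\<close>. The factor 2 in the
  hypothesis pays for replacing \<kappa> by the mean.\<close>

theorem fefferman_stein:
 fixes h :: "'n cfun"
 assumes r: "0 < r" and h: "integrable lebesgue h" and S [measurable]: "S \<in> bmeas"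
  and osc: "\<And>m. 0 < snd m \<Longrightarrow> \<exists>\<kappa>. \<forall>x\<in>rcube m.
   2 * abs_int (rcube m) (\<lambda>y. h y - \<kappa>) \<le> S x * vol (rcube m)"
 shows "pow_int U r h \<le> ennreal (fs_const r) * (\<integral>\<^sup>+x. epowr (S x) r \<partial>U)"
proof -
 have [measurable]: "h \<in> bmeas" using h by simp
 define L where "L n = real (Suc n)" for n
 have L: "0 < L n" for n by (simp add: L_def)
 let ?f = "\<lambda>n x. ennreal (norm (h x - average (root_cell (L n)) h) powr r) * indicator (root_cell (L n)) x"
 have sq: "set_integrable lebesgue q h" if "q \<in> sets lebesgue" for q
  unfolding set_integrable_def using h that by (intro integrable_mult_indicator) auto
 show ?thesis
 proof (rule nn_fatou_bound)
  show "?f n \<in> borel_measurable U" for n by measurable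
  show "(\<integral>\<^sup>+x. ?f n x \<partial>U) \<le> ennreal (fs_const r) * (\<integral>\<^sup>+x. epowr (S x) r \<partial>U)" for n
  proof (rule FS_root[OF L r h S])
   fix k x and j :: "'n \<Rightarrow> int" assume x: "x \<in> cell (L n) k j"
   let ?q = "cell (L n) k j"
   \<comment> \<open>Integer half-sides keep the centres and radii of all cells rational, so the
     closed cube of a cell is among the cubes of the hypothesis.\<close>
   define m :: "('n \<Rightarrow> rat) \<times> rat" where "m = ((\<lambda>i. (2 * of_int (j i) + 1) * of_nat (Suc n) / 2 ^ k - of_nat (Suc n) :: rat), of_nat (Suc n) / 2 ^ k :: rat)"
   have m: "rcube m = cb (center (L n) k j) (L n / 2 ^ k)" "0 < snd m"
    by (simp_all add: m_def center_def L_def of_rat_add of_rat_diff of_rat_mult of_rat_divide of_rat_power del: of_nat_Suc)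
   obtain \<kappa> where \<kappa>: "\<And>x. x \<in> rcube m \<Longrightarrow>
     2 * abs_int (rcube m) (\<lambda>y. h y - \<kappa>) \<le> S x * vol (rcube m)"
    using osc[OF m(2)] by blast
   have q: "vol ?q < \<infinity>" "0 < measure lebesgue ?q"
    using L[of n] by (simp_all add: emeasure_cell measure_def)
   have "abs_int ?q (\<lambda>y. h y - average ?q h) \<le>
    2 * abs_int ?q (\<lambda>y. h y - \<kappa>)"
    by (rule average_osc_le[OF sets_cell q sq[OF sets_cell]])
   also have "\<dots> \<le> 2 * abs_int (rcube m) (\<lambda>y. h y - \<kappa>)"
    using cell_cb(1)[OF L, of n k j] unfolding m by (intro mult_left_mono nn_integral_mono) (auto simp: indicator_def)
   also have "\<dots> \<le> S x * vol (rcube m)" using x cell_cb(1)[OF L, of n k j] unfolding m(1)[symmetric] by (intro \<kappa>) auto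
   also have "vol (rcube m) = vol ?q"
    unfolding m using AE_cell[OF L, of n k j] by (intro emeasure_eq_AE) auto
   finally show "abs_int ?q (\<lambda>y. h y - average ?q h) \<le> S x * vol ?q" .
  qed
  have a0: "(\<lambda>n. average (root_cell (L n)) h) \<longlonglongrightarrow> 0"
  proof (rule Lim_null_comparison)
   let ?I = "LINT y|lebesgue. norm (h y)"
   have "norm (average (root_cell (L n)) h) \<le> ?I * inverse (real (Suc n))" for n
   proof -
    have "norm (LINT y:root_cell (L n)|lebesgue. h y) \<le> (LINT y:root_cell (L n)|lebesgue. norm (h y))"
     by (rule set_integral_norm_bound[OF sq]) simp
    also have "\<dots> \<le> ?I"
     unfolding set_lebesgue_integral_def using h
     by (intro integral_mono integrable_mult_indicator integrable_norm) (auto simp: indicator_def)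
    finally have 1: "norm (LINT y:root_cell (L n)|lebesgue. h y) \<le> ?I" .
    have "measure lebesgue (root_cell (L n) :: (real^'n) set) = (2 * L n) ^ CARD('n)"
     using L[of n] by (simp add: measure_def emeasure_cell)
    \<comment> \<open>As 2 L n and the dimension are both at least 1, the volume grows at least
      linearly in n.\<close>
    moreover have "L n \<le> (2 * L n) ^ CARD('n)"
    proof -
     have "L n \<le> (2 * L n) ^ 1" using L[of n] by simp
     also have "\<dots> \<le> (2 * L n) ^ CARD('n)" by (intro power_increasing) (auto simp: L_def Suc_le_eq)
     finally show ?thesis .
    qed
    ultimately have "real (Suc n) \<le> measure lebesgue (root_cell (L n) :: (real^'n) set)" by (simp add: L_def)
    then have "inverse (measure lebesgue (root_cell (L n) :: (real^'n) set)) \<le> inverse (real (Suc n))" by (intro le_imp_inverse_le) auto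
    then have "inverse (measure lebesgue (root_cell (L n) :: (real^'n) set)) * norm (LINT y:root_cell (L n)|lebesgue. h y) \<le> inverse (real (Suc n)) * ?I"
     using 1 by (intro mult_mono) auto
    then show ?thesis by (simp add: average_def mult.commute)
   qed
   then show "eventually (\<lambda>n. norm (average (root_cell (L n)) h) \<le> ?I * inverse (real (Suc n))) sequentially" by simp
   have "(\<lambda>n. ?I * inverse (real (Suc n))) \<longlonglongrightarrow> ?I * 0" by (intro tendsto_intros LIMSEQ_inverse_real_of_nat)
   then show "(\<lambda>n. ?I * inverse (real (Suc n))) \<longlonglongrightarrow> 0" by simp
  qed
  show "AE x in U. (\<lambda>n. ?f n x) \<longlonglongrightarrow> ennreal (norm (h x) powr r)"
  proof (rule AE_I2)
   fix x
   have "(\<lambda>n. h x - average (root_cell (L n)) h) \<longlonglongrightarrow> h x - 0" by (intro tendsto_intros a0)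
   then have "(\<lambda>n. ennreal (norm (h x - average (root_cell (L n)) h) powr r)) \<longlonglongrightarrow> ennreal (norm (h x) powr r)"
    by (intro powr_norm_tendsto r) simp
   moreover have "eventually (\<lambda>n. ennreal (norm (h x - average (root_cell (L n)) h) powr r) = ?f n x) sequentially"
   proof -
    obtain R where R: "R > 0" "x \<in> cb 0 R" using bounded_subset_cb[where S="{x}" and x=0] by auto
    obtain n0 :: nat where n0: "R \<le> real n0" using real_arch_simple by blast
    have "x \<in> root_cell (L n)" if "n \<ge> n0" for n
    proof -
     have "\<bar>x $ i\<bar> < L n" for i
     proof -
      have "\<bar>x $ i\<bar> \<le> R" using R(2) by (auto simp: mem_cb)
      moreover have "real n0 \<le> real n" using that by simp
      ultimately show ?thesis using n0 unfolding L_def of_nat_Suc by linarith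
     qed
     then have "x \<in> interior (cb (center (L n) 0 (\<lambda>_. 0)) (L n / 2 ^ 0))" by (auto simp: interior_cb center_def)
     then show ?thesis using cell_cb(2)[OF L, of n 0 "\<lambda>_. 0"] by blast
    qed
    then show ?thesis by (intro eventually_sequentiallyI[of n0]) simp
   qed
   ultimately show "(\<lambda>n. ?f n x) \<longlonglongrightarrow> ennreal (norm (h x) powr r)" by (rule Lim_transform_eventually)
  qed
 qed
qed

end

subsection \<open>Square integrable functions\<close>

definition L2 :: "'n::finite cfun set" where
 "L2 = {f \<in> bmeas. integrable lebesgue (\<lambda>x. (norm (f x))\<^sup>2)}"

definition n2 :: "'n::finite cfun \<Rightarrow> real" where
 "n2 f = sqrt (LINT x|lebesgue. (norm (f x))\<^sup>2)"

lemma n2_nonneg [simp]: "0 \<le> n2 f"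
 by (simp add: n2_def)

lemma n2_square: "(n2 f)\<^sup>2 = (LINT x|lebesgue. (norm (f x))\<^sup>2)"
 by (simp add: n2_def)

lemma L2_lincomb:
 assumes "f \<in> L2" "g \<in> L2" shows "(\<lambda>x. a * f x + b * g x) \<in> L2"
proof -
 have [measurable]: "f \<in> bmeas" "g \<in> bmeas" using assms by (auto simp: L2_def)
 have i: "integrable lebesgue (\<lambda>x. 2 ^ 2 * ((norm a)\<^sup>2 * (norm (f x))\<^sup>2 + (norm b)\<^sup>2 * (norm (g x))\<^sup>2))"
  using assms by (auto simp: L2_def)
 have "integrable lebesgue (\<lambda>x. (norm (a * f x + b * g x))\<^sup>2)"
 proof (rule Bochner_Integration.integrable_bound[OF i])
  show "AE x in lebesgue. norm ((norm (a * f x + b * g x))\<^sup>2) \<le> norm (2 ^ 2 * ((norm a)\<^sup>2 * (norm (f x))\<^sup>2 + (norm b)\<^sup>2 * (norm (g x))\<^sup>2))"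
  proof (intro AE_I2)
   fix x
   have "(norm (a * f x + b * g x))\<^sup>2 \<le> (norm (a * f x) + norm (b * g x))\<^sup>2"
    by (intro power_mono norm_triangle_ineq) auto
   also have "\<dots> \<le> 2 ^ 2 * ((norm (a * f x))\<^sup>2 + (norm (b * g x))\<^sup>2)" by (rule power_add_le) auto
   also have "\<dots> = 2 ^ 2 * ((norm a)\<^sup>2 * (norm (f x))\<^sup>2 + (norm b)\<^sup>2 * (norm (g x))\<^sup>2)"
    by (simp add: norm_mult power_mult_distrib)
   finally show "norm ((norm (a * f x + b * g x))\<^sup>2) \<le> norm (2 ^ 2 * ((norm a)\<^sup>2 * (norm (f x))\<^sup>2 + (norm b)\<^sup>2 * (norm (g x))\<^sup>2))"
    by simp
  qed
 qed measurable
 then show ?thesis by (simp add: L2_def)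
qed

lemma L2_diff: "f \<in> L2 \<Longrightarrow> g \<in> L2 \<Longrightarrow> (\<lambda>x. f x - g x) \<in> L2"
 using L2_lincomb[of f g 1 "-1"] by simp

lemma L2_indicator:
 assumes "f \<in> L2" "E \<in> sets lebesgue" shows "(\<lambda>x. indicator E x *\<^sub>R f x) \<in> L2"
proof -
 have "(\<lambda>x. (norm (indicator E x *\<^sub>R f x))\<^sup>2) = (\<lambda>x. indicator E x *\<^sub>R (norm (f x))\<^sup>2)"
  by (auto simp: indicator_def)
 moreover have "integrable lebesgue (\<lambda>x. indicator E x *\<^sub>R (norm (f x))\<^sup>2)"
  using assms by (intro integrable_mult_indicator) (auto simp: L2_def)
 moreover have "(\<lambda>x. indicator E x *\<^sub>R f x) \<in> bmeas"
  using assms by (auto simp: L2_def)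
 ultimately show ?thesis unfolding L2_def mem_Collect_eq by (simp only:)
qed

lemma n2_indicator:
 assumes "f \<in> L2" "E \<in> sets lebesgue"
 shows "ennreal ((n2 (\<lambda>x. indicator E x *\<^sub>R f x))\<^sup>2) = sq_int E f"
proof -
 have "ennreal ((n2 (\<lambda>x. indicator E x *\<^sub>R f x))\<^sup>2) = (\<integral>\<^sup>+x. ennreal ((norm (indicator E x *\<^sub>R f x))\<^sup>2) \<partial>lebesgue)"
  unfolding n2_square using L2_indicator[OF assms] by (intro nn_integral_eq_integral[symmetric]) (auto simp: L2_def)
 also have "\<dots> = sq_int E f"
  by (intro nn_integral_cong) (auto simp: indicator_def)
 finally show ?thesis .
qed

lemma ennreal_power2_le_imp_le: "a\<^sup>2 \<le> (b::ennreal)\<^sup>2 \<Longrightarrow> a \<le> b"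
proof -
 assume le: "a\<^sup>2 \<le> b\<^sup>2"
 show "a \<le> b"
 proof (cases b)
  case (real s)
  show ?thesis
  proof (cases a)
   case (real r)
   then have "ennreal (r\<^sup>2) \<le> ennreal (s\<^sup>2)" using le \<open>b = ennreal s\<close> \<open>0 \<le> s\<close> by (simp add: ennreal_power)
   then have "r\<^sup>2 \<le> s\<^sup>2" by simp
   then have "r \<le> s" by (rule power2_le_imp_le) fact
   then show ?thesis using real \<open>b = ennreal s\<close> by (simp add: ennreal_leI)
  next
   case top
   then show ?thesis using le real by (simp add: power2_eq_square ennreal_mult[symmetric] top_unique)
  qed
 qed simp
qed

lemma L2_bounded_support_integrable:
 assumes f: "f \<in> L2" and E: "E \<in> sets lebesgue" "vol E < \<infinity>"
 shows "set_integrable lebesgue E f"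
  and "(LINT x:E|lebesgue. norm (f x)) \<le> sqrt (measure lebesgue E) * n2 (\<lambda>x. indicator E x *\<^sub>R f x)"
proof -
 have [measurable]: "f \<in> bmeas" "E \<in> sets lebesgue" using f E by (auto simp: L2_def)
 let ?f = "\<lambda>x. indicator E x *\<^sub>R f x"
 have "(abs_int E ?f)\<^sup>2 \<le>
  (\<integral>\<^sup>+x. (ennreal (norm (?f x)))\<^sup>2 \<partial>lebesgue) * (\<integral>\<^sup>+x. (indicator E x)\<^sup>2 \<partial>lebesgue)"
  by (rule Cauchy_Schwarz_nn_integral) measurable
 also have "(\<integral>\<^sup>+x. (indicator E x :: ennreal)\<^sup>2 \<partial>lebesgue) = vol E"
 proof -
  have "(\<integral>\<^sup>+x. (indicator E x :: ennreal)\<^sup>2 \<partial>lebesgue) = (\<integral>\<^sup>+x. indicator E x \<partial>lebesgue)"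
   by (intro nn_integral_cong) (auto simp: indicator_def)
  then show ?thesis using E(1) by simp
 qed
 also have "(\<integral>\<^sup>+x. (ennreal (norm (?f x)))\<^sup>2 \<partial>lebesgue) = ennreal ((n2 ?f)\<^sup>2)"
  unfolding n2_indicator[OF f E(1)] by (intro nn_integral_cong) (auto simp: indicator_def ennreal_power)
 also have "vol E = ennreal (measure lebesgue E)" using E by (simp add: emeasure_eq_ennreal_measure)
 also have "ennreal ((n2 ?f)\<^sup>2) * ennreal (measure lebesgue E) = (ennreal (sqrt (measure lebesgue E) * n2 ?f))\<^sup>2"
  by (simp add: ennreal_mult[symmetric] ennreal_power power_mult_distrib mult.commute)
 finally have "(abs_int E ?f)\<^sup>2 \<le> (ennreal (sqrt (measure lebesgue E) * n2 ?f))\<^sup>2" .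
 then have le: "abs_int E ?f \<le> ennreal (sqrt (measure lebesgue E) * n2 ?f)"
  by (rule ennreal_power2_le_imp_le)
 also have "abs_int E ?f = (\<integral>\<^sup>+x. ennreal (norm (?f x)) \<partial>lebesgue)"
  by (intro nn_integral_cong) (auto simp: indicator_def)
 finally have le: "(\<integral>\<^sup>+x. ennreal (norm (?f x)) \<partial>lebesgue) \<le> ennreal (sqrt (measure lebesgue E) * n2 ?f)" .
 have i: "integrable lebesgue ?f"
  by (rule integrableI_bounded) (use le in \<open>auto intro: le_less_trans\<close>)
 then show "set_integrable lebesgue E f" by (simp add: set_integrable_def)
 have "(LINT x:E|lebesgue. norm (f x)) = (LINT x|lebesgue. norm (?f x))"
  unfolding set_lebesgue_integral_def by (intro Bochner_Integration.integral_cong) auto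
 also have "\<dots> \<le> sqrt (measure lebesgue E) * n2 ?f"
  using le nn_integral_eq_integral[OF integrable_norm[OF i]] by (simp add: ennreal_le_iff)
 finally show "(LINT x:E|lebesgue. norm (f x)) \<le> sqrt (measure lebesgue E) * n2 ?f" .
qed

lemma bounded_integrable_L2:
 assumes [measurable]: "f \<in> bmeas" and "\<And>x. norm (f x) \<le> indicator E x * b" "E \<in> sets lebesgue" "vol E < \<infinity>"
 shows "f \<in> L2"
proof -
 have i: "integrable lebesgue (\<lambda>x. b\<^sup>2 * indicator E x :: real)"
  using assms by (intro integrable_mult_right integrable_real_indicator) auto
 have "integrable lebesgue (\<lambda>x. (norm (f x))\<^sup>2)"
 proof (rule Bochner_Integration.integrable_bound[OF i])
  show "AE x in lebesgue. norm ((norm (f x))\<^sup>2) \<le> norm (b\<^sup>2 * indicator E x :: real)"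
  proof (rule AE_I2)
   fix x
   have "(norm (f x))\<^sup>2 \<le> (indicator E x * b)\<^sup>2" using assms(2)[of x] by (intro power_mono) auto
   then show "norm ((norm (f x))\<^sup>2) \<le> norm (b\<^sup>2 * indicator E x :: real)" by (auto simp: indicator_def)
  qed
 qed measurable
 then show ?thesis by (simp add: L2_def)
qed

lemma test_L2: "\<phi> \<in> test_functions \<Longrightarrow> \<phi> \<in> L2"
proof -
 assume \<phi>: "\<phi> \<in> test_functions"
 then have c: "compact (supp \<phi>)" by (simp add: test_functions_def)
 have "compact (\<phi> ` supp \<phi>)" using c test_continuous[OF \<phi>] by (blast intro: compact_continuous_image continuous_on_subset)
 then obtain b where b: "\<And>x. x \<in> supp \<phi> \<Longrightarrow> norm (\<phi> x) \<le> b" using compact_imp_bounded by (force simp: bounded_iff)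
 have s: "supp \<phi> \<in> sets lebesgue" "vol (supp \<phi>) < \<infinity>"
  using fmeasurableD[OF lmeasurable_compact[OF c]] fmeasurableD2[OF lmeasurable_compact[OF c]]
  by (simp_all add: less_top[symmetric])
 show ?thesis
  by (rule bounded_integrable_L2[OF test_measurable[OF \<phi>] _ s, of b]) (use b outside_supp[of _ \<phi>] in \<open>auto simp: indicator_def\<close>)
qed

lemma L2_test_approx:
 fixes f :: "'n::finite cfun"
 assumes V: "open V" "bounded V" and f: "f \<in> L2" "\<And>x. x \<notin> V \<Longrightarrow> f x = 0"
 shows "\<exists>\<phi>. (\<forall>k. \<phi> k \<in> test_functions \<and> supp (\<phi> k) \<subseteq> V) \<and> (\<lambda>k. n2 (\<lambda>x. \<phi> k x - f x)) \<longlonglongrightarrow> 0"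
proof -
 have "\<exists>\<phi>\<in>test_functions. supp \<phi> \<subseteq> V \<and> integrable lebesgue (\<lambda>x. norm (\<phi> x - f x) ^ 2) \<and>
   (LINT x|lebesgue. norm (\<phi> x - f x) ^ 2) < inverse (real (Suc k))" for k
  using f V by (intro test_dense) (auto simp: L2_def)
 then have "\<forall>k. \<exists>\<phi>. \<phi> \<in> test_functions \<and> supp \<phi> \<subseteq> V \<and> (LINT x|lebesgue. norm (\<phi> x - f x) ^ 2) < inverse (real (Suc k))" by blast
 then obtain \<phi> where \<phi>: "\<forall>k. \<phi> k \<in> test_functions \<and> supp (\<phi> k) \<subseteq> V \<and> (LINT x|lebesgue. norm (\<phi> k x - f x) ^ 2) < inverse (real (Suc k))"
  by (rule choice[THEN exE])
 have "(\<lambda>k. LINT x|lebesgue. norm (\<phi> k x - f x) ^ 2) \<longlonglongrightarrow> 0"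
 proof (rule Lim_null_comparison)
  show "eventually (\<lambda>k. norm (LINT x|lebesgue. norm (\<phi> k x - f x) ^ 2) \<le> inverse (real (Suc k))) sequentially"
   using \<phi> by (intro always_eventually allI) (simp add: less_imp_le)
 qed (rule LIMSEQ_inverse_real_of_nat)
 then have "(\<lambda>k. sqrt (LINT x|lebesgue. norm (\<phi> k x - f x) ^ 2)) \<longlonglongrightarrow> sqrt 0" by (rule tendsto_real_sqrt)
 then show ?thesis using \<phi> by (intro exI[of _ \<phi>]) (simp add: n2_def)
qed

lemma lebesgue_measurable_AE:
 fixes f g :: "'a::euclidean_space \<Rightarrow> 'b::topological_space"
 assumes f: "f \<in> bmeas" and ae: "AE x in lebesgue. f x = g x"
 shows "g \<in> bmeas"
proof (rule borel_measurableI)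
 fix S :: "'b set" assume S: "open S"
 have 1: "f -` S \<inter> space lebesgue \<in> sets lebesgue" by (rule measurable_sets[OF f borel_open[OF S]])
 have 2: "AE x in lebesgue. x \<in> f -` S \<inter> space lebesgue \<longleftrightarrow> x \<in> g -` S \<inter> space lebesgue"
  using ae by eventually_elim auto
 show "g -` S \<inter> space lebesgue \<in> sets lebesgue"
  using completion.in_sets_AE[OF 2 1] by simp
qed

text \<open>Lebesgue measure on a product is the completion of the product measure. A Borel version
  agrees with G almost everywhere on almost every slice, and completeness makes these slices
  measurable.\<close>

lemma lebesgue_fubini:
 fixes G :: "'a::euclidean_space \<times> 'b::euclidean_space \<Rightarrow> complex"
 assumes G: "integrable lebesgue G"
 shows "AE x in lebesgue. integrable lebesgue (\<lambda>y. G (x, y))"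
  and "integrable lebesgue (\<lambda>x. LINT y|lebesgue. G (x, y))"
proof -
 have Gm: "G \<in> bmeas" using G by simp
 then have "(\<lambda>x. Re (G x)) \<in> bmeas" "(\<lambda>x. Im (G x)) \<in> bmeas" by simp_all
 then obtain g1 g2 where g: "g1 \<in> borel_measurable lborel" "g2 \<in> borel_measurable lborel"
  "AE x in lborel. Re (G x) = g1 x" "AE x in lborel. Im (G x) = g2 x"
  using completion_ex_borel_measurable_real[of "\<lambda>x. Re (G x)" lborel] completion_ex_borel_measurable_real[of "\<lambda>x. Im (G x)" lborel] by blast
 define G' where "G' x = Complex (g1 x) (g2 x)" for x
 have G'm: "G' \<in> borel_measurable lborel"
 proof -
  have "G' = (\<lambda>x. complex_of_real (g1 x) + \<i> * complex_of_real (g2 x))" by (auto simp: G'_def complex_eq_iff)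
  then show ?thesis using g(1,2) by simp
 qed
 have ae: "AE x in lborel. G x = G' x" using g(3,4) by eventually_elim (simp add: G'_def complex_eq_iff)
 have "integrable lebesgue G'"
  using G AE_completion[OF ae] Gm measurable_completion[OF G'm] by (subst (asm) integrable_cong_AE) auto
 then have G'i: "integrable (lborel \<Otimes>\<^sub>M lborel) G'"
  using integrable_completion[OF G'm] by (simp add: lborel_prod)
 have ae2: "AE x in lborel. AE y in lborel. G (x, y) = G' (x, y)"
  by (rule lborel_pair.AE_pair) (use ae in \<open>subst lborel_prod\<close>)
 have sec: "(\<lambda>y. G' (x, y)) \<in> borel_measurable lborel" for x
  using borel_measurable_integrable[OF G'i] by measurable
 have main: "AE x in lborel. integrable lebesgue (\<lambda>y. G (x, y)) \<and> (LINT y|lborel. G' (x, y)) = (LINT y|lebesgue. G (x, y))"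
  using ae2 lborel_pair.AE_integrable_fst'[OF G'i]
 proof eventually_elim
  case (elim x)
  have a: "AE y in lebesgue. G' (x, y) = G (x, y)" using AE_completion[OF elim(1)] by eventually_elim simp
  have m': "(\<lambda>y. G' (x, y)) \<in> bmeas" by (rule measurable_completion[OF sec])
  have m: "(\<lambda>y. G (x, y)) \<in> bmeas" by (rule lebesgue_measurable_AE[OF m' a])
  have i': "integrable lebesgue (\<lambda>y. G' (x, y))" using elim(2) by (simp add: integrable_completion[OF sec])
  have "integrable lebesgue (\<lambda>y. G (x, y))" using i' by (subst (asm) integrable_cong_AE[OF m' m a])
  moreover have "(LINT y|lebesgue. G (x, y)) = (LINT y|lebesgue. G' (x, y))" using integral_cong_AE[OF m' m a] by simp
  ultimately show ?case by (simp add: integral_completion[OF sec])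
 qed
 then show "AE x in lebesgue. integrable lebesgue (\<lambda>y. G (x, y))" by (intro AE_completion) (auto elim: eventually_mono)
 let ?H = "\<lambda>x. LINT y|lborel. G' (x, y)"
 have Hi: "integrable lborel ?H" by (rule lborel_pair.integrable_fst'[OF G'i])
 then have Hl: "integrable lebesgue ?H" by (subst integrable_completion) auto
 have a: "AE x in lebesgue. ?H x = (LINT y|lebesgue. G (x, y))" using main by (intro AE_completion) (auto elim: eventually_mono)
 have "(\<lambda>x. LINT y|lebesgue. G (x, y)) \<in> bmeas"
  by (rule lebesgue_measurable_AE[OF _ a]) (use Hl in simp)
 moreover have "?H \<in> bmeas" using Hl by simp
 ultimately show "integrable lebesgue (\<lambda>x. LINT y|lebesgue. G (x, y))"
  using Hl integrable_cong_AE[OF _ _ a] by simp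
qed

lemma n2_tendsto_zero_L1:
 assumes f: "\<And>k. f k \<in> L2" "(\<lambda>k. n2 (f k)) \<longlonglongrightarrow> 0" and E: "E \<in> sets lebesgue" "vol E < \<infinity>"
 shows "(\<lambda>k. LINT x:E|lebesgue. norm (f k x)) \<longlonglongrightarrow> 0"
proof (rule Lim_null_comparison)
 have n: "n2 (\<lambda>x. indicator E x *\<^sub>R f k x) \<le> n2 (f k)" for k
  unfolding n2_def using f(1)[of k] L2_indicator[OF f(1)[of k] E(1)]
  by (intro real_sqrt_le_mono integral_mono) (auto simp: L2_def indicator_def)
 show "eventually (\<lambda>k. norm (LINT x:E|lebesgue. norm (f k x)) \<le> sqrt (measure lebesgue E) * n2 (f k)) sequentially"
 proof (intro always_eventually allI)
  fix k
  have "0 \<le> (LINT x:E|lebesgue. norm (f k x))" unfolding set_lebesgue_integral_def by (intro integral_nonneg_AE) auto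
  then show "norm (LINT x:E|lebesgue. norm (f k x)) \<le> sqrt (measure lebesgue E) * n2 (f k)"
   using L2_bounded_support_integrable(2)[OF f(1) E, of k] mult_left_mono[OF n[of k], of "sqrt (measure lebesgue E)"] by simp
 qed
 have "(\<lambda>k. sqrt (measure lebesgue E) * n2 (f k)) \<longlonglongrightarrow> sqrt (measure lebesgue E) * 0" by (intro tendsto_intros f)
 then show "(\<lambda>k. sqrt (measure lebesgue E) * n2 (f k)) \<longlonglongrightarrow> 0" by simp
qed

subsection \<open>Oscillation estimates for the kernel operator\<close>

text \<open>Selects the dyadic scale at which a condition starts to hold, both for the shells of the
  kernel integral and for the choice of a radius.\<close>

lemma first_success: "Q (N::nat) \<Longrightarrow> \<not> Q 0 \<Longrightarrow> \<exists>k<N. \<not> Q k \<and> Q (Suc k)"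
proof (induct N)
 case (Suc N)
 show ?case
 proof (cases "Q N")
  case True
  then show ?thesis using Suc(1)[OF True Suc(3)] less_SucI by blast
 qed (use Suc(2) in blast)
qed simp

text \<open>\<open>B\<close> is the extension into L1, and one constant \<open>A\<close> serves both
  bounds. The L^(1/\<epsilon>) bound is recorded on test functions, where the two given extensions
  are compared.\<close>

locale kernel_operator =
 fixes B :: "'n::finite cfun \<Rightarrow> 'n cfun \<Rightarrow> 'n cfun"
  and K :: "(real ^ 'n) \<times> (real ^ 'n) \<times> (real ^ 'n) \<Rightarrow> complex" and A \<epsilon> s c C :: real
 assumes A: "0 \<le> A" and \<epsilon>: "0 < \<epsilon>" "\<epsilon> < 1" and s: "0 < s" "s \<le> 1" and c: "0 < c" and C: "0 < C"
  and Bint: "f \<in> L2 \<Longrightarrow> g \<in> L2 \<Longrightarrow> integrable lebesgue (B f g)"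
  and Blin1: "f \<in> L2 \<Longrightarrow> h \<in> L2 \<Longrightarrow> g \<in> L2 \<Longrightarrow> AE x in lebesgue. B (\<lambda>x. a * f x + b * h x) g x = a * B f g x + b * B h g x"
  and Blin2: "f \<in> L2 \<Longrightarrow> h \<in> L2 \<Longrightarrow> g \<in> L2 \<Longrightarrow> AE x in lebesgue. B g (\<lambda>x. a * f x + b * h x) x = a * B g f x + b * B g h x"
  and Bbd: "f \<in> L2 \<Longrightarrow> g \<in> L2 \<Longrightarrow> (LINT x|lebesgue. norm (B f g x)) \<le> A * n2 f * n2 g"
  and Bq: "f \<in> test_functions \<Longrightarrow> g \<in> test_functions \<Longrightarrow>
   pow_int lebesgue (1 / \<epsilon>) (B f g) \<le> ennreal ((A * n2 f * n2 g) powr (1 / \<epsilon>))"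
  and Kint: "locally_integrable_on K (- triple_diagonal)"
  and Bkernel: "f \<in> test_functions \<Longrightarrow> g \<in> test_functions \<Longrightarrow> \<phi> \<in> test_functions \<Longrightarrow>
   supp \<phi> \<inter> (supp f \<inter> supp g) = {} \<Longrightarrow>
   (LINT x|lebesgue. B f g x * \<phi> x) = (LINT x|lebesgue. (LINT (y, z)|lebesgue. K (x, y, z) * f y * g z) * \<phi> x)"
  and Kreg: "(x, y, z) \<notin> triple_diagonal \<Longrightarrow> (x', y, z) \<notin> triple_diagonal \<Longrightarrow>
      norm (x - x') powr \<epsilon> \<le> c * (norm (x - y) + norm (x - z)) \<Longrightarrow>
      norm (K (x, y, z) - K (x', y, z)) \<le>
       C * (norm (x - x') powr s / (norm (x - y) + norm (x - z)) powr (2 * real CARD('n) + s / \<epsilon>))"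
begin

lemma Bm: "f \<in> L2 \<Longrightarrow> g \<in> L2 \<Longrightarrow> B f g \<in> bmeas"
 by (rule borel_measurable_integrable[OF Bint])

lemma Bdiff1: "f \<in> L2 \<Longrightarrow> h \<in> L2 \<Longrightarrow> g \<in> L2 \<Longrightarrow> AE x in lebesgue. B (\<lambda>x. f x - h x) g x = B f g x - B h g x"
 using Blin1[of f h g 1 "-1"] by simp

lemma Bdiff2: "f \<in> L2 \<Longrightarrow> h \<in> L2 \<Longrightarrow> g \<in> L2 \<Longrightarrow> AE x in lebesgue. B g (\<lambda>x. f x - h x) x = B g f x - B g h x"
 using Blin2[of f h g 1 "-1"] by simp

text \<open>Writing each approximant as limit plus error splits the difference into three terms with
  an error in at least one argument, each controlled by the L2 bound.\<close>

lemma B_conv: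
 assumes f: "f \<in> L2" "\<And>k. fk k \<in> L2" "(\<lambda>k. n2 (\<lambda>x. fk k x - f x)) \<longlonglongrightarrow> 0"
  and g: "g \<in> L2" "\<And>k. gk k \<in> L2" "(\<lambda>k. n2 (\<lambda>x. gk k x - g x)) \<longlonglongrightarrow> 0"
 shows "(\<lambda>k. LINT x|lebesgue. norm (B (fk k) (gk k) x - B f g x)) \<longlonglongrightarrow> 0"
proof (rule Lim_null_comparison)
 let ?d = "\<lambda>k x. fk k x - f x" and ?e = "\<lambda>k x. gk k x - g x"
 have L: "?d k \<in> L2" "?e k \<in> L2" for k using f g by (auto intro: L2_diff)
 show "eventually (\<lambda>k. norm (LINT x|lebesgue. norm (B (fk k) (gk k) x - B f g x)) \<le>
  A * n2 (?d k) * n2 (?e k) + A * n2 (?d k) * n2 g + A * n2 f * n2 (?e k)) sequentially"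
 proof (intro always_eventually allI)
  fix k
  have i: "integrable lebesgue (B (?d k) (?e k))" "integrable lebesgue (B (?d k) g)" "integrable lebesgue (B f (?e k))"
   "integrable lebesgue (B (fk k) (gk k))" "integrable lebesgue (B f g)"
   using f g L by (auto intro: Bint)
  have ae: "AE x in lebesgue. norm (B (fk k) (gk k) x - B f g x) \<le>
    norm (B (?d k) (?e k) x) + norm (B (?d k) g x) + norm (B f (?e k) x)"
   using Bdiff1[OF f(2)[of k] f(1) g(2)[of k]] Bdiff2[OF g(2)[of k] g(1) f(1)] Bdiff2[OF g(2)[of k] g(1) L(1)[of k]]
  proof eventually_elim
   case (elim x)
   have "B (fk k) (gk k) x - B f g x = B (?d k) (?e k) x + B (?d k) g x + B f (?e k) x"
    unfolding elim(3) elim(2) elim(1) by simp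
   then show ?case using norm_triangle_ineq[of "B (?d k) (?e k) x + B (?d k) g x" "B f (?e k) x"]
     norm_triangle_ineq[of "B (?d k) (?e k) x" "B (?d k) g x"] by simp
  qed
  have "(LINT x|lebesgue. norm (B (fk k) (gk k) x - B f g x)) \<le>
   (LINT x|lebesgue. norm (B (?d k) (?e k) x) + norm (B (?d k) g x) + norm (B f (?e k) x))"
   using i ae by (intro integral_mono_AE) auto
  also have "\<dots> = (LINT x|lebesgue. norm (B (?d k) (?e k) x)) + (LINT x|lebesgue. norm (B (?d k) g x)) + (LINT x|lebesgue. norm (B f (?e k) x))"
   using i by simp
  also have "\<dots> \<le> A * n2 (?d k) * n2 (?e k) + A * n2 (?d k) * n2 g + A * n2 f * n2 (?e k)"
   using f g L by (intro add_mono Bbd) auto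
  finally show "norm (LINT x|lebesgue. norm (B (fk k) (gk k) x - B f g x)) \<le>
   A * n2 (?d k) * n2 (?e k) + A * n2 (?d k) * n2 g + A * n2 f * n2 (?e k)" by simp
 qed
 have "(\<lambda>k. A * n2 (?d k) * n2 (?e k) + A * n2 (?d k) * n2 g + A * n2 f * n2 (?e k)) \<longlonglongrightarrow> A * 0 * 0 + A * 0 * n2 g + A * n2 f * 0"
  by (intro tendsto_intros f g)
 then show "(\<lambda>k. A * n2 (?d k) * n2 (?e k) + A * n2 (?d k) * n2 g + A * n2 f * n2 (?e k)) \<longlonglongrightarrow> 0" by simp
qed

lemma B_conv_subseq:
 assumes f: "f \<in> L2" "\<And>k. fk k \<in> L2" "(\<lambda>k. n2 (\<lambda>x. fk k x - f x)) \<longlonglongrightarrow> 0"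
  and g: "g \<in> L2" "\<And>k. gk k \<in> L2" "(\<lambda>k. n2 (\<lambda>x. gk k x - g x)) \<longlonglongrightarrow> 0"
 shows "\<exists>r::nat \<Rightarrow> nat. strict_mono r \<and> (AE x in lebesgue. (\<lambda>k. B (fk (r k)) (gk (r k)) x) \<longlonglongrightarrow> B f g x)"
proof -
 have "\<exists>r::nat \<Rightarrow> nat. strict_mono r \<and> (AE x in lebesgue. (\<lambda>k. B (fk (r k)) (gk (r k)) x - B f g x) \<longlonglongrightarrow> 0)"
 proof (rule tendsto_L1_AE_subseq)
  show "integrable lebesgue (\<lambda>x. B (fk k) (gk k) x - B f g x)" for k
   by (intro Bochner_Integration.integrable_diff Bint f g)
 qed (rule B_conv[OF f g])
 then show ?thesis by (simp add: LIM_zero_iff)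
qed

text \<open>The hypothesis keeps the compact product of the cube and both supports off the diagonal,
  so K is integrable there and Fubini applies. The identity of distributions, tested inside the
  cube, becomes one almost everywhere.\<close>

lemma kernel_rep:
 assumes f: "f \<in> test_functions" and g: "g \<in> test_functions"
  and W: "cb x0 l \<inter> supp f \<inter> supp g = {}"
 shows "AE x in lebesgue. x \<in> cb x0 l \<longrightarrow> integrable lebesgue (\<lambda>(y, z). K (x, y, z) * f y * g z) \<and>
   B f g x = (LINT (y, z)|lebesgue. K (x, y, z) * f y * g z)"
proof -
 let ?W = "cb x0 l" and ?V = "interior (cb x0 l)"
 let ?P = "?W \<times> supp f \<times> supp g"
 have cs: "compact (supp f)" "compact (supp g)" using f g by (auto simp: test_functions_def)
 have "compact ?P" using cs by (intro compact_Times) auto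
 moreover have "?P \<subseteq> - triple_diagonal" using W by (auto simp: triple_diagonal_def)
 ultimately have "set_integrable lebesgue ?P K" using Kint by (auto simp: locally_integrable_on_def)
 then have J: "integrable lebesgue (\<lambda>x. indicator ?P x *\<^sub>R K x)" by (simp add: set_integrable_def)
 define G :: "(real^'n) \<times> (real^'n) \<times> (real^'n) \<Rightarrow> complex" where "G w = (indicator ?P w *\<^sub>R K w) * (f (fst (snd w)) * g (snd (snd w)))" for w
 have cf: "continuous_on UNIV f" "continuous_on UNIV g" using f g by (auto intro: test_continuous)
 have bounded_range: "\<exists>b. \<forall>x. norm (h x) \<le> b" if h: "h \<in> test_functions" for h :: "'n cfun"
 proof -
  have "compact (h ` supp h)"
   using h by (intro compact_continuous_image continuous_on_subset[OF test_continuous[OF h]]) (auto simp: test_functions_def)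
  then obtain b where b: "\<forall>y\<in>h ` supp h. norm y \<le> b" using compact_imp_bounded bounded_iff by blast
  have "norm (h x) \<le> max b 0" for x
   using b outside_supp[of x h] by (cases "x \<in> supp h") (auto intro: max.coboundedI1)
  then show ?thesis by blast
 qed
 obtain bf bg where b: "\<forall>x. norm (f x) \<le> bf" "\<forall>x. norm (g x) \<le> bg" using bounded_range[OF f] bounded_range[OF g] by blast
 have "continuous_on UNIV (\<lambda>w::(real^'n) \<times> (real^'n) \<times> (real^'n). f (fst (snd w)) * g (snd (snd w)))"
  by (intro continuous_intros continuous_on_compose2[OF cf(1)] continuous_on_compose2[OF cf(2)]) auto
 then have fgm: "(\<lambda>w::(real^'n) \<times> (real^'n) \<times> (real^'n). f (fst (snd w)) * g (snd (snd w))) \<in> bmeas"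
  by (rule measurable_continuous_lebesgue)
 have G: "integrable lebesgue G"
 proof (rule Bochner_Integration.integrable_bound)
  show "integrable lebesgue (\<lambda>w. (bf * bg) *\<^sub>R (indicator ?P w *\<^sub>R K w))" using J by (rule integrable_scaleR_right)
  show "G \<in> bmeas"
   unfolding G_def[abs_def] by (rule borel_measurable_times[OF borel_measurable_integrable[OF J] fgm])
  show "AE w in lebesgue. norm (G w) \<le> norm ((bf * bg) *\<^sub>R (indicator ?P w *\<^sub>R K w))"
  proof (rule AE_I2)
   fix w :: "(real^'n) \<times> (real^'n) \<times> (real^'n)"
   have "norm (f (fst (snd w)) * g (snd (snd w))) \<le> bf * bg"
    unfolding norm_mult using b by (intro mult_mono) (auto intro: order_trans[OF norm_ge_zero])
   then have "norm (f (fst (snd w)) * g (snd (snd w))) \<le> \<bar>bf * bg\<bar>" by linarith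
   then show "norm (G w) \<le> norm ((bf * bg) *\<^sub>R (indicator ?P w *\<^sub>R K w))"
    unfolding G_def norm_mult norm_scaleR by (subst mult.commute) (intro mult_right_mono, auto)
  qed
 qed
 have Gin: "G (x, y, z) = K (x, y, z) * f y * g z" if x: "x \<in> ?W" for x y z
 proof (cases "y \<in> supp f \<and> z \<in> supp g")
  case False
  then have "f y * g z = 0" using outside_supp by auto
  then show ?thesis by (auto simp: G_def)
 qed (use x in \<open>simp add: G_def\<close>)
 have Gin': "(\<lambda>p. G (x, p)) = (\<lambda>(y, z). K (x, y, z) * f y * g z)" if "x \<in> ?W" for x
  using Gin[OF that] by (auto simp: fun_eq_iff)
 define H where "H x = (LINT p|lebesgue. G (x, p))" for x
 have Hi: "integrable lebesgue H" unfolding H_def[abs_def] by (rule lebesgue_fubini(2)[OF G])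
 have "AE x in lebesgue. x \<in> ?V \<longrightarrow> B f g x - H x = 0"
 proof (rule fundamental_lemma)
  show "open ?V" by simp
  show "bounded ?V" by (rule bounded_subset[OF bounded_cb interior_subset])
  have Bi: "integrable lebesgue (B f g)" using f g by (intro Bint test_L2)
  show "set_integrable lebesgue ?V (\<lambda>x. B f g x - H x)"
   unfolding set_integrable_def using Bi Hi by (intro integrable_mult_indicator Bochner_Integration.integrable_diff) (auto intro: open_lebesgue)
  fix \<phi> :: "'n cfun" assume \<phi>: "\<phi> \<in> test_functions" "supp \<phi> \<subseteq> ?V"
  obtain b\<phi> where b\<phi>: "\<forall>x. norm (\<phi> x) \<le> b\<phi>" using bounded_range[OF \<phi>(1)] by blast
  have pi: "integrable lebesgue (\<lambda>x. h x * \<phi> x)" if h: "integrable lebesgue h" for h :: "'n cfun"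
  proof (rule Bochner_Integration.integrable_bound)
   show "integrable lebesgue (\<lambda>x. b\<phi> *\<^sub>R h x)" using h by (rule integrable_scaleR_right)
   show "(\<lambda>x. h x * \<phi> x) \<in> bmeas" using h test_measurable[OF \<phi>(1)] by (intro borel_measurable_times) auto
   show "AE x in lebesgue. norm (h x * \<phi> x) \<le> norm (b\<phi> *\<^sub>R h x)"
   proof (rule AE_I2)
    fix x
    have "norm (\<phi> x) \<le> \<bar>b\<phi>\<bar>" using b\<phi>[rule_format, of x] by linarith
    then show "norm (h x * \<phi> x) \<le> norm (b\<phi> *\<^sub>R h x)" by (simp add: norm_mult mult.commute mult_right_mono)
   qed
  qed
  have "(LINT x|lebesgue. B f g x * \<phi> x) = (LINT x|lebesgue. (LINT (y, z)|lebesgue. K (x, y, z) * f y * g z) * \<phi> x)"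
   using \<phi> W interior_subset[of ?W] by (intro Bkernel f g) blast+
  also have "\<dots> = (LINT x|lebesgue. H x * \<phi> x)"
  proof (intro Bochner_Integration.integral_cong refl)
   fix x
   show "(LINT (y, z)|lebesgue. K (x, y, z) * f y * g z) * \<phi> x = H x * \<phi> x"
   proof (cases "x \<in> ?W")
    case True
    then show ?thesis by (simp add: H_def Gin')
   next
    case False
    then have "\<phi> x = 0" using \<phi>(2) interior_subset[of ?W] by (intro outside_supp) blast
    then show ?thesis by simp
   qed
  qed
  finally have "(LINT x|lebesgue. B f g x * \<phi> x) = (LINT x|lebesgue. H x * \<phi> x)" .
  then have "(LINT x|lebesgue. B f g x * \<phi> x - H x * \<phi> x) = 0"
   using pi[OF Bi] pi[OF Hi] by simp
  then show "(LINT x|lebesgue. (B f g x - H x) * \<phi> x) = 0" by (simp add: algebra_simps)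
 qed
 then show ?thesis using lebesgue_fubini(1)[OF G] AE_interior_cb[of x0 l]
 proof eventually_elim
  case (elim x)
  show ?case
  proof
   assume x: "x \<in> ?W"
   then have "B f g x = H x" using elim by simp
   then show "integrable lebesgue (\<lambda>(y, z). K (x, y, z) * f y * g z) \<and>
     B f g x = (LINT (y, z)|lebesgue. K (x, y, z) * f y * g z)"
    using elim(2) unfolding H_def Gin'[OF x] by simp
  qed
 qed
qed

text \<open>Bounds the oscillation of \<open>K\<close> on a cube of half-side \<open>l\<close> if \<open>y\<close> or \<open>z\<close> is outside the cube of half-side \<open>2^k * R\<close>.\<close>

definition ck :: "real \<Rightarrow> real \<Rightarrow> nat \<Rightarrow> real" where
 "ck l R k = C * ((2 * real CARD('n) * l) powr s / (2 ^ k * R / 2) powr (2 * real CARD('n) + s / \<epsilon>))"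

lemma ck_nonneg: "0 \<le> ck l R k"
 unfolding ck_def using C by simp

text \<open>Since l is at most R / 2, a point outside the cube of radius 2^k R is at distance at
  least 2^k R / 2 from x. Two points of the small cube are at most 2 n l apart in the l1 norm, and
  the second condition on R is what then activates \<open>Kreg\<close>.\<close>

lemma kernel_shell:
 assumes l: "0 < l" and R: "2 * l \<le> R" "(2 * real CARD('n) * l) powr \<epsilon> \<le> c * (R / 2)"
  and x: "x \<in> cb x0 l" "x' \<in> cb x0 l" and yz: "y \<notin> cb x0 (2 ^ k * R) \<or> z \<notin> cb x0 (2 ^ k * R)"
 shows "norm (K (x, y, z) - K (x', y, z)) \<le> ck l R k"
proof -
 have R0: "0 < R" using l R by linarith
 have kR: "R \<le> 2 ^ k * R" using R0 by (simp add: mult_le_cancel_right1)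
 have far: "2 ^ k * R / 2 \<le> norm (x - v)" if v: "v \<notin> cb x0 (2 ^ k * R)" for v
 proof -
  obtain i where i: "2 ^ k * R < \<bar>v $ i - x0 $ i\<bar>" using v by (auto simp: mem_cb not_le)
  have "\<bar>x $ i - x0 $ i\<bar> \<le> l" using x by (auto simp: mem_cb)
  then have "2 ^ k * R - l \<le> \<bar>(x - v) $ i\<bar>" using i by simp
  then show ?thesis using component_le_norm_cart[of "x - v" i] R(1) kR by linarith
 qed
 let ?d = "norm (x - y) + norm (x - z)"
 have d: "2 ^ k * R / 2 \<le> ?d" using yz far[of y] far[of z] norm_ge_zero[of "x - y"] norm_ge_zero[of "x - z"] by linarith
 have d0: "0 < 2 ^ k * R / 2" using R0 by simp
 have "norm (x - x') \<le> (\<Sum>i\<in>UNIV. \<bar>(x - x') $ i\<bar>)" by (rule norm_le_l1_cart)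
 also have "\<dots> \<le> (\<Sum>i\<in>(UNIV::'n set). 2 * l)"
 proof (rule sum_mono)
  fix i
  have "\<bar>x $ i - x0 $ i\<bar> \<le> l" "\<bar>x' $ i - x0 $ i\<bar> \<le> l" using x by (auto simp: mem_cb)
  then show "\<bar>(x - x') $ i\<bar> \<le> 2 * l" by simp
 qed
 also have "\<dots> = 2 * real CARD('n) * l" by simp
 finally have xx: "norm (x - x') \<le> 2 * real CARD('n) * l" .
 have sub: "cb x0 l \<subseteq> cb x0 (2 ^ k * R)" using R kR l by (intro cb_mono) linarith
 then have nd: "(x, y, z) \<notin> triple_diagonal" "(x', y, z) \<notin> triple_diagonal" using yz x by (auto simp: triple_diagonal_def)
 have "norm (x - x') powr \<epsilon> \<le> (2 * real CARD('n) * l) powr \<epsilon>" using xx \<epsilon> by (intro powr_mono2) auto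
 also have "\<dots> \<le> c * ?d"
 proof -
  have "R / 2 \<le> ?d" using d kR by linarith
  then show ?thesis using R(2) mult_left_mono[of "R / 2" ?d c] c by linarith
 qed
 finally have "norm (K (x, y, z) - K (x', y, z)) \<le> C * (norm (x - x') powr s / ?d powr (2 * real CARD('n) + s / \<epsilon>))"
  by (rule Kreg[OF nd])
 also have "\<dots> \<le> ck l R k"
  unfolding ck_def
 proof (intro mult_left_mono frac_le)
  show "norm (x - x') powr s \<le> (2 * real CARD('n) * l) powr s" using xx s by (intro powr_mono2) auto
  show "(2 ^ k * R / 2) powr (2 * real CARD('n) + s / \<epsilon>) \<le> ?d powr (2 * real CARD('n) + s / \<epsilon>)"
   using d d0 s \<epsilon> by (intro powr_mono2) auto
 qed (use C d0 in auto)
 finally show ?thesis .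
qed

abbreviation I1 :: "real^'n \<Rightarrow> real \<Rightarrow> 'n cfun \<Rightarrow> real" where
 "I1 x0 R f \<equiv> (LINT y:cb x0 R|lebesgue. norm (f y))"

text \<open>Pairs (y, z) are sorted by shells. On a shell the kernel oscillates by at most
  \<open>ck\<close>, and both points lie in the next cube, so the double integral is bounded by a
  product of L1 norms. The null set is explicit because two points are compared at a time.\<close>

lemma far_test:
 assumes f: "f \<in> test_functions" and g: "g \<in> test_functions"
  and l: "0 < l" and R: "2 * l \<le> R" "(2 * real CARD('n) * l) powr \<epsilon> \<le> c * (R / 2)"
  and off: "supp f \<inter> cb x0 R = {} \<or> supp g \<inter> cb x0 R = {}"
  and N: "supp f \<subseteq> cb x0 (2 ^ N * R)" "supp g \<subseteq> cb x0 (2 ^ N * R)"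
 shows "\<exists>Z. (AE x in lebesgue. x \<notin> Z) \<and> (\<forall>x\<in>cb x0 l - Z. \<forall>x'\<in>cb x0 l - Z.
  norm (B f g x - B f g x') \<le> (\<Sum>k<N. ck l R k * I1 x0 (2 ^ Suc k * R) f * I1 x0 (2 ^ Suc k * R) g))"
proof -
 define P where "P x \<longleftrightarrow> integrable lebesgue (\<lambda>(y, z). K (x, y, z) * f y * g z) \<and>
   B f g x = (LINT (y, z)|lebesgue. K (x, y, z) * f y * g z)" for x
 have lR: "cb x0 l \<subseteq> cb x0 R" using l R by (intro cb_mono) linarith
 have AEP: "AE x in lebesgue. x \<in> cb x0 l \<longrightarrow> P x"
  unfolding P_def using off lR by (intro kernel_rep f g) blast
 define Fk where "Fk k y = indicator (cb x0 (2 ^ Suc k * R)) y * norm (f y)" for k y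
 define Gk where "Gk k y = indicator (cb x0 (2 ^ Suc k * R)) y * norm (g y)" for k y
 have fm: "f \<in> borel_measurable borel" "g \<in> borel_measurable borel"
  using f g by (auto intro!: borel_measurable_continuous_onI test_continuous)
 have Fm [measurable]: "Fk k \<in> borel_measurable borel" "Gk k \<in> borel_measurable borel" for k
  unfolding Fk_def[abs_def] Gk_def[abs_def] using fm by measurable
 have nn: "0 \<le> Fk k y" "0 \<le> Gk k y" for k y by (simp_all add: Fk_def Gk_def)
 have int: "(\<integral>\<^sup>+y. ennreal (indicator (cb x0 R') y * norm (h y)) \<partial>lborel) = ennreal (I1 x0 R' h)" if h: "h \<in> test_functions" for h R'
 proof -
  have "set_integrable lebesgue (cb x0 R') h"
   using test_L2[OF h] emeasure_cb_pos(2) by (intro L2_bounded_support_integrable(1)) auto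
  then have i: "integrable lebesgue (\<lambda>y. indicator (cb x0 R') y *\<^sub>R norm (h y))"
   using set_integrable_norm[of lebesgue "cb x0 R'" h] by (simp add: set_integrable_def)
  have "(\<integral>\<^sup>+y. ennreal (indicator (cb x0 R') y * norm (h y)) \<partial>lebesgue) = ennreal (I1 x0 R' h)"
   unfolding set_lebesgue_integral_def using nn_integral_eq_integral[OF i] by simp
  then show ?thesis by (simp add: nn_integral_completion)
 qed
 have I1nn: "0 \<le> I1 x0 R' h" for R' h
  unfolding set_lebesgue_integral_def by (intro integral_nonneg_AE) auto
 have bound: "norm (B f g x - B f g x') \<le> (\<Sum>k<N. ck l R k * I1 x0 (2 ^ Suc k * R) f * I1 x0 (2 ^ Suc k * R) g)"
  if x: "x \<in> cb x0 l" "P x" and x': "x' \<in> cb x0 l" "P x'" for x x'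
 proof -
  let ?D = "\<lambda>(y, z). K (x, y, z) * f y * g z - K (x', y, z) * f y * g z"
  have Di: "integrable lebesgue ?D"
   using x(2) x'(2) unfolding P_def by (auto simp: case_prod_unfold intro: Bochner_Integration.integrable_diff)
  have "B f g x - B f g x' = (LINT p|lebesgue. ?D p)"
   using x(2) x'(2) unfolding P_def by (simp add: case_prod_unfold)
  then have "ennreal (norm (B f g x - B f g x')) \<le> (\<integral>\<^sup>+p. ennreal (norm (?D p)) \<partial>lebesgue)"
   using integral_norm_bound_ennreal[OF Di] by simp
  also have "\<dots> \<le> (\<integral>\<^sup>+p. (\<Sum>k<N. ennreal (ck l R k) * (ennreal (Fk k (fst p)) * ennreal (Gk k (snd p)))) \<partial>lebesgue)"
  proof (rule nn_integral_mono)
   fix p :: "(real^'n) \<times> (real^'n)"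
   obtain y z where p: "p = (y, z)" by (cases p)
   have "norm (?D p) \<le> (\<Sum>k<N. ck l R k * (Fk k y * Gk k z))"
   proof (cases "f y * g z = 0")
    case True
    have "0 \<le> (\<Sum>k<N. ck l R k * (Fk k y * Gk k z))" by (intro sum_nonneg mult_nonneg_nonneg nn ck_nonneg)
    then show ?thesis using True by (auto simp: p)
   next
    case False
    then have yz: "y \<in> supp f" "z \<in> supp g" using outside_supp[of y f] outside_supp[of z g] by auto
    \<comment> \<open>One support misses the cube of radius R and both lie in that of radius 2^N R.
      So some cube still misses y or z, which gives the kernel bound, while the next one contains
      both.\<close>
    let ?Q = "\<lambda>m. y \<in> cb x0 (2 ^ m * R) \<and> z \<in> cb x0 (2 ^ m * R)"
    have "?Q N" using yz N by blast
    moreover have "\<not> ?Q 0" using yz off by auto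
    ultimately obtain k where k: "k < N" "\<not> ?Q k" "?Q (Suc k)"
     using first_success[of ?Q N] by blast
    have "norm (?D p) = norm (K (x, y, z) - K (x', y, z)) * (norm (f y) * norm (g z))"
     by (simp add: p left_diff_distrib[symmetric] norm_mult mult.assoc)
    also have "\<dots> \<le> ck l R k * (norm (f y) * norm (g z))"
     using k(2) x(1) x'(1) by (intro mult_right_mono kernel_shell[OF l R]) auto
    also have "\<dots> = ck l R k * (Fk k y * Gk k z)" using k(3) by (simp add: Fk_def Gk_def)
    also have "\<dots> \<le> (\<Sum>k<N. ck l R k * (Fk k y * Gk k z))"
     using k(1) by (intro member_le_sum mult_nonneg_nonneg nn ck_nonneg) auto
    finally show ?thesis .
   qed
   then have "ennreal (norm (?D p)) \<le> ennreal (\<Sum>k<N. ck l R k * (Fk k y * Gk k z))" by (rule ennreal_leI)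
   also have "\<dots> = (\<Sum>k<N. ennreal (ck l R k) * (ennreal (Fk k y) * ennreal (Gk k z)))"
    by (subst sum_ennreal[symmetric]) (auto simp: nn ck_nonneg ennreal_mult)
   finally show "ennreal (norm (?D p)) \<le> (\<Sum>k<N. ennreal (ck l R k) * (ennreal (Fk k (fst p)) * ennreal (Gk k (snd p))))"
    by (simp add: p)
  qed
  also have "\<dots> = (\<integral>\<^sup>+p. (\<Sum>k<N. ennreal (ck l R k) * (ennreal (Fk k (fst p)) * ennreal (Gk k (snd p)))) \<partial>(lborel \<Otimes>\<^sub>M lborel))"
   by (simp add: nn_integral_completion lborel_prod)
  also have "\<dots> = (\<Sum>k<N. ennreal (ck l R k) * (\<integral>\<^sup>+p. ennreal (Fk k (fst p)) * ennreal (Gk k (snd p)) \<partial>(lborel \<Otimes>\<^sub>M lborel)))"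
   by (subst nn_integral_sum) (auto simp: nn_integral_cmult)
  also have "\<dots> = (\<Sum>k<N. ennreal (ck l R k) * (ennreal (I1 x0 (2 ^ Suc k * R) f) * ennreal (I1 x0 (2 ^ Suc k * R) g)))"
  proof (intro sum.cong refl arg_cong2[where f="(*)"])
   fix k
   have "(\<integral>\<^sup>+p. ennreal (Fk k (fst p)) * ennreal (Gk k (snd p)) \<partial>(lborel \<Otimes>\<^sub>M lborel)) =
    (\<integral>\<^sup>+y. (\<integral>\<^sup>+z. ennreal (Fk k y) * ennreal (Gk k z) \<partial>lborel) \<partial>lborel)"
    by (subst lborel.nn_integral_fst[symmetric]) auto
   also have "\<dots> = (\<integral>\<^sup>+y. ennreal (Fk k y) * (\<integral>\<^sup>+z. ennreal (Gk k z) \<partial>lborel) \<partial>lborel)"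
    by (intro nn_integral_cong nn_integral_cmult) simp
   also have "\<dots> = (\<integral>\<^sup>+y. ennreal (Fk k y) \<partial>lborel) * (\<integral>\<^sup>+z. ennreal (Gk k z) \<partial>lborel)"
    by (rule nn_integral_multc) simp
   finally show "(\<integral>\<^sup>+p. ennreal (Fk k (fst p)) * ennreal (Gk k (snd p)) \<partial>(lborel \<Otimes>\<^sub>M lborel)) =
    ennreal (I1 x0 (2 ^ Suc k * R) f) * ennreal (I1 x0 (2 ^ Suc k * R) g)"
    unfolding Fk_def Gk_def int[OF f] int[OF g] .
  qed
  also have "\<dots> = ennreal (\<Sum>k<N. ck l R k * I1 x0 (2 ^ Suc k * R) f * I1 x0 (2 ^ Suc k * R) g)"
   by (subst sum_ennreal[symmetric]) (auto simp: I1nn ck_nonneg ennreal_mult mult.assoc)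
  finally show ?thesis
   by (subst (asm) ennreal_le_iff) (auto intro!: sum_nonneg mult_nonneg_nonneg ck_nonneg I1nn)
 qed
 show ?thesis
 proof (intro exI[of _ "{x. x \<in> cb x0 l \<and> \<not> P x}"] conjI ballI)
  show "AE x in lebesgue. x \<notin> {x. x \<in> cb x0 l \<and> \<not> P x}" using AEP by eventually_elim simp
 qed (use bound in auto)
qed

end

section \<open>Passage from test functions to square integrable functions\<close>

lemma n2_triangle:
 assumes u: "u \<in> L2" and v: "v \<in> L2" shows "n2 (\<lambda>x. u x + v x) \<le> n2 u + n2 v"
proof -
 have [measurable]: "u \<in> bmeas" "v \<in> bmeas" using u v by (auto simp: L2_def)
 have s: "(\<lambda>x. u x + v x) \<in> L2" using L2_lincomb[OF u v, of 1 1] by simp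
 have E: "ennreal ((n2 h)\<^sup>2) = (\<integral>\<^sup>+x. (ennreal (norm (h x)))\<^sup>2 \<partial>lebesgue)" if "h \<in> L2" for h :: "'a cfun"
  unfolding n2_square using that by (subst nn_integral_eq_integral[symmetric]) (auto simp: L2_def ennreal_power)
 have CS: "(\<integral>\<^sup>+x. ennreal (norm (u x)) * ennreal (norm (v x)) \<partial>lebesgue) \<le> ennreal (n2 u * n2 v)"
 proof (rule ennreal_power2_le_imp_le)
  have "(\<integral>\<^sup>+x. ennreal (norm (u x)) * ennreal (norm (v x)) \<partial>lebesgue)\<^sup>2 \<le>
   (\<integral>\<^sup>+x. (ennreal (norm (u x)))\<^sup>2 \<partial>lebesgue) * (\<integral>\<^sup>+x. (ennreal (norm (v x)))\<^sup>2 \<partial>lebesgue)"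
   by (rule Cauchy_Schwarz_nn_integral) measurable
  also have "\<dots> = (ennreal (n2 u * n2 v))\<^sup>2"
   unfolding E[OF u, symmetric] E[OF v, symmetric] by (simp add: ennreal_mult[symmetric] ennreal_power power_mult_distrib)
  finally show "(\<integral>\<^sup>+x. ennreal (norm (u x)) * ennreal (norm (v x)) \<partial>lebesgue)\<^sup>2 \<le> (ennreal (n2 u * n2 v))\<^sup>2" .
 qed
 have "ennreal ((n2 (\<lambda>x. u x + v x))\<^sup>2) \<le> (\<integral>\<^sup>+x. (ennreal (norm (u x)))\<^sup>2 + (ennreal (norm (v x)))\<^sup>2 +
   2 * (ennreal (norm (u x)) * ennreal (norm (v x))) \<partial>lebesgue)"
  unfolding E[OF s]
 proof (rule nn_integral_mono)
  fix x
  have "(norm (u x + v x))\<^sup>2 \<le> (norm (u x) + norm (v x))\<^sup>2" by (intro power_mono norm_triangle_ineq) auto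
  also have "\<dots> = (norm (u x))\<^sup>2 + (norm (v x))\<^sup>2 + 2 * (norm (u x) * norm (v x))" by (simp add: power2_sum)
  finally have "ennreal ((norm (u x + v x))\<^sup>2) \<le> ennreal ((norm (u x))\<^sup>2 + (norm (v x))\<^sup>2 + 2 * (norm (u x) * norm (v x)))"
   by (rule ennreal_leI)
  then show "(ennreal (norm (u x + v x)))\<^sup>2 \<le> (ennreal (norm (u x)))\<^sup>2 + (ennreal (norm (v x)))\<^sup>2 +
   2 * (ennreal (norm (u x)) * ennreal (norm (v x)))"
   by (simp add: ennreal_power ennreal_mult ennreal_plus)
 qed
 also have "\<dots> = ennreal ((n2 u)\<^sup>2) + ennreal ((n2 v)\<^sup>2) + 2 * (\<integral>\<^sup>+x. ennreal (norm (u x)) * ennreal (norm (v x)) \<partial>lebesgue)"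
  by (simp add: nn_integral_add nn_integral_cmult E u v)
 also have "\<dots> \<le> ennreal ((n2 u)\<^sup>2) + ennreal ((n2 v)\<^sup>2) + 2 * ennreal (n2 u * n2 v)"
  by (intro add_left_mono mult_left_mono CS) simp
 also have "\<dots> = ennreal ((n2 u + n2 v)\<^sup>2)"
  by (simp add: power2_sum ennreal_plus ennreal_mult mult.assoc)
 finally have "(n2 (\<lambda>x. u x + v x))\<^sup>2 \<le> (n2 u + n2 v)\<^sup>2" by (subst (asm) ennreal_le_iff) auto
 then show ?thesis by (rule power2_le_imp_le) simp
qed

context kernel_operator
begin

lemma I1_nonneg: "0 \<le> I1 x0 R f"
 unfolding set_lebesgue_integral_def by (intro integral_nonneg_AE) auto

lemma L2_set_integrable_cb: "f \<in> L2 \<Longrightarrow> set_integrable lebesgue (cb x0 R) f"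
 using emeasure_cb_pos(2) by (intro L2_bounded_support_integrable(1)) auto

lemma I1_tendsto:
 assumes f: "f \<in> L2" "\<And>k. fk k \<in> L2" "(\<lambda>k. n2 (\<lambda>x. fk k x - f x)) \<longlonglongrightarrow> 0"
 shows "(\<lambda>k. I1 x0 R (fk k)) \<longlonglongrightarrow> I1 x0 R f"
proof -
 have D: "(\<lambda>x. fk k x - f x) \<in> L2" for k by (intro L2_diff f)
 have "(\<lambda>k. I1 x0 R (fk k) - I1 x0 R f) \<longlonglongrightarrow> 0"
 proof (rule Lim_null_comparison)
  show "(\<lambda>k. I1 x0 R (\<lambda>x. fk k x - f x)) \<longlonglongrightarrow> 0"
   using emeasure_cb_pos(2) by (intro n2_tendsto_zero_L1 D f) auto
  show "eventually (\<lambda>k. norm (I1 x0 R (fk k) - I1 x0 R f) \<le> I1 x0 R (\<lambda>x. fk k x - f x)) sequentially"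
  proof (intro always_eventually allI)
   fix k
   note i = set_integrable_norm[OF L2_set_integrable_cb[OF f(1), of x0 R]]
    set_integrable_norm[OF L2_set_integrable_cb[OF f(2)[of k], of x0 R]]
    set_integrable_norm[OF L2_set_integrable_cb[OF D[of k], of x0 R]]
   have "I1 x0 R (fk k) - I1 x0 R f = (LINT y:cb x0 R|lebesgue. norm (fk k y) - norm (f y))"
    using set_integral_diff(2)[OF i(2) i(1)] by simp
   also have "norm \<dots> \<le> (LINT y:cb x0 R|lebesgue. norm (norm (fk k y) - norm (f y)))"
    by (rule set_integral_norm_bound[OF set_integral_diff(1)[OF i(2) i(1)]])
   also have "\<dots> \<le> I1 x0 R (\<lambda>x. fk k x - f x)"
    using i(3) set_integrable_norm[OF set_integral_diff(1)[OF i(2) i(1)]]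
    by (intro set_integral_mono) (auto simp: norm_triangle_ineq3)
   finally show "norm (I1 x0 R (fk k) - I1 x0 R f) \<le> I1 x0 R (\<lambda>x. fk k x - f x)" .
  qed
 qed
 then show ?thesis by (simp add: LIM_zero_iff)
qed

text \<open>The approximating test functions keep their supports in open sets that respect the hole,
  so \<open>far_test\<close> applies to each of them. The sums converge with the L1 norms on cubes,
  and the values of B almost everywhere along a subsequence.\<close>

lemma far_sum:
 assumes f: "f \<in> L2" and g: "g \<in> L2"
  and l: "0 < l" and R: "2 * l \<le> R" "(2 * real CARD('n) * l) powr \<epsilon> \<le> c * (R / 2)"
  and off: "(\<forall>y\<in>cb x0 R. f y = 0) \<or> (\<forall>y\<in>cb x0 R. g y = 0)"
  and N: "\<And>y. y \<notin> interior (cb x0 (2 ^ N * R)) \<Longrightarrow> f y = 0 \<and> g y = 0"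
 shows "\<exists>Z. (AE x in lebesgue. x \<notin> Z) \<and> (\<forall>x\<in>cb x0 l - Z. \<forall>x'\<in>cb x0 l - Z.
  norm (B f g x - B f g x') \<le> (\<Sum>k<N. ck l R k * I1 x0 (2 ^ Suc k * R) f * I1 x0 (2 ^ Suc k * R) g))"
proof -
 let ?O = "interior (cb x0 (2 ^ N * R))"
 \<comment> \<open>Only one of the two functions needs the hole; removing the closed cube leaves an
   open set, as the approximation requires.\<close>
 define Vf where "Vf = (if \<forall>y\<in>cb x0 R. f y = 0 then ?O - cb x0 R else ?O)"
 define Vg where "Vg = (if \<forall>y\<in>cb x0 R. f y = 0 then ?O else ?O - cb x0 R)"
 have O: "open ?O" "bounded ?O" by (simp_all add: bounded_subset[OF bounded_cb interior_subset])
 then have V: "open Vf" "bounded Vf" "open Vg" "bounded Vg"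
  by (auto simp: Vf_def Vg_def intro!: open_Diff bounded_subset[OF O(2)])
 have f0: "f y = 0" if "y \<notin> Vf" for y using that N by (auto simp: Vf_def split: if_splits)
 have g0: "g y = 0" if "y \<notin> Vg" for y using that N off by (auto simp: Vg_def split: if_splits)
 obtain \<phi> where \<phi>: "\<And>k. \<phi> k \<in> test_functions" "\<And>k. supp (\<phi> k) \<subseteq> Vf" "(\<lambda>k. n2 (\<lambda>x. \<phi> k x - f x)) \<longlonglongrightarrow> 0"
  using L2_test_approx[OF V(1,2) f f0] by auto
 obtain \<psi> where \<psi>: "\<And>k. \<psi> k \<in> test_functions" "\<And>k. supp (\<psi> k) \<subseteq> Vg" "(\<lambda>k. n2 (\<lambda>x. \<psi> k x - g x)) \<longlonglongrightarrow> 0"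
  using L2_test_approx[OF V(3,4) g g0] by auto
 have L: "\<phi> k \<in> L2" "\<psi> k \<in> L2" for k using \<phi>(1) \<psi>(1) by (auto intro: test_L2)
 obtain r where r: "strict_mono r" "AE x in lebesgue. (\<lambda>k. B (\<phi> (r k)) (\<psi> (r k)) x) \<longlonglongrightarrow> B f g x"
  using B_conv_subseq[OF f L(1) \<phi>(3) g L(2) \<psi>(3)] by blast
 let ?S = "\<lambda>f g. (\<Sum>k<N. ck l R k * I1 x0 (2 ^ Suc k * R) f * I1 x0 (2 ^ Suc k * R) g)"
 have "\<exists>Z. (AE x in lebesgue. x \<notin> Z) \<and> (\<forall>x\<in>cb x0 l - Z. \<forall>x'\<in>cb x0 l - Z.
  norm (B (\<phi> k) (\<psi> k) x - B (\<phi> k) (\<psi> k) x') \<le> ?S (\<phi> k) (\<psi> k))" for k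
 proof (rule far_test[OF \<phi>(1) \<psi>(1) l R])
  have "Vf \<inter> cb x0 R = {} \<or> Vg \<inter> cb x0 R = {}" by (auto simp: Vf_def Vg_def)
  then show "supp (\<phi> k) \<inter> cb x0 R = {} \<or> supp (\<psi> k) \<inter> cb x0 R = {}" using \<phi>(2)[of k] \<psi>(2)[of k] by blast
  have "Vf \<subseteq> ?O" "Vg \<subseteq> ?O" by (auto simp: Vf_def Vg_def)
  then show "supp (\<phi> k) \<subseteq> cb x0 (2 ^ N * R)" "supp (\<psi> k) \<subseteq> cb x0 (2 ^ N * R)"
   using \<phi>(2)[of k] \<psi>(2)[of k] interior_subset[of "cb x0 (2 ^ N * R)"] by blast+
 qed
 then have "\<forall>k. \<exists>Z. (AE x in lebesgue. x \<notin> Z) \<and> (\<forall>x\<in>cb x0 l - Z. \<forall>x'\<in>cb x0 l - Z.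
  norm (B (\<phi> k) (\<psi> k) x - B (\<phi> k) (\<psi> k) x') \<le> ?S (\<phi> k) (\<psi> k))" by (rule allI)
 then obtain Z where Z: "\<forall>k. (AE x in lebesgue. x \<notin> Z k) \<and> (\<forall>x\<in>cb x0 l - Z k. \<forall>x'\<in>cb x0 l - Z k.
  norm (B (\<phi> k) (\<psi> k) x - B (\<phi> k) (\<psi> k) x') \<le> ?S (\<phi> k) (\<psi> k))"
  by (rule choice[THEN exE])
 define Z' where "Z' = (\<Union>k. Z k) \<union> {x. \<not> (\<lambda>k. B (\<phi> (r k)) (\<psi> (r k)) x) \<longlonglongrightarrow> B f g x}"
 have "AE x in lebesgue. \<forall>k. x \<notin> Z k" using Z by (subst AE_all_countable) blast
 then have AEZ: "AE x in lebesgue. x \<notin> Z'" using r(2) by eventually_elim (simp add: Z'_def)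
 have "norm (B f g x - B f g x') \<le> ?S f g" if x: "x \<in> cb x0 l - Z'" "x' \<in> cb x0 l - Z'" for x x'
 proof (rule LIMSEQ_le)
  show "(\<lambda>k. norm (B (\<phi> (r k)) (\<psi> (r k)) x - B (\<phi> (r k)) (\<psi> (r k)) x')) \<longlonglongrightarrow> norm (B f g x - B f g x')"
   using x by (intro tendsto_intros) (auto simp: Z'_def)
  have "(\<lambda>k. ?S (\<phi> k) (\<psi> k)) \<longlonglongrightarrow> ?S f g"
   by (intro tendsto_sum tendsto_mult tendsto_const I1_tendsto f g L \<phi>(3) \<psi>(3))
  from LIMSEQ_subseq_LIMSEQ[OF this r(1)] show "(\<lambda>k. ?S (\<phi> (r k)) (\<psi> (r k))) \<longlonglongrightarrow> ?S f g" by (simp add: o_def)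
  show "\<exists>N. \<forall>n\<ge>N. norm (B (\<phi> (r n)) (\<psi> (r n)) x - B (\<phi> (r n)) (\<psi> (r n)) x') \<le> ?S (\<phi> (r n)) (\<psi> (r n))"
   using Z x by (auto simp: Z'_def)
 qed
 then show ?thesis using AEZ by blast
qed

text \<open>With t = 2^k R / 2 the two cubes in the k-th term have side 8 t, whence the power of 8.
  Halving in t contributes 2^(s/\<epsilon>), and the denominator sums a geometric series of ratio
  2^(-s/\<epsilon>).\<close>

definition far_const :: real where
 "far_const = C * (2 * real CARD('n)) powr s * 8 ^ (2 * CARD('n)) * 2 powr (s / \<epsilon>) / (1 - 2 powr (- s / \<epsilon>))"

lemma far_const_nonneg: "0 \<le> far_const"
proof -
 have "2 powr (- s / \<epsilon>) < (2::real) powr 0" using s \<epsilon> by (intro powr_less_mono) auto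
 then show ?thesis unfolding far_const_def using C by (intro divide_nonneg_nonneg mult_nonneg_nonneg) auto
qed

text \<open>Here a and b bound the means over the dilated cubes. In the k-th term the two volumes
  cancel against the kernel and leave (2^k R / 2)^(-s/\<epsilon>), a geometric series whose sum does
  not depend on the number of shells.\<close>

lemma far:
 assumes f: "f \<in> L2" "bounded {y. f y \<noteq> 0}" and g: "g \<in> L2" "bounded {y. g y \<noteq> 0}"
  and l: "0 < l" and R: "2 * l \<le> R" "(2 * real CARD('n) * l) powr \<epsilon> \<le> c * (R / 2)"
  and off: "(\<forall>y\<in>cb x0 R. f y = 0) \<or> (\<forall>y\<in>cb x0 R. g y = 0)"
  and a: "\<And>k. I1 x0 (2 ^ Suc k * R) f \<le> a * (2 * (2 ^ Suc k * R)) ^ CARD('n)"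
  and b: "\<And>k. I1 x0 (2 ^ Suc k * R) g \<le> b * (2 * (2 ^ Suc k * R)) ^ CARD('n)"
  and ab: "0 \<le> a" "0 \<le> b"
 shows "\<exists>Z. (AE x in lebesgue. x \<notin> Z) \<and> (\<forall>x\<in>cb x0 l - Z. \<forall>x'\<in>cb x0 l - Z.
  norm (B f g x - B f g x') \<le> far_const * l powr s * R powr (- s / \<epsilon>) * a * b)"
proof -
 have R0: "0 < R" using l R by linarith
 have "bounded ({y. f y \<noteq> 0} \<union> {y. g y \<noteq> 0})" using f g by simp
 then obtain R' where R': "{y. f y \<noteq> 0} \<union> {y. g y \<noteq> 0} \<subseteq> cb x0 R'" using bounded_subset_cb by blast
 obtain N :: nat where N: "R' / R < 2 ^ N" using real_arch_pow[where x=2] by auto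
 then have "R' < 2 ^ N * R" using R0 by (simp add: field_simps)
 then have "cb x0 R' \<subseteq> interior (cb x0 (2 ^ N * R))" by (intro subsetI) (auto simp: mem_cb interior_cb intro: le_less_trans)
 then have N0: "f y = 0 \<and> g y = 0" if "y \<notin> interior (cb x0 (2 ^ N * R))" for y using R' that by blast
 define q where "q = 2 powr (- s / \<epsilon>)"
 have q: "0 < q" "q < 1"
 proof -
  have "2 powr (- s / \<epsilon>) < (2::real) powr 0" using s \<epsilon> by (intro powr_less_mono) auto
  then show "0 < q" "q < 1" by (auto simp: q_def)
 qed
 let ?M = "C * (2 * real CARD('n)) powr s * 8 ^ (2 * CARD('n)) * 2 powr (s / \<epsilon>) * l powr s * R powr (- s / \<epsilon>) * a * b"
 have M0: "0 \<le> ?M" using C ab by (intro mult_nonneg_nonneg) auto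
 have term_le: "ck l R k * I1 x0 (2 ^ Suc k * R) f * I1 x0 (2 ^ Suc k * R) g \<le> ?M * q ^ k" for k
 proof -
  define t where "t = 2 ^ k * R / 2"
  have t: "0 < t" "2 * (2 ^ Suc k * R) = 8 * t" using R0 by (simp_all add: t_def)
  have "ck l R k * I1 x0 (2 ^ Suc k * R) f * I1 x0 (2 ^ Suc k * R) g \<le>
    ck l R k * (a * (8 * t) ^ CARD('n)) * (b * (8 * t) ^ CARD('n))"
   using a[of k] b[of k] ab t unfolding t(2)
   by (intro mult_mono mult_nonneg_nonneg ck_nonneg I1_nonneg order_refl) auto
  also have "\<dots> = C * (2 * real CARD('n) * l) powr s * 8 ^ (2 * CARD('n)) * (t ^ (2 * CARD('n)) / t powr (2 * real CARD('n) + s / \<epsilon>)) * a * b"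
  proof -
   have e: "(8 * t) ^ CARD('n) * (8 * t) ^ CARD('n) = 8 ^ (2 * CARD('n)) * t ^ (2 * CARD('n))"
    by (simp add: power_mult_distrib mult_2 power_add)
   have "ck l R k * (a * (8 * t) ^ CARD('n)) * (b * (8 * t) ^ CARD('n)) =
     ck l R k * ((8 * t) ^ CARD('n) * (8 * t) ^ CARD('n)) * a * b" by (simp only: mult_ac)
   then show ?thesis unfolding e ck_def t_def[symmetric] by simp
  qed
  also have "t ^ (2 * CARD('n)) / t powr (2 * real CARD('n) + s / \<epsilon>) = t powr (- s / \<epsilon>)"
  proof -
   have "t ^ (2 * CARD('n)) = t powr (2 * real CARD('n))" using t powr_realpow[OF t(1), of "2 * CARD('n)"] by simp
   then show ?thesis by (simp add: powr_diff[symmetric])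
  qed
  also have "t powr (- s / \<epsilon>) = R powr (- s / \<epsilon>) * 2 powr (s / \<epsilon>) * q ^ k"
  proof -
   have "t powr (- s / \<epsilon>) = (2 ^ k) powr (- s / \<epsilon>) * (R powr (- s / \<epsilon>) * (1 / 2) powr (- s / \<epsilon>))"
    unfolding t_def using R0 by (simp add: powr_mult[symmetric])
   also have "((2::real) ^ k) powr (- s / \<epsilon>) = q ^ k"
   proof -
    have "((2::real) ^ k) powr (- s / \<epsilon>) = (2 powr real k) powr (- s / \<epsilon>)" by (subst powr_realpow) simp_all
    also have "\<dots> = (2 powr (- s / \<epsilon>)) powr real k" by (simp only: powr_powr mult.commute)
    also have "\<dots> = q ^ k" unfolding q_def by (rule powr_realpow) simp
    finally show ?thesis .
   qed
   also have "(1 / 2 :: real) powr (- s / \<epsilon>) = 2 powr (s / \<epsilon>)" by (simp add: powr_divide powr_minus inverse_eq_divide)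
   finally show ?thesis by (simp only: mult_ac)
  qed
  also have "(2 * real CARD('n) * l) powr s = (2 * real CARD('n)) powr s * l powr s" using l by (intro powr_mult)
  finally show ?thesis by (simp only: mult_ac)
 qed
 have sum_le: "(\<Sum>k<N. ck l R k * I1 x0 (2 ^ Suc k * R) f * I1 x0 (2 ^ Suc k * R) g) \<le> far_const * l powr s * R powr (- s / \<epsilon>) * a * b"
 proof -
  have "(\<Sum>k<N. ck l R k * I1 x0 (2 ^ Suc k * R) f * I1 x0 (2 ^ Suc k * R) g) \<le> (\<Sum>k<N. ?M * q ^ k)"
   by (intro sum_mono term_le)
  also have "\<dots> = ?M * (\<Sum>k<N. q ^ k)" by (rule sum_distrib_left[symmetric])
  also have "(\<Sum>k<N. q ^ k) \<le> 1 / (1 - q)"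
   using q sum_le_suminf[OF summable_geometric[of q], of "{..<N}"] by (simp add: suminf_geometric)
  then have "?M * (\<Sum>k<N. q ^ k) \<le> ?M * (1 / (1 - q))" using M0 by (rule mult_left_mono)
  also have "\<dots> = far_const * l powr s * R powr (- s / \<epsilon>) * a * b"
   unfolding far_const_def q_def[symmetric] by simp
  finally show ?thesis .
 qed
 obtain Z where Z: "AE x in lebesgue. x \<notin> Z" "\<forall>x\<in>cb x0 l - Z. \<forall>x'\<in>cb x0 l - Z.
  norm (B f g x - B f g x') \<le> (\<Sum>k<N. ck l R k * I1 x0 (2 ^ Suc k * R) f * I1 x0 (2 ^ Suc k * R) g)"
  using far_sum[OF f(1) g(1) l R off N0] by blast
 then show ?thesis using sum_le by (intro exI[of _ Z] conjI ballI) (auto intro: order_trans)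
qed

text \<open>Fatou's lemma along an almost everywhere convergent subsequence; the L2 norms of the
  approximants converge by the triangle inequality.\<close>

lemma Bq_L2:
 assumes f: "f \<in> L2" "bounded {y. f y \<noteq> 0}" and g: "g \<in> L2" "bounded {y. g y \<noteq> 0}"
 shows "pow_int lebesgue (1 / \<epsilon>) (B f g) \<le> ennreal ((A * n2 f * n2 g) powr (1 / \<epsilon>))"
proof -
 obtain V where V: "open V" "bounded V" "{y. f y \<noteq> 0} \<subseteq> V" "{y. g y \<noteq> 0} \<subseteq> V"
 proof -
  have "bounded ({y. f y \<noteq> 0} \<union> {y. g y \<noteq> 0})" using f g by simp
  then obtain b where "{y. f y \<noteq> 0} \<union> {y. g y \<noteq> 0} \<subseteq> ball 0 b" using bounded_subset_ballD by blast
  then show ?thesis by (intro that[of "ball 0 b"]) auto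
 qed
 obtain \<phi> where \<phi>: "\<And>k. \<phi> k \<in> test_functions" "(\<lambda>k. n2 (\<lambda>x. \<phi> k x - f x)) \<longlonglongrightarrow> 0"
 proof -
  have "f x = 0" if "x \<notin> V" for x using V(3) that by blast
  from L2_test_approx[OF V(1,2) f(1) this] show ?thesis using that by blast
 qed
 obtain \<psi> where \<psi>: "\<And>k. \<psi> k \<in> test_functions" "(\<lambda>k. n2 (\<lambda>x. \<psi> k x - g x)) \<longlonglongrightarrow> 0"
 proof -
  have "g x = 0" if "x \<notin> V" for x using V(4) that by blast
  from L2_test_approx[OF V(1,2) g(1) this] show ?thesis using that by blast
 qed
 have L: "\<phi> k \<in> L2" "\<psi> k \<in> L2" for k using \<phi>(1) \<psi>(1) by (auto intro: test_L2)
 obtain r where r: "strict_mono r" "AE x in lebesgue. (\<lambda>k. B (\<phi> (r k)) (\<psi> (r k)) x) \<longlonglongrightarrow> B f g x"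
  using B_conv_subseq[OF f(1) L(1) \<phi>(2) g(1) L(2) \<psi>(2)] by blast
 have n2_lim: "(\<lambda>k. n2 (\<theta> k)) \<longlonglongrightarrow> n2 h" if h: "h \<in> L2" "\<And>k. \<theta> k \<in> L2" "(\<lambda>k. n2 (\<lambda>x. \<theta> k x - h x)) \<longlonglongrightarrow> 0" for \<theta> h
 proof -
  have tri: "n2 (\<lambda>x. u x + v x) \<le> n2 u + n2 v" if uv: "u \<in> L2" "v \<in> L2" for u v
   using uv by (rule n2_triangle)
  have "norm (n2 (\<theta> k) - n2 h) \<le> n2 (\<lambda>x. \<theta> k x - h x)" for k
  proof -
   have "n2 (\<theta> k) \<le> n2 (\<lambda>x. \<theta> k x - h x) + n2 h"
    using tri[OF L2_diff[OF h(2)[of k] h(1)] h(1)] by simp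
   moreover have "n2 h \<le> n2 (\<lambda>x. h x - \<theta> k x) + n2 (\<theta> k)"
    using tri[OF L2_diff[OF h(1) h(2)[of k]] h(2)[of k]] by simp
   moreover have "n2 (\<lambda>x. h x - \<theta> k x) = n2 (\<lambda>x. \<theta> k x - h x)" by (simp add: n2_def norm_minus_commute)
   ultimately show ?thesis by simp
  qed
  then have "(\<lambda>k. n2 (\<theta> k) - n2 h) \<longlonglongrightarrow> 0" by (intro Lim_null_comparison[OF _ h(3)]) simp
  then show ?thesis by (simp add: LIM_zero_iff)
 qed
 have lim: "(\<lambda>k. ennreal ((A * n2 (\<phi> (r k)) * n2 (\<psi> (r k))) powr (1 / \<epsilon>))) \<longlonglongrightarrow> ennreal ((A * n2 f * n2 g) powr (1 / \<epsilon>))"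
 proof -
  have "(\<lambda>k. A * n2 (\<phi> (r k)) * n2 (\<psi> (r k))) \<longlonglongrightarrow> A * n2 f * n2 g"
   using LIMSEQ_subseq_LIMSEQ[OF n2_lim[OF f(1) L(1) \<phi>(2)] r(1)] LIMSEQ_subseq_LIMSEQ[OF n2_lim[OF g(1) L(2) \<psi>(2)] r(1)]
   by (intro tendsto_intros) (simp_all add: o_def)
  then show ?thesis using A \<epsilon> by (intro tendsto_ennrealI tendsto_powr') auto
 qed
 have "pow_int lebesgue (1 / \<epsilon>) (B f g) =
   (\<integral>\<^sup>+x. liminf (\<lambda>k. ennreal (norm (B (\<phi> (r k)) (\<psi> (r k)) x) powr (1 / \<epsilon>))) \<partial>lebesgue)"
 proof (rule nn_integral_cong_AE, use r(2) in eventually_elim)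
  case (elim x)
  have "(\<lambda>k. ennreal (norm (B (\<phi> (r k)) (\<psi> (r k)) x) powr (1 / \<epsilon>))) \<longlonglongrightarrow> ennreal (norm (B f g x) powr (1 / \<epsilon>))"
   using \<epsilon> elim by (intro powr_norm_tendsto) auto
  then show ?case by (rule lim_imp_Liminf[OF trivial_limit_sequentially, symmetric])
 qed
 also have "\<dots> \<le> liminf (\<lambda>k. \<integral>\<^sup>+x. ennreal (norm (B (\<phi> (r k)) (\<psi> (r k)) x) powr (1 / \<epsilon>)) \<partial>lebesgue)"
 proof (rule nn_integral_liminf)
  fix k
  have [measurable]: "B (\<phi> (r k)) (\<psi> (r k)) \<in> bmeas" by (intro Bm L)
  show "(\<lambda>x. ennreal (norm (B (\<phi> (r k)) (\<psi> (r k)) x) powr (1 / \<epsilon>))) \<in> bmeas" by measurable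
 qed
 also have "\<dots> \<le> liminf (\<lambda>k. ennreal ((A * n2 (\<phi> (r k)) * n2 (\<psi> (r k))) powr (1 / \<epsilon>)))"
  by (intro Liminf_mono always_eventually allI Bq \<phi> \<psi>)
 also have "\<dots> = ennreal ((A * n2 f * n2 g) powr (1 / \<epsilon>))" using lim by (intro lim_imp_Liminf) auto
 finally show ?thesis .
qed

section \<open>Mean oscillation over cubes of arbitrary size\<close>

definition far_scale :: real where
 "far_scale = (c / 2) powr (s / \<epsilon>) * (2 * real CARD('n)) powr (- s)"

text \<open>The condition on R bounds l^\<epsilon> by a multiple of R. Its power s / \<epsilon>
  bounds l^s by a multiple of R^(s/\<epsilon>), so the exponent in the decay of the kernel is just
  what makes the far bound independent of the scale.\<close>

lemma far_scale:
 assumes l: "0 < l" and R: "0 < R" "(2 * real CARD('n) * l) powr \<epsilon> \<le> c * (R / 2)"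
 shows "l powr s * R powr (- s / \<epsilon>) \<le> far_scale"
proof -
 let ?n = "2 * real CARD('n)"
 have "((?n * l) powr \<epsilon>) powr (s / \<epsilon>) \<le> (c / 2 * R) powr (s / \<epsilon>)"
  using R(2) s \<epsilon> by (intro powr_mono2) auto
 moreover have "((?n * l) powr \<epsilon>) powr (s / \<epsilon>) = ?n powr s * l powr s"
 proof -
  have "((?n * l) powr \<epsilon>) powr (s / \<epsilon>) = (?n * l) powr s" using \<epsilon> by (simp add: powr_powr)
  also have "\<dots> = ?n powr s * l powr s" using l by (intro powr_mult)
  finally show ?thesis .
 qed
 moreover have "(c / 2 * R) powr (s / \<epsilon>) = (c / 2) powr (s / \<epsilon>) * R powr (s / \<epsilon>)" using c R(1) by (intro powr_mult)
 ultimately have "?n powr s * l powr s \<le> (c / 2) powr (s / \<epsilon>) * R powr (s / \<epsilon>)" by (simp only:)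
 then have "(?n powr s * l powr s) * (?n powr (- s) * R powr (- s / \<epsilon>)) \<le>
   ((c / 2) powr (s / \<epsilon>) * R powr (s / \<epsilon>)) * (?n powr (- s) * R powr (- s / \<epsilon>))"
  by (intro mult_right_mono) auto
 also have "(?n powr s * l powr s) * (?n powr (- s) * R powr (- s / \<epsilon>)) = (?n powr s * ?n powr (- s)) * (l powr s * R powr (- s / \<epsilon>))"
  by (simp only: mult_ac)
 also have "?n powr s * ?n powr (- s) = 1" by (simp only: powr_add[symmetric]) simp
 also have "((c / 2) powr (s / \<epsilon>) * R powr (s / \<epsilon>)) * (?n powr (- s) * R powr (- s / \<epsilon>)) = far_scale * (R powr (s / \<epsilon>) * R powr (- s / \<epsilon>))"
  unfolding far_scale_def by (simp only: mult_ac)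
 also have "R powr (s / \<epsilon>) * R powr (- s / \<epsilon>) = 1" using R(1) by (simp only: powr_add[symmetric]) simp
 finally show ?thesis by simp
qed

text \<open>The radius used in \<open>sharp\<close> is at most twice the larger of 2 l and 2 (2 n
  l)^\<epsilon> / c; the two entries are the resulting coefficients of l and l^\<epsilon>.\<close>

definition radius_const :: real where
 "radius_const = max 4 (4 * (2 * real CARD('n)) powr \<epsilon> / c)"

text \<open>The first summand belongs to the local term, the second to the two far terms.\<close>

definition sharp_const :: real where
 "sharp_const = A * (2 * radius_const) ^ CARD('n) + 2 * (far_const * far_scale)"

lemma sharp_const_nonneg: "0 \<le> sharp_const"
 unfolding sharp_const_def far_scale_def radius_const_def using A far_const_nonneg
 by (intro add_nonneg_nonneg mult_nonneg_nonneg zero_le_power) auto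

text \<open>Cauchy--Schwarz turns a bound on quadratic means into the same bound on means. The
  function h stands for a piece of f cut out by an indicator.\<close>

lemma I1_le:
 assumes f: "f \<in> L2" and h: "h \<in> L2" "\<And>y. norm (h y) \<le> norm (f y)" and a: "0 \<le> a" and R: "0 < R"
  and le: "sq_int (cb x0 R) f \<le> ennreal (a\<^sup>2 * (2 * R) ^ CARD('n))"
 shows "I1 x0 R h \<le> a * (2 * R) ^ CARD('n)" "(n2 (\<lambda>x. indicator (cb x0 R) x *\<^sub>R h x))\<^sup>2 \<le> a\<^sup>2 * (2 * R) ^ CARD('n)"
proof -
 have "ennreal ((n2 (\<lambda>x. indicator (cb x0 R) x *\<^sub>R h x))\<^sup>2) \<le> ennreal (a\<^sup>2 * (2 * R) ^ CARD('n))"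
  unfolding n2_indicator[OF h(1) sets_cb(2)]
  by (rule order_trans[OF _ le]) (intro nn_integral_mono mult_right_mono ennreal_leI power_mono h, auto)
 then show n: "(n2 (\<lambda>x. indicator (cb x0 R) x *\<^sub>R h x))\<^sup>2 \<le> a\<^sup>2 * (2 * R) ^ CARD('n)"
  using R by (subst (asm) ennreal_le_iff) auto
 then have "n2 (\<lambda>x. indicator (cb x0 R) x *\<^sub>R h x) \<le> sqrt (a\<^sup>2 * (2 * R) ^ CARD('n))" by (rule real_le_rsqrt)
 also have "\<dots> = a * sqrt ((2 * R) ^ CARD('n))" using a by (simp add: real_sqrt_mult)
 finally have n': "n2 (\<lambda>x. indicator (cb x0 R) x *\<^sub>R h x) \<le> a * sqrt ((2 * R) ^ CARD('n))" .
 have "I1 x0 R h \<le> sqrt (measure lebesgue (cb x0 R)) * n2 (\<lambda>x. indicator (cb x0 R) x *\<^sub>R h x)"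
  using emeasure_cb_pos(2) by (intro L2_bounded_support_integrable(2) h) auto
 also have "measure lebesgue (cb x0 R) = (2 * R) ^ CARD('n)" using R by (intro measure_cb) simp
 also have "sqrt ((2 * R) ^ CARD('n)) * n2 (\<lambda>x. indicator (cb x0 R) x *\<^sub>R h x) \<le> sqrt ((2 * R) ^ CARD('n)) * (a * sqrt ((2 * R) ^ CARD('n)))"
  using R by (intro mult_left_mono n') auto
 also have "\<dots> = a * (2 * R) ^ CARD('n)" using R by (simp add: mult.left_commute real_sqrt_mult[symmetric] del: real_sqrt_mult)
 finally show "I1 x0 R h \<le> a * (2 * R) ^ CARD('n)" .
qed

text \<open>The second alternative for \<open>R\<close> is the case of small cubes, in which the volume factors lost by
passing from \<open>l\<close> to \<open>l powr \<epsilon>\<close> are regained from the \<open>L\<^bsup>1/\<epsilon>\<^esup>\<close> bound.\<close>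

lemma local_estimate:
 assumes f: "f \<in> L2" "bounded {y. f y \<noteq> 0}" and g: "g \<in> L2" "bounded {y. g y \<noteq> 0}"
  and l: "0 < l" and t: "0 \<le> t" "n2 f * n2 g \<le> t * (2 * R) ^ CARD('n)" "0 < R"
  and Rl: "R \<le> radius_const * l \<or> R \<le> radius_const * l powr \<epsilon>" and l1: "1 \<le> l \<Longrightarrow> R \<le> radius_const * l"
 shows "abs_int (cb x0 l) (B f g) \<le>
  ennreal (A * (2 * radius_const) ^ CARD('n) * t * (2 * l) ^ CARD('n))"
proof -
 let ?n = "CARD('n)" and ?D = "radius_const"
 have D: "0 < ?D" by (simp add: radius_const_def)
 have Bi: "integrable lebesgue (B f g)" by (intro Bint f g)
 have [measurable]: "B f g \<in> bmeas" using Bi by simp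
 have AB: "A * n2 f * n2 g \<le> A * t * (2 * R) ^ ?n"
  using mult_left_mono[OF t(2) A] by (simp add: mult.assoc)
 show ?thesis
 proof (cases "R \<le> ?D * l")
  case True
  have "abs_int (cb x0 l) (B f g) \<le> (\<integral>\<^sup>+x. ennreal (norm (B f g x)) \<partial>lebesgue)"
   by (intro nn_integral_mono) (auto simp: indicator_def)
  also have "\<dots> = ennreal (LINT x|lebesgue. norm (B f g x))" using Bi by (intro nn_integral_eq_integral) auto
  also have "\<dots> \<le> ennreal (A * (2 * ?D) ^ ?n * t * (2 * l) ^ ?n)"
  proof (rule ennreal_leI)
   have "(LINT x|lebesgue. norm (B f g x)) \<le> A * t * (2 * R) ^ ?n" using Bbd[OF f(1) g(1)] AB by linarith
   also have "\<dots> \<le> A * t * ((2 * ?D) * (2 * l)) ^ ?n"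
   proof (intro mult_left_mono power_mono)
    have "2 * R \<le> 4 * (?D * l)" using True mult_pos_pos[OF D l] by linarith
    then show "2 * R \<le> (2 * ?D) * (2 * l)" by simp
   qed (use A t in auto)
   also have "\<dots> = A * (2 * ?D) ^ ?n * t * (2 * l) ^ ?n" by (simp only: power_mult_distrib mult_ac)
   finally show "(LINT x|lebesgue. norm (B f g x)) \<le> A * (2 * ?D) ^ ?n * t * (2 * l) ^ ?n" .
  qed
  finally show ?thesis .
 next
  case False
  then have Re: "R \<le> ?D * l powr \<epsilon>" and l1': "l < 1" using Rl l1 by (auto simp: not_le[symmetric])
  let ?F = "\<lambda>x. ennreal (norm (B f g x) powr (1 / \<epsilon>))" and ?G = "\<lambda>x. indicator (cb x0 l) x :: ennreal"
  \<comment> \<open>Hoelder's inequality with exponents 1/\<epsilon> and 1/(1-\<epsilon>) against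
    the indicator of the small cube.\<close>
  have "abs_int (cb x0 l) (B f g) = (\<integral>\<^sup>+x. epowr (?F x) \<epsilon> * epowr (?G x) (1 - \<epsilon>) \<partial>lebesgue)"
  proof (rule nn_integral_cong)
   fix x
   show "ennreal (norm (B f g x)) * indicator (cb x0 l) x = epowr (?F x) \<epsilon> * epowr (?G x) (1 - \<epsilon>)"
    using \<epsilon> by (cases "x \<in> cb x0 l") (auto simp: epowr_ennreal powr_powr epowr_def)
  qed
  also have "\<dots> \<le> epowr (\<integral>\<^sup>+x. ?F x \<partial>lebesgue) \<epsilon> * epowr (\<integral>\<^sup>+x. ?G x \<partial>lebesgue) (1 - \<epsilon>)"
   by (rule nn_Holder[OF \<epsilon>]) measurable
  also have "\<dots> \<le> ennreal (A * n2 f * n2 g) * ennreal (((2 * l) ^ ?n) powr (1 - \<epsilon>))"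
  proof (intro mult_mono)
   have "epowr (\<integral>\<^sup>+x. ?F x \<partial>lebesgue) \<epsilon> \<le> epowr (ennreal ((A * n2 f * n2 g) powr (1 / \<epsilon>))) \<epsilon>"
    by (rule epowr_mono[OF \<epsilon>(1) Bq_L2[OF f g]])
   also have "\<dots> = ennreal (A * n2 f * n2 g)" using \<epsilon> A by (simp add: epowr_ennreal powr_powr)
   finally show "epowr (\<integral>\<^sup>+x. ?F x \<partial>lebesgue) \<epsilon> \<le> ennreal (A * n2 f * n2 g)" .
   have "(\<integral>\<^sup>+x. ?G x \<partial>lebesgue) = ennreal ((2 * l) ^ ?n)" using l by (simp add: emeasure_cb)
   then show "epowr (\<integral>\<^sup>+x. ?G x \<partial>lebesgue) (1 - \<epsilon>) \<le> ennreal (((2 * l) ^ ?n) powr (1 - \<epsilon>))"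
    using \<epsilon> l epowr_ennreal[of "1 - \<epsilon>" "(2 * l) ^ ?n"] by simp
  qed auto
  also have "\<dots> = ennreal ((A * n2 f * n2 g) * ((2 * l) ^ ?n) powr (1 - \<epsilon>))"
   using A by (intro ennreal_mult[symmetric]) auto
  also have "\<dots> \<le> ennreal (A * (2 * ?D) ^ ?n * t * (2 * l) ^ ?n)"
  proof (rule ennreal_leI)
   have "(A * n2 f * n2 g) * ((2 * l) ^ ?n) powr (1 - \<epsilon>) \<le> (A * t * (2 * R) ^ ?n) * ((2 * l) ^ ?n) powr (1 - \<epsilon>)"
    using AB by (intro mult_right_mono) auto
   also have "\<dots> \<le> (A * t * ((2 * ?D) * (2 * l) powr \<epsilon>) ^ ?n) * ((2 * l) ^ ?n) powr (1 - \<epsilon>)"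
   proof (intro mult_right_mono mult_left_mono power_mono)
    have "l powr \<epsilon> \<le> (2 * l) powr \<epsilon>" using l \<epsilon> by (intro powr_mono2) auto
    then have "?D * l powr \<epsilon> \<le> ?D * (2 * l) powr \<epsilon>" using D by (intro mult_left_mono) auto
    then show "2 * R \<le> (2 * ?D) * (2 * l) powr \<epsilon>" using Re by linarith
   qed (use A t in auto)
   also have "\<dots> = A * t * (2 * ?D) ^ ?n * (((2 * l) powr \<epsilon>) ^ ?n * ((2 * l) ^ ?n) powr (1 - \<epsilon>))"
    by (simp only: power_mult_distrib mult_ac)
   \<comment> \<open>The enlarged local cube contributes the power \<epsilon> of the volume and
     Hoelder's inequality the power 1 - \<epsilon>; together they restore the full volume.\<close>
   also have "((2 * l) powr \<epsilon>) ^ ?n * ((2 * l) ^ ?n) powr (1 - \<epsilon>) = (2 * l) ^ ?n"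
   proof -
    have "((2 * l) powr \<epsilon>) ^ ?n = ((2 * l) ^ ?n) powr \<epsilon>"
    proof -
     have "((2 * l) powr \<epsilon>) ^ ?n = ((2 * l) powr \<epsilon>) powr real ?n" using l by (intro powr_realpow[symmetric]) auto
     also have "\<dots> = ((2 * l) powr real ?n) powr \<epsilon>" by (simp only: powr_powr mult.commute)
     also have "(2 * l) powr real ?n = (2 * l) ^ ?n" using l by (intro powr_realpow) auto
     finally show ?thesis .
    qed
    then have "((2 * l) powr \<epsilon>) ^ ?n * ((2 * l) ^ ?n) powr (1 - \<epsilon>) = ((2 * l) ^ ?n) powr (\<epsilon> + (1 - \<epsilon>))"
     by (simp only: powr_add)
    also have "\<dots> = (2 * l) ^ ?n" using l by simp
    finally show ?thesis .
   qed
   finally show "(A * n2 f * n2 g) * ((2 * l) ^ ?n) powr (1 - \<epsilon>) \<le> A * (2 * ?D) ^ ?n * t * (2 * l) ^ ?n"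
    by (simp only: mult_ac)
  qed
  finally show ?thesis .
 qed
qed

text \<open>A far term needs only one argument that vanishes on the cube of radius R. Splitting both
  functions at that cube and regrouping thus leaves one local term, for
  \<open>local_estimate\<close>, and two far terms, for \<open>far\<close>.\<close>

theorem sharp:
 assumes f: "f \<in> L2" "bounded {y. f y \<noteq> 0}" and g: "g \<in> L2" "bounded {y. g y \<noteq> 0}"
  and l: "0 < l" and ab: "0 \<le> a" "0 \<le> b"
  and a: "\<And>j. (sq_int (cb x0 (2 ^ j * l)) f) \<le> ennreal (a\<^sup>2 * (2 * (2 ^ j * l)) ^ CARD('n))"
  and b: "\<And>j. (sq_int (cb x0 (2 ^ j * l)) g) \<le> ennreal (b\<^sup>2 * (2 * (2 ^ j * l)) ^ CARD('n))"
 shows "\<exists>\<kappa>. (abs_int (cb x0 l) (\<lambda>x. B f g x - \<kappa>)) \<le>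
   ennreal (sharp_const * a * b * (2 * l) ^ CARD('n))"
proof -
 let ?n = "CARD('n)"
 \<comment> \<open>The least radius meeting both requirements of \<open>far\<close>. It is rounded
   up to 2^(k+1) l, less than a factor 2 above it, because the bounds by a and b are given on dyadic
   dilates.\<close>
 define R1 where "R1 = max (2 * l) (2 * (2 * real ?n * l) powr \<epsilon> / c)"
 obtain N :: nat where "R1 / l < 2 ^ N" using real_arch_pow[where x=2] by auto
 then have "R1 \<le> 2 ^ N * l" using l by (simp add: field_simps)
 moreover have "\<not> R1 \<le> 2 ^ 0 * l" using l by (simp add: R1_def not_le less_max_iff_disj)
 ultimately obtain k where k: "\<not> R1 \<le> 2 ^ k * l" "R1 \<le> 2 ^ Suc k * l"
  using first_success[of "\<lambda>m. R1 \<le> 2 ^ m * l" N] by blast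
 define R where "R = 2 ^ Suc k * l"
 have R: "0 < R" "R1 \<le> R" "R \<le> 2 * R1" using k l by (auto simp: R_def)
 have R2: "2 * l \<le> R" "(2 * real ?n * l) powr \<epsilon> \<le> c * (R / 2)"
 proof -
  show "2 * l \<le> R" using R by (simp add: R1_def)
  have "2 * (2 * real ?n * l) powr \<epsilon> / c \<le> R" using R by (simp add: R1_def)
  then show "(2 * real ?n * l) powr \<epsilon> \<le> c * (R / 2)" using c by (simp add: field_simps)
 qed
 define f1 where "f1 x = indicator (cb x0 R) x *\<^sub>R f x" for x
 define f2 where "f2 x = indicator (- cb x0 R) x *\<^sub>R f x" for x
 define g1 where "g1 x = indicator (cb x0 R) x *\<^sub>R g x" for x
 define g2 where "g2 x = indicator (- cb x0 R) x *\<^sub>R g x" for x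
 have sc: "- cb x0 R \<in> sets lebesgue" using sets.compl_sets[OF sets_cb(2)[of x0 R]] by (simp add: Compl_eq_Diff_UNIV)
 have L: "f1 \<in> L2" "f2 \<in> L2" "g1 \<in> L2" "g2 \<in> L2"
  unfolding f1_def[abs_def] f2_def[abs_def] g1_def[abs_def] g2_def[abs_def] by (intro L2_indicator f g sc sets_cb)+
 have bd: "bounded {y. f1 y \<noteq> 0}" "bounded {y. f2 y \<noteq> 0}" "bounded {y. g1 y \<noteq> 0}" "bounded {y. g2 y \<noteq> 0}"
  by (rule bounded_subset[OF f(2)] bounded_subset[OF g(2)]; auto simp: f1_def f2_def g1_def g2_def)+
 have le: "norm (f1 y) \<le> norm (f y)" "norm (f2 y) \<le> norm (f y)" "norm (g1 y) \<le> norm (g y)" "norm (g2 y) \<le> norm (g y)" for y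
  by (auto simp: f1_def f2_def g1_def g2_def indicator_def)
 have ff: "f = (\<lambda>x. 1 * f1 x + 1 * f2 x)" "g = (\<lambda>x. 1 * g1 x + 1 * g2 x)"
  by (auto simp: f1_def f2_def g1_def g2_def indicator_def)
 have split: "AE x in lebesgue. B f g x = B f1 g1 x + (B f1 g2 x + B f2 g x)"
 proof -
  have "AE x in lebesgue. B f g x = B f1 g x + B f2 g x"
   using Blin1[OF L(1,2) g(1), of 1 1] unfolding ff(1)[symmetric] by simp
  moreover have "AE x in lebesgue. B f1 g x = B f1 g1 x + B f1 g2 x"
   using Blin2[OF L(3,4) L(1), of 1 1] unfolding ff(2)[symmetric] by simp
  ultimately show ?thesis by eventually_elim simp
 qed
 have sz: "2 ^ Suc m * R = 2 ^ (Suc m + Suc k) * l" for m by (simp add: R_def power_add)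
 have If: "I1 x0 (2 ^ Suc m * R) h \<le> a * (2 * (2 ^ Suc m * R)) ^ ?n" if h: "h \<in> L2" "\<And>y. norm (h y) \<le> norm (f y)" for h m
  unfolding sz by (rule I1_le(1)[OF f(1) h ab(1) _ a]) (use l in simp)
 have Ig: "I1 x0 (2 ^ Suc m * R) h \<le> b * (2 * (2 ^ Suc m * R)) ^ ?n" if h: "h \<in> L2" "\<And>y. norm (h y) \<le> norm (g y)" for h m
  unfolding sz by (rule I1_le(1)[OF g(1) h ab(2) _ b]) (use l in simp)
 have off: "(\<forall>y\<in>cb x0 R. f1 y = 0) \<or> (\<forall>y\<in>cb x0 R. g2 y = 0)" "(\<forall>y\<in>cb x0 R. f2 y = 0) \<or> (\<forall>y\<in>cb x0 R. g y = 0)"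
  by (auto simp: g2_def f2_def)
 obtain Z1 where Z1: "AE x in lebesgue. x \<notin> Z1" "\<forall>x\<in>cb x0 l - Z1. \<forall>x'\<in>cb x0 l - Z1.
  norm (B f1 g2 x - B f1 g2 x') \<le> far_const * l powr s * R powr (- s / \<epsilon>) * a * b"
  using far[OF L(1) bd(1) L(4) bd(4) l R2 off(1) If[OF L(1) le(1)] Ig[OF L(4) le(4)] ab] by blast
 obtain Z2 where Z2: "AE x in lebesgue. x \<notin> Z2" "\<forall>x\<in>cb x0 l - Z2. \<forall>x'\<in>cb x0 l - Z2.
  norm (B f2 g x - B f2 g x') \<le> far_const * l powr s * R powr (- s / \<epsilon>) * a * b"
  using far[OF L(2) bd(2) g l R2 off(2) If[OF L(2) le(2)] Ig[OF g(1) order_refl] ab] by blast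
 define F where "F = far_const * far_scale * a * b"
 have FF: "far_const * l powr s * R powr (- s / \<epsilon>) * a * b \<le> F"
 proof -
  have "far_const * (l powr s * R powr (- s / \<epsilon>)) * a * b \<le> far_const * far_scale * a * b"
   using far_scale[OF l R(1) R2(2)] far_const_nonneg ab by (intro mult_right_mono mult_left_mono) auto
  then show ?thesis by (simp only: F_def mult.assoc)
 qed
 have F0: "0 \<le> F" unfolding F_def far_scale_def using far_const_nonneg ab by simp
 have ne: "\<exists>x'. x' \<in> cb x0 l - Z1 - Z2"
 proof (rule ccontr)
  assume no: "\<not> ?thesis"
  have "AE x in lebesgue. x \<notin> cb x0 l" using Z1(1) Z2(1) by eventually_elim (use no in blast)
  then have "vol (cb x0 l) = 0"
   by (subst (asm) AE_iff_measurable[where N="cb x0 l"]) auto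
  then show False using emeasure_cb_pos(1)[OF l] by blast
 qed
 then obtain x' where x': "x' \<in> cb x0 l - Z1 - Z2" by blast
 \<comment> \<open>Each far term varies by at most F on the cube, so its value at a single point off
   the null sets may be subtracted.\<close>
 define \<kappa> where "\<kappa> = B f1 g2 x' + B f2 g x'"
 have "AE x in lebesgue. ennreal (norm (B f g x - \<kappa>)) * indicator (cb x0 l) x \<le>
  ennreal (norm (B f1 g1 x)) * indicator (cb x0 l) x + ennreal (2 * F) * indicator (cb x0 l) x"
  using split Z1(1) Z2(1)
 proof eventually_elim
  case (elim x)
  show ?case
  proof (cases "x \<in> cb x0 l")
   case True
   have "norm (B f1 g2 x - B f1 g2 x') \<le> F" "norm (B f2 g x - B f2 g x') \<le> F"
    using Z1(2)[rule_format, of x x'] Z2(2)[rule_format, of x x'] True elim(2,3) x' FF by auto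
   moreover have e: "B f g x - \<kappa> = B f1 g1 x + ((B f1 g2 x - B f1 g2 x') + (B f2 g x - B f2 g x'))"
    unfolding elim(1) \<kappa>_def by simp
   ultimately have "norm (B f g x - \<kappa>) \<le> norm (B f1 g1 x) + 2 * F"
    unfolding e
    using norm_triangle_ineq[of "B f1 g1 x" "(B f1 g2 x - B f1 g2 x') + (B f2 g x - B f2 g x')"]
     norm_triangle_ineq[of "B f1 g2 x - B f1 g2 x'" "B f2 g x - B f2 g x'"] by linarith
   then have "ennreal (norm (B f g x - \<kappa>)) \<le> ennreal (norm (B f1 g1 x) + 2 * F)" by (rule ennreal_leI)
   then show ?thesis using True F0 by (simp add: ennreal_plus)
  qed simp
 qed
 then have "abs_int (cb x0 l) (\<lambda>x. B f g x - \<kappa>) \<le>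
  (\<integral>\<^sup>+x. ennreal (norm (B f1 g1 x)) * indicator (cb x0 l) x + ennreal (2 * F) * indicator (cb x0 l) x \<partial>lebesgue)"
  by (rule nn_integral_mono_AE)
 also have "\<dots> = abs_int (cb x0 l) (B f1 g1) + ennreal (2 * F) * vol (cb x0 l)"
 proof -
  have [measurable]: "B f1 g1 \<in> bmeas" by (intro Bm L)
  show ?thesis by (subst nn_integral_add) (auto simp: nn_integral_cmult_indicator)
 qed
 also have "\<dots> \<le> ennreal (A * (2 * radius_const) ^ ?n * (a * b) * (2 * l) ^ ?n) + ennreal (2 * F) * ennreal ((2 * l) ^ ?n)"
 proof (intro add_mono mult_left_mono)
  show "vol (cb x0 l) \<le> ennreal ((2 * l) ^ ?n)" using l by (subst emeasure_cb) auto
  show "abs_int (cb x0 l) (B f1 g1) \<le>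
   ennreal (A * (2 * radius_const) ^ ?n * (a * b) * (2 * l) ^ ?n)"
  proof (rule local_estimate[OF L(1) bd(1) L(3) bd(3) l])
   have n1: "(n2 f1)\<^sup>2 \<le> a\<^sup>2 * (2 * R) ^ ?n" "(n2 g1)\<^sup>2 \<le> b\<^sup>2 * (2 * R) ^ ?n"
    using I1_le(2)[OF f(1) f(1) order_refl ab(1) R(1), of x0] a[of "Suc k"]
     I1_le(2)[OF g(1) g(1) order_refl ab(2) R(1), of x0] b[of "Suc k"]
    by (simp_all only: R_def[symmetric] f1_def[abs_def] g1_def[abs_def])
   have "(n2 f1 * n2 g1)\<^sup>2 \<le> (a\<^sup>2 * (2 * R) ^ ?n) * (b\<^sup>2 * (2 * R) ^ ?n)"
    unfolding power_mult_distrib using n1 R by (intro mult_mono) auto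
   also have "\<dots> = (a * b * (2 * R) ^ ?n)\<^sup>2"
   proof -
    have "(x\<^sup>2 * z) * (y\<^sup>2 * z) = (x * y * z)\<^sup>2" for x y z :: real by (simp add: power2_eq_square)
    then show ?thesis .
   qed
   finally have "(n2 f1 * n2 g1)\<^sup>2 \<le> (a * b * (2 * R) ^ ?n)\<^sup>2" .
   then show "n2 f1 * n2 g1 \<le> a * b * (2 * R) ^ ?n" by (rule power2_le_imp_le) (use ab R in simp)
   show "0 \<le> a * b" using ab by simp
   show "0 < R" by (rule R)
   have R3: "R \<le> max (4 * l) (4 * (2 * real ?n) powr \<epsilon> / c * l powr \<epsilon>)"
   proof -
    have "(2 * real ?n * l) powr \<epsilon> = (2 * real ?n) powr \<epsilon> * l powr \<epsilon>" using l by (intro powr_mult)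
    then have "R1 = max (2 * l) (2 * ((2 * real ?n) powr \<epsilon> * l powr \<epsilon>) / c)" by (simp only: R1_def)
    then have "2 * R1 = max (4 * l) (4 * (2 * real ?n) powr \<epsilon> / c * l powr \<epsilon>)" by (simp add: max_def)
    then show ?thesis using R(3) by simp
   qed
   have C3: "4 \<le> radius_const" "4 * (2 * real ?n) powr \<epsilon> / c \<le> radius_const" by (simp_all add: radius_const_def)
   have x1: "4 * l \<le> radius_const * l" using C3(1) l by (intro mult_right_mono) auto
   have x2: "4 * (2 * real ?n) powr \<epsilon> / c * l powr \<epsilon> \<le> radius_const * l powr \<epsilon>" using C3(2) by (intro mult_right_mono) auto
   show "R \<le> radius_const * l \<or> R \<le> radius_const * l powr \<epsilon>" using R3 x1 x2 by linarith
   assume "1 \<le> l"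
   then have "l powr \<epsilon> \<le> l powr 1" using \<epsilon> by (intro powr_mono) auto
   then have "radius_const * l powr \<epsilon> \<le> radius_const * l" using C3(1) l by (intro mult_left_mono) auto
   then show "R \<le> radius_const * l" using R3 x1 x2 by linarith
  qed
 qed auto
 also have "\<dots> = ennreal (sharp_const * a * b * (2 * l) ^ ?n)"
 proof -
  have nn: "0 \<le> A * (2 * radius_const) ^ ?n * (a * b) * (2 * l) ^ ?n" "0 \<le> 2 * F * (2 * l) ^ ?n"
   using A ab l F0 by (auto intro!: mult_nonneg_nonneg simp: radius_const_def)
  have "ennreal (2 * F) * ennreal ((2 * l) ^ ?n) = ennreal (2 * F * (2 * l) ^ ?n)" using F0 l by (intro ennreal_mult[symmetric]) auto
  moreover have "sharp_const * a * b * (2 * l) ^ ?n = A * (2 * radius_const) ^ ?n * (a * b) * (2 * l) ^ ?n + 2 * F * (2 * l) ^ ?n"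
   unfolding sharp_const_def F_def by (simp add: distrib_left distrib_right mult_ac)
  ultimately show ?thesis using nn by (simp only: ennreal_plus)
 qed
 finally show ?thesis by blast
qed

end

subsection \<open>From the hypotheses to the kernel operator\<close>

lemma Lp_norm_alt: "Lp_norm p w f = epowr (pow_int (wmeas w) p f) (1 / p)"
 by (simp add: Lp_norm_def)

lemma fst_weighted_Lp:
 assumes p: "0 < p"
 shows "f \<in> fst (weighted_Lp p w) \<longleftrightarrow> f \<in> bmeas \<and> (pow_int (wmeas w) p f) < \<infinity>"
 unfolding weighted_Lp_def Lp_norm_alt using p epowr_less_top_iff[of "1 / p"] by simp

lemma snd_weighted_Lp: "snd (weighted_Lp p w) = Lp_norm p w"
 by (simp add: weighted_Lp_def)

lemma Lp_norm_eq_0_iff: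
 assumes p: "0 < p" and f: "f \<in> bmeas" and w: "w \<in> bmeas"
 shows "Lp_norm p w f = 0 \<longleftrightarrow> (AE x in wmeas w. f x = 0)"
proof -
 have "Lp_norm p w f = 0 \<longleftrightarrow> (pow_int (wmeas w) p f) = 0"
  unfolding Lp_norm_alt using p by (simp add: epowr_eq_0_iff)
 also have "\<dots> \<longleftrightarrow> (AE x in wmeas w. ennreal (norm (f x) powr p) = 0)"
  using f by (intro nn_integral_0_iff_AE) auto
 also have "\<dots> \<longleftrightarrow> (AE x in wmeas w. f x = 0)" by (intro AE_cong) (auto simp: ennreal_eq_0_iff powr_eq_0_iff)
 finally show ?thesis .
qed

lemma wmeas_1: "wmeas (\<lambda>x. 1) = lebesgue"
 by (simp add: density_1)

lemma powr_two: "norm (z::complex) powr 2 = (norm z)\<^sup>2"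
 by (cases "z = 0") simp_all

lemma L2_iff: "f \<in> fst (Lp 2) \<longleftrightarrow> f \<in> L2"
proof -
 have "f \<in> fst (Lp 2) \<longleftrightarrow> f \<in> bmeas \<and> (\<integral>\<^sup>+x. ennreal ((norm (f x))\<^sup>2) \<partial>lebesgue) < \<infinity>"
  by (subst fst_weighted_Lp) (simp_all only: wmeas_1 powr_two zero_less_numeral)
 also have "\<dots> \<longleftrightarrow> f \<in> L2"
  unfolding L2_def integrable_iff_bounded by (auto simp: nn_integral_completion)
 finally show ?thesis .
qed

lemma fst_L2: "fst (Lp 2) = L2"
 using L2_iff by blast

lemma Lp2_norm: "f \<in> L2 \<Longrightarrow> Lp_norm 2 (\<lambda>x. 1) f = ennreal (n2 f)"
proof -
 assume f: "f \<in> L2"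
 have "(\<integral>\<^sup>+x. ennreal ((norm (f x))\<^sup>2) \<partial>lebesgue) = ennreal ((n2 f)\<^sup>2)"
  unfolding n2_square using f by (intro nn_integral_eq_integral) (auto simp: L2_def)
 then have "Lp_norm 2 (\<lambda>x. 1) f = epowr (ennreal ((n2 f)\<^sup>2)) (1 / 2)"
  unfolding Lp_norm_alt wmeas_1 powr_two by (simp only:)
 also have "\<dots> = ennreal (((n2 f)\<^sup>2) powr (1 / 2))" by (intro epowr_ennreal) auto
 also have "((n2 f)\<^sup>2) powr (1 / 2) = n2 f" by (simp add: powr_half_sqrt)
 finally show ?thesis .
qed

lemma represents_cong_AE:
 assumes h: "h \<in> bmeas" "h' \<in> bmeas" and ae: "AE x in lebesgue. h x = h' x"
  and rep: "represents h u"
 shows "represents h' u"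
 unfolding represents_def
proof (intro ballI)
 fix \<phi> :: "'a cfun" assume \<phi>: "\<phi> \<in> schwartz_space"
 have m: "(\<lambda>x. h x * \<phi> x) \<in> bmeas" "(\<lambda>x. h' x * \<phi> x) \<in> bmeas"
  using h schwartz_measurable[OF \<phi>] by auto
 have a: "AE x in lebesgue. h x * \<phi> x = h' x * \<phi> x" using ae by eventually_elim simp
 show "integrable lebesgue (\<lambda>x. h' x * \<phi> x) \<and> u \<phi> = (LINT x|lebesgue. h' x * \<phi> x)"
  using rep \<phi> integrable_cong_AE[OF m a] integral_cong_AE[OF m a] unfolding represents_def by auto
qed

locale Lp_extension =
 fixes T :: "'n::finite bilinear_op" and p :: real and B :: "'n cfun \<Rightarrow> 'n cfun \<Rightarrow> 'n cfun" and A :: real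
 assumes A: "0 \<le> A" and meas: "f \<in> L2 \<Longrightarrow> g \<in> L2 \<Longrightarrow> B f g \<in> bmeas"
  and bound: "f \<in> L2 \<Longrightarrow> g \<in> L2 \<Longrightarrow> pow_int lebesgue p (B f g) \<le> ennreal ((A * n2 f * n2 g) powr p)"
  and lin1: "f \<in> L2 \<Longrightarrow> h \<in> L2 \<Longrightarrow> g \<in> L2 \<Longrightarrow> AE x in lebesgue. B (\<lambda>x. a * f x + b * h x) g x = a * B f g x + b * B h g x"
  and lin2: "f \<in> L2 \<Longrightarrow> h \<in> L2 \<Longrightarrow> g \<in> L2 \<Longrightarrow> AE x in lebesgue. B g (\<lambda>x. a * f x + b * h x) x = a * B g f x + b * B g h x"
  and rep: "f \<in> schwartz_space \<Longrightarrow> g \<in> schwartz_space \<Longrightarrow> f \<in> L2 \<Longrightarrow> g \<in> L2 \<Longrightarrow> represents (B f g) (T f g)"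

text \<open>Seminorm zero becomes equality almost everywhere. In particular \<open>B f g\<close>
  itself, rather than some function equivalent to it, represents the distribution.\<close>

lemma extends_Lp:
 assumes ext: "extends_to_bounded T (Lp 2) (Lp 2) (Lp p)" and p: "0 < p"
 shows "\<exists>B A. Lp_extension T p B A"
proof -
 obtain B where B: "bounded_bilinear_operator (Lp 2) (Lp 2) (Lp p) B"
  and agree: "\<And>f g. f \<in> schwartz_space \<Longrightarrow> g \<in> schwartz_space \<Longrightarrow> \<exists>h\<in>fst (Lp p). Lp_norm p (\<lambda>x. 1) (\<lambda>x. B f g x - h x) = 0 \<and> represents h (T f g)"
  using ext unfolding extends_to_bounded_def snd_weighted_Lp by blast
 have Bm: "B f g \<in> bmeas" if "f \<in> L2" "g \<in> L2" for f g
  using B that fst_weighted_Lp[OF p] unfolding bounded_bilinear_operator_def fst_L2 by blast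
 have z: "AE x in lebesgue. F x = 0" if "Lp_norm p (\<lambda>x. 1) F = 0" "F \<in> bmeas" for F :: "'a cfun"
  using Lp_norm_eq_0_iff[OF p that(2), of "\<lambda>x. 1"] that(1) unfolding wmeas_1 by simp
 obtain C :: real where C: "\<And>f g. f \<in> L2 \<Longrightarrow> g \<in> L2 \<Longrightarrow> Lp_norm p (\<lambda>x. 1) (B f g) \<le> ennreal C * Lp_norm 2 (\<lambda>x. 1) f * Lp_norm 2 (\<lambda>x. 1) g"
  using B unfolding bounded_bilinear_operator_def fst_L2 snd_weighted_Lp by blast
 define A where "A = max C 0"
 have "Lp_extension T p B A"
 proof (rule Lp_extension.intro)
  show "0 \<le> A" by (simp add: A_def)
  show "B f g \<in> bmeas" if "f \<in> L2" "g \<in> L2" for f g by (rule Bm[OF that])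
  show "pow_int lebesgue p (B f g) \<le> ennreal ((A * n2 f * n2 g) powr p)" if fg: "f \<in> L2" "g \<in> L2" for f g
  proof -
   have "Lp_norm p (\<lambda>x. 1) (B f g) \<le> ennreal C * Lp_norm 2 (\<lambda>x. 1) f * Lp_norm 2 (\<lambda>x. 1) g" by (rule C[OF fg])
   also have "\<dots> \<le> ennreal A * ennreal (n2 f) * ennreal (n2 g)"
    unfolding Lp2_norm[OF fg(1)] Lp2_norm[OF fg(2)] by (intro mult_right_mono ennreal_leI) (auto simp: A_def)
   also have "\<dots> = ennreal (A * n2 f * n2 g)" by (simp add: ennreal_mult A_def)
   finally have "epowr (pow_int lebesgue p (B f g)) (1 / p) \<le> ennreal (A * n2 f * n2 g)"
    unfolding Lp_norm_alt wmeas_1 .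
   then have "epowr (epowr (pow_int lebesgue p (B f g)) (1 / p)) p \<le> epowr (ennreal (A * n2 f * n2 g)) p"
    by (rule epowr_mono[OF p])
   then show ?thesis using p by (simp add: epowr_epowr epowr_ennreal A_def)
  qed
  show "AE x in lebesgue. B (\<lambda>x. a * f x + b * h x) g x = a * B f g x + b * B h g x" if fg: "f \<in> L2" "h \<in> L2" "g \<in> L2" for f h g a b
  proof -
   have "Lp_norm p (\<lambda>x. 1) (\<lambda>x. B (\<lambda>x. a * f x + b * h x) g x - (a * B f g x + b * B h g x)) = 0"
    using B fg unfolding bounded_bilinear_operator_def fst_L2 snd_weighted_Lp by blast
   moreover have "(\<lambda>x. B (\<lambda>x. a * f x + b * h x) g x - (a * B f g x + b * B h g x)) \<in> bmeas"
    using Bm[OF L2_lincomb[OF fg(1,2)] fg(3)] Bm[OF fg(1,3)] Bm[OF fg(2,3)] by auto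
   ultimately have "AE x in lebesgue. B (\<lambda>x. a * f x + b * h x) g x - (a * B f g x + b * B h g x) = 0" by (rule z)
   then show ?thesis by eventually_elim simp
  qed
  show "AE x in lebesgue. B g (\<lambda>x. a * f x + b * h x) x = a * B g f x + b * B g h x" if fg: "f \<in> L2" "h \<in> L2" "g \<in> L2" for f h g a b
  proof -
   have "Lp_norm p (\<lambda>x. 1) (\<lambda>x. B g (\<lambda>x. a * f x + b * h x) x - (a * B g f x + b * B g h x)) = 0"
    using B fg unfolding bounded_bilinear_operator_def fst_L2 snd_weighted_Lp by blast
   moreover have "(\<lambda>x. B g (\<lambda>x. a * f x + b * h x) x - (a * B g f x + b * B g h x)) \<in> bmeas"
    using Bm[OF fg(3) L2_lincomb[OF fg(1,2)]] Bm[OF fg(3,1)] Bm[OF fg(3,2)] by auto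
   ultimately have "AE x in lebesgue. B g (\<lambda>x. a * f x + b * h x) x - (a * B g f x + b * B g h x) = 0" by (rule z)
   then show ?thesis by eventually_elim simp
  qed
  show "represents (B f g) (T f g)" if sp: "f \<in> schwartz_space" "g \<in> schwartz_space" and fg: "f \<in> L2" "g \<in> L2" for f g
  proof -
   obtain h where h: "h \<in> fst (Lp p)" "Lp_norm p (\<lambda>x. 1) (\<lambda>x. B f g x - h x) = 0" "represents h (T f g)"
    using agree[OF sp] by blast
   have hm: "h \<in> bmeas" using h(1) fst_weighted_Lp[OF p] by blast
   have "AE x in lebesgue. B f g x - h x = 0" by (rule z[OF h(2)]) (use Bm[OF fg] hm in auto)
   then have "AE x in lebesgue. h x = B f g x" by eventually_elim simp
   then show ?thesis by (rule represents_cong_AE[OF hm Bm[OF fg] _ h(3)])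
  qed
 qed
 then show ?thesis by blast
qed

text \<open>The fundamental lemma on growing cubes; local integrability is all that it requires of
  the two functions.\<close>

lemma represents_unique:
 fixes h h' :: "'n::finite cfun"
 assumes rep: "represents h u" "represents h' u"
  and li: "\<And>R. set_integrable lebesgue (cb 0 R) h" "\<And>R. set_integrable lebesgue (cb 0 R) h'"
 shows "AE x in lebesgue. h x = h' x"
proof -
 have "AE x in lebesgue. x \<in> interior (cb 0 (real k)) \<longrightarrow> h x - h' x = 0" for k :: nat
 proof (rule fundamental_lemma)
  show "open (interior (cb (0::real^'n) (real k)))" by simp
  show "bounded (interior (cb (0::real^'n) (real k)))" by (rule bounded_subset[OF bounded_cb interior_subset])
  show "set_integrable lebesgue (interior (cb 0 (real k))) (\<lambda>x. h x - h' x)"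
   by (rule set_integrable_subset[OF set_integral_diff(1)[OF li]]) (auto intro: open_lebesgue interior_subset[THEN subsetD])
  fix \<phi> :: "'n cfun" assume "\<phi> \<in> test_functions"
  then have \<phi>: "\<phi> \<in> schwartz_space" using test_in_schwartz by blast
  have i: "integrable lebesgue (\<lambda>x. h x * \<phi> x)" "integrable lebesgue (\<lambda>x. h' x * \<phi> x)"
   and e: "(LINT x|lebesgue. h x * \<phi> x) = (LINT x|lebesgue. h' x * \<phi> x)"
   using rep \<phi> by (auto simp: represents_def)
  have "(LINT x|lebesgue. h x * \<phi> x - h' x * \<phi> x) = 0" using i e by simp
  then show "(LINT x|lebesgue. (h x - h' x) * \<phi> x) = 0" by (simp add: left_diff_distrib)
 qed
 then have "AE x in lebesgue. \<forall>k::nat. x \<in> interior (cb 0 (real k)) \<longrightarrow> h x - h' x = 0" by (subst AE_all_countable) (rule allI)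
 then show ?thesis
 proof eventually_elim
  case (elim x)
  obtain R where R: "R > 0" "x \<in> cb 0 R" using bounded_subset_cb[where S="{x}" and x=0] by auto
  obtain k :: nat where "R < real k" using reals_Archimedean2 by blast
  then have "x \<in> interior (cb 0 (real k))" using R(2) by (auto simp: mem_cb interior_cb intro: le_less_trans)
  from elim[rule_format, OF this] show ?case by simp
 qed
qed

text \<open>The two given extensions are unrelated a priori. On test functions both represent the
  same distribution and hence agree almost everywhere, which puts the L1 bound and the
  L^(1/\<epsilon>) bound on a single operator.\<close>

lemma kernel_operator_exists:
 fixes T :: "'n::finite bilinear_op"
  and K :: "(real ^ 'n) \<times> (real ^ 'n) \<times> (real ^ 'n) \<Rightarrow> complex"
  and \<epsilon> s c C :: real
 assumes Kint: "locally_integrable_on K (- triple_diagonal)"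
  and ker: "associated_kernel T K"
  and par: "0 < \<epsilon>" "\<epsilon> < 1" "0 < s" "s \<le> 1" "0 < c" "0 < C"
  and reg: "\<And>x x' y z. (x, y, z) \<notin> triple_diagonal \<Longrightarrow> (x', y, z) \<notin> triple_diagonal \<Longrightarrow>
      norm (x - x') powr \<epsilon> \<le> c * (norm (x - y) + norm (x - z)) \<Longrightarrow>
      norm (K (x, y, z) - K (x', y, z)) \<le>
       C * (norm (x - x') powr s /
        (norm (x - y) + norm (x - z)) powr (2 * real CARD('n) + s / \<epsilon>))"
  and e1: "extends_to_bounded T (Lp 2) (Lp 2) (Lp 1)"
  and e2: "extends_to_bounded T (Lp 2) (Lp 2) (Lp (1 / \<epsilon>))"
 obtains B A where "kernel_operator B K A \<epsilon> s c C"
  "\<And>f g. f \<in> schwartz_space \<Longrightarrow> g \<in> schwartz_space \<Longrightarrow> f \<in> L2 \<Longrightarrow> g \<in> L2 \<Longrightarrow> represents (B f g) (T f g)"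
proof -
 obtain B A1 where "Lp_extension T 1 B A1" using extends_Lp[OF e1 zero_less_one] by blast
 then interpret E1: Lp_extension T 1 B A1 .
 have ep: "0 < 1 / \<epsilon>" using par by simp
 obtain B2 A2 where "Lp_extension T (1 / \<epsilon>) B2 A2" using extends_Lp[OF e2 ep] by blast
 then interpret E2: Lp_extension T "1 / \<epsilon>" B2 A2 .
 note A1 = E1.A and Bm = E1.meas and Bb = E1.bound and Bl1 = E1.lin1 and Bl2 = E1.lin2 and Br = E1.rep
 note A2 = E2.A and B2m = E2.meas and B2b = E2.bound and B2r = E2.rep
 define A where "A = max A1 A2"
 have A: "0 \<le> A" "A1 \<le> A" "A2 \<le> A" using A1 by (auto simp: A_def)
 have Bnn: "(\<integral>\<^sup>+x. ennreal (norm (B f g x)) \<partial>lebesgue) \<le> ennreal (A1 * n2 f * n2 g)" if "f \<in> L2" "g \<in> L2" for f g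
  using Bb[OF that] A1 by simp
 have Bi: "integrable lebesgue (B f g)" if fg: "f \<in> L2" "g \<in> L2" for f g
  by (rule integrableI_bounded[OF Bm[OF fg]]) (rule le_less_trans[OF Bnn[OF fg]], simp)
 have mono: "A' * n2 f * n2 g \<le> A * n2 f * n2 g" if "A' \<le> A" for A' f g
  using that by (intro mult_right_mono) auto
 have "kernel_operator B K A \<epsilon> s c C"
 proof (rule kernel_operator.intro)
  show "0 \<le> A" by (rule A)
  show "integrable lebesgue (B f g)" if "f \<in> L2" "g \<in> L2" for f g by (rule Bi[OF that])
  show "(LINT x|lebesgue. norm (B f g x)) \<le> A * n2 f * n2 g" if fg: "f \<in> L2" "g \<in> L2" for f g
  proof -
   have "ennreal (LINT x|lebesgue. norm (B f g x)) \<le> ennreal (A1 * n2 f * n2 g)"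
    using Bnn[OF fg] nn_integral_eq_integral[OF integrable_norm[OF Bi[OF fg]]] by simp
   then have "(LINT x|lebesgue. norm (B f g x)) \<le> A1 * n2 f * n2 g" using A1 by (subst (asm) ennreal_le_iff) auto
   then show ?thesis using mono[OF A(2), of f g] by linarith
  qed
  show "pow_int lebesgue (1 / \<epsilon>) (B f g) \<le> ennreal ((A * n2 f * n2 g) powr (1 / \<epsilon>))"
   if t: "f \<in> test_functions" "g \<in> test_functions" for f g
  proof -
   have L: "f \<in> L2" "g \<in> L2" using t by (auto intro: test_L2)
   have S: "f \<in> schwartz_space" "g \<in> schwartz_space" using t test_in_schwartz by auto
   have "AE x in lebesgue. B f g x = B2 f g x"
   proof (rule represents_unique[OF Br[OF S L] B2r[OF S L]])
    fix R
    show "set_integrable lebesgue (cb 0 R) (B f g)" unfolding set_integrable_def using Bi[OF L] by (intro integrable_mult_indicator) auto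
    have [measurable]: "B2 f g \<in> bmeas" by (rule B2m[OF L])
    show "set_integrable lebesgue (cb 0 R) (B2 f g)" unfolding set_integrable_def
    proof (rule integrableI_bounded)
     have "(\<integral>\<^sup>+x. ennreal (norm (indicator (cb 0 R) x *\<^sub>R B2 f g x)) \<partial>lebesgue) \<le>
      (\<integral>\<^sup>+x. indicator (cb 0 R) x + ennreal (norm (B2 f g x) powr (1 / \<epsilon>)) \<partial>lebesgue)"
     proof (rule nn_integral_mono)
      fix x
      \<comment> \<open>As 1/\<epsilon> exceeds 1, this comparison makes the L^(1/\<epsilon>)
        function locally integrable.\<close>
      have "norm (B2 f g x) \<le> 1 + norm (B2 f g x) powr (1 / \<epsilon>)"
      proof (cases "norm (B2 f g x) \<le> 1")
       case False
       then have "norm (B2 f g x) powr 1 \<le> norm (B2 f g x) powr (1 / \<epsilon>)" using par by (intro powr_mono) auto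
       then show ?thesis using False by simp
      qed (simp add: add_increasing2)
      then have "ennreal (norm (B2 f g x)) \<le> ennreal (1 + norm (B2 f g x) powr (1 / \<epsilon>))" by (rule ennreal_leI)
      also have "\<dots> = 1 + ennreal (norm (B2 f g x) powr (1 / \<epsilon>))" by (simp add: ennreal_plus)
      finally show "ennreal (norm (indicator (cb 0 R) x *\<^sub>R B2 f g x)) \<le> indicator (cb 0 R) x + ennreal (norm (B2 f g x) powr (1 / \<epsilon>))"
       by (simp add: indicator_def)
     qed
     also have "\<dots> = vol (cb (0::real^'n) R) + pow_int lebesgue (1 / \<epsilon>) (B2 f g)"
      by (subst nn_integral_add) auto
     also have "\<dots> < \<infinity>"
      unfolding infinity_ennreal_def
      by (rule ennreal_add_less_top[THEN iffD2, OF conjI, OF emeasure_cb_pos(2)[unfolded infinity_ennreal_def] le_less_trans[OF B2b[OF L] ennreal_less_top]])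
     finally show "(\<integral>\<^sup>+x. ennreal (norm (indicator (cb 0 R) x *\<^sub>R B2 f g x)) \<partial>lebesgue) < \<infinity>" .
    qed measurable
   qed
   note ae = this
   have "pow_int lebesgue (1 / \<epsilon>) (B f g) = pow_int lebesgue (1 / \<epsilon>) (B2 f g)"
    by (rule nn_integral_cong_AE, use ae in eventually_elim) simp
   also have "\<dots> \<le> ennreal ((A2 * n2 f * n2 g) powr (1 / \<epsilon>))" by (rule B2b[OF L])
   also have "\<dots> \<le> ennreal ((A * n2 f * n2 g) powr (1 / \<epsilon>))"
    using mono[OF A(3), of f g] A2 ep by (intro ennreal_leI powr_mono2) auto
   finally show ?thesis .
  qed
  show "(LINT x|lebesgue. B f g x * \<phi> x) = (LINT x|lebesgue. (LINT (y, z)|lebesgue. K (x, y, z) * f y * g z) * \<phi> x)"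
   if t: "f \<in> test_functions" "g \<in> test_functions" "\<phi> \<in> test_functions" "supp \<phi> \<inter> (supp f \<inter> supp g) = {}" for f g \<phi>
  proof -
   have L: "f \<in> L2" "g \<in> L2" using t by (auto intro: test_L2)
   have S: "f \<in> schwartz_space" "g \<in> schwartz_space" "\<phi> \<in> schwartz_space" using t test_in_schwartz by auto
   have "T f g \<phi> = (LINT x|lebesgue. B f g x * \<phi> x)" using Br[OF S(1,2) L] S(3) by (simp add: represents_def)
   then show ?thesis using ker t unfolding associated_kernel_def by simp
  qed
 qed (fact par Kint Bl1 Bl2 reg)+
 then show thesis using Br by (rule that)
qed

subsection \<open>The extension to bounded functions\<close>

lemma set_integrable_const_cb:
 "set_integrable lebesgue (cb x R) (\<lambda>_. z :: 'b::{banach, second_countable_topology})"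
proof -
 have "vol (cb x R) < \<infinity>" by (rule emeasure_cb_pos)
 then show ?thesis by (simp add: set_integrable_def integrable_indicator_iff)
qed

lemma average_cb_dist_le:
 fixes h :: "'n::finite cfun"
 assumes R: "0 < R" and h: "set_integrable lebesgue (cb x R) h" and b: "0 \<le> b"
  and ae: "AE y in lebesgue. y \<in> cb x R \<longrightarrow> norm (h y - z) \<le> b"
 shows "norm (average (cb x R) h - z) \<le> b"
proof -
 have mp: "0 < measure lebesgue (cb x R)" using R by (subst measure_cb) auto
 have V: "vol (cb x R) \<noteq> 0" "vol (cb x R) \<noteq> top"
  using emeasure_cb_pos(1)[OF R] emeasure_cb_pos(2) by (auto simp: less_top[symmetric])
 have "ennreal (norm (average (cb x R) h - z)) * vol (cb x R) \<le>
  abs_int (cb x R) (\<lambda>y. h y - z)"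
  by (rule norm_average_le[OF sets_cb(2) mp emeasure_cb_pos(2) h])
 also have "\<dots> \<le> (\<integral>\<^sup>+y. ennreal b * indicator (cb x R) y \<partial>lebesgue)"
  by (rule nn_integral_mono_AE, use ae in eventually_elim) (auto simp: indicator_def ennreal_leI)
 also have "\<dots> = ennreal b * vol (cb x R)" by (rule nn_integral_cmult_indicator) simp
 finally have "vol (cb x R) * ennreal (norm (average (cb x R) h - z)) \<le> vol (cb x R) * ennreal b"
  by (simp only: mult.commute)
 then have "ennreal (norm (average (cb x R) h - z)) \<le> ennreal b" by (rule ennreal_mult_le_mult_iff[OF V, THEN iffD1])
 then show ?thesis using b by simp
qed

lemma average_cong_AE:
 assumes "f \<in> bmeas" "g \<in> bmeas" "Q \<in> sets lebesgue" "AE x in lebesgue. f x = g x"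
 shows "average Q f = average Q g"
proof -
 have "(LINT y:Q|lebesgue. f y) = (LINT y:Q|lebesgue. g y)"
  unfolding set_lebesgue_integral_def using assms by (intro integral_cong_AE) (auto elim: eventually_mono)
 then show ?thesis by (simp add: average_def)
qed

lemma average_lincomb:
 assumes "set_integrable lebesgue Q f" "set_integrable lebesgue Q g"
 shows "average Q (\<lambda>x. a * f x + b * g x) = a * average Q f + b * average Q g"
 using assms by (simp add: average_def scaleR_add_right mult.commute[of _ "_ /\<^sub>R _"] scaleR_conv_of_real algebra_simps)

lemma BMO_norm_shift:
 fixes F G :: "'n::finite cfun"
 assumes F: "\<And>x R. set_integrable lebesgue (cb x R) F" and Fm: "F \<in> bmeas"
  and Gm: "G \<in> bmeas"
  and ae: "AE x in lebesgue. G x = F x - c"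
 shows "BMO_norm G = BMO_norm F"
 unfolding BMO_norm_def
proof (rule SUP_cong[OF refl])
 fix Q :: "(real^'n) set" assume "Q \<in> cubes"
 then obtain x R where Q: "Q = cb x R" "0 < R" unfolding cubes_eq by blast
 have mp: "0 < measure lebesgue (cb x R)" using Q(2) by (subst measure_cb) auto
 have "average Q G = average Q (\<lambda>y. F y - c)" using ae Fm Gm Q by (intro average_cong_AE) auto
 also have "\<dots> = average Q F - c" unfolding Q
  by (rule average_diff_const(1)[OF sets_cb(2) emeasure_cb_pos(2) mp F])
 finally have a: "average Q G = average Q F - c" .
 show "eaverage Q (\<lambda>y. ennreal (norm (G y - average Q G))) = eaverage Q (\<lambda>y. ennreal (norm (F y - average Q F)))"
  unfolding eaverage_def a
  by (rule arg_cong2[where f="(/)", OF _ refl], rule nn_integral_cong_AE, use ae in eventually_elim) simp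
qed

lemma BMO_norm_AE_const:
 fixes G :: "'n::finite cfun"
 assumes "G \<in> bmeas" "AE x in lebesgue. G x = c"
 shows "BMO_norm G = 0"
proof -
 have "BMO_norm G = BMO_norm ((\<lambda>_. 0) :: 'n cfun)"
 proof (rule BMO_norm_shift[where c="-c"])
  show "set_integrable lebesgue (cb x R) (\<lambda>_. 0::complex)" for x :: "real^'n" and R by (rule set_integrable_const_cb)
 qed (use assms in auto)
 also have "\<dots> \<le> 0" unfolding BMO_norm_def
  by (rule SUP_least) (simp add: average_def eaverage_def set_lebesgue_integral_def)
 finally show ?thesis by simp
qed

definition trunc :: "nat \<Rightarrow> 'n::finite cfun \<Rightarrow> 'n cfun" where
 "trunc N f x = indicator (cb 0 (real N)) x *\<^sub>R f x"

lemma trunc_lincomb: "trunc N (\<lambda>x. a * f x + b * g x) = (\<lambda>x. a * trunc N f x + b * trunc N g x)"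
 by (auto simp: trunc_def indicator_def)

lemma trunc_bounded: "bounded {y. trunc N f y \<noteq> 0}"
 by (rule bounded_subset[OF bounded_cb[of 0 "real N"]]) (auto simp: trunc_def indicator_def)

lemma eventually_in_cb: "eventually (\<lambda>N::nat. x \<in> cb 0 (real N)) sequentially"
proof -
 obtain R where R: "R > 0" "x \<in> cb 0 R" using bounded_subset_cb[where S="{x}" and x=0] by auto
 obtain n0 :: nat where n0: "R \<le> real n0" using real_arch_simple by blast
 have "x \<in> cb 0 (real N)" if "n0 \<le> N" for N
  using R(2) cb_mono[where x=0 and R=R and R'="real N"] n0 that by (auto simp: subset_iff)
 then show ?thesis by (rule eventually_sequentiallyI)
qed

lemma trunc_L2_tendsto:
 assumes f: "f \<in> L2" shows "trunc N f \<in> L2" "(\<lambda>N. n2 (\<lambda>x. trunc N f x - f x)) \<longlonglongrightarrow> 0"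
proof -
 show "trunc N f \<in> L2" for N unfolding trunc_def[abs_def] using f by (intro L2_indicator) auto
 then have m: "trunc N f \<in> bmeas" for N by (auto simp: L2_def)
 have fm: "f \<in> bmeas" using f by (simp add: L2_def)
 have "(\<lambda>N. LINT x|lebesgue. (norm (trunc N f x - f x))\<^sup>2) \<longlonglongrightarrow> (LINT (x::real^'a)|lebesgue. (0::real))"
 proof (rule integral_dominated_convergence[where w="\<lambda>x. (norm (f x))\<^sup>2"])
  show "integrable lebesgue (\<lambda>x. (norm (f x))\<^sup>2)" using f by (simp add: L2_def)
  show "AE x in lebesgue. norm ((norm (trunc N f x - f x))\<^sup>2) \<le> (norm (f x))\<^sup>2" for N
   by (rule AE_I2) (auto simp: trunc_def indicator_def)
  show "AE x in lebesgue. (\<lambda>N. (norm (trunc N f x - f x))\<^sup>2) \<longlonglongrightarrow> 0"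
  proof (rule AE_I2)
   fix x
   have "eventually (\<lambda>N. (norm (trunc N f x - f x))\<^sup>2 = 0) sequentially"
    using eventually_in_cb[of x] by eventually_elim (simp add: trunc_def)
   then show "(\<lambda>N. (norm (trunc N f x - f x))\<^sup>2) \<longlonglongrightarrow> 0" by (rule tendsto_eventually)
  qed
 qed (use m fm in auto)
 then have "(\<lambda>N. sqrt (LINT x|lebesgue. (norm (trunc N f x - f x))\<^sup>2)) \<longlonglongrightarrow> sqrt 0"
  by (intro tendsto_real_sqrt) simp
 then show "(\<lambda>N. n2 (\<lambda>x. trunc N f x - f x)) \<longlonglongrightarrow> 0" by (simp add: n2_def)
qed

lemma Linf_bound:
 assumes "f \<in> fst Linf"
 shows "f \<in> bmeas" "AE x in lebesgue. norm (f x) \<le> enn2real (Linf_norm f)"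
  "Linf_norm f = ennreal (enn2real (Linf_norm f))"
proof -
 show m: "f \<in> bmeas" using assms by (simp add: Linf_def)
 show e: "Linf_norm f = ennreal (enn2real (Linf_norm f))" using assms by (simp add: Linf_def ennreal_enn2real)
 have "AE x in lebesgue. ennreal (norm (f x)) \<le> Linf_norm f" unfolding Linf_norm_def by (rule esssup_AE)
 then show "AE x in lebesgue. norm (f x) \<le> enn2real (Linf_norm f)"
 proof eventually_elim
  case (elim x)
  then have "ennreal (norm (f x)) \<le> ennreal (enn2real (Linf_norm f))" using e by simp
  then show ?case by (subst (asm) ennreal_le_iff) auto
 qed
qed

lemma AE_bounded_L2:
 assumes [measurable]: "h \<in> bmeas" and ae: "AE x in lebesgue. norm (h x) \<le> a"
  and a: "0 \<le> a" and E: "E \<in> sets lebesgue" "vol E < \<infinity>" "\<And>x. x \<notin> E \<Longrightarrow> h x = 0"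
 shows "h \<in> L2"
proof -
 have i: "integrable lebesgue (\<lambda>x. a\<^sup>2 * indicator E x :: real)"
  using E by (intro integrable_mult_right integrable_real_indicator) auto
 have "integrable lebesgue (\<lambda>x. (norm (h x))\<^sup>2)"
 proof (rule Bochner_Integration.integrable_bound[OF i])
  show "AE x in lebesgue. norm ((norm (h x))\<^sup>2) \<le> norm (a\<^sup>2 * indicator E x :: real)"
   using ae
  proof eventually_elim
   case (elim x)
   then have "(norm (h x))\<^sup>2 \<le> a\<^sup>2" by (intro power_mono) auto
   then show ?case using E(3)[of x] by (auto simp: indicator_def)
  qed
 qed measurable
 then show ?thesis by (simp add: L2_def)
qed

section \<open>Limits of normalised truncations for bounded functions\<close>

context kernel_operator
begin

lemma I1_bounded:
 assumes h: "h \<in> L2" and ae: "AE x in lebesgue. norm (h x) \<le> a" and R: "0 < R"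
 shows "I1 x0 R h \<le> a * (2 * R) ^ CARD('n)"
proof -
 have "I1 x0 R h \<le> (LINT y:cb x0 R|lebesgue. a)"
  unfolding set_lebesgue_integral_def
 proof (rule integral_mono_AE)
  show "integrable lebesgue (\<lambda>x. indicator (cb x0 R) x *\<^sub>R norm (h x))"
   using set_integrable_norm[OF L2_set_integrable_cb[OF h, of x0 R]] by (simp add: set_integrable_def)
  show "integrable lebesgue (\<lambda>x. indicator (cb x0 R) x *\<^sub>R a)"
   using set_integrable_const_cb[of x0 R a] by (simp add: set_integrable_def)
  show "AE x in lebesgue. indicator (cb x0 R) x *\<^sub>R norm (h x) \<le> indicator (cb x0 R) x *\<^sub>R a"
   using ae by eventually_elim (auto simp: indicator_def)
 qed
 also have "\<dots> = measure lebesgue (cb x0 R) *\<^sub>R a"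
  using emeasure_cb_pos(2)[of x0 R] by (intro set_integral_const) auto
 also have "\<dots> = a * (2 * R) ^ CARD('n)" using R by (subst measure_cb) auto
 finally show ?thesis .
qed

text \<open>Without the subtraction of the mean over the unit cube the contributions of distant points to
the truncations need not converge.\<close>

definition Bn :: "'n cfun \<Rightarrow> 'n cfun \<Rightarrow> nat \<Rightarrow> 'n cfun" where
 "Bn f g N x = B (trunc N f) (trunc N g) x - average (cb 0 1) (B (trunc N f) (trunc N g))"

text \<open>At points of divergence \<open>lim\<close> returns an arbitrary value; for bounded f and
  g these points form a null set.\<close>

definition Blim :: "'n cfun \<Rightarrow> 'n cfun \<Rightarrow> 'n cfun" where
 "Blim f g x = lim (\<lambda>N. Bn f g N x)"

context
 fixes f g :: "'n cfun" and a b :: real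
 assumes fm: "f \<in> bmeas" and gm: "g \<in> bmeas"
  and fa: "AE x in lebesgue. norm (f x) \<le> a" and gb: "AE x in lebesgue. norm (g x) \<le> b"
  and a: "0 \<le> a" and b: "0 \<le> b"
begin

lemma trunc_Linf_L2: "trunc N f \<in> L2" "trunc N g \<in> L2"
 and trunc_Linf_AE: "AE x in lebesgue. norm (trunc N f x) \<le> a" "AE x in lebesgue. norm (trunc N g x) \<le> b"
proof -
 show 1: "AE x in lebesgue. norm (trunc N f x) \<le> a" using fa by eventually_elim (use a in \<open>auto simp: trunc_def indicator_def\<close>)
 show 2: "AE x in lebesgue. norm (trunc N g x) \<le> b" using gb by eventually_elim (use b in \<open>auto simp: trunc_def indicator_def\<close>)
 have m: "trunc N f \<in> bmeas" "trunc N g \<in> bmeas"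
  unfolding trunc_def[abs_def] using fm gm by auto
 show "trunc N f \<in> L2" by (rule AE_bounded_L2[OF m(1) 1 a sets_cb(2)[of 0 "real N"] emeasure_cb_pos(2)]) (simp add: trunc_def)
 show "trunc N g \<in> L2" by (rule AE_bounded_L2[OF m(2) 2 b sets_cb(2)[of 0 "real N"] emeasure_cb_pos(2)]) (simp add: trunc_def)
qed

lemma Bn_measurable: "Bn f g N \<in> bmeas"
 unfolding Bn_def[abs_def] using Bm[OF trunc_Linf_L2] by auto

lemma Bn_integrable: "set_integrable lebesgue (cb x R) (Bn f g N)"
proof -
 have "set_integrable lebesgue (cb x R) (B (trunc N f) (trunc N g))"
  unfolding set_integrable_def using Bint[OF trunc_Linf_L2] by (intro integrable_mult_indicator) auto
 then show ?thesis unfolding Bn_def[abs_def] by (rule set_integral_diff(1)[OF _ set_integrable_const_cb])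
qed

text \<open>The increments of the truncations vanish on the cube of radius N, so the difference of
  the operators consists of two far terms, each varying by little on the cube of radius l.
  Subtracting its mean over the unit cube inside turns small variation into small size.\<close>

lemma Bn_cauchy:
 assumes l: "1 \<le> l" and N: "2 * l \<le> real N" "(2 * real CARD('n) * l) powr \<epsilon> \<le> c * (real N / 2)" and MN: "N \<le> M"
 shows "AE x in lebesgue. x \<in> cb 0 l \<longrightarrow> norm (Bn f g M x - Bn f g N x) \<le> 2 * (far_const * l powr s * real N powr (- s / \<epsilon>) * a * b)"
proof -
 let ?d = "\<lambda>x. trunc M f x - trunc N f x" and ?e = "\<lambda>x. trunc M g x - trunc N g x"
 let ?D = "far_const * l powr s * real N powr (- s / \<epsilon>) * a * b"
 note L = trunc_Linf_L2
 have D0: "0 \<le> ?D" using far_const_nonneg a b by simp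
 have N0: "0 < real N" using N(1) l by linarith
 have sub: "cb 0 (real N) \<subseteq> cb (0::real^'n) (real M)" using MN by (intro cb_mono) simp
 have dL: "?d \<in> L2" "?e \<in> L2" by (intro L2_diff L)+
 have bd: "bounded {y. ?d y \<noteq> 0}" "bounded {y. ?e y \<noteq> 0}"
  by (rule bounded_subset[OF bounded_cb[of 0 "real M"]], use sub in \<open>auto simp: trunc_def indicator_def split: if_splits\<close>)+
 have off: "(\<forall>y\<in>cb 0 (real N). ?d y = 0) \<or> (\<forall>y\<in>cb 0 (real N). trunc M g y = 0)"
  "(\<forall>y\<in>cb 0 (real N). trunc N f y = 0) \<or> (\<forall>y\<in>cb 0 (real N). ?e y = 0)"
  using sub by (auto simp: trunc_def)
 have dae: "AE x in lebesgue. norm (?d x) \<le> a" "AE x in lebesgue. norm (?e x) \<le> b"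
  using fa gb by (eventually_elim, use sub a b in \<open>auto simp: trunc_def indicator_def split: if_splits\<close>)+
 have l0: "0 < l" using l by simp
 have If: "I1 0 (2 ^ Suc k * real N) h \<le> a * (2 * (2 ^ Suc k * real N)) ^ CARD('n)" if "h \<in> L2" "AE x in lebesgue. norm (h x) \<le> a" for h k
  using that N0 by (intro I1_bounded) auto
 have Ig: "I1 0 (2 ^ Suc k * real N) h \<le> b * (2 * (2 ^ Suc k * real N)) ^ CARD('n)" if "h \<in> L2" "AE x in lebesgue. norm (h x) \<le> b" for h k
  using that N0 by (intro I1_bounded) auto
 obtain Z1 where Z1: "AE x in lebesgue. x \<notin> Z1" "\<forall>x\<in>cb 0 l - Z1. \<forall>x'\<in>cb 0 l - Z1. norm (B ?d (trunc M g) x - B ?d (trunc M g) x') \<le> ?D"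
  using far[OF dL(1) bd(1) L(2) trunc_bounded l0 N off(1) If[OF dL(1) dae(1)] Ig[OF L(2) trunc_Linf_AE(2)] a b] by blast
 obtain Z2 where Z2: "AE x in lebesgue. x \<notin> Z2" "\<forall>x\<in>cb 0 l - Z2. \<forall>x'\<in>cb 0 l - Z2. norm (B (trunc N f) ?e x - B (trunc N f) ?e x') \<le> ?D"
  using far[OF L(1) trunc_bounded dL(2) bd(2) l0 N off(2) If[OF L(1) trunc_Linf_AE(1)] Ig[OF dL(2) dae(2)] a b] by blast
 let ?h = "\<lambda>N. B (trunc N f) (trunc N g)"
 have split: "AE x in lebesgue. ?h M x - ?h N x = B ?d (trunc M g) x + B (trunc N f) ?e x"
  using Bdiff1[OF L(1)[of M] L(1)[of N] L(2)[of M]] Bdiff2[OF L(2)[of M] L(2)[of N] L(1)[of N]]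
  by eventually_elim simp
 let ?A = "average (cb 0 1) (?h M) - average (cb 0 1) (?h N)"
 have cb1: "cb 0 1 \<subseteq> cb (0::real^'n) l" using l by (intro cb_mono)
 have hi: "set_integrable lebesgue (cb 0 1) (?h N)" for N
  unfolding set_integrable_def using Bint[OF L] by (intro integrable_mult_indicator) auto
 have av: "average (cb 0 1) (\<lambda>x. ?h M x - ?h N x) = ?A"
  using average_lincomb[OF hi[of M] hi[of N], of 1 "-1"] by simp
 show ?thesis
  using split Z1(1) Z2(1)
 proof eventually_elim
  case (elim x)
  show ?case
  proof
   assume x: "x \<in> cb 0 l"
   \<comment> \<open>The difference at x is compared with its values on the unit cube; each far term
     contributes one copy of \<open>?D\<close>.\<close>
   have "norm (average (cb 0 1) (\<lambda>x. ?h M x - ?h N x) - (?h M x - ?h N x)) \<le> 2 * ?D"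
   proof (rule average_cb_dist_le)
    show "set_integrable lebesgue (cb 0 1) (\<lambda>x. ?h M x - ?h N x)" by (rule set_integral_diff(1)[OF hi hi])
    show "AE y in lebesgue. y \<in> cb 0 1 \<longrightarrow> norm ((?h M y - ?h N y) - (?h M x - ?h N x)) \<le> 2 * ?D"
     using split Z1(1) Z2(1)
    proof eventually_elim
     case (elim y)
     note y = elim
     show ?case
     proof
      assume "y \<in> cb 0 1"
      then have yl: "y \<in> cb 0 l" using cb1 by blast
      have 1: "norm (B ?d (trunc M g) y - B ?d (trunc M g) x) \<le> ?D"
       using Z1(2)[rule_format, of y x] x yl y(2) \<open>x \<notin> Z1\<close> by simp
      have 2: "norm (B (trunc N f) ?e y - B (trunc N f) ?e x) \<le> ?D"
       using Z2(2)[rule_format, of y x] x yl y(3) \<open>x \<notin> Z2\<close> by simp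
      have "(?h M y - ?h N y) - (?h M x - ?h N x) =
        (B ?d (trunc M g) y - B ?d (trunc M g) x) + (B (trunc N f) ?e y - B (trunc N f) ?e x)"
       unfolding y(1) \<open>?h M x - ?h N x = B ?d (trunc M g) x + B (trunc N f) ?e x\<close> by simp
      then show "norm ((?h M y - ?h N y) - (?h M x - ?h N x)) \<le> 2 * ?D"
       using norm_triangle_ineq[of "B ?d (trunc M g) y - B ?d (trunc M g) x" "B (trunc N f) ?e y - B (trunc N f) ?e x"] 1 2 by simp
     qed
    qed
   qed (use D0 in auto)
   moreover have "Bn f g M x - Bn f g N x = - (average (cb 0 1) (\<lambda>x. ?h M x - ?h N x) - (?h M x - ?h N x))"
    unfolding av Bn_def by simp
   ultimately show "norm (Bn f g M x - Bn f g N x) \<le> 2 * ?D" by (simp only: norm_minus_cancel)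
  qed
 qed
qed

text \<open>For fixed l the bound in \<open>Bn_cauchy\<close> decays like N^(-s/\<epsilon>). One
  null set serves all N and M, since there are countably many pairs.\<close>

lemma Bn_uniform:
 assumes l: "1 \<le> l" and d: "0 < d"
 shows "\<exists>N0. AE x in lebesgue. x \<in> cb 0 l \<longrightarrow> (\<forall>N\<ge>N0. \<forall>M\<ge>N. norm (Bn f g M x - Bn f g N x) \<le> d)"
proof -
 have "((\<lambda>N. 2 * (far_const * l powr s * real N powr (- s / \<epsilon>) * a * b)) \<longlongrightarrow> 2 * (far_const * l powr s * 0 * a * b)) sequentially"
  using s \<epsilon> by (intro tendsto_intros tendsto_neg_powr filterlim_real_sequentially) auto
 then have 1: "eventually (\<lambda>N. 2 * (far_const * l powr s * real N powr (- s / \<epsilon>) * a * b) < d) sequentially"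
  by (rule order_tendstoD(2)) (use d in simp)
 have 2: "eventually (\<lambda>N. 2 * l \<le> real N) sequentially" "eventually (\<lambda>N. 2 * (2 * real CARD('n) * l) powr \<epsilon> / c \<le> real N) sequentially"
  using filterlim_real_sequentially unfolding filterlim_at_top by blast+
 have "eventually (\<lambda>N. 2 * (far_const * l powr s * real N powr (- s / \<epsilon>) * a * b) < d \<and> 2 * l \<le> real N \<and> (2 * real CARD('n) * l) powr \<epsilon> \<le> c * (real N / 2)) sequentially"
  using 1 2 by eventually_elim (use c in \<open>auto simp: field_simps\<close>)
 then obtain N0 where N0: "\<And>N. N \<ge> N0 \<Longrightarrow> 2 * (far_const * l powr s * real N powr (- s / \<epsilon>) * a * b) < d \<and> 2 * l \<le> real N \<and> (2 * real CARD('n) * l) powr \<epsilon> \<le> c * (real N / 2)"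
  unfolding eventually_sequentially by blast
 have "AE x in lebesgue. x \<in> cb 0 l \<longrightarrow> norm (Bn f g M x - Bn f g N x) \<le> d" if NM: "N0 \<le> N" "N \<le> M" for N M
  using Bn_cauchy[OF l _ _ NM(2)] N0[OF NM(1)] by (auto elim!: eventually_mono)
 then have "AE x in lebesgue. \<forall>N M. N0 \<le> N \<longrightarrow> N \<le> M \<longrightarrow> x \<in> cb 0 l \<longrightarrow> norm (Bn f g M x - Bn f g N x) \<le> d"
  unfolding AE_all_countable by (auto intro: AE_I2)
 then have "AE x in lebesgue. x \<in> cb 0 l \<longrightarrow> (\<forall>N\<ge>N0. \<forall>M\<ge>N. norm (Bn f g M x - Bn f g N x) \<le> d)"
  by (rule eventually_mono) simp
 then show ?thesis by (rule exI)
qed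

lemma Bn_convergent: "AE x in lebesgue. (\<lambda>N. Bn f g N x) \<longlonglongrightarrow> Blim f g x"
proof -
 have "AE x in lebesgue. \<forall>l k :: nat. \<exists>N0. x \<in> cb 0 (real (Suc l)) \<longrightarrow> (\<forall>N\<ge>N0. \<forall>M\<ge>N. norm (Bn f g M x - Bn f g N x) \<le> inverse (real (Suc k)))"
 proof (subst AE_all_countable, intro allI, subst AE_all_countable, intro allI)
  fix l k :: nat
  obtain N0 where "AE x in lebesgue. x \<in> cb 0 (real (Suc l)) \<longrightarrow> (\<forall>N\<ge>N0. \<forall>M\<ge>N. norm (Bn f g M x - Bn f g N x) \<le> inverse (real (Suc k)))"
   using Bn_uniform[of "real (Suc l)" "inverse (real (Suc k))"] by auto
  then show "AE x in lebesgue. \<exists>N0. x \<in> cb 0 (real (Suc l)) \<longrightarrow> (\<forall>N\<ge>N0. \<forall>M\<ge>N. norm (Bn f g M x - Bn f g N x) \<le> inverse (real (Suc k)))"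
   by eventually_elim blast
 qed
 then show ?thesis
 proof eventually_elim
  case (elim x)
  obtain l0 where l0: "\<And>l::nat. l0 \<le> l \<Longrightarrow> x \<in> cb 0 (real l)" using eventually_in_cb[of x] unfolding eventually_sequentially by blast
  have xl: "x \<in> cb 0 (real (Suc l0))" by (rule l0) simp
  have "Cauchy (\<lambda>N. Bn f g N x)"
  proof (rule CauchyI')
   fix e :: real assume e: "0 < e"
   obtain k :: nat where k: "inverse (real (Suc k)) < e" using reals_Archimedean[OF e] by blast
   obtain N0 where N0: "\<forall>N\<ge>N0. \<forall>M\<ge>N. norm (Bn f g M x - Bn f g N x) \<le> inverse (real (Suc k))" using elim xl by blast
   have "dist (Bn f g m x) (Bn f g n x) < e" if "N0 \<le> m" "m < n" for m n :: nat
   proof -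
    have "norm (Bn f g n x - Bn f g m x) \<le> inverse (real (Suc k))" using N0 that by simp
    then show ?thesis using k by (simp only: dist_norm norm_minus_commute[of "Bn f g m x"])
   qed
   then show "\<exists>M. \<forall>m\<ge>M. \<forall>n>m. dist (Bn f g m x) (Bn f g n x) < e" by blast
  qed
  then have "convergent (\<lambda>N. Bn f g N x)" by (rule Cauchy_convergent)
  then show ?case unfolding Blim_def by (rule convergent_LIMSEQ_iff[THEN iffD1])
 qed
qed

lemma Blim_measurable: "Blim f g \<in> bmeas"
 unfolding Blim_def[abs_def] by (rule borel_measurable_lim_metric) (rule Bn_measurable)

lemma Blim_uniform:
 assumes l: "1 \<le> l" and d: "0 < d"
 shows "\<exists>N. AE x in lebesgue. x \<in> cb 0 l \<longrightarrow> norm (Blim f g x - Bn f g N x) \<le> d"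
proof -
 obtain N where N: "AE x in lebesgue. x \<in> cb 0 l \<longrightarrow> (\<forall>N'\<ge>N. \<forall>M\<ge>N'. norm (Bn f g M x - Bn f g N' x) \<le> d)"
  using Bn_uniform[OF l d] by blast
 have "AE x in lebesgue. x \<in> cb 0 l \<longrightarrow> norm (Blim f g x - Bn f g N x) \<le> d"
  using N Bn_convergent
 proof eventually_elim
  case (elim x)
  show ?case
  proof
   assume x: "x \<in> cb 0 l"
   have "(\<lambda>M. norm (Bn f g M x - Bn f g N x)) \<longlonglongrightarrow> norm (Blim f g x - Bn f g N x)" by (intro tendsto_intros elim)
   then show "norm (Blim f g x - Bn f g N x) \<le> d"
    by (rule LIMSEQ_le_const2) (use elim(1) x in auto)
  qed
 qed
 then show ?thesis by blast
qed

lemma Blim_integrable: "set_integrable lebesgue (cb x R) (Blim f g)"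
proof -
 obtain R' where R': "cb x R \<subseteq> cb 0 R'" using bounded_subset_cb[OF bounded_cb[of x R], of 0] by blast
 define l where "l = max R' 1"
 have sub: "cb x R \<subseteq> cb 0 l" using R' cb_mono[where x=0 and R=R' and R'=l] by (auto simp: l_def)
 obtain N where N: "AE x in lebesgue. x \<in> cb 0 l \<longrightarrow> norm (Blim f g x - Bn f g N x) \<le> 1"
  using Blim_uniform[of l 1] by (auto simp: l_def)
 have i: "integrable lebesgue (\<lambda>y. indicator (cb x R) y *\<^sub>R norm (Bn f g N y) + indicator (cb x R) y *\<^sub>R (1::real))"
  using set_integrable_norm[OF Bn_integrable[of x R N]] set_integrable_const_cb[of x R "1::real"]
  unfolding set_integrable_def by (rule Bochner_Integration.integrable_add)
 show ?thesis unfolding set_integrable_def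
 proof (rule Bochner_Integration.integrable_bound[OF i])
  show "(\<lambda>y. indicator (cb x R) y *\<^sub>R Blim f g y) \<in> bmeas" using Blim_measurable by auto
  show "AE y in lebesgue. norm (indicator (cb x R) y *\<^sub>R Blim f g y) \<le>
   norm (indicator (cb x R) y *\<^sub>R norm (Bn f g N y) + indicator (cb x R) y *\<^sub>R (1::real))"
   using N
  proof eventually_elim
   case (elim y)
   show ?case
   proof (cases "y \<in> cb x R")
    case True
    then have "norm (Blim f g y - Bn f g N y) \<le> 1" using elim sub by blast
    then show ?thesis using True norm_triangle_ineq2[of "Blim f g y" "Bn f g N y"] by simp
   qed simp
  qed
 qed
qed

text \<open>On a given cube the limit is within d / 2 of one normalised truncation, to which
  \<open>sharp\<close> applies with the supremum bounds as a and b. The normalising constant is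
  absorbed into \<kappa>, and d is arbitrary.\<close>

lemma Blim_BMO: "BMO_norm (Blim f g) \<le> ennreal (2 * sharp_const * a * b)"
 unfolding BMO_norm_def
proof (rule SUP_least)
 fix Q :: "(real^'n) set" assume "Q \<in> cubes"
 then obtain x0 l where Q: "Q = cb x0 l" "0 < l" unfolding cubes_eq by blast
 let ?V = "vol (cb x0 l)"
 have V: "?V \<noteq> 0" "?V \<noteq> top" "?V = ennreal ((2 * l) ^ CARD('n))"
  using emeasure_cb_pos(1)[OF Q(2), of x0] emeasure_cb_pos(2)[of x0 l] Q(2) emeasure_cb[of l x0]
  by (auto simp: less_top[symmetric])
 have mp: "0 < measure lebesgue (cb x0 l)" using Q(2) by (subst measure_cb) auto
 obtain R' where R': "cb x0 l \<subseteq> cb 0 R'" using bounded_subset_cb[OF bounded_cb[of x0 l], of 0] by blast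
 define L where "L = max R' 1"
 have sub: "cb x0 l \<subseteq> cb 0 L" using R' cb_mono[where x=0 and R=R' and R'=L] by (auto simp: L_def)
 show "eaverage Q (\<lambda>y. ennreal (norm (Blim f g y - average Q (Blim f g)))) \<le> ennreal (2 * sharp_const * a * b)"
 proof (rule ennreal_le_epsilon)
  fix d :: real assume d: "0 < d"
  obtain N where N: "AE x in lebesgue. x \<in> cb 0 L \<longrightarrow> norm (Blim f g x - Bn f g N x) \<le> d / 2"
   using Blim_uniform[of L "d / 2"] d by (auto simp: L_def)
  have sq: "sq_int (cb x0 (2 ^ j * l)) h \<le> ennreal (t\<^sup>2 * (2 * (2 ^ j * l)) ^ CARD('n))"
   if ae: "AE x in lebesgue. norm (h x) \<le> t" for h :: "'n cfun" and t j
  proof -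
   have "sq_int (cb x0 (2 ^ j * l)) h \<le> (\<integral>\<^sup>+y. ennreal (t\<^sup>2) * indicator (cb x0 (2 ^ j * l)) y \<partial>lebesgue)"
    by (rule nn_integral_mono_AE, use ae in eventually_elim) (intro mult_right_mono ennreal_leI power_mono, auto)
   also have "\<dots> = ennreal (t\<^sup>2) * vol (cb x0 (2 ^ j * l))" by (rule nn_integral_cmult_indicator) simp
   also have "\<dots> = ennreal (t\<^sup>2 * (2 * (2 ^ j * l)) ^ CARD('n))" using Q(2) by (subst emeasure_cb) (auto simp: ennreal_mult)
   finally show ?thesis .
  qed
  obtain \<kappa> where \<kappa>: "abs_int (cb x0 l) (\<lambda>x. B (trunc N f) (trunc N g) x - \<kappa>) \<le> ennreal (sharp_const * a * b * (2 * l) ^ CARD('n))"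
   using sharp[OF trunc_Linf_L2(1) trunc_bounded trunc_Linf_L2(2) trunc_bounded Q(2) a b sq[OF trunc_Linf_AE(1)] sq[OF trunc_Linf_AE(2)]] by blast
  define \<kappa>' where "\<kappa>' = \<kappa> - average (cb 0 1) (B (trunc N f) (trunc N g))"
  have "abs_int Q (\<lambda>y. Blim f g y - average Q (Blim f g)) \<le>
   2 * abs_int Q (\<lambda>y. Blim f g y - \<kappa>')"
   unfolding Q by (rule average_osc_le[OF sets_cb(2) emeasure_cb_pos(2) mp Blim_integrable])
  also have "\<dots> \<le> 2 * (\<integral>\<^sup>+y. ennreal (norm (B (trunc N f) (trunc N g) y - \<kappa>)) * indicator (cb x0 l) y + ennreal (d / 2) * indicator (cb x0 l) y \<partial>lebesgue)"
  proof (rule mult_left_mono, rule nn_integral_mono_AE, use N in eventually_elim)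
   fix y assume y: "y \<in> cb 0 L \<longrightarrow> norm (Blim f g y - Bn f g N y) \<le> d / 2"
   show "ennreal (norm (Blim f g y - \<kappa>')) * indicator Q y \<le>
    ennreal (norm (B (trunc N f) (trunc N g) y - \<kappa>)) * indicator (cb x0 l) y + ennreal (d / 2) * indicator (cb x0 l) y"
   proof (cases "y \<in> cb x0 l")
    case True
    have e: "Blim f g y - \<kappa>' = (B (trunc N f) (trunc N g) y - \<kappa>) + (Blim f g y - Bn f g N y)"
     by (simp add: \<kappa>'_def Bn_def)
    have "norm (Blim f g y - \<kappa>') \<le> norm (B (trunc N f) (trunc N g) y - \<kappa>) + norm (Blim f g y - Bn f g N y)"
     unfolding e by (rule norm_triangle_ineq)
    also have "\<dots> \<le> norm (B (trunc N f) (trunc N g) y - \<kappa>) + d / 2" using y True sub by auto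
    finally have "ennreal (norm (Blim f g y - \<kappa>')) \<le> ennreal (norm (B (trunc N f) (trunc N g) y - \<kappa>) + d / 2)" by (rule ennreal_leI)
    then show ?thesis using True d Q by (simp add: ennreal_plus)
   qed (simp add: Q)
  qed simp
  also have "(\<integral>\<^sup>+y. ennreal (norm (B (trunc N f) (trunc N g) y - \<kappa>)) * indicator (cb x0 l) y + ennreal (d / 2) * indicator (cb x0 l) y \<partial>lebesgue) =
   abs_int (cb x0 l) (\<lambda>y. B (trunc N f) (trunc N g) y - \<kappa>) + ennreal (d / 2) * ?V"
  proof -
   have [measurable]: "B (trunc N f) (trunc N g) \<in> bmeas" by (rule Bm[OF trunc_Linf_L2])
   show ?thesis by (subst nn_integral_add) (auto simp: nn_integral_cmult_indicator)
  qed
  also have "2 * (abs_int (cb x0 l) (\<lambda>y. B (trunc N f) (trunc N g) y - \<kappa>) + ennreal (d / 2) * ?V) \<le>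
   2 * (ennreal (sharp_const * a * b * (2 * l) ^ CARD('n)) + ennreal (d / 2) * ?V)"
   by (intro mult_left_mono add_right_mono \<kappa>) simp
  also have "\<dots> = (ennreal (2 * sharp_const * a * b) + ennreal d) * ?V"
  proof -
   have nn: "0 \<le> sharp_const * a * b" using sharp_const_nonneg a b by simp
   have 1: "ennreal (sharp_const * a * b * (2 * l) ^ CARD('n)) = ennreal (sharp_const * a * b) * ?V"
    unfolding V(3) using nn Q(2) by (intro ennreal_mult) auto
   have 2: "2 * ennreal (sharp_const * a * b) = ennreal (2 * sharp_const * a * b)" "2 * ennreal (d / 2) = ennreal d"
    using nn d ennreal_mult[of 2 "sharp_const * a * b"] ennreal_mult[of 2 "d / 2"] by (simp_all add: mult.assoc)
   show ?thesis unfolding 1 distrib_left distrib_right mult.assoc[symmetric] 2 ..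
  qed
  finally have "eaverage Q (\<lambda>y. ennreal (norm (Blim f g y - average Q (Blim f g)))) \<le> (ennreal (2 * sharp_const * a * b) + ennreal d) * ?V / ?V"
   unfolding eaverage_def Q(1) by (rule divide_right_mono_ennreal)
  also have "\<dots> = ennreal (2 * sharp_const * a * b) + ennreal d"
   using V(1,2) by (intro ennreal_mult_divide_eq) (auto simp: less_top[symmetric])
  finally show "eaverage Q (\<lambda>y. ennreal (norm (Blim f g y - average Q (Blim f g)))) \<le> ennreal (2 * sharp_const * a * b) + ennreal d" .
 qed
qed

end

end

section \<open>The operator into BMO and its agreement with T\<close>

lemma schwartz_bounded:
 assumes f: "f \<in> schwartz_space"
 obtains M where "0 \<le> M" "\<And>x. norm (f x) \<le> M"
proof -
 have "bounded (range (\<lambda>x. (1 + norm x) ^ 0 * norm (partials [] f x)))"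
  using f unfolding schwartz_space_def by blast
 then have "bounded (range (\<lambda>x. norm (f x)))" by simp
 then obtain M where M: "\<And>y. y \<in> range (\<lambda>x. norm (f x)) \<Longrightarrow> norm y \<le> M" unfolding bounded_iff by blast
 have "norm (f x) \<le> M" for x using M[of "norm (f x)"] by simp
 moreover from this[of 0] have "0 \<le> M" using norm_ge_zero order_trans by blast
 ultimately show thesis using that by blast
qed

lemma Linf_I:
 assumes m: "f \<in> bmeas" and ae: "AE x in lebesgue. norm (f x) \<le> M"
 shows "f \<in> fst Linf"
proof -
 have "Linf_norm f \<le> ennreal M" unfolding Linf_norm_def
  by (rule esssup_I) (use m in simp, use ae in \<open>eventually_elim, simp add: ennreal_leI\<close>)
 also have "\<dots> < \<infinity>" by simp
 finally show ?thesis using m by (simp add: Linf_def)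
qed

lemma schwartz_Linf: "f \<in> schwartz_space \<Longrightarrow> f \<in> fst Linf"
 by (rule schwartz_bounded[of f], assumption, rule Linf_I[OF schwartz_measurable]) auto

lemma schwartz_L2:
 assumes f: "f \<in> schwartz_space" shows "f \<in> L2"
proof -
 let ?n = "CARD('a)"
 have "pow_int lebesgue 2 f < \<infinity>"
 proof (rule schwartz_nn_integral_finite[OF f, where D="2 ^ ?n" and C="2 ^ ?n"])
  show "vol (cb (0::real^'a) (2 ^ j)) \<le> ennreal (2 ^ ?n * (2 ^ ?n) ^ j)" for j :: nat
   by (subst emeasure_cb) (simp_all add: power_mult_distrib power_mult[symmetric] mult.commute)
 qed auto
 then have "f \<in> fst (Lp 2)" using schwartz_measurable[OF f] by (subst fst_weighted_Lp) (simp_all only: wmeas_1 zero_less_numeral)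
 then show ?thesis by (simp add: fst_L2)
qed

lemma Linf_lincomb:
 assumes f: "f \<in> fst Linf" and h: "h \<in> fst Linf" shows "(\<lambda>x. a * f x + b * h x) \<in> fst Linf"
proof (rule Linf_I)
 show "(\<lambda>x. a * f x + b * h x) \<in> bmeas" using Linf_bound(1)[OF f] Linf_bound(1)[OF h] by auto
 show "AE x in lebesgue. norm (a * f x + b * h x) \<le> norm a * enn2real (Linf_norm f) + norm b * enn2real (Linf_norm h)"
  using Linf_bound(2)[OF f] Linf_bound(2)[OF h]
 proof eventually_elim
  case (elim x)
  have "norm (a * f x + b * h x) \<le> norm (a * f x) + norm (b * h x)" by (rule norm_triangle_ineq)
  also have "\<dots> = norm a * norm (f x) + norm b * norm (h x)" by (simp only: norm_mult)
  also have "\<dots> \<le> norm a * enn2real (Linf_norm f) + norm b * enn2real (Linf_norm h)"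
   using elim by (intro add_mono mult_left_mono) auto
  finally show ?case .
 qed
qed

lemma centered_lincomb:
 assumes m: "P \<in> bmeas" "Q \<in> bmeas" "R \<in> bmeas"
  and D: "D \<in> sets lebesgue" and i: "set_integrable lebesgue D Q" "set_integrable lebesgue D R"
  and ae: "AE x in lebesgue. P x = a * Q x + b * R x"
 shows "AE x in lebesgue. P x - average D P = a * (Q x - average D Q) + b * (R x - average D R)"
proof -
 have "average D P = average D (\<lambda>x. a * Q x + b * R x)" by (rule average_cong_AE[OF m(1) _ D ae]) (use m in auto)
 also have "\<dots> = a * average D Q + b * average D R" by (rule average_lincomb[OF i])
 finally have e: "average D P = a * average D Q + b * average D R" .
 show ?thesis using ae by eventually_elim (simp add: e algebra_simps)
qed

context kernel_operator
begin

lemma B_set_integrable: "f \<in> L2 \<Longrightarrow> g \<in> L2 \<Longrightarrow> set_integrable lebesgue (cb x R) (B f g)"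
 unfolding set_integrable_def by (intro integrable_mult_indicator Bint) auto

context
 fixes f g :: "'n cfun"
 assumes f: "f \<in> fst Linf" and g: "g \<in> fst Linf"
begin

lemmas Linf_args = Linf_bound(1)[OF f] Linf_bound(1)[OF g] Linf_bound(2)[OF f] Linf_bound(2)[OF g] enn2real_nonneg enn2real_nonneg

lemmas Linf_trunc_L2 = trunc_Linf_L2[OF Linf_args]
lemmas Linf_Bn_convergent = Bn_convergent[OF Linf_args]
lemmas Linf_Blim_measurable = Blim_measurable[OF Linf_args]
lemmas Linf_Blim_integrable = Blim_integrable[OF Linf_args]
lemmas Linf_Blim_BMO = Blim_BMO[OF Linf_args]

lemma Blim_in_BMO: "Blim f g \<in> fst BMO"
proof -
 have "Blim f g absolutely_integrable_on S" if S: "compact S" for S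
 proof -
  obtain R where R: "S \<subseteq> cb 0 R" using bounded_subset_cb[OF compact_imp_bounded[OF S], of 0] by blast
  have "S \<in> sets lebesgue" using S by (simp add: lmeasurable_compact fmeasurableD)
  then show ?thesis by (rule set_integrable_subset[OF Linf_Blim_integrable _ R])
 qed
 moreover have "BMO_norm (Blim f g) < \<infinity>" by (rule le_less_trans[OF Linf_Blim_BMO]) simp
 ultimately show ?thesis by (simp add: BMO_def locally_integrable_on_def)
qed

end

lemma Blim_lincomb:
 assumes L: "f' \<in> fst Linf" "g' \<in> fst Linf" "f1 \<in> fst Linf" "g1 \<in> fst Linf" "f2 \<in> fst Linf" "g2 \<in> fst Linf"
  and ae: "\<And>N. AE x in lebesgue. B (trunc N f') (trunc N g') x = a * B (trunc N f1) (trunc N g1) x + b * B (trunc N f2) (trunc N g2) x"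
 shows "BMO_norm (\<lambda>x. Blim f' g' x - (a * Blim f1 g1 x + b * Blim f2 g2 x)) = 0"
proof (rule BMO_norm_AE_const)
 note m = Linf_Blim_measurable[OF L(1,2)] Linf_Blim_measurable[OF L(3,4)] Linf_Blim_measurable[OF L(5,6)]
 show "(\<lambda>x. Blim f' g' x - (a * Blim f1 g1 x + b * Blim f2 g2 x)) \<in> bmeas" using m by auto
 have "AE x in lebesgue. Bn f' g' N x = a * Bn f1 g1 N x + b * Bn f2 g2 N x" for N
  unfolding Bn_def
  by (rule centered_lincomb[OF Bm[OF Linf_trunc_L2[OF L(1,2)]] Bm[OF Linf_trunc_L2[OF L(3,4)]] Bm[OF Linf_trunc_L2[OF L(5,6)]] sets_cb(2)
     B_set_integrable[OF Linf_trunc_L2[OF L(3,4)]] B_set_integrable[OF Linf_trunc_L2[OF L(5,6)]] ae])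
 then have "AE x in lebesgue. \<forall>N. Bn f' g' N x = a * Bn f1 g1 N x + b * Bn f2 g2 N x" by (subst AE_all_countable) (rule allI)
 then show "AE x in lebesgue. Blim f' g' x - (a * Blim f1 g1 x + b * Blim f2 g2 x) = 0"
  using Linf_Bn_convergent[OF L(1,2)] Linf_Bn_convergent[OF L(3,4)] Linf_Bn_convergent[OF L(5,6)]
 proof eventually_elim
  case (elim x)
  have "(\<lambda>N. a * Bn f1 g1 N x + b * Bn f2 g2 N x) \<longlonglongrightarrow> a * Blim f1 g1 x + b * Blim f2 g2 x" by (intro tendsto_intros elim)
  moreover have "(\<lambda>N. a * Bn f1 g1 N x + b * Bn f2 g2 N x) \<longlonglongrightarrow> Blim f' g' x" using elim(1,2) by simp
  ultimately have "Blim f' g' x = a * Blim f1 g1 x + b * Blim f2 g2 x" by (rule LIMSEQ_unique[symmetric])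
  then show ?case by simp
 qed
qed

text \<open>For square integrable arguments the truncated operators converge in L1, so their means
  over the unit cube converge as well. The limit therefore differs from \<open>B f g\<close> by a
  constant, which is agreement in BMO.\<close>

lemma Blim_eq_B:
 assumes L2: "f \<in> L2" "g \<in> L2" and L: "f \<in> fst Linf" "g \<in> fst Linf"
 shows "AE x in lebesgue. Blim f g x = B f g x - average (cb 0 1) (B f g)"
proof -
 note t = L2(1) trunc_L2_tendsto[OF L2(1)] L2(2) trunc_L2_tendsto[OF L2(2)]
 let ?D = "\<lambda>N. B (trunc N f) (trunc N g)"
 note tL = trunc_L2_tendsto(1)[OF L2(1)] trunc_L2_tendsto(1)[OF L2(2)]
 obtain \<rho> :: "nat \<Rightarrow> nat" where \<rho>: "strict_mono \<rho>" "AE x in lebesgue. (\<lambda>k. ?D (\<rho> k) x) \<longlonglongrightarrow> B f g x"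
  using B_conv_subseq[OF t] by blast
 have "(\<lambda>N. (LINT y:cb 0 1|lebesgue. ?D N y)) \<longlonglongrightarrow> (LINT y:cb 0 1|lebesgue. B f g y)"
 proof (rule Lim_null[THEN iffD2], rule Lim_null_comparison[OF _ B_conv[OF t]], rule always_eventually, rule allI)
  fix N
  have i: "integrable lebesgue (\<lambda>y. ?D N y - B f g y)" by (intro Bochner_Integration.integrable_diff Bint tL L2)
  have "(LINT y:cb 0 1|lebesgue. ?D N y) - (LINT y:cb 0 1|lebesgue. B f g y) = (LINT y:cb 0 1|lebesgue. ?D N y - B f g y)"
   by (rule set_integral_diff(2)[symmetric, OF B_set_integrable B_set_integrable]) (intro tL L2)+
  also have "norm \<dots> \<le> (LINT y:cb 0 1|lebesgue. norm (?D N y - B f g y))"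
   unfolding set_lebesgue_integral_def
   by (rule order_trans[OF integral_norm_bound]) simp
  also have "\<dots> \<le> (LINT y|lebesgue. norm (?D N y - B f g y))"
   unfolding set_lebesgue_integral_def
  proof (rule integral_mono)
   show "integrable lebesgue (\<lambda>y. indicator (cb 0 1) y *\<^sub>R norm (?D N y - B f g y))"
    by (rule integrable_mult_indicator[OF sets_cb(2) integrable_norm[OF i]])
   show "integrable lebesgue (\<lambda>y. norm (?D N y - B f g y))" by (rule integrable_norm[OF i])
  qed (simp add: indicator_def)
  finally show "norm ((LINT y:cb 0 1|lebesgue. ?D N y) - (LINT y:cb 0 1|lebesgue. B f g y)) \<le> (LINT y|lebesgue. norm (?D N y - B f g y))" .
 qed
 then have av: "(\<lambda>N. average (cb 0 1) (?D N)) \<longlonglongrightarrow> average (cb 0 1) (B f g)"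
  unfolding average_def by (rule tendsto_scaleR[OF tendsto_const])
 show ?thesis using \<rho>(2) Linf_Bn_convergent[OF L]
 proof eventually_elim
  case (elim x)
  have "(\<lambda>k. Bn f g (\<rho> k) x) \<longlonglongrightarrow> B f g x - average (cb 0 1) (B f g)"
   unfolding Bn_def by (intro tendsto_diff elim LIMSEQ_subseq_LIMSEQ[OF av \<rho>(1), unfolded o_def])
  moreover have "(\<lambda>k. Bn f g (\<rho> k) x) \<longlonglongrightarrow> Blim f g x" by (rule LIMSEQ_subseq_LIMSEQ[OF elim(2) \<rho>(1), unfolded o_def])
  ultimately show ?case by (rule LIMSEQ_unique[symmetric])
 qed
qed

lemma Linf_BMO:
 assumes rep: "\<And>f g. f \<in> schwartz_space \<Longrightarrow> g \<in> schwartz_space \<Longrightarrow> represents (B f g) (T f g)"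
 shows "extends_to_bounded T Linf Linf BMO"
 unfolding extends_to_bounded_def
proof (rule exI[of _ Blim], rule conjI)
 have s: "snd Linf = Linf_norm" "snd BMO = BMO_norm" by (simp_all add: Linf_def BMO_def)
 show "bounded_bilinear_operator Linf Linf BMO Blim"
  unfolding bounded_bilinear_operator_def s
 proof (intro conjI ballI allI)
  show "Blim f g \<in> fst BMO" if "f \<in> fst Linf" "g \<in> fst Linf" for f g by (rule Blim_in_BMO[OF that])
  show "BMO_norm (\<lambda>x. Blim (\<lambda>x. a * f x + b * h x) g x - (a * Blim f g x + b * Blim h g x)) = 0"
   if L: "f \<in> fst Linf" "h \<in> fst Linf" "g \<in> fst Linf" for f h g a b
  proof (rule Blim_lincomb)
   show "AE x in lebesgue. B (trunc N (\<lambda>x. a * f x + b * h x)) (trunc N g) x = a * B (trunc N f) (trunc N g) x + b * B (trunc N h) (trunc N g) x" for N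
    unfolding trunc_lincomb by (rule Blin1) (intro Linf_trunc_L2[OF L(1,1)] Linf_trunc_L2[OF L(2,2)] Linf_trunc_L2[OF L(3,3)])+
  qed (intro Linf_lincomb L)+
  show "BMO_norm (\<lambda>x. Blim f (\<lambda>x. a * g x + b * h x) x - (a * Blim f g x + b * Blim f h x)) = 0"
   if L: "f \<in> fst Linf" "g \<in> fst Linf" "h \<in> fst Linf" for f g h a b
  proof (rule Blim_lincomb)
   show "AE x in lebesgue. B (trunc N f) (trunc N (\<lambda>x. a * g x + b * h x)) x = a * B (trunc N f) (trunc N g) x + b * B (trunc N f) (trunc N h) x" for N
    unfolding trunc_lincomb by (rule Blin2) (intro Linf_trunc_L2[OF L(1,1)] Linf_trunc_L2[OF L(2,2)] Linf_trunc_L2[OF L(3,3)])+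
  qed (intro Linf_lincomb L)+
  show "\<exists>C::real. \<forall>f\<in>fst Linf. \<forall>g\<in>fst Linf. BMO_norm (Blim f g) \<le> ennreal C * Linf_norm f * Linf_norm g"
  proof (intro exI[of _ "2 * sharp_const"] ballI)
   fix f g :: "'n cfun" assume L: "f \<in> fst Linf" "g \<in> fst Linf"
   let ?a = "enn2real (Linf_norm f)" and ?b = "enn2real (Linf_norm g)"
   have "BMO_norm (Blim f g) \<le> ennreal (2 * sharp_const * ?a * ?b)" by (rule Linf_Blim_BMO[OF L])
   also have "\<dots> = ennreal (2 * sharp_const) * ennreal ?a * ennreal ?b"
    using sharp_const_nonneg by (simp only: ennreal_mult mult_nonneg_nonneg enn2real_nonneg zero_le_numeral)
   also have "\<dots> = ennreal (2 * sharp_const) * Linf_norm f * Linf_norm g"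
    using Linf_bound(3)[OF L(1)] Linf_bound(3)[OF L(2)] by simp
   finally show "BMO_norm (Blim f g) \<le> ennreal (2 * sharp_const) * Linf_norm f * Linf_norm g" .
  qed
 qed
 show "\<forall>f\<in>schwartz_space. \<forall>g\<in>schwartz_space. \<exists>h\<in>fst BMO. snd BMO (\<lambda>x. Blim f g x - h x) = 0 \<and> represents h (T f g)"
  unfolding s
 proof (intro ballI)
  fix f g :: "'n cfun" assume S: "f \<in> schwartz_space" "g \<in> schwartz_space"
  note L2 = S[THEN schwartz_L2] and L = S[THEN schwartz_Linf]
  note ae = Blim_eq_B[OF L2 L]
  have m: "B f g \<in> bmeas" "Blim f g \<in> bmeas"
   by (rule Bm[OF L2], rule Linf_Blim_measurable[OF L])
  have i: "B f g absolutely_integrable_on S" if "compact S" for S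
   unfolding set_integrable_def by (intro integrable_mult_indicator Bint L2) (use that in \<open>simp add: lmeasurable_compact fmeasurableD\<close>)
  have "BMO_norm (B f g) = BMO_norm (Blim f g)"
   by (rule BMO_norm_shift[symmetric, OF B_set_integrable[OF L2] m ae])
  also have "\<dots> < \<infinity>" using Blim_in_BMO[OF L] by (simp add: BMO_def)
  finally have "B f g \<in> fst BMO" using i by (simp add: BMO_def locally_integrable_on_def)
  moreover have "BMO_norm (\<lambda>x. Blim f g x - B f g x) = 0"
   by (rule BMO_norm_AE_const[where c="- average (cb 0 1) (B f g)"]) (use m in auto, use ae in \<open>eventually_elim, simp\<close>)
  ultimately show "\<exists>h\<in>fst BMO. BMO_norm (\<lambda>x. Blim f g x - h x) = 0 \<and> represents h (T f g)"
   using rep[OF S] by blast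
 qed
qed

end

subsection \<open>Convergence in the r-th mean\<close>

lemma epowr_tendsto_0:
 assumes a: "0 < a" and X: "(X \<longlongrightarrow> 0) F" shows "((\<lambda>n. epowr (X n) a) \<longlongrightarrow> 0) F"
proof (rule order_tendstoI)
 fix y :: ennreal assume y: "0 < y"
 have i: "0 < 1 / a" using a by simp
 have "0 < epowr y (1 / a)" using y epowr_eq_0_iff[OF i, of y] by (simp add: zero_less_iff_neq_zero)
 then have "eventually (\<lambda>n. X n < epowr y (1 / a)) F" by (rule order_tendstoD(2)[OF X])
 then show "eventually (\<lambda>n. epowr (X n) a < y) F"
 proof eventually_elim
  case (elim n)
  have "epowr (epowr y (1 / a)) a = y" using a by (simp add: epowr_epowr)
  then show ?case using elim epowr_le_iff[OF a, of "epowr y (1 / a)" "X n"] by (simp add: not_le[symmetric])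
 qed
qed simp

lemma nn_Holder3:
 assumes t: "0 < a" "0 < b" "0 < c" "a + b + c = 1"
  and [measurable]: "f \<in> borel_measurable M" "g \<in> borel_measurable M" "h \<in> borel_measurable M"
 shows "(\<integral>\<^sup>+x. epowr (f x) a * (epowr (g x) b * epowr (h x) c) \<partial>M) \<le>
  epowr (\<integral>\<^sup>+x. f x \<partial>M) a * (epowr (\<integral>\<^sup>+x. g x \<partial>M) b * epowr (\<integral>\<^sup>+x. h x \<partial>M) c)"
proof -
 \<comment> \<open>The last two exponents are first merged into 1 - a = b + c, of which they are the
   shares t and 1 - t.\<close>
 define t where "t = b / (b + c)"
 have a1: "1 - a = b + c" using t(4) by simp
 have t01: "0 < t" "t < 1" "a < 1" "0 < 1 - a" "t * (1 - a) = b" "(1 - t) * (1 - a) = c"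
  unfolding a1 using t by (auto simp: t_def field_simps)
 have e: "epowr (epowr y t * epowr z (1 - t)) (1 - a) = epowr y b * epowr z c" for y z
  using t01 by (simp add: epowr_mult epowr_epowr)
 have "(\<integral>\<^sup>+x. epowr (f x) a * (epowr (g x) b * epowr (h x) c) \<partial>M) =
  (\<integral>\<^sup>+x. epowr (f x) a * epowr (epowr (g x) t * epowr (h x) (1 - t)) (1 - a) \<partial>M)" by (simp only: e)
 also have "\<dots> \<le> epowr (\<integral>\<^sup>+x. f x \<partial>M) a * epowr (\<integral>\<^sup>+x. epowr (g x) t * epowr (h x) (1 - t) \<partial>M) (1 - a)"
  by (rule nn_Holder[OF t(1) t01(3)]) measurable
 also have "\<dots> \<le> epowr (\<integral>\<^sup>+x. f x \<partial>M) a * epowr (epowr (\<integral>\<^sup>+x. g x \<partial>M) t * epowr (\<integral>\<^sup>+x. h x \<partial>M) (1 - t)) (1 - a)"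
  by (intro mult_left_mono epowr_mono[OF t01(4)] nn_Holder[OF t01(1,2)]) auto
 finally show ?thesis unfolding e .
qed

lemma powr_add_le:
 fixes a b r :: real
 assumes "0 \<le> a" "0 \<le> b" "0 < r" shows "(a + b) powr r \<le> 2 powr r * (a powr r + b powr r)"
 using assms(1,2)
proof (induct a b rule: linorder_wlog)
 case (le a b)
 have "(a + b) powr r \<le> (2 * b) powr r" using le assms(3) by (intro powr_mono2) auto
 also have "\<dots> \<le> 2 powr r * (a powr r + b powr r)" using le by (simp add: powr_mult)
 finally show ?case .
qed (simp add: add.commute)

text \<open>A quasi-triangle inequality: the crude factor makes one argument work for every positive
  r.\<close>

lemma nn_integral_powr_add:
 fixes x y :: "'a \<Rightarrow> complex"
 assumes r: "0 < r" and [measurable]: "x \<in> borel_measurable M" "y \<in> borel_measurable M"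
 shows "pow_int M r (\<lambda>t. x t + y t) \<le>
  ennreal (2 powr r) * (pow_int M r x + pow_int M r y)"
proof -
 have "pow_int M r (\<lambda>t. x t + y t) \<le>
  (\<integral>\<^sup>+t. ennreal (2 powr r) * (ennreal (norm (x t) powr r) + ennreal (norm (y t) powr r)) \<partial>M)"
 proof (rule nn_integral_mono)
  fix t
  have "norm (x t + y t) powr r \<le> (norm (x t) + norm (y t)) powr r" using r by (intro powr_mono2 norm_triangle_ineq) auto
  also have "\<dots> \<le> 2 powr r * (norm (x t) powr r + norm (y t) powr r)" by (intro powr_add_le norm_ge_zero r)
  finally have "ennreal (norm (x t + y t) powr r) \<le> ennreal (2 powr r * (norm (x t) powr r + norm (y t) powr r))" by (rule ennreal_leI)
  then show "ennreal (norm (x t + y t) powr r) \<le> ennreal (2 powr r) * (ennreal (norm (x t) powr r) + ennreal (norm (y t) powr r))"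
   by (simp add: ennreal_mult)
 qed
 also have "\<dots> = ennreal (2 powr r) * (pow_int M r x + pow_int M r y)"
  by (simp add: nn_integral_cmult nn_integral_add)
 finally show ?thesis .
qed

lemma nn_integral_powr_cmult:
 fixes x :: "'a \<Rightarrow> complex"
 assumes [measurable]: "x \<in> borel_measurable M"
 shows "pow_int M r (\<lambda>t. c * x t) = ennreal (norm c powr r) * pow_int M r x"
 by (simp add: norm_mult powr_mult ennreal_mult nn_integral_cmult)

lemma mean_limit_lincomb:
 fixes x y z :: "'a \<Rightarrow> complex"
 assumes r: "0 < r"
  and [measurable]: "x \<in> borel_measurable M" "y \<in> borel_measurable M" "z \<in> borel_measurable M"
   "\<And>N. X N \<in> borel_measurable M" "\<And>N. Y N \<in> borel_measurable M" "\<And>N. Z N \<in> borel_measurable M"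
  and lim: "(\<lambda>N::nat. \<integral>\<^sup>+t. ennreal (norm (x t - X N t) powr r) \<partial>M) \<longlonglongrightarrow> 0"
   "(\<lambda>N. \<integral>\<^sup>+t. ennreal (norm (y t - Y N t) powr r) \<partial>M) \<longlonglongrightarrow> 0"
   "(\<lambda>N. \<integral>\<^sup>+t. ennreal (norm (z t - Z N t) powr r) \<partial>M) \<longlonglongrightarrow> 0"
  and ae: "\<And>N. AE t in M. Z N t = a * X N t + b * Y N t"
 shows "pow_int M r (\<lambda>t. z t - (a * x t + b * y t)) = 0"
proof -
 let ?I = "\<lambda>f. \<integral>\<^sup>+t. ennreal (norm (f t :: complex) powr r) \<partial>M"
 let ?c = "ennreal (2 powr r)"
 let ?X = "\<lambda>N. ?I (\<lambda>t. x t - X N t)" and ?Y = "\<lambda>N. ?I (\<lambda>t. y t - Y N t)" and ?Z = "\<lambda>N. ?I (\<lambda>t. z t - Z N t)"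
 let ?E = "\<lambda>N. ?c * (?Z N + ?c * (ennreal (norm (- a) powr r) * ?X N + ennreal (norm (- b) powr r) * ?Y N))"
 have b: "?I (\<lambda>t. z t - (a * x t + b * y t)) \<le> ?E N" for N
 proof -
  have "?I (\<lambda>t. z t - (a * x t + b * y t)) = ?I (\<lambda>t. (z t - Z N t) + ((- a) * (x t - X N t) + (- b) * (y t - Y N t)))"
   by (rule nn_integral_cong_AE, use ae[of N] in eventually_elim) (simp add: algebra_simps)
  also have "\<dots> \<le> ?c * (?Z N + ?I (\<lambda>t. (- a) * (x t - X N t) + (- b) * (y t - Y N t)))"
   by (rule nn_integral_powr_add[OF r]) measurable
  also have "\<dots> \<le> ?c * (?Z N + ?c * (?I (\<lambda>t. (- a) * (x t - X N t)) + ?I (\<lambda>t. (- b) * (y t - Y N t))))"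
   by (intro mult_left_mono add_left_mono nn_integral_powr_add[OF r]) measurable
  also have "\<dots> = ?E N" by (subst (1 2) nn_integral_powr_cmult) measurable
  finally show ?thesis .
 qed
 have cm: "(\<lambda>N. ennreal k * f N) \<longlonglongrightarrow> 0" if "f \<longlonglongrightarrow> 0" for k and f :: "nat \<Rightarrow> ennreal"
  using ennreal_tendsto_cmult[OF ennreal_less_top that, of k] by simp
 have ad: "(\<lambda>N. f N + g N) \<longlonglongrightarrow> 0" if "f \<longlonglongrightarrow> 0" "g \<longlonglongrightarrow> 0" for f g :: "nat \<Rightarrow> ennreal"
  using tendsto_add[OF that] by simp
 have "?E \<longlonglongrightarrow> 0" by (intro cm ad lim)
 then have "?I (\<lambda>t. z t - (a * x t + b * y t)) \<le> 0" by (rule LIMSEQ_le_const) (use b in blast)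
 then show ?thesis by simp
qed

lemma mean_limit_bound:
 fixes h :: "'a \<Rightarrow> complex"
 assumes r: "0 < r" and [measurable]: "h \<in> borel_measurable M" "\<And>N. H N \<in> borel_measurable M"
  and lim: "(\<lambda>N::nat. \<integral>\<^sup>+t. ennreal (norm (h t - H N t) powr r) \<partial>M) \<longlonglongrightarrow> 0"
  and b: "\<And>N. (pow_int M r (H N)) \<le> D"
 shows "pow_int M r h \<le> ennreal (2 powr r) * D"
proof -
 let ?I = "\<lambda>f. \<integral>\<^sup>+t. ennreal (norm (f t :: complex) powr r) \<partial>M"
 have "?I h \<le> ennreal (2 powr r) * ?I (\<lambda>t. h t - H N t) + ennreal (2 powr r) * D" for N
 proof -
  have "?I h = ?I (\<lambda>t. (h t - H N t) + H N t)" by simp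
  also have "\<dots> \<le> ennreal (2 powr r) * (?I (\<lambda>t. h t - H N t) + ?I (H N))" by (rule nn_integral_powr_add[OF r]) measurable
  also have "\<dots> \<le> ennreal (2 powr r) * (?I (\<lambda>t. h t - H N t) + D)" by (intro mult_left_mono add_left_mono b) simp
  finally show ?thesis by (simp only: distrib_left)
 qed
 moreover have "(\<lambda>N. ennreal (2 powr r) * ?I (\<lambda>t. h t - H N t) + ennreal (2 powr r) * D) \<longlonglongrightarrow> 0 + ennreal (2 powr r) * D"
  using ennreal_tendsto_cmult[OF ennreal_less_top lim, of "2 powr r"] by (intro tendsto_add tendsto_const) simp
 ultimately have "?I h \<le> 0 + ennreal (2 powr r) * D" by (intro LIMSEQ_le_const) auto
 then show ?thesis by simp
qed

lemma nn_integral_Fatou_0: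
 fixes f :: "nat \<Rightarrow> 'a \<Rightarrow> ennreal"
 assumes "\<And>n. f n \<in> borel_measurable M" "AE x in M. (\<lambda>n. f n x) \<longlonglongrightarrow> g x" "(\<lambda>n. \<integral>\<^sup>+x. f n x \<partial>M) \<longlonglongrightarrow> 0"
 shows "(\<integral>\<^sup>+x. g x \<partial>M) = 0"
proof -
 have "(\<integral>\<^sup>+x. g x \<partial>M) = (\<integral>\<^sup>+x. liminf (\<lambda>n. f n x) \<partial>M)"
  by (rule nn_integral_cong_AE, use assms(2) in eventually_elim) (simp add: lim_imp_Liminf)
 also have "\<dots> \<le> liminf (\<lambda>n. \<integral>\<^sup>+x. f n x \<partial>M)" using assms(1) by (rule nn_integral_liminf)
 also have "\<dots> = 0" using assms(3) by (simp add: lim_imp_Liminf)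
 finally show ?thesis by simp
qed

text \<open>Along a subsequence the increments are at most 4^(-k r) in the mean of order r.
  Weighting them by 2^(k r) keeps the sum integrable, so almost everywhere they are bounded by a
  multiple of 2^(-k) and the subsequence converges. Fatou's lemma carries the rate E over to the
  limit.\<close>

lemma mean_complete:
 fixes h :: "nat \<Rightarrow> 'a \<Rightarrow> complex"
 assumes r: "0 < r" and [measurable]: "\<And>N. h N \<in> borel_measurable M"
  and E: "E \<longlonglongrightarrow> 0" and cauchy: "\<And>N k. N \<le> k \<Longrightarrow> pow_int M r (\<lambda>x. h k x - h N x) \<le> E N"
 shows "\<exists>l\<in>borel_measurable M. \<forall>N. (pow_int M r (\<lambda>x. l x - h N x)) \<le> E N"
proof -
 define e where "e k = ennreal (((1 / 4) ^ k) powr r)" for k :: nat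
 have "\<exists>m. \<forall>N\<ge>m. E N \<le> e k" for k
 proof -
  have "0 < e k" by (simp add: e_def)
  then have "eventually (\<lambda>N. E N < e k) sequentially" by (rule order_tendstoD(2)[OF E])
  then show ?thesis unfolding eventually_sequentially by (meson less_imp_le)
 qed
 then obtain m where m: "\<And>k N. m k \<le> N \<Longrightarrow> E N \<le> e k" by metis
 \<comment> \<open>Partial sums make the indices strictly increasing while keeping them at least m
   k.\<close>
 define n where "n k = (\<Sum>i\<le>k. Suc (m i))" for k
 have n: "strict_mono n" by (rule strict_mono_Suc_iff[THEN iffD2]) (simp add: n_def)
 have mn: "m k \<le> n k" for k by (cases k) (simp_all add: n_def)
 define d where "d k x = h (n (Suc k)) x - h (n k) x" for k x
 have [measurable]: "d k \<in> borel_measurable M" for k unfolding d_def by measurable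
 have dI: "pow_int M r (d k) \<le> e k" for k
  unfolding d_def by (rule order_trans[OF cauchy m[OF mn]]) (use n in \<open>simp add: strict_mono_less_eq\<close>)
 have "(\<integral>\<^sup>+x. (\<Sum>k. ennreal ((2 ^ k) powr r) * ennreal (norm (d k x) powr r)) \<partial>M) =
   (\<Sum>k. ennreal ((2 ^ k) powr r) * pow_int M r (d k))"
  by (subst nn_integral_suminf) (simp_all add: nn_integral_cmult)
 also have "\<dots> \<le> (\<Sum>k. ennreal (((1 / 2) powr r) ^ k))"
 proof (intro suminf_le summableI)
  fix k
  have "(2 ^ k) powr r * ((1 / 4) ^ k) powr r = ((1 / 2) ^ k) powr r"
   by (simp only: powr_mult[symmetric] power_mult_distrib[symmetric] zero_le_power) simp
  also have "\<dots> = ((1 / 2) powr r) ^ k" by (simp add: powr_power powr_realpow[symmetric] powr_powr mult.commute)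
  finally have e: "ennreal ((2 ^ k) powr r) * e k = ennreal (((1 / 2) powr r) ^ k)" by (simp add: e_def ennreal_mult[symmetric])
  show "ennreal ((2 ^ k) powr r) * pow_int M r (d k) \<le> ennreal (((1 / 2) powr r) ^ k)"
   unfolding e[symmetric] by (intro mult_left_mono dI) simp
 qed
 also have "\<dots> < \<infinity>"
 proof -
  have "(1 / 2) powr r < (1::real) powr r" using r by (intro powr_less_mono2) auto
  then have "summable (\<lambda>k. ((1 / 2) powr r) ^ k)" by (intro summable_geometric) simp
  then show ?thesis by (subst suminf_ennreal2) auto
 qed
 finally have "(\<integral>\<^sup>+x. (\<Sum>k. ennreal ((2 ^ k) powr r) * ennreal (norm (d k x) powr r)) \<partial>M) \<noteq> \<infinity>" by simp
 then have "AE x in M. (\<Sum>k. ennreal ((2 ^ k) powr r) * ennreal (norm (d k x) powr r)) \<noteq> \<infinity>"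
  by (intro nn_integral_PInf_AE) auto
 then have conv: "AE x in M. (\<lambda>k. h (n k) x) \<longlonglongrightarrow> lim (\<lambda>k. h (n k) x)"
 proof eventually_elim
  case (elim x)
  then obtain c where c: "0 \<le> c" "(\<Sum>k. ennreal ((2 ^ k) powr r) * ennreal (norm (d k x) powr r)) = ennreal c"
   by (cases "\<Sum>k. ennreal ((2 ^ k) powr r) * ennreal (norm (d k x) powr r)") auto
  have "norm (d k x) \<le> c powr (1 / r) * (1 / 2) ^ k" for k
  proof -
   have "ennreal ((2 ^ k * norm (d k x)) powr r) \<le> ennreal c"
    using nn_term_le_suminf[of "\<lambda>k. ennreal ((2 ^ k) powr r) * ennreal (norm (d k x) powr r)" k]
    unfolding c(2) by (simp add: powr_mult ennreal_mult)
   then have "(2 ^ k * norm (d k x)) powr r \<le> c" using c by simp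
   then have "((2 ^ k * norm (d k x)) powr r) powr (1 / r) \<le> c powr (1 / r)" using r by (intro powr_mono2) auto
   then have "2 ^ k * norm (d k x) \<le> c powr (1 / r)" using r by (simp add: powr_powr)
   then show ?thesis by (simp add: field_simps power_one_over)
  qed
  then have "summable (\<lambda>k. d k x)"
   by (intro summable_comparison_test[OF _ summable_mult[OF summable_geometric, of "1/2" "c powr (1 / r)"]]) auto
  then have "(\<lambda>k. \<Sum>i<k. d i x) \<longlonglongrightarrow> (\<Sum>i. d i x)" by (rule summable_LIMSEQ)
  moreover have "(\<Sum>i<k. d i x) = h (n k) x - h (n 0) x" for k unfolding d_def by (rule sum_lessThan_telescope)
  ultimately have "(\<lambda>k. h (n k) x - h (n 0) x) \<longlonglongrightarrow> (\<Sum>i. d i x)" by simp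
  then have "(\<lambda>k. (h (n k) x - h (n 0) x) + h (n 0) x) \<longlonglongrightarrow> (\<Sum>i. d i x) + h (n 0) x" by (rule tendsto_add[OF _ tendsto_const])
  then have "convergent (\<lambda>k. h (n k) x)" by (auto simp: convergent_def)
  then show ?case by (rule convergent_LIMSEQ_iff[THEN iffD1])
 qed
 show ?thesis
 proof (intro bexI allI)
  show "(\<lambda>x. lim (\<lambda>k. h (n k) x)) \<in> borel_measurable M" by measurable
  fix N
  show "pow_int M r (\<lambda>x. lim (\<lambda>k. h (n k) x) - h N x) \<le> E N"
  proof (rule nn_fatou_bound)
   show "(\<lambda>x. ennreal (norm (h (n (k + N)) x - h N x) powr r)) \<in> borel_measurable M" for k by measurable
   show "AE x in M. (\<lambda>k. ennreal (norm (h (n (k + N)) x - h N x) powr r)) \<longlonglongrightarrow> ennreal (norm (lim (\<lambda>k. h (n k) x) - h N x) powr r)"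
    using conv by eventually_elim (intro powr_norm_tendsto[OF r] tendsto_diff tendsto_const LIMSEQ_ignore_initial_segment)
   show "pow_int M r (\<lambda>x. h (n (k + N)) x - h N x) \<le> E N" for k
    by (rule cauchy) (rule order_trans[OF _ seq_suble[OF n]], simp)
  qed
 qed
qed

subsection \<open>Nondegenerate Muckenhoupt weights\<close>

lemma weight_measurable:
 fixes w :: "real^'n::finite \<Rightarrow> real"
 assumes "weight w" shows "w \<in> bmeas"
proof -
 have "(\<lambda>x. indicator (cb 0 (real k)) x *\<^sub>R w x) \<in> bmeas" for k :: nat
 proof -
  have "w absolutely_integrable_on (cb 0 (real k))" using assms by (auto simp: weight_def locally_integrable_on_def cb_def)
  then show ?thesis by (auto simp: set_integrable_def)
 qed
 moreover have "(\<lambda>k. indicator (cb 0 (real k)) x *\<^sub>R w x) \<longlonglongrightarrow> w x" for x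
  by (rule tendsto_eventually, use eventually_in_cb[of x] in eventually_elim) simp
 ultimately show ?thesis by (rule borel_measurable_LIMSEQ_metric)
qed

text \<open>The dual weight is infinite where w vanishes. If w has positive mass on some cube, the
  class condition makes the dual integral finite on every larger cube, which forces w to be positive
  almost everywhere there and hence everywhere up to a null set.\<close>

lemma A_class_cases:
 fixes w :: "real^'n::finite \<Rightarrow> real"
 assumes w: "w \<in> A_class P"
 shows "(AE x in lebesgue. w x = 0) \<or> (\<exists>K. Ap_weight P K w)"
proof (rule disjCI)
 have P: "1 < P" and wt: "weight w" and
  sup: "(SUP Q\<in>cubes. eaverage Q (\<lambda>y. ennreal (w y)) * epowr (eaverage Q (\<lambda>y. epowr (ennreal (w y)) (1 - P / (P - 1)))) (P - 1)) < \<infinity>"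
  using w by (auto simp: A_class_def)
 have w0: "0 \<le> w x" for x using wt by (simp add: weight_def)
 note wm [measurable] = weight_measurable[OF wt]
 define k where "k = enn2real (SUP Q\<in>cubes. eaverage Q (\<lambda>y. ennreal (w y)) * epowr (eaverage Q (\<lambda>y. epowr (ennreal (w y)) (1 - P / (P - 1)))) (P - 1))"
 let ?d = "\<lambda>y. epowr (ennreal (w y)) (1 - P / (P - 1))"
 have ex: "1 - P / (P - 1) = - 1 / (P - 1)" using P by (simp add: field_simps)
 have ex0: "1 - P / (P - 1) < 0" unfolding ex using P by simp
 have d: "?d y = (if w y = 0 then top else ennreal (dual_weight P w y))" for y
  using w0[of y] ex0 unfolding epowr_def dual_weight_def ex[symmetric] by (auto simp: ennreal_eq_0_iff)
 have dm [measurable]: "?d \<in> bmeas" by measurable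
 have D: "eaverage (cb x R) (\<lambda>y. ennreal (w y)) * epowr (eaverage (cb x R) ?d) (P - 1) \<le> ennreal k" if R: "0 < R" for x R
 proof -
  have "cb x R \<in> cubes" using R unfolding cubes_eq by blast
  then have "eaverage (cb x R) (\<lambda>y. ennreal (w y)) * epowr (eaverage (cb x R) ?d) (P - 1) \<le>
   (SUP Q\<in>cubes. eaverage Q (\<lambda>y. ennreal (w y)) * epowr (eaverage Q ?d) (P - 1))" by (rule SUP_upper)
  also have "\<dots> = ennreal k" unfolding k_def using sup by (intro ennreal_enn2real[symmetric]) simp
  finally show ?thesis .
 qed
 have W: "emeasure (wmeas w) E = (\<integral>\<^sup>+y. ennreal (w y) * indicator E y \<partial>lebesgue)" if "E \<in> sets lebesgue" for E
  using that by (intro emeasure_density) auto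
 have Wfin: "emeasure (wmeas w) (cb x R) < \<infinity>" for x R
 proof -
  have "w absolutely_integrable_on (cb x R)" using wt by (auto simp: weight_def locally_integrable_on_def cb_def)
  then have "(\<integral>\<^sup>+y. ennreal (norm (indicator (cb x R) y *\<^sub>R w y)) \<partial>lebesgue) < \<infinity>" by (simp add: set_integrable_def integrable_iff_bounded)
  moreover have "(\<integral>\<^sup>+y. ennreal (norm (indicator (cb x R) y *\<^sub>R w y)) \<partial>lebesgue) = emeasure (wmeas w) (cb x R)"
   unfolding W[OF sets_cb(2)] using w0 by (intro nn_integral_cong) (auto simp: indicator_def)
  ultimately show ?thesis by simp
 qed
 have V: "vol (cb x R) \<noteq> 0" "vol (cb x R) \<noteq> top" if "0 < R" for x :: "real^'n" and R
  using emeasure_cb_pos(1)[OF that, of x] emeasure_cb_pos(2)[of x R] by (auto simp: less_top[symmetric])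
 have full: "emeasure (wmeas w) (cb x R) * epowr (\<integral>\<^sup>+y. ?d y * indicator (cb x R) y \<partial>lebesgue) (P - 1) \<le>
   ennreal k * epowr (vol (cb x R)) P" if R: "0 < R" for x R
 proof -
  let ?V = "vol (cb x R)"
  have c: "X / ?V * ?V = X" for X
   using V[OF R, of x] by (simp add: ennreal_divide_times ennreal_mult_divide_eq top.not_eq_extremum)
  have p: "0 < P - 1" using P by simp
  have VP: "epowr ?V P = ?V * epowr ?V (P - 1)" using epowr_add[of 1 "P - 1" ?V] p by simp
  let ?w = "eaverage (cb x R) (\<lambda>y. ennreal (w y))" and ?e = "eaverage (cb x R) ?d"
  have "emeasure (wmeas w) (cb x R) * epowr (\<integral>\<^sup>+y. ?d y * indicator (cb x R) y \<partial>lebesgue) (P - 1) = ?w * ?V * epowr (?e * ?V) (P - 1)"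
   unfolding eaverage_def c W[OF sets_cb(2)] ..
  also have "\<dots> = ?w * epowr ?e (P - 1) * epowr ?V P" unfolding VP epowr_mult[OF p] by (simp only: mult_ac)
  also have "\<dots> \<le> ennreal k * epowr ?V P" by (intro mult_right_mono D R) simp
  finally show ?thesis .
 qed
 have dfin: "(\<integral>\<^sup>+y. ?d y * indicator (cb x R) y \<partial>lebesgue) < \<infinity>" if R: "0 < R" and pos: "0 < emeasure (wmeas w) (cb x R)" for x R
 proof (rule ccontr)
  assume "\<not> ?thesis"
  then have "(\<integral>\<^sup>+y. ?d y * indicator (cb x R) y \<partial>lebesgue) = top" by (simp only: infinity_ennreal_def less_top[symmetric] not_not)
  then have "emeasure (wmeas w) (cb x R) * epowr (\<integral>\<^sup>+y. ?d y * indicator (cb x R) y \<partial>lebesgue) (P - 1) = top"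
   using pos P by (simp add: ennreal_mult_top)
  then have "ennreal k * epowr (vol (cb x R)) P = top" using full[OF R, of x] by (simp add: top_unique)
  moreover have "epowr (vol (cb x R)) P < top"
   using epowr_less_top_iff[of P] P emeasure_cb_pos(2)[of x R] by simp
  ultimately show False by (auto simp: ennreal_mult_eq_top_iff)
 qed
 assume "\<nexists>K. Ap_weight P K w"
 moreover have "Ap_weight P k w" if nz: "\<not> (AE x in lebesgue. w x = 0)"
 proof -
  have "\<exists>j::nat. 0 < emeasure (wmeas w) (cb 0 (real j))"
  proof (rule ccontr)
   assume "\<not> ?thesis"
   then have z: "emeasure (wmeas w) (cb 0 (real j)) = 0" for j :: nat by simp
   have "AE y in lebesgue. ennreal (w y) * indicator (cb 0 (real j)) y = 0" for j :: nat
    using z[of j] unfolding W[OF sets_cb(2)] by (subst (asm) nn_integral_0_iff_AE) auto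
   then have "AE y in lebesgue. \<forall>j::nat. ennreal (w y) * indicator (cb 0 (real j)) y = 0" by (subst AE_all_countable) (rule allI)
   then have "AE x in lebesgue. w x = 0"
   proof eventually_elim
    case (elim y)
    obtain j :: nat where "y \<in> cb 0 (real j)" using eventually_in_cb[of y] unfolding eventually_sequentially by blast
    then show ?case using elim[rule_format, of j] w0[of y] by (simp add: ennreal_eq_0_iff)
   qed
   then show False using nz by contradiction
  qed
  then obtain j0 :: nat where j0: "0 < emeasure (wmeas w) (cb 0 (real j0))" by blast
  have "AE y in lebesgue. y \<in> cb 0 (real j) \<longrightarrow> w y \<noteq> 0" for j :: nat
  proof -
   define i where "i = Suc (max j j0)"
   have sub: "cb 0 (real j) \<subseteq> cb (0::real^'n) (real i)" "cb 0 (real j0) \<subseteq> cb (0::real^'n) (real i)" by (auto simp: i_def intro!: cb_mono)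
   have "0 < emeasure (wmeas w) (cb 0 (real i))" by (rule less_le_trans[OF j0 emeasure_mono[OF sub(2)]]) simp
   then have "(\<integral>\<^sup>+y. ?d y * indicator (cb 0 (real i)) y \<partial>lebesgue) < \<infinity>" by (intro dfin) (simp_all add: i_def)
   then have "AE y in lebesgue. ?d y * indicator (cb 0 (real i)) y \<noteq> \<infinity>" by (intro nn_integral_PInf_AE) auto
   then show ?thesis by eventually_elim (use sub in \<open>auto simp: d\<close>)
  qed
  then have "AE y in lebesgue. \<forall>j::nat. y \<in> cb 0 (real j) \<longrightarrow> w y \<noteq> 0" by (subst AE_all_countable) (rule allI)
  then have wpos: "AE y in lebesgue. 0 < w y"
  proof eventually_elim
   case (elim y)
   obtain j :: nat where "y \<in> cb 0 (real j)" using eventually_in_cb[of y] unfolding eventually_sequentially by blast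
   then show ?case using elim[rule_format, of j] w0[of y] by simp
  qed
  have dw [measurable]: "dual_weight P w \<in> bmeas" unfolding dual_weight_def[abs_def] by measurable
  have S: "(\<integral>\<^sup>+y. ?d y * indicator (cb x R) y \<partial>lebesgue) = emeasure (wmeas (dual_weight P w)) (cb x R)" for x R
  proof (subst emeasure_density)
   show "(\<integral>\<^sup>+y. ?d y * indicator (cb x R) y \<partial>lebesgue) = (\<integral>\<^sup>+y. ennreal (dual_weight P w y) * indicator (cb x R) y \<partial>lebesgue)"
    by (rule nn_integral_cong_AE, use wpos in eventually_elim) (simp add: d)
  qed auto
  show "Ap_weight P k w"
  proof (rule Ap_weight.intro)
   show "0 \<le> k" by (simp add: k_def)
   show "emeasure (wmeas w) (cb x R) * epowr (emeasure (wmeas (dual_weight P w)) (cb x R)) (P - 1) \<le> ennreal k * epowr (vol (cb x R)) P"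
    if "0 < R" for x R using full[OF that, of x] unfolding S .
   show "emeasure (wmeas (dual_weight P w)) (cb x R) < \<infinity>" for x R
   proof -
    have R: "0 < max R 1" by simp
    have "emeasure (wmeas (dual_weight P w)) (cb x R) \<le> emeasure (wmeas (dual_weight P w)) (cb x (max R 1))"
     by (intro emeasure_mono cb_mono) auto
    also have "\<dots> < \<infinity>" using dfin[OF R wmeas_pos[OF wpos wm R], of x] unfolding S .
    finally show ?thesis .
   qed
  qed (fact P wm w0 wpos Wfin)+
 qed
 ultimately show "AE x in lebesgue. w x = 0" by blast
qed

subsection \<open>The product weight\<close>

text \<open>\<open>holder_set\<close> with a function in place of the indicator. Applied to the
  squared norm, it shows that functions in the weighted space of exponent 2 p are square integrable
  on cubes.\<close>

lemma (in Ap_weight) nn_integral_cb_le: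
 assumes [measurable]: "F \<in> bmeas"
 shows "(\<integral>\<^sup>+x. F x * indicator (cb y R) x \<partial>lebesgue) \<le>
  epowr (\<integral>\<^sup>+x. epowr (F x) p \<partial>wmeas w) (1 / p) * epowr (emeasure (wmeas (dual_weight p w)) (cb y R)) (1 - 1 / p)"
proof -
 let ?Q = "cb y R"
 have t: "0 < 1 / p" "1 / p < 1" "0 < 1 - 1 / p" using p by auto
 have "(\<integral>\<^sup>+x. F x * indicator ?Q x \<partial>lebesgue) =
  (\<integral>\<^sup>+x. epowr (ennreal (w x) * epowr (F x) p) (1/p) * epowr (ennreal (dual_weight p w x) * indicator ?Q x) (1 - 1/p) \<partial>lebesgue)"
 proof (rule nn_integral_cong_AE, use wpos in eventually_elim)
  fix x assume x: "0 < w x"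
  have "w x powr (1/p) * (w x powr (- 1 / (p - 1))) powr (1 - 1/p) = w x powr (1/p + (- 1 / (p - 1)) * (1 - 1/p))"
   by (simp only: powr_powr powr_add)
  also have "1/p + (- 1 / (p - 1)) * (1 - 1/p) = 0" using p by (simp add: field_simps)
  finally have e: "epowr (ennreal (w x)) (1/p) * epowr (ennreal (dual_weight p w x)) (1 - 1/p) = 1"
   using x t by (subst epowr_ennreal, simp, simp, subst epowr_ennreal)
    (simp_all add: dual_weight_def ennreal_mult[symmetric])
  have "epowr (ennreal (w x) * epowr (F x) p) (1/p) = epowr (ennreal (w x)) (1/p) * F x"
   unfolding epowr_mult[OF t(1)] using p by (simp add: epowr_epowr)
  then show "F x * indicator ?Q x = epowr (ennreal (w x) * epowr (F x) p) (1/p) * epowr (ennreal (dual_weight p w x) * indicator ?Q x) (1 - 1/p)"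
   using e t(3) by (cases "x \<in> ?Q") (simp_all add: mult_ac)
 qed
 also have "\<dots> \<le> epowr (\<integral>\<^sup>+x. ennreal (w x) * epowr (F x) p \<partial>lebesgue) (1/p) *
   epowr (\<integral>\<^sup>+x. ennreal (dual_weight p w x) * indicator ?Q x \<partial>lebesgue) (1 - 1/p)"
  by (rule nn_Holder[OF t(1,2)]) measurable
 also have "\<dots> = epowr (\<integral>\<^sup>+x. epowr (F x) p \<partial>wmeas w) (1 / p) * epowr (emeasure (wmeas (dual_weight p w)) ?Q) (1 - 1 / p)"
  by (simp add: emeasure_density nn_integral_density)
 finally show ?thesis .
qed

locale weight_pair =
 fixes p q r Kv Kw :: real and v w :: "real^'n::finite \<Rightarrow> real"
 assumes pq: "2 < p" "2 < q" and r_def: "1 / r = 1 / p + 1 / q"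
  and Vw: "Ap_weight (p / 2) Kv v" and Ww: "Ap_weight (q / 2) Kw w"
begin

sublocale PV: Ap_weight "p / 2" Kv v by (rule Vw)
sublocale PW: Ap_weight "q / 2" Kw w by (rule Ww)

definition u :: "real^'n \<Rightarrow> real" where
 "u x = v x powr (r / p) * w x powr (r / q)"

lemma u_measurable [measurable]: "u \<in> bmeas"
 unfolding u_def[abs_def] by measurable

lemma exps: "0 < r" "0 < r / p" "r / p < 1" "r / q = 1 - r / p" "0 < r / q" "1 < r"
proof -
 have "0 < 1 / p + 1 / q" using pq by (intro add_pos_pos) auto
 then have "0 < 1 / r" using r_def by simp
 then show r: "0 < r" by simp
 then show "0 < r / p" "0 < r / q" using pq by auto
 have "r * (1 / p + 1 / q) = 1" using r unfolding r_def[symmetric] by simp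
 then show 1: "r / q = 1 - r / p" by (simp add: distrib_left)
 then show "r / p < 1" using \<open>0 < r / q\<close> by simp
 have "1 / p < 1 / 2" "1 / q < 1 / 2" using pq by (simp_all add: field_simps)
 then have "1 / r < 1" using r_def by simp
 then show "1 < r" using r by simp
qed

text \<open>The exponents r / p and r / q add up to 1, and u is the product of v and w to these same
  powers.\<close>

lemma U_Holder:
 assumes [measurable]: "F \<in> bmeas" "G \<in> bmeas"
 shows "(\<integral>\<^sup>+x. epowr (F x) (r / p) * epowr (G x) (r / q) \<partial>wmeas u) \<le>
  epowr (\<integral>\<^sup>+x. F x \<partial>wmeas v) (r / p) * epowr (\<integral>\<^sup>+x. G x \<partial>wmeas w) (r / q)"
proof -
 have "(\<integral>\<^sup>+x. epowr (F x) (r / p) * epowr (G x) (r / q) \<partial>wmeas u) =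
  (\<integral>\<^sup>+x. epowr (ennreal (v x) * F x) (r / p) * epowr (ennreal (w x) * G x) (r / q) \<partial>lebesgue)"
 proof (subst nn_integral_density)
  have e: "ennreal (u x) = epowr (ennreal (v x)) (r / p) * epowr (ennreal (w x)) (r / q)" for x
   using PV.w0[of x] PW.w0[of x] exps by (simp add: u_def epowr_ennreal ennreal_mult)
  show "(\<integral>\<^sup>+x. ennreal (u x) * (epowr (F x) (r / p) * epowr (G x) (r / q)) \<partial>lebesgue) =
   (\<integral>\<^sup>+x. epowr (ennreal (v x) * F x) (r / p) * epowr (ennreal (w x) * G x) (r / q) \<partial>lebesgue)"
   unfolding e epowr_mult[OF exps(2)] epowr_mult[OF exps(5)] by (simp only: mult_ac)
 qed measurable
 also have "\<dots> \<le> epowr (\<integral>\<^sup>+x. ennreal (v x) * F x \<partial>lebesgue) (r / p) * epowr (\<integral>\<^sup>+x. ennreal (w x) * G x \<partial>lebesgue) (r / q)"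
  unfolding exps(4) by (rule nn_Holder[OF exps(2,3)]) measurable
 finally show ?thesis by (simp add: nn_integral_density)
qed

lemma U_cb_le: "emeasure (wmeas u) (cb x R) \<le> epowr (emeasure (wmeas v) (cb x R)) (r / p) * epowr (emeasure (wmeas w) (cb x R)) (r / q)"
proof -
 have "emeasure (wmeas u) (cb x R) = (\<integral>\<^sup>+y. epowr (indicator (cb x R) y) (r / p) * epowr (indicator (cb x R) y) (r / q) \<partial>wmeas u)"
 proof -
  have "emeasure (wmeas u) (cb x R) = (\<integral>\<^sup>+y. indicator (cb x R) y \<partial>wmeas u)" by (rule nn_integral_indicator[symmetric]) simp
  also have "\<dots> = (\<integral>\<^sup>+y. epowr (indicator (cb x R) y) (r / p) * epowr (indicator (cb x R) y) (r / q) \<partial>wmeas u)"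
   using exps epowr_ennreal[of "r / p" 1] epowr_ennreal[of "r / q" 1] by (intro nn_integral_cong) (auto simp: indicator_def)
  finally show ?thesis .
 qed
 also have "\<dots> \<le> epowr (\<integral>\<^sup>+y. indicator (cb x R) y \<partial>wmeas v) (r / p) * epowr (\<integral>\<^sup>+y. indicator (cb x R) y \<partial>wmeas w) (r / q)"
  by (rule U_Holder) auto
 also have "\<dots> = epowr (emeasure (wmeas v) (cb x R)) (r / p) * epowr (emeasure (wmeas w) (cb x R)) (r / q)"
  by (subst (1 2) nn_integral_indicator) auto
 finally show ?thesis .
qed

lemma U_fin: "emeasure (wmeas u) (cb x R) < \<infinity>"
 by (rule le_less_trans[OF U_cb_le])
  (use PV.Wfin PW.Wfin epowr_less_top_iff[OF exps(2)] epowr_less_top_iff[OF exps(5)] in \<open>auto simp: ennreal_mult_less_top\<close>)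

text \<open>The maximum with 1 keeps \<open>eta\<close> nonnegative.\<close>

definition Ku :: real where "Ku = max 1 (Kv powr (r / p) * Kw powr (r / q))"

text \<open>The analogue of \<open>key\<close> for the product weight, with exponent r. A three-fold
  Hoelder inequality on F involves u and both dual weights; the conditions on v and w, raised to r /
  p and r / q, remove the dual weights after \<open>U_cb_le\<close> has brought in the masses of v
  and w.\<close>

lemma U_key:
 assumes R: "0 < R" and F: "F \<in> sets lebesgue" "F \<subseteq> cb x R"
 shows "epowr (vol F) r * emeasure (wmeas u) (cb x R) \<le> ennreal Ku * epowr (vol (cb x R)) r * emeasure (wmeas u) F"
proof -
 let ?Q = "cb x R" let ?sv = "dual_weight (p / 2) v" and ?sw = "dual_weight (q / 2) w"
 let ?Sv = "wmeas ?sv" and ?Sw = "wmeas ?sw"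
 \<comment> \<open>Together with 1 / r these exponents sum to 1, and the corresponding powers of u
   and the two dual weights multiply to 1 almost everywhere.\<close>
 define \<beta> \<gamma> where "\<beta> = 1 / 2 - 1 / p" and "\<gamma> = 1 / 2 - 1 / q"
 have t: "0 < 1 / r" "0 < \<beta>" "0 < \<gamma>" "1 / r + \<beta> + \<gamma> = 1"
  using exps(1) pq r_def by (auto simp: \<beta>_def \<gamma>_def field_simps)
 have E [measurable]: "F \<in> sets lebesgue" by fact
 have one: "epowr (ennreal (u y)) (1 / r) * (epowr (ennreal (?sv y)) \<beta> * epowr (ennreal (?sw y)) \<gamma>) = 1"
  if y: "0 < v y" "0 < w y" for y
 proof -
  have "u y powr (1 / r) = v y powr (1 / p) * w y powr (1 / q)"
   using exps(1) by (simp add: u_def powr_mult powr_powr)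
  moreover have "?sv y powr \<beta> = v y powr (- (1 / p))"
  proof -
   have "- 1 / (p / 2 - 1) * \<beta> = - (1 / p)" using pq by (simp add: \<beta>_def field_simps)
   then show ?thesis by (simp add: dual_weight_def powr_powr)
  qed
  moreover have "?sw y powr \<gamma> = w y powr (- (1 / q))"
  proof -
   have "- 1 / (q / 2 - 1) * \<gamma> = - (1 / q)" using pq by (simp add: \<gamma>_def field_simps)
   then show ?thesis by (simp add: dual_weight_def powr_powr)
  qed
  ultimately have "u y powr (1 / r) * (?sv y powr \<beta> * ?sw y powr \<gamma>) =
   (v y powr (1 / p) * v y powr (- (1 / p))) * (w y powr (1 / q) * w y powr (- (1 / q)))" by (simp only: mult_ac)
  also have "\<dots> = 1" using y by (simp add: powr_add[symmetric] del: powr_minus)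
  finally have "u y powr (1 / r) * (?sv y powr \<beta> * ?sw y powr \<gamma>) = 1" .
  then have "ennreal (u y powr (1 / r)) * (ennreal (?sv y powr \<beta>) * ennreal (?sw y powr \<gamma>)) = 1"
   by (simp only: ennreal_mult[symmetric] powr_ge_zero mult_nonneg_nonneg ennreal_1)
  then show ?thesis using t by (subst (1 2 3) epowr_ennreal) (auto simp: u_def dual_weight_def)
 qed
 have "vol F = (\<integral>\<^sup>+y. indicator F y \<partial>lebesgue)" by (rule nn_integral_indicator[symmetric]) simp
 also have "\<dots> = (\<integral>\<^sup>+y. epowr (ennreal (u y) * indicator F y) (1 / r) * (epowr (ennreal (?sv y) * indicator F y) \<beta> * epowr (ennreal (?sw y) * indicator F y) \<gamma>) \<partial>lebesgue)"
  by (rule nn_integral_cong_AE, use PV.wpos PW.wpos in eventually_elim) (use t one in \<open>auto simp: indicator_def\<close>)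
 also have "\<dots> \<le> epowr (\<integral>\<^sup>+y. ennreal (u y) * indicator F y \<partial>lebesgue) (1 / r) *
  (epowr (\<integral>\<^sup>+y. ennreal (?sv y) * indicator F y \<partial>lebesgue) \<beta> * epowr (\<integral>\<^sup>+y. ennreal (?sw y) * indicator F y \<partial>lebesgue) \<gamma>)"
  using PV.sm PW.sm by (intro nn_Holder3 t) auto
 also have "\<dots> = epowr (emeasure (wmeas u) F) (1 / r) * (epowr (emeasure ?Sv F) \<beta> * epowr (emeasure ?Sw F) \<gamma>)"
  using PV.sm PW.sm by (subst (1 2 3) emeasure_density) auto
 finally have "epowr (vol F) r \<le> epowr (epowr (emeasure (wmeas u) F) (1 / r) * (epowr (emeasure ?Sv F) \<beta> * epowr (emeasure ?Sw F) \<gamma>)) r"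
  by (rule epowr_mono[OF exps(1)])
 also have "\<dots> = emeasure (wmeas u) F * (epowr (emeasure ?Sv F) (\<beta> * r) * epowr (emeasure ?Sw F) (\<gamma> * r))"
  using t exps(1) by (simp add: epowr_mult epowr_epowr)
 also have "\<dots> \<le> emeasure (wmeas u) F * (epowr (emeasure ?Sv ?Q) (\<beta> * r) * epowr (emeasure ?Sw ?Q) (\<gamma> * r))"
  using t exps(1) F by (intro mult_left_mono mult_mono epowr_mono emeasure_mono) auto
 finally have 1: "epowr (vol F) r \<le> emeasure (wmeas u) F * (epowr (emeasure ?Sv ?Q) (\<beta> * r) * epowr (emeasure ?Sw ?Q) (\<gamma> * r))" .
 have Av: "epowr (emeasure (wmeas v) ?Q) (r / p) * epowr (emeasure ?Sv ?Q) (\<beta> * r) \<le> ennreal (Kv powr (r / p)) * epowr (vol ?Q) (r / 2)"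
 proof -
  have "(p / 2 - 1) * (r / p) = \<beta> * r" "p / 2 * (r / p) = r / 2" "0 < p / 2 - 1" "0 < p / 2" using pq by (auto simp: \<beta>_def field_simps)
  then show ?thesis
   using epowr_mono[OF exps(2) PV.Ap[OF R, of x]] PV.K exps(2) by (simp add: epowr_mult epowr_epowr epowr_ennreal)
 qed
 have Aw: "epowr (emeasure (wmeas w) ?Q) (r / q) * epowr (emeasure ?Sw ?Q) (\<gamma> * r) \<le> ennreal (Kw powr (r / q)) * epowr (vol ?Q) (r / 2)"
 proof -
  have "(q / 2 - 1) * (r / q) = \<gamma> * r" "q / 2 * (r / q) = r / 2" "0 < q / 2 - 1" "0 < q / 2" using pq by (auto simp: \<gamma>_def field_simps)
  then show ?thesis
   using epowr_mono[OF exps(5) PW.Ap[OF R, of x]] PW.K exps(5) by (simp add: epowr_mult epowr_epowr epowr_ennreal)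
 qed
 let ?Uf = "emeasure (wmeas u) F"
 have "epowr (vol F) r * emeasure (wmeas u) ?Q \<le>
  (?Uf * (epowr (emeasure ?Sv ?Q) (\<beta> * r) * epowr (emeasure ?Sw ?Q) (\<gamma> * r))) *
  (epowr (emeasure (wmeas v) ?Q) (r / p) * epowr (emeasure (wmeas w) ?Q) (r / q))"
  by (intro mult_mono 1 U_cb_le) auto
 also have "\<dots> = ?Uf * ((epowr (emeasure (wmeas v) ?Q) (r / p) * epowr (emeasure ?Sv ?Q) (\<beta> * r)) *
   (epowr (emeasure (wmeas w) ?Q) (r / q) * epowr (emeasure ?Sw ?Q) (\<gamma> * r)))" by (simp only: mult_ac)
 also have "\<dots> \<le> ?Uf * ((ennreal (Kv powr (r / p)) * epowr (vol ?Q) (r / 2)) * (ennreal (Kw powr (r / q)) * epowr (vol ?Q) (r / 2)))"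
  by (intro mult_left_mono mult_mono Av Aw) auto
 also have "\<dots> = ennreal (Kv powr (r / p) * Kw powr (r / q)) * epowr (vol ?Q) r * ?Uf"
  using epowr_add[of "r / 2" "r / 2" "vol ?Q"] exps(1) by (simp add: ennreal_mult mult_ac)
 also have "\<dots> \<le> ennreal Ku * epowr (vol ?Q) r * ?Uf"
  by (intro mult_right_mono ennreal_leI) (auto simp: Ku_def)
 finally show ?thesis .
qed

definition eta :: real where "eta = 1 - 1 / (Ku * 2 powr r)"

text \<open>\<open>U_key\<close> is applied to the complement of E, which fills at least half of the
  cube and so carries at least the share 1 / (Ku 2^r) of the mass; E keeps at most the rest.\<close>

sublocale Ainf_weight u eta
proof
 have M: "1 \<le> Ku * 2 powr r"
 proof -
  have "1 * 1 \<le> Ku * 2 powr r" using exps(1) by (intro mult_mono) (auto simp: Ku_def ge_one_powr_ge_zero)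
  then show ?thesis by simp
 qed
 show "0 \<le> eta" using M by (simp add: eta_def)
 show "eta < 1" using M by (simp add: eta_def)
 show "0 \<le> u x" for x by (simp add: u_def)
 show "emeasure (wmeas u) (cb x R) < \<infinity>" for x R by (rule U_fin)
 show "emeasure (wmeas u) E \<le> ennreal eta * emeasure (wmeas u) (cb x R)"
  if R: "0 < R" and E: "E \<in> sets lebesgue" "E \<subseteq> cb x R" and half: "2 * vol E \<le> vol (cb x R)" for x R E
 proof -
  let ?Q = "cb x R" define F where "F = ?Q - E"
  have F: "F \<in> sets lebesgue" "F \<subseteq> ?Q" using E by (auto simp: F_def)
  have V: "vol ?Q \<noteq> 0" "vol ?Q \<noteq> top"
   using emeasure_cb_pos(1)[OF R, of x] emeasure_cb_pos(2)[of x R] by (auto simp: less_top[symmetric])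
  have add: "emeasure M E + emeasure M F = emeasure M ?Q" if "sets M = sets lebesgue" for M
   using plus_emeasure[of E M F] E F that by (auto simp: F_def Un_absorb1)
  have le: "vol ?Q \<le> 2 * vol F"
  proof -
   have "vol ?Q + vol ?Q = 2 * vol E + 2 * vol F"
    unfolding add[OF refl, symmetric] by (simp only: mult_2 add_ac)
   also have "\<dots> \<le> vol ?Q + 2 * vol F" by (rule add_right_mono[OF half])
   finally show ?thesis by (rule ennreal_add_left_cancel_le[THEN iffD1, THEN disjE]) (use V in auto)
  qed
  have "epowr (vol ?Q) r * emeasure (wmeas u) ?Q \<le> epowr (2 * vol F) r * emeasure (wmeas u) ?Q"
   by (intro mult_right_mono epowr_mono exps le) simp
  also have "\<dots> = ennreal (2 powr r) * (epowr (vol F) r * emeasure (wmeas u) ?Q)"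
   using exps(1) epowr_ennreal[of r 2] by (simp add: epowr_mult mult_ac)
  also have "\<dots> \<le> ennreal (2 powr r) * (ennreal Ku * epowr (vol ?Q) r * emeasure (wmeas u) F)"
   by (intro mult_left_mono U_key R F) simp
  also have "\<dots> = epowr (vol ?Q) r * (ennreal (Ku * 2 powr r) * emeasure (wmeas u) F)"
  proof -
   have "ennreal (Ku * 2 powr r) = ennreal Ku * ennreal (2 powr r)" by (rule ennreal_mult) (auto simp: Ku_def)
   then show ?thesis by (simp only: mult_ac)
  qed
  finally have "emeasure (wmeas u) ?Q \<le> ennreal (Ku * 2 powr r) * emeasure (wmeas u) F"
  proof (rule ennreal_mult_le_mult_iff[THEN iffD1, rotated 2])
   show "epowr (vol ?Q) r \<noteq> 0" using V(1) epowr_eq_0_iff[OF exps(1)] by simp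
   show "epowr (vol ?Q) r \<noteq> top" using emeasure_cb_pos(2)[of x R] epowr_less_top_iff[OF exps(1), of "vol ?Q"]
    by (auto simp: less_top[symmetric])
  qed
  moreover have "emeasure (wmeas u) E \<le> emeasure (wmeas u) ?Q" "emeasure (wmeas u) F \<le> emeasure (wmeas u) ?Q"
   using E F by (auto intro!: emeasure_mono)
  then have fin: "emeasure (wmeas u) E < top" "emeasure (wmeas u) F < top" using U_fin[of x R] by auto
  obtain e f where ef: "0 \<le> e" "0 \<le> f" "emeasure (wmeas u) E = ennreal e" "emeasure (wmeas u) F = ennreal f"
   using fin by (cases "emeasure (wmeas u) E"; cases "emeasure (wmeas u) F") auto
  have Q: "emeasure (wmeas u) ?Q = ennreal (e + f)" using add[of "wmeas u"] ef by (simp add: ennreal_plus)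
  ultimately have "ennreal (e + f) \<le> ennreal (Ku * 2 powr r * f)" using ef M by (simp add: ennreal_mult')
  then have "e + f \<le> Ku * 2 powr r * f" using ef M by (subst (asm) ennreal_le_iff) auto
  then have "(e + f) / (Ku * 2 powr r) \<le> f" using M by (simp add: field_simps)
  then have "e \<le> eta * (e + f)" by (simp add: eta_def left_diff_distrib)
  then have "ennreal e \<le> ennreal (eta * (e + f))" by (rule ennreal_leI)
  then show ?thesis unfolding ef(3) Q using \<open>0 \<le> eta\<close> ef by (simp add: ennreal_mult)
 qed
qed measurable

end

subsection \<open>The extension to weighted spaces\<close>

lemma epowr_norm_square: "0 < a \<Longrightarrow> epowr (ennreal ((norm (z::complex))\<^sup>2)) a = ennreal (norm z powr (2 * a))"
 by (simp add: epowr_ennreal powr_powr[symmetric] powr_two)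

text \<open>The square of a is the supremum of the averages over the dyadic dilates. It is finite
  because the total integral is finite and the volumes are bounded below. Every dilate is a rational
  cube containing x, hence the comparison with \<open>maxf\<close>.\<close>

lemma cube_average_bound:
 fixes f :: "'n::finite cfun" and m :: "('n \<Rightarrow> rat) \<times> rat"
 assumes f: "f \<in> L2" and m: "0 < snd m"
 shows "\<exists>a\<ge>0. (\<forall>j. (sq_int (cb (\<chi> i. of_rat (fst m i)) (2 ^ j * of_rat (snd m))) f)
   \<le> ennreal (a\<^sup>2 * (2 * (2 ^ j * of_rat (snd m))) ^ CARD('n)))
  \<and> (\<forall>x\<in>rcube m. ennreal a \<le> epowr (maxf lebesgue (\<lambda>y. ennreal ((norm (f y))\<^sup>2)) x) (1 / 2))"
proof -
 let ?x = "(\<chi> i. of_rat (fst m i)) :: real^'n" and ?l = "of_rat (snd m) :: real"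
 let ?F = "\<lambda>y. ennreal ((norm (f y))\<^sup>2)"
 let ?Q = "\<lambda>j::nat. cb ?x (2 ^ j * ?l)"
 have l: "0 < ?l" using m by simp
 have [measurable]: "f \<in> bmeas" using f by (simp add: L2_def)
 define av where "av j = (\<integral>\<^sup>+y. ?F y * indicator (?Q j) y \<partial>lebesgue) / vol (?Q j)" for j
 define t where "t = (LINT y|lebesgue. (norm (f y))\<^sup>2)"
 have t: "(\<integral>\<^sup>+y. ?F y \<partial>lebesgue) = ennreal t" "0 \<le> t"
  unfolding t_def using f by (auto intro!: nn_integral_eq_integral simp: L2_def)
 have V: "vol (?Q j) = ennreal ((2 * (2 ^ j * ?l)) ^ CARD('n))" for j
  using l by (intro emeasure_cb) simp
 have av_le: "av j \<le> ennreal (t / (2 * ?l) ^ CARD('n))" for j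
 proof -
  have "(\<integral>\<^sup>+y. ?F y * indicator (?Q j) y \<partial>lebesgue) \<le> ennreal t"
   unfolding t(1)[symmetric] by (intro nn_integral_mono) (auto simp: indicator_def)
  then have "av j \<le> ennreal t / ennreal ((2 * (2 ^ j * ?l)) ^ CARD('n))" unfolding av_def V by (rule divide_right_mono_ennreal)
  also have "\<dots> = ennreal (t / (2 * (2 ^ j * ?l)) ^ CARD('n))" using t l by (intro divide_ennreal) auto
  also have "\<dots> \<le> ennreal (t / (2 * ?l) ^ CARD('n))"
   using t l by (intro ennreal_leI divide_left_mono power_mono mult_pos_pos zero_less_power mult_left_mono) auto
  finally show ?thesis .
 qed
 define a where "a = sqrt (enn2real (SUP j. av j))"
 have "(SUP j. av j) \<le> ennreal (t / (2 * ?l) ^ CARD('n))" by (rule SUP_least) (rule av_le)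
 then have "(SUP j. av j) < top" by (rule le_less_trans) simp
 then have a: "ennreal (a\<^sup>2) = (SUP j. av j)" "0 \<le> a" by (simp_all add: a_def)
 show ?thesis
 proof (intro exI[of _ a] conjI allI ballI)
  show "0 \<le> a" by (rule a)
  show "(\<integral>\<^sup>+y. ?F y * indicator (?Q j) y \<partial>lebesgue) \<le> ennreal (a\<^sup>2 * (2 * (2 ^ j * ?l)) ^ CARD('n))" for j
  proof -
   have "(\<integral>\<^sup>+y. ?F y * indicator (?Q j) y \<partial>lebesgue) = av j * vol (?Q j)"
    unfolding av_def using emeasure_cb_pos(1)[of "2 ^ j * ?l" ?x] emeasure_cb_pos(2)[of ?x "2 ^ j * ?l"] l
    by (simp add: ennreal_divide_times ennreal_mult_divide_eq)
   also have "\<dots> \<le> ennreal (a\<^sup>2) * vol (?Q j)" unfolding a(1) by (intro mult_right_mono SUP_upper) auto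
   also have "\<dots> = ennreal (a\<^sup>2 * (2 * (2 ^ j * ?l)) ^ CARD('n))" unfolding V using l by (simp add: ennreal_mult)
   finally show ?thesis .
  qed
  fix x assume x: "x \<in> rcube m"
  have "av j \<le> maxf lebesgue ?F x" for j
  proof -
   have "?l \<le> 2 ^ j * ?l" using l by simp
   then have "x \<in> ?Q j" using x cb_mono[of ?l "2 ^ j * ?l" ?x] by blast
   then show ?thesis
    using maxf_upper[where m="(fst m, 2 ^ j * snd m)" and x=x and f="?F" and \<mu>=lebesgue] m by (simp add: av_def of_rat_mult of_rat_power)
  qed
  then have "ennreal (a\<^sup>2) \<le> maxf lebesgue ?F x" unfolding a(1) by (intro SUP_least)
  then have "epowr (ennreal (a\<^sup>2)) (1 / 2) \<le> epowr (maxf lebesgue ?F x) (1 / 2)" by (intro epowr_mono) auto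
  then show "ennreal a \<le> epowr (maxf lebesgue ?F x) (1 / 2)"
   using a(2) by (simp add: epowr_ennreal powr_half_sqrt)
 qed
qed

lemma trunc_measurable: "f \<in> bmeas \<Longrightarrow> trunc N f \<in> bmeas"
 unfolding trunc_def[abs_def] by auto

lemma (in Ap_weight) trunc_L2:
 assumes [measurable]: "f \<in> bmeas" and fin: "pow_int (wmeas w) (2 * p) f < \<infinity>"
 shows "trunc N f \<in> L2"
proof -
 have p0: "0 < p" "0 < 1 / p" "0 < 1 - 1 / p" using p by auto
 have "pow_int lebesgue 2 (trunc N f) = sq_int (cb 0 (real N)) f"
  unfolding powr_two by (intro nn_integral_cong) (auto simp: trunc_def indicator_def)
 also have "\<dots> \<le> epowr (\<integral>\<^sup>+x. epowr (ennreal ((norm (f x))\<^sup>2)) p \<partial>wmeas w) (1 / p) *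
   epowr (emeasure (wmeas (dual_weight p w)) (cb 0 (real N))) (1 - 1 / p)" by (rule nn_integral_cb_le) measurable
 also have "\<dots> < \<infinity>"
  unfolding epowr_norm_square[OF p0(1)] using fin Sfin[of 0 "real N"] epowr_less_top_iff[OF p0(2)] epowr_less_top_iff[OF p0(3)]
  by (auto simp: ennreal_mult_less_top)
 finally have "pow_int (wmeas (\<lambda>x. 1)) 2 (trunc N f) < \<infinity>" unfolding wmeas_1 .
 then have "trunc N f \<in> fst (Lp 2)" using trunc_measurable[OF assms(1), of N] by (subst fst_weighted_Lp) auto
 then show ?thesis by (simp add: fst_L2)
qed

lemma trunc_mean_tendsto:
 fixes f :: "'n::finite cfun"
 assumes p: "0 < p" and [measurable_cong, simp]: "sets M = sets lebesgue" and [measurable]: "f \<in> bmeas"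
  and fin: "pow_int M p f < \<infinity>"
 shows "(\<lambda>N. \<integral>\<^sup>+x. ennreal (norm (f x - trunc N f x) powr p) \<partial>M) \<longlonglongrightarrow> 0"
proof -
 have [measurable]: "trunc N f \<in> bmeas" for N by (rule trunc_measurable) fact
 have "(\<lambda>N. \<integral>\<^sup>+x. ennreal (norm (f x - trunc N f x) powr p) \<partial>M) \<longlonglongrightarrow> (\<integral>\<^sup>+x. 0 \<partial>M)"
 proof (rule nn_integral_dominated_convergence[where w="\<lambda>x. ennreal (norm (f x) powr p)"])
  show "(\<lambda>x. ennreal (norm (f x - trunc N f x) powr p)) \<in> borel_measurable M" for N by measurable
  show "(\<lambda>x. ennreal (norm (f x) powr p)) \<in> borel_measurable M" by measurable
  show "AE x in M. ennreal (norm (f x - trunc N f x) powr p) \<le> ennreal (norm (f x) powr p)" for N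
   by (rule AE_I2) (auto simp: trunc_def indicator_def)
  show "AE x in M. (\<lambda>N. ennreal (norm (f x - trunc N f x) powr p)) \<longlonglongrightarrow> 0"
  proof (rule AE_I2)
   fix x
   have "eventually (\<lambda>N. ennreal (norm (f x - trunc N f x) powr p) = 0) sequentially"
    using eventually_in_cb[of x] by eventually_elim (use p in \<open>simp add: trunc_def\<close>)
   then show "(\<lambda>N. ennreal (norm (f x - trunc N f x) powr p)) \<longlonglongrightarrow> 0" by (rule tendsto_eventually)
  qed
 qed (use fin in auto)
 then show ?thesis by simp
qed

text \<open>\<open>growth\<close> bounds the masses of the dyadic cubes by a geometric progression,
  which is all the decay argument asks of a measure.\<close>

lemma (in Ap_weight) schwartz_weighted_finite:
 assumes f: "f \<in> schwartz_space" and a: "0 < a"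
 shows "pow_int (wmeas w) a f < \<infinity>"
proof (rule schwartz_nn_integral_finite[OF f a, where D="(2 ^ CARD('n)) powr p" and C="K * enn2real (emeasure (wmeas w) (cb 0 1))"])
 show "sets (wmeas w) = sets lebesgue" by simp
 have "1 powr p \<le> (2 ^ CARD('n)) powr p" using p by (intro powr_mono2) auto
 then show "1 \<le> (2 ^ CARD('n)) powr p" by simp
 fix j :: nat
 have "((2::real) ^ j) ^ CARD('n) = (2 ^ CARD('n)) ^ j" by (simp only: power_mult[symmetric] mult.commute)
 then have e: "(((2::real) ^ j) ^ CARD('n)) powr p = ((2 ^ CARD('n)) powr p) ^ j"
  by (simp add: powr_realpow[symmetric] powr_powr mult_ac)
 have "emeasure (wmeas w) (cb 0 (2 ^ j)) \<le> ennreal (K * ((2 ^ j) ^ CARD('n)) powr p) * emeasure (wmeas w) (cb 0 1)"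
  using growth(1)[of 1 "2 ^ j" 0] by simp
 also have "emeasure (wmeas w) (cb 0 1) = ennreal (enn2real (emeasure (wmeas w) (cb 0 1)))"
  using Wfin[of 0 1] by (intro ennreal_enn2real[symmetric]) simp
 also have "ennreal (K * ((2 ^ j) ^ CARD('n)) powr p) * ennreal (enn2real (emeasure (wmeas w) (cb 0 1))) =
  ennreal (K * enn2real (emeasure (wmeas w) (cb 0 1)) * ((2 ^ CARD('n)) powr p) ^ j)"
  unfolding e using K by (subst ennreal_mult[symmetric]) (auto simp: mult_ac)
 finally show "emeasure (wmeas w) (cb 0 (2 ^ j)) \<le> ennreal (K * enn2real (emeasure (wmeas w) (cb 0 1)) * ((2 ^ CARD('n)) powr p) ^ j)" .
qed

locale weighted_kernel_operator = kernel_operator B K A \<epsilon> s c C + weight_pair p q r Kv Kw v w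
 for B :: "'n::finite cfun \<Rightarrow> 'n cfun \<Rightarrow> 'n cfun" and K A \<epsilon> s c C p q r Kv Kw and v w :: "real^'n \<Rightarrow> real"
begin

abbreviation "Iv \<equiv> pow_int (wmeas v) p"
abbreviation "Iw \<equiv> pow_int (wmeas w) q"
abbreviation "Iu \<equiv> pow_int (wmeas u) r"

text \<open>Square integrability and bounded support make \<open>sharp\<close> applicable and
  \<open>B f g\<close> integrable, as \<open>fefferman_stein\<close> requires. The squares inside
  the maximal functions are the reason why the weights are taken in the classes of exponents p / 2
  and q / 2.\<close>

lemma weighted_estimate_ex:
 "\<exists>D::real. \<forall>f\<in>L2. \<forall>g\<in>L2. bounded {y. f y \<noteq> 0} \<longrightarrow> bounded {y. g y \<noteq> 0} \<longrightarrow>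
   Iu (B f g) \<le> ennreal D * (epowr (Iv f) (r / p) * epowr (Iw g) (r / q))"
proof -
 obtain C1 where C1: "\<forall>f\<in>bmeas. (\<integral>\<^sup>+x. epowr (maxf lebesgue f x) (p / 2) \<partial>wmeas v) \<le> ennreal C1 * (\<integral>\<^sup>+x. epowr (f x) (p / 2) \<partial>wmeas v)"
  using PV.muckenhoupt by blast
 obtain C2 where C2: "\<forall>f\<in>bmeas. (\<integral>\<^sup>+x. epowr (maxf lebesgue f x) (q / 2) \<partial>wmeas w) \<le> ennreal C2 * (\<integral>\<^sup>+x. epowr (f x) (q / 2) \<partial>wmeas w)"
  using PW.muckenhoupt by blast
 \<comment> \<open>The factor 2 is the one in the hypothesis of
   \<open>fefferman_stein\<close>.\<close>
 define c0 where "c0 = 2 * sharp_const"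
 have c0: "0 \<le> c0" using sharp_const_nonneg by (simp add: c0_def)
 define Z where "Z = ennreal (fs_const r) * (ennreal (c0 powr r) * (epowr (ennreal C1) (r / p) * epowr (ennreal C2) (r / q)))"
 have "Z < top" unfolding Z_def using epowr_less_top_iff[OF exps(2), of "ennreal C1"] epowr_less_top_iff[OF exps(5), of "ennreal C2"]
  by (auto simp: ennreal_mult_less_top)
 then have Z: "ennreal (enn2real Z) = Z" by simp
 show ?thesis
 proof (intro exI[of _ "enn2real Z"] ballI impI)
  fix f g :: "'n cfun" assume L: "f \<in> L2" "g \<in> L2" and bd: "bounded {y. f y \<noteq> 0}" "bounded {y. g y \<noteq> 0}"
  have [measurable]: "f \<in> bmeas" "g \<in> bmeas" using L by (simp_all add: L2_def)
  let ?F = "\<lambda>y::real^'n. ennreal ((norm (f y))\<^sup>2)" and ?G = "\<lambda>y::real^'n. ennreal ((norm (g y))\<^sup>2)"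
  let ?MF = "maxf lebesgue ?F" and ?MG = "maxf lebesgue ?G"
  have [measurable]: "?MF \<in> bmeas" "?MG \<in> bmeas" by (rule maxf_measurable, simp)+
  define Sf where "Sf x = ennreal c0 * (epowr (?MF x) (1 / 2) * epowr (?MG x) (1 / 2))" for x
  have Sm: "Sf \<in> bmeas" unfolding Sf_def[abs_def] by measurable
  have "Iu (B f g) \<le> ennreal (fs_const r) * (\<integral>\<^sup>+x. epowr (Sf x) r \<partial>wmeas u)"
  proof (rule fefferman_stein[OF exps(1) Bint[OF L] Sm])
   fix m :: "('n \<Rightarrow> rat) \<times> rat" assume m: "0 < snd m"
   let ?x = "(\<chi> i. of_rat (fst m i)) :: real^'n" and ?l = "of_rat (snd m) :: real"
   have l: "0 < ?l" using m by simp
   obtain a where a: "0 \<le> a" "\<And>j. (\<integral>\<^sup>+y. ?F y * indicator (cb ?x (2 ^ j * ?l)) y \<partial>lebesgue) \<le> ennreal (a\<^sup>2 * (2 * (2 ^ j * ?l)) ^ CARD('n))"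
    "\<And>x. x \<in> rcube m \<Longrightarrow> ennreal a \<le> epowr (?MF x) (1 / 2)"
    using cube_average_bound[OF L(1) m] by blast
   obtain b where b: "0 \<le> b" "\<And>j. (\<integral>\<^sup>+y. ?G y * indicator (cb ?x (2 ^ j * ?l)) y \<partial>lebesgue) \<le> ennreal (b\<^sup>2 * (2 * (2 ^ j * ?l)) ^ CARD('n))"
    "\<And>x. x \<in> rcube m \<Longrightarrow> ennreal b \<le> epowr (?MG x) (1 / 2)"
    using cube_average_bound[OF L(2) m] by blast
   obtain \<kappa> where \<kappa>: "abs_int (cb ?x ?l) (\<lambda>x. B f g x - \<kappa>) \<le> ennreal (sharp_const * a * b * (2 * ?l) ^ CARD('n))"
    using sharp[OF L(1) bd(1) L(2) bd(2) l a(1) b(1) a(2) b(2)] by blast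
   have "2 * abs_int (rcube m) (\<lambda>y. B f g y - \<kappa>) \<le> Sf x * vol (rcube m)" if x: "x \<in> rcube m" for x
   proof -
    have "2 * abs_int (rcube m) (\<lambda>y. B f g y - \<kappa>) \<le> 2 * ennreal (sharp_const * a * b * (2 * ?l) ^ CARD('n))"
     by (intro mult_left_mono \<kappa>) simp
    also have "\<dots> = ennreal (2 * (sharp_const * a * b * (2 * ?l) ^ CARD('n)))"
     using sharp_const_nonneg a(1) b(1) l by (subst ennreal_mult) auto
    also have "2 * (sharp_const * a * b * (2 * ?l) ^ CARD('n)) = c0 * (a * b) * (2 * ?l) ^ CARD('n)" by (simp add: c0_def)
    also have "ennreal (c0 * (a * b) * (2 * ?l) ^ CARD('n)) = ennreal c0 * (ennreal a * ennreal b) * vol (rcube m)"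
     using c0 a(1) b(1) l by (subst emeasure_cb) (simp_all add: ennreal_mult)
    also have "\<dots> \<le> ennreal c0 * (epowr (?MF x) (1 / 2) * epowr (?MG x) (1 / 2)) * vol (rcube m)"
     by (intro mult_right_mono mult_left_mono mult_mono a(3) b(3) x) auto
    finally show ?thesis by (simp only: Sf_def)
   qed
   then show "\<exists>\<kappa>. \<forall>x\<in>rcube m. 2 * abs_int (rcube m) (\<lambda>y. B f g y - \<kappa>) \<le> Sf x * vol (rcube m)"
    by (intro exI[of _ \<kappa>] ballI)
  qed
  also have "(\<integral>\<^sup>+x. epowr (Sf x) r \<partial>wmeas u) =
   ennreal (c0 powr r) * (\<integral>\<^sup>+x. epowr (epowr (?MF x) (p / 2)) (r / p) * epowr (epowr (?MG x) (q / 2)) (r / q) \<partial>wmeas u)"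
  proof -
   \<comment> \<open>The power r / 2 of each maximal function is rewritten as p / 2 followed by r /
     p, or q / 2 followed by r / q, to match \<open>U_Holder\<close> and the maximal
     theorems.\<close>
   have h: "0 < p / 2" "0 < q / 2" "1 / 2 * r = p / 2 * (r / p)" "1 / 2 * r = q / 2 * (r / q)" "(0::real) < 1 / 2" using pq by auto
   have "epowr (Sf x) r = ennreal (c0 powr r) * (epowr (epowr (?MF x) (p / 2)) (r / p) * epowr (epowr (?MG x) (q / 2)) (r / q))" for x
    unfolding Sf_def epowr_mult[OF exps(1)] epowr_epowr[OF h(5) exps(1)] epowr_epowr[OF h(1) exps(2)] epowr_epowr[OF h(2) exps(5)] epowr_ennreal[OF exps(1) c0]
     h(3)[symmetric] h(4)[symmetric] ..
   then show ?thesis by (simp only:) (rule nn_integral_cmult, measurable)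
  qed
  also have "(\<integral>\<^sup>+x. epowr (epowr (?MF x) (p / 2)) (r / p) * epowr (epowr (?MG x) (q / 2)) (r / q) \<partial>wmeas u) \<le>
   epowr (\<integral>\<^sup>+x. epowr (?MF x) (p / 2) \<partial>wmeas v) (r / p) * epowr (\<integral>\<^sup>+x. epowr (?MG x) (q / 2) \<partial>wmeas w) (r / q)"
   by (rule U_Holder) measurable
  also have "\<dots> \<le> epowr (ennreal C1 * Iv f) (r / p) * epowr (ennreal C2 * Iw g) (r / q)"
  proof (intro mult_mono epowr_mono exps)
   have h: "0 < p / 2" "0 < q / 2" using pq by auto
   have e: "2 * (p / 2) = p" "2 * (q / 2) = q" by simp_all
   show "(\<integral>\<^sup>+x. epowr (?MF x) (p / 2) \<partial>wmeas v) \<le> ennreal C1 * Iv f"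
    using bspec[OF C1, of ?F] unfolding epowr_norm_square[OF h(1)] e by simp
   show "(\<integral>\<^sup>+x. epowr (?MG x) (q / 2) \<partial>wmeas w) \<le> ennreal C2 * Iw g"
    using bspec[OF C2, of ?G] unfolding epowr_norm_square[OF h(2)] e by simp
  qed auto
  finally have "Iu (B f g) \<le> ennreal (fs_const r) * (ennreal (c0 powr r) * (epowr (ennreal C1 * Iv f) (r / p) * epowr (ennreal C2 * Iw g) (r / q)))"
   by (simp add: mult_left_mono)
  also have "\<dots> = Z * (epowr (Iv f) (r / p) * epowr (Iw g) (r / q))"
   unfolding Z_def epowr_mult[OF exps(2)] epowr_mult[OF exps(5)] by (simp only: mult_ac)
  finally show "Iu (B f g) \<le> ennreal (enn2real Z) * (epowr (Iv f) (r / p) * epowr (Iw g) (r / q))" unfolding Z .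
 qed
qed

end

section \<open>Extension from truncated functions by completeness\<close>

context weighted_kernel_operator
begin

definition weighted_const :: real where
 "weighted_const = (SOME D. \<forall>f\<in>L2. \<forall>g\<in>L2. bounded {y. f y \<noteq> 0} \<longrightarrow> bounded {y. g y \<noteq> 0} \<longrightarrow>
   Iu (B f g) \<le> ennreal D * (epowr (Iv f) (r / p) * epowr (Iw g) (r / q)))"

lemma weighted_estimate:
 assumes "f \<in> L2" "g \<in> L2" "bounded {y. f y \<noteq> 0}" "bounded {y. g y \<noteq> 0}"
 shows "Iu (B f g) \<le> ennreal weighted_const * (epowr (Iv f) (r / p) * epowr (Iw g) (r / q))"
 using someI_ex[OF weighted_estimate_ex, folded weighted_const_def] assms by blast

definition domv :: "'n cfun set" where "domv = {f \<in> bmeas. Iv f < \<infinity>}"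
definition domw :: "'n cfun set" where "domw = {g \<in> bmeas. Iw g < \<infinity>}"

lemma dom_trunc_L2: "f \<in> domv \<Longrightarrow> trunc N f \<in> L2" "g \<in> domw \<Longrightarrow> trunc N g \<in> L2"
 using PV.trunc_L2[of f N] PW.trunc_L2[of g N] by (simp_all add: domv_def domw_def)

definition Hn :: "'n cfun \<Rightarrow> 'n cfun \<Rightarrow> nat \<Rightarrow> 'n cfun" where
 "Hn f g N = B (trunc N f) (trunc N g)"

lemma Hn_measurable: "f \<in> domv \<Longrightarrow> g \<in> domw \<Longrightarrow> Hn f g N \<in> bmeas"
 unfolding Hn_def by (intro Bm dom_trunc_L2)

lemma borel_U: "borel_measurable (wmeas u) = bmeas"
 by (rule measurable_cong_sets) auto

text \<open>Bounds the distance from the N-th truncation to all later ones; the two summands come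
  from changing one argument at a time.\<close>

definition Hrate :: "'n cfun \<Rightarrow> 'n cfun \<Rightarrow> nat \<Rightarrow> ennreal" where
 "Hrate f g N = ennreal (2 powr r) *
   (ennreal weighted_const * (epowr (Iv (\<lambda>x. f x - trunc N f x)) (r / p) * epowr (Iw g) (r / q)) +
   ennreal weighted_const * (epowr (Iv f) (r / p) * epowr (Iw (\<lambda>x. g x - trunc N g x)) (r / q)))"

lemma Hn_bound:
 assumes f: "f \<in> domv" and g: "g \<in> domw"
 shows "Iu (Hn f g N) \<le> ennreal weighted_const * (epowr (Iv f) (r / p) * epowr (Iw g) (r / q))"
proof -
 have "Iu (Hn f g N) \<le> ennreal weighted_const * (epowr (Iv (trunc N f)) (r / p) * epowr (Iw (trunc N g)) (r / q))"
  unfolding Hn_def by (intro weighted_estimate dom_trunc_L2 trunc_bounded f g)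
 also have "\<dots> \<le> ennreal weighted_const * (epowr (Iv f) (r / p) * epowr (Iw g) (r / q))"
  using pq by (intro mult_left_mono mult_mono epowr_mono exps nn_integral_mono) (auto simp: trunc_def indicator_def)
 finally show ?thesis .
qed

lemma Hn_cauchy:
 assumes f: "f \<in> domv" and g: "g \<in> domw" and N: "N \<le> k"
 shows "Iu (\<lambda>x. Hn f g k x - Hn f g N x) \<le> Hrate f g N"
proof -
 let ?d = "\<lambda>x. trunc k f x - trunc N f x" and ?e = "\<lambda>x. trunc k g x - trunc N g x"
 note L = dom_trunc_L2(1)[OF f] dom_trunc_L2(2)[OF g]
 have d: "?d \<in> L2" "?e \<in> L2" by (intro L2_diff L)+
 have sub: "cb 0 (real N) \<subseteq> cb (0::real^'n) (real k)" using N by (intro cb_mono) simp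
 have bd: "bounded {y. ?d y \<noteq> 0}" "bounded {y. ?e y \<noteq> 0}"
  by (rule bounded_subset[OF bounded_cb[of 0 "real k"]], use sub in \<open>auto simp: trunc_def indicator_def split: if_splits\<close>)+
 have le: "norm (?d x) \<le> norm (f x - trunc N f x)" "norm (?e x) \<le> norm (g x - trunc N g x)" for x
  using sub by (auto simp: trunc_def indicator_def)
 have [measurable]: "B ?d (trunc k g) \<in> bmeas" "B (trunc N f) ?e \<in> bmeas"
  by (intro Bm d L)+
 have "AE x in lebesgue. Hn f g k x - Hn f g N x = B ?d (trunc k g) x + B (trunc N f) ?e x"
  using Bdiff1[OF L(1)[of k] L(1)[of N] L(2)[of k]] Bdiff2[OF L(2)[of k] L(2)[of N] L(1)[of N]]
  by eventually_elim (simp add: Hn_def)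
 then have "Iu (\<lambda>x. Hn f g k x - Hn f g N x) = Iu (\<lambda>x. B ?d (trunc k g) x + B (trunc N f) ?e x)"
  by (intro nn_integral_cong_AE AE_U) (rule eventually_mono, auto)
 also have "\<dots> \<le> ennreal (2 powr r) * (Iu (B ?d (trunc k g)) + Iu (B (trunc N f) ?e))"
  by (rule nn_integral_powr_add[OF exps(1)]) measurable
 also have "\<dots> \<le> ennreal (2 powr r) *
   (ennreal weighted_const * (epowr (Iv ?d) (r / p) * epowr (Iw (trunc k g)) (r / q)) +
   ennreal weighted_const * (epowr (Iv (trunc N f)) (r / p) * epowr (Iw ?e) (r / q)))"
  by (intro mult_left_mono add_mono weighted_estimate d L bd trunc_bounded) auto
 also have "\<dots> \<le> Hrate f g N" unfolding Hrate_def
 proof (intro mult_left_mono add_mono mult_mono epowr_mono exps nn_integral_mono ennreal_leI powr_mono2 le)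
  show "norm (trunc k g x) \<le> norm (g x)" for x by (simp add: trunc_def indicator_def)
  show "norm (trunc N f x) \<le> norm (f x)" for x by (simp add: trunc_def indicator_def)
 qed (use pq in auto)
 finally show ?thesis .
qed

lemma Hrate_tendsto:
 assumes f: "f \<in> domv" and g: "g \<in> domw" shows "Hrate f g \<longlonglongrightarrow> 0"
proof -
 have fin: "epowr (Iv f) (r / p) < top" "epowr (Iw g) (r / q) < top"
  using f g epowr_less_top_iff[OF exps(2)] epowr_less_top_iff[OF exps(5)] by (auto simp: domv_def domw_def)
 have T: "(\<lambda>N. epowr (Iv (\<lambda>x. f x - trunc N f x)) (r / p)) \<longlonglongrightarrow> 0"
  by (intro epowr_tendsto_0 exps trunc_mean_tendsto) (use f pq in \<open>auto simp: domv_def\<close>)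
 have T': "(\<lambda>N. epowr (Iw (\<lambda>x. g x - trunc N g x)) (r / q)) \<longlonglongrightarrow> 0"
  by (intro epowr_tendsto_0 exps trunc_mean_tendsto) (use g pq in \<open>auto simp: domw_def\<close>)
 have cm: "(\<lambda>N. k * X N) \<longlonglongrightarrow> 0" if "k < top" "X \<longlonglongrightarrow> 0" for k and X :: "nat \<Rightarrow> ennreal"
  using ennreal_tendsto_cmult[OF that] by simp
 have "(\<lambda>N. ennreal weighted_const * (epowr (Iw g) (r / q) * epowr (Iv (\<lambda>x. f x - trunc N f x)) (r / p)) +
   ennreal weighted_const * (epowr (Iv f) (r / p) * epowr (Iw (\<lambda>x. g x - trunc N g x)) (r / q))) \<longlonglongrightarrow> 0 + 0"
  by (intro tendsto_add cm T T' fin ennreal_less_top)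
 then have "(\<lambda>N. ennreal (2 powr r) * (ennreal weighted_const * (epowr (Iw g) (r / q) * epowr (Iv (\<lambda>x. f x - trunc N f x)) (r / p)) +
   ennreal weighted_const * (epowr (Iv f) (r / p) * epowr (Iw (\<lambda>x. g x - trunc N g x)) (r / q)))) \<longlonglongrightarrow> 0"
  by (intro cm) auto
 then show ?thesis unfolding Hrate_def[abs_def] by (simp only: mult.commute[of "epowr (Iw g) (r / q)"])
qed

text \<open>The limit is determined up to functions whose mean of order r is zero, so a choice is
  made; linearity then holds modulo such functions, as \<open>bounded_bilinear_operator\<close>
  demands.\<close>

definition Bext :: "'n cfun \<Rightarrow> 'n cfun \<Rightarrow> 'n cfun" where
 "Bext f g = (SOME l. l \<in> bmeas \<and> (\<lambda>N. Iu (\<lambda>x. l x - Hn f g N x)) \<longlonglongrightarrow> 0)"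

lemma Bext:
 assumes f: "f \<in> domv" and g: "g \<in> domw"
 shows "Bext f g \<in> bmeas" "(\<lambda>N. Iu (\<lambda>x. Bext f g x - Hn f g N x)) \<longlonglongrightarrow> 0"
proof -
 obtain l where l: "l \<in> borel_measurable (wmeas u)" "\<And>N. Iu (\<lambda>x. l x - Hn f g N x) \<le> Hrate f g N"
  using mean_complete[where M="wmeas u" and h="Hn f g" and E="Hrate f g" and r=r, OF exps(1) _ Hrate_tendsto[OF f g] Hn_cauchy[OF f g]]
   Hn_measurable[OF f g] unfolding borel_U by blast
 have "(\<lambda>N. Iu (\<lambda>x. l x - Hn f g N x)) \<longlonglongrightarrow> 0"
  by (rule tendsto_sandwich[OF _ _ tendsto_const Hrate_tendsto[OF f g]]) (auto simp: l(2))
 then have "\<exists>l. l \<in> bmeas \<and> (\<lambda>N. Iu (\<lambda>x. l x - Hn f g N x)) \<longlonglongrightarrow> 0" using l(1) unfolding borel_U by blast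
 from someI_ex[OF this] have "Bext f g \<in> bmeas \<and> (\<lambda>N. Iu (\<lambda>x. Bext f g x - Hn f g N x)) \<longlonglongrightarrow> 0"
  unfolding Bext_def[symmetric] .
 then show "Bext f g \<in> bmeas" "(\<lambda>N. Iu (\<lambda>x. Bext f g x - Hn f g N x)) \<longlonglongrightarrow> 0" by blast+
qed

lemma Bext_bound:
 assumes f: "f \<in> domv" and g: "g \<in> domw"
 shows "Iu (Bext f g) \<le> ennreal (2 powr r) * (ennreal weighted_const * (epowr (Iv f) (r / p) * epowr (Iw g) (r / q)))"
 by (rule mean_limit_bound[where H="Hn f g", OF exps(1) _ _ Bext(2)[OF f g] Hn_bound[OF f g]])
  (simp_all only: borel_U Bext(1)[OF f g] Hn_measurable[OF f g])

lemma Bext_lincomb: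
 assumes L: "f' \<in> domv" "g' \<in> domw" "f1 \<in> domv" "g1 \<in> domw" "f2 \<in> domv" "g2 \<in> domw"
  and ae: "\<And>N. AE x in lebesgue. Hn f' g' N x = a * Hn f1 g1 N x + b * Hn f2 g2 N x"
 shows "Lp_norm r u (\<lambda>x. Bext f' g' x - (a * Bext f1 g1 x + b * Bext f2 g2 x)) = 0"
proof -
 have "Iu (\<lambda>x. Bext f' g' x - (a * Bext f1 g1 x + b * Bext f2 g2 x)) = 0"
  by (rule mean_limit_lincomb[OF exps(1) _ _ _ _ _ _ Bext(2)[OF L(3,4)] Bext(2)[OF L(5,6)] Bext(2)[OF L(1,2)] AE_U[OF ae]])
   (simp_all only: borel_U Bext(1)[OF L(1,2)] Bext(1)[OF L(3,4)] Bext(1)[OF L(5,6)] Hn_measurable[OF L(1,2)] Hn_measurable[OF L(3,4)] Hn_measurable[OF L(5,6)])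
 then show ?thesis unfolding Lp_norm_alt using exps(1) by simp
qed

text \<open>The truncations converge to \<open>Bext f g\<close> in the weighted mean and, by the L2
  theory, to \<open>B f g\<close> almost everywhere along a subsequence; Fatou's lemma identifies
  the two limits.\<close>

lemma Bext_eq_B:
 assumes f: "f \<in> domv" "f \<in> L2" and g: "g \<in> domw" "g \<in> L2"
 shows "Iu (\<lambda>x. Bext f g x - B f g x) = 0"
proof -
 obtain \<rho> :: "nat \<Rightarrow> nat" where \<rho>: "strict_mono \<rho>" "AE x in lebesgue. (\<lambda>k. B (trunc (\<rho> k) f) (trunc (\<rho> k) g) x) \<longlonglongrightarrow> B f g x"
  using B_conv_subseq[OF f(2) trunc_L2_tendsto[OF f(2)] g(2) trunc_L2_tendsto[OF g(2)]] by blast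
 show ?thesis
 proof (rule nn_integral_Fatou_0)
  have [measurable]: "Bext f g \<in> bmeas" "Hn f g (\<rho> k) \<in> bmeas" for k
   by (rule Bext[OF f(1) g(1)], rule Hn_measurable[OF f(1) g(1)])
  show "(\<lambda>x. ennreal (norm (Bext f g x - Hn f g (\<rho> k) x) powr r)) \<in> borel_measurable (wmeas u)" for k by measurable
  show "AE x in wmeas u. (\<lambda>k. ennreal (norm (Bext f g x - Hn f g (\<rho> k) x) powr r)) \<longlonglongrightarrow> ennreal (norm (Bext f g x - B f g x) powr r)"
   using AE_U[OF \<rho>(2)] unfolding Hn_def
   by eventually_elim (intro powr_norm_tendsto[OF exps(1)] tendsto_diff tendsto_const)
  show "(\<lambda>k. Iu (\<lambda>x. Bext f g x - Hn f g (\<rho> k) x)) \<longlonglongrightarrow> 0"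
   using LIMSEQ_subseq_LIMSEQ[OF Bext(2)[OF f(1) g(1)] \<rho>(1)] by (simp add: o_def)
 qed
qed

lemma Iv_lincomb_finite:
 assumes a: "0 < a" and M: "sets M = sets lebesgue" and [measurable]: "f \<in> bmeas" "h \<in> bmeas"
  and fin: "pow_int M a (\<lambda>x. f x :: complex) < \<infinity>" "pow_int M a (\<lambda>x. h x :: complex) < \<infinity>"
 shows "pow_int M a (\<lambda>x. \<alpha> * f x + \<beta> * h x) < \<infinity>"
proof -
 have m: "f \<in> borel_measurable M" "h \<in> borel_measurable M" unfolding measurable_cong_sets[OF M refl] by measurable
 have "pow_int M a (\<lambda>x. \<alpha> * f x + \<beta> * h x) \<le>
  ennreal (2 powr a) * (ennreal (norm \<alpha> powr a) * pow_int M a f + ennreal (norm \<beta> powr a) * pow_int M a h)"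
  unfolding nn_integral_powr_cmult[OF m(1), symmetric] nn_integral_powr_cmult[OF m(2), symmetric]
  by (rule nn_integral_powr_add[OF a]) (use m in auto)
 also have "\<dots> < \<infinity>" using fin by (auto simp: ennreal_mult_less_top)
 finally show ?thesis .
qed

lemma dom_lincomb: "f \<in> domv \<Longrightarrow> h \<in> domv \<Longrightarrow> (\<lambda>x. a * f x + b * h x) \<in> domv"
 "f \<in> domw \<Longrightarrow> h \<in> domw \<Longrightarrow> (\<lambda>x. a * f x + b * h x) \<in> domw"
 using Iv_lincomb_finite[of p "wmeas v" f h a b] Iv_lincomb_finite[of q "wmeas w" f h a b] pq by (auto simp: domv_def domw_def)

lemma weighted_extension:
 assumes rep: "\<And>f g. f \<in> schwartz_space \<Longrightarrow> g \<in> schwartz_space \<Longrightarrow> represents (B f g) (T f g)"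
 shows "extends_to_bounded T (weighted_Lp p v) (weighted_Lp q w) (weighted_Lp r u)"
 unfolding extends_to_bounded_def
proof (rule exI[of _ Bext], rule conjI)
 have p0: "0 < p" "0 < q" using pq by auto
 have X: "fst (weighted_Lp p v) = domv" "fst (weighted_Lp q w) = domw"
  by (auto simp: fst_weighted_Lp[OF p0(1)] fst_weighted_Lp[OF p0(2)] domv_def domw_def)
 have fin: "epowr (Iv f) (r / p) < top" "epowr (Iw g) (r / q) < top" if "f \<in> domv" "g \<in> domw" for f g
  using that epowr_less_top_iff[OF exps(2)] epowr_less_top_iff[OF exps(5)] by (auto simp: domv_def domw_def)
 show "bounded_bilinear_operator (weighted_Lp p v) (weighted_Lp q w) (weighted_Lp r u) Bext"
  unfolding bounded_bilinear_operator_def X snd_weighted_Lp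
 proof (intro conjI ballI allI)
  show "Bext f g \<in> fst (weighted_Lp r u)" if L: "f \<in> domv" "g \<in> domw" for f g
  proof -
   have "Iu (Bext f g) < \<infinity>" by (rule le_less_trans[OF Bext_bound[OF L]]) (use fin[OF L] in \<open>auto simp: ennreal_mult_less_top\<close>)
   then show ?thesis using Bext(1)[OF L] by (simp add: fst_weighted_Lp[OF exps(1)])
  qed
  show "Lp_norm r u (\<lambda>x. Bext (\<lambda>x. a * f x + b * h x) g x - (a * Bext f g x + b * Bext h g x)) = 0"
   if L: "f \<in> domv" "h \<in> domv" "g \<in> domw" for f h g a b
  proof (rule Bext_lincomb)
   show "AE x in lebesgue. Hn (\<lambda>x. a * f x + b * h x) g N x = a * Hn f g N x + b * Hn h g N x" for N
    unfolding Hn_def trunc_lincomb by (intro Blin1 dom_trunc_L2 L)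
  qed (intro dom_lincomb L)+
  show "Lp_norm r u (\<lambda>x. Bext f (\<lambda>x. a * g x + b * h x) x - (a * Bext f g x + b * Bext f h x)) = 0"
   if L: "f \<in> domv" "g \<in> domw" "h \<in> domw" for f g h a b
  proof (rule Bext_lincomb)
   show "AE x in lebesgue. Hn f (\<lambda>x. a * g x + b * h x) N x = a * Hn f g N x + b * Hn f h N x" for N
    unfolding Hn_def trunc_lincomb by (intro Blin2 dom_trunc_L2 L)
  qed (intro dom_lincomb L)+
  define Z where "Z = epowr (ennreal (2 powr r) * ennreal weighted_const) (1 / r)"
  have i: "0 < 1 / r" using exps(1) by simp
  have "Z < top" unfolding Z_def using epowr_less_top_iff[OF i, of "ennreal (2 powr r) * ennreal weighted_const"] by (simp add: ennreal_mult_less_top)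
  then have Z: "ennreal (enn2real Z) = Z" by simp
  show "\<exists>C::real. \<forall>f\<in>domv. \<forall>g\<in>domw. Lp_norm r u (Bext f g) \<le> ennreal C * Lp_norm p v f * Lp_norm q w g"
  proof (intro exI[of _ "enn2real Z"] ballI)
   fix f g assume L: "f \<in> domv" "g \<in> domw"
   have "Lp_norm r u (Bext f g) \<le> epowr (ennreal (2 powr r) * (ennreal weighted_const * (epowr (Iv f) (r / p) * epowr (Iw g) (r / q)))) (1 / r)"
    unfolding Lp_norm_alt by (rule epowr_mono[OF i Bext_bound[OF L]])
   also have "\<dots> = Z * (epowr (epowr (Iv f) (r / p)) (1 / r) * epowr (epowr (Iw g) (r / q)) (1 / r))"
    unfolding Z_def epowr_mult[OF i] by (simp only: mult_ac)
   also have "\<dots> = Z * Lp_norm p v f * Lp_norm q w g"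
   proof -
    have e: "r / p * (1 / r) = 1 / p" "r / q * (1 / r) = 1 / q" using exps(1) by auto
    show ?thesis unfolding Lp_norm_alt epowr_epowr[OF exps(2) i] epowr_epowr[OF exps(5) i] e by (simp only: mult_ac)
   qed
   finally show "Lp_norm r u (Bext f g) \<le> ennreal (enn2real Z) * Lp_norm p v f * Lp_norm q w g" unfolding Z .
  qed
 qed
 show "\<forall>f\<in>schwartz_space. \<forall>g\<in>schwartz_space. \<exists>h\<in>fst (weighted_Lp r u).
   snd (weighted_Lp r u) (\<lambda>x. Bext f g x - h x) = 0 \<and> represents h (T f g)"
  unfolding snd_weighted_Lp
 proof (intro ballI)
  fix f g :: "'n cfun" assume S: "f \<in> schwartz_space" "g \<in> schwartz_space"
  note L2 = S[THEN schwartz_L2]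
  have D: "f \<in> domv" "g \<in> domw"
   using PV.schwartz_weighted_finite[OF S(1) p0(1)] PW.schwartz_weighted_finite[OF S(2) p0(2)] S[THEN schwartz_measurable]
   by (simp_all add: domv_def domw_def)
  have z: "Iu (\<lambda>x. Bext f g x - B f g x) = 0" by (rule Bext_eq_B[OF D(1) L2(1) D(2) L2(2)])
  have [measurable]: "Bext f g \<in> bmeas" "B f g \<in> bmeas" by (rule Bext(1)[OF D], rule Bm[OF L2])
  \<comment> \<open>With a constant sequence in \<open>mean_limit_bound\<close>, finiteness passes
    from \<open>Bext f g\<close> to the function that represents T.\<close>
  have "Iu (B f g) \<le> ennreal (2 powr r) * Iu (Bext f g)"
  proof (rule mean_limit_bound[OF exps(1), where H="\<lambda>_. Bext f g"])
   show "(\<lambda>N. Iu (\<lambda>x. B f g x - Bext f g x)) \<longlonglongrightarrow> 0" using z by (simp add: norm_minus_commute)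
  qed auto
  also have "\<dots> < \<infinity>"
   using le_less_trans[OF Bext_bound[OF D]] fin[OF D] by (auto simp: ennreal_mult_less_top)
  finally have "B f g \<in> fst (weighted_Lp r u)" using Bm[OF L2] by (simp add: fst_weighted_Lp[OF exps(1)])
  moreover have "Lp_norm r u (\<lambda>x. Bext f g x - B f g x) = 0" unfolding Lp_norm_alt z using exps(1) by simp
  ultimately show "\<exists>h\<in>fst (weighted_Lp r u). Lp_norm r u (\<lambda>x. Bext f g x - h x) = 0 \<and> represents h (T f g)"
   using rep[OF S] by blast
 qed
qed

end

text \<open>When u vanishes almost everywhere every measurable function has seminorm zero, so the
  zero operator qualifies; a measurable function representing T is still to be supplied.\<close>

lemma degenerate_extension:
 fixes u :: "real^'n::finite \<Rightarrow> real" and X Y :: "'n fspace"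
 assumes r: "0 < r" and [measurable]: "u \<in> bmeas" and z: "AE x in lebesgue. u x = 0"
  and rep: "\<And>f g. f \<in> schwartz_space \<Longrightarrow> g \<in> schwartz_space \<Longrightarrow> \<exists>h\<in>bmeas. represents h (T f g)"
 shows "extends_to_bounded T X Y (weighted_Lp r u)"
proof -
 have I: "(\<integral>\<^sup>+x. F x \<partial>wmeas u) = 0" if [measurable]: "F \<in> bmeas" for F
 proof -
  have "(\<integral>\<^sup>+x. F x \<partial>wmeas u) = (\<integral>\<^sup>+x. ennreal (u x) * F x \<partial>lebesgue)" by (rule nn_integral_density) auto
  also have "\<dots> = (\<integral>\<^sup>+x. 0 \<partial>(lebesgue :: (real^'n) measure))" by (rule nn_integral_cong_AE, use z in eventually_elim) simp
  finally show ?thesis by simp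
 qed
 have N: "Lp_norm r u F = 0" if [measurable]: "F \<in> bmeas" for F :: "'n cfun"
  unfolding Lp_norm_alt by (subst I) (use r in auto)
 have "extends_to_bounded T X Y (weighted_Lp r u) =
  (\<exists>B. bounded_bilinear_operator X Y (weighted_Lp r u) B \<and> (\<forall>f\<in>schwartz_space. \<forall>g\<in>schwartz_space. \<exists>h\<in>fst (weighted_Lp r u).
   snd (weighted_Lp r u) (\<lambda>x. B f g x - h x) = 0 \<and> represents h (T f g)))" by (simp only: extends_to_bounded_def)
 also have "\<dots>"
 proof (intro exI[of _ "\<lambda>f g x. 0"] conjI ballI)
  show "bounded_bilinear_operator X Y (weighted_Lp r u) (\<lambda>f g x. 0)"
   unfolding bounded_bilinear_operator_def snd_weighted_Lp weighted_Lp_def by (simp add: N)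
  fix f g :: "'n cfun" assume "f \<in> schwartz_space" "g \<in> schwartz_space"
  then obtain h where h: "h \<in> bmeas" "represents h (T f g)" using rep by blast
  have "Lp_norm r u (\<lambda>x. 0 - h x) = 0" by (rule N) (use h(1) in measurable)
  then show "\<exists>h\<in>fst (weighted_Lp r u). snd (weighted_Lp r u) (\<lambda>x. 0 - h x) = 0 \<and> represents h (T f g)"
   using h N[OF h(1)] by (intro bexI[of _ h]) (simp_all add: weighted_Lp_def)
 qed
 finally show ?thesis .
qed

theorem corollary3p2:
 fixes T :: "'n::finite bilinear_op"
  and K :: "(real ^ 'n) \<times> (real ^ 'n) \<times> (real ^ 'n) \<Rightarrow> complex"
  and \<epsilon> s c C :: real
 assumes "continuous_bilinear_op T"
  and "locally_integrable_on K (- triple_diagonal)"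
  and "associated_kernel T K"
  and "0 < \<epsilon>" and "\<epsilon> < 1" and "0 < s" and "s \<le> 1" and "0 < c" and "0 < C"
  and "\<And>x x' y z. (x, y, z) \<notin> triple_diagonal \<Longrightarrow> (x', y, z) \<notin> triple_diagonal \<Longrightarrow>
      norm (x - x') powr \<epsilon> \<le> c * (norm (x - y) + norm (x - z)) \<Longrightarrow>
      norm (K (x, y, z) - K (x', y, z)) \<le>
       C * (norm (x - x') powr s /
        (norm (x - y) + norm (x - z)) powr (2 * real CARD('n) + s / \<epsilon>))"
  and "extends_to_bounded T (Lp 2) (Lp 2) (Lp 1)"
  and "extends_to_bounded T (Lp 2) (Lp 2) (Lp (1 / \<epsilon>))"
 shows "extends_to_bounded T Linf Linf BMO \<and>
  (\<forall>p q r :: real. \<forall>v w :: real ^ 'n \<Rightarrow> real.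
    2 < p \<and> 2 < q \<and> 1 / r = 1 / p + 1 / q \<and> v \<in> A_class (p / 2) \<and> w \<in> A_class (q / 2) \<longrightarrow>
    extends_to_bounded T (weighted_Lp p v) (weighted_Lp q w)
     (weighted_Lp r (\<lambda>x. v x powr (r / p) * w x powr (r / q))))"
proof -
 obtain B A where B: "kernel_operator B K A \<epsilon> s c C"
  and rep: "\<And>f g. f \<in> schwartz_space \<Longrightarrow> g \<in> schwartz_space \<Longrightarrow> f \<in> L2 \<Longrightarrow> g \<in> L2 \<Longrightarrow> represents (B f g) (T f g)"
  using kernel_operator_exists[OF assms(2-12)] by blast
 have rep': "represents (B f g) (T f g)" if "f \<in> schwartz_space" "g \<in> schwartz_space" for f g
  using that by (intro rep schwartz_L2)
 show ?thesis
 proof (intro conjI allI impI)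
  show "extends_to_bounded T Linf Linf BMO" by (rule kernel_operator.Linf_BMO[OF B rep'])
  fix p q r :: real and v w :: "real ^ 'n \<Rightarrow> real"
  assume "2 < p \<and> 2 < q \<and> 1 / r = 1 / p + 1 / q \<and> v \<in> A_class (p / 2) \<and> w \<in> A_class (q / 2)"
  then have pq: "2 < p" "2 < q" "1 / r = 1 / p + 1 / q" and V: "v \<in> A_class (p / 2)" and W: "w \<in> A_class (q / 2)" by blast+
  let ?u = "\<lambda>x. v x powr (r / p) * w x powr (r / q)"
  have [measurable]: "v \<in> bmeas" "w \<in> bmeas"
   using V W by (auto intro!: weight_measurable simp: A_class_def)
  \<comment> \<open>If v or w vanishes almost everywhere, so does the product weight, because zero
    to any real power is zero under \<open>powr\<close>.\<close>
  consider (nondeg) Kv Kw where "Ap_weight (p / 2) Kv v" "Ap_weight (q / 2) Kw w" | (deg) "AE x in lebesgue. ?u x = 0"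
  proof -
   have "AE x in lebesgue. ?u x = 0" if "AE x in lebesgue. v x = 0" using that by eventually_elim simp
   moreover have "AE x in lebesgue. ?u x = 0" if "AE x in lebesgue. w x = 0" using that by eventually_elim simp
   ultimately show thesis using A_class_cases[OF V] A_class_cases[OF W] nondeg deg by blast
  qed
  then show "extends_to_bounded T (weighted_Lp p v) (weighted_Lp q w) (weighted_Lp r ?u)"
  proof cases
   case nondeg
   interpret weight_pair p q r Kv Kw v w by (rule weight_pair.intro[OF pq nondeg])
   interpret B: weighted_kernel_operator B K A \<epsilon> s c C p q r Kv Kw v w
    by (rule weighted_kernel_operator.intro[OF B weight_pair_axioms])
   show ?thesis using B.weighted_extension[OF rep'] unfolding u_def[abs_def] .
  next
   case deg
   have "0 < 1 / r" unfolding pq(3) using pq by (intro add_pos_pos) auto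
   then have r: "0 < r" by simp
   show ?thesis
   proof (rule degenerate_extension[OF r _ deg])
    show "?u \<in> bmeas" by measurable
    show "\<exists>h\<in>bmeas. represents h (T f g)" if "f \<in> schwartz_space" "g \<in> schwartz_space" for f g
     using rep'[OF that] kernel_operator.Bm[OF B schwartz_L2[OF that(1)] schwartz_L2[OF that(2)]] by blast
   qed
  qed
 qed
qed

end
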